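(* Assume that $W$ satisfies the following three conditions. (1) For every $\delta>0$ there exists $\eta>0$ such that for every $x\in\mathbb{R}^d$, every $\xi\in\mathrm{dom}\,W(x,\cdot)$ and every $t\in[0,1)$: $1-t\le\eta$ implies $W(x,t\xi)\le W(x,\xi)+\delta$. (2) For every compact set $K\subset\mathrm{int}\,C$, the function $x\mapsto\sup\{W(x,\xi):\xi\in K\}$ belongs to $L^\infty_{\rm loc}(\mathbb{R}^d)$. (3) For every $s>0$ there exists a compact set $K_s\subset\mathrm{int}\,C$ such that for every $x\in\mathbb{R}^d$, $\inf\{W(x,\xi):\xi\in\overline{C}\setminus K_s\}\ge s$. Then the lower semicontinuous envelope $\overline{\mathcal{H}W}$ of $\mathcal{H}W$ is $1$-sup-quasiconvex.
   Context: Let $m,d\ge1$ be integers, $\mathbb{M}^{m\times d}$ the space of real $m\times d$ matrices, $Y=(0,1)^d$. Let $C\subset\mathbb{M}^{m\times d}$ be a bounded convex set with $0\in\mathrm{int}\,C$; $\overline{C}$ is its closure. Let $W:\mathbb{R}^d\times\mathbb{M}^{m\times d}\to[0,+\infty]$ be Borel measurable, $Y$-periodic in its first variable ($W(x+z,\xi)=W(x,\xi)$ for all $z\in\mathbb{Z}^d$), with $\mathrm{dom}\,W(x,\cdot):=\{\xi:W(x,\xi)<+\infty\}\subset\overline{C}$ for all $x\in\mathbb{R}^d$. For a bounded open $D\subset\mathbb{R}^d$ with $|\partial D|=0$, $W^{1,\infty}_0(D;\mathbb{R}^m)=\{\varphi\in W^{1,\infty}(D;\mathbb{R}^m):\varphi=0\text{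 on }\partial D\}$. Define $$\mathcal{H}W(\xi)=\inf_{n\ge1}\frac1{n^d}\inf\left\{\int_{nY}W(x,\xi+\nabla\phi(x))\,dx:\phi\in W^{1,\infty}_0(nY;\mathbb{R}^m)\right\}.$$ A function $g:\mathbb{M}^{m\times d}\to[0,+\infty)$ is quasiconvex if it is Borel measurable and $g(\xi)=\inf\{\int_Yg(\xi+\nabla\phi(x))dx:\phi\in W^{1,\infty}_0(Y;\mathbb{R}^m)\}$ for all $\xi\in\mathbb{M}^{m\times d}$. For $p\in[1,+\infty)$, a Borel measurable function $h:\mathbb{M}^{m\times d}\to[0,+\infty]$ is $p$-sup-quasiconvex if there is a nondecreasing sequence $\{h_n\}_{n\in\mathbb{N}}$ of functions $h_n:\mathbb{M}^{m\times d}\to[0,+\infty)$ such that: each $h_n$ is quasiconvex; for every $n$ there exists $\alpha_n>0$ with $h_n(\xi)\le\alpha_n(1+|\xi|^p)$ for all $\xi$; and $\sup_nh_n(\xi)=h(\xi)$ for every $\xi\in\mathbb{M}^{m\times d}$. *)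

theory Defs
  imports "HOL-Analysis.Analysis"
begin

text \<open>Conventions: real \<open>m \<times> d\<close> matrices are elements of \<open>real^'d^'m\<close>, whose norm is the
  Frobenius norm. Functions with values in \<open>[0, \<infinity>]\<close> are \<open>ennreal\<close>-valued, and integrals
  are taken with respect to the (complete) Lebesgue measure.\<close>

subsection \<open>The space \<open>W\<^sup>1\<^sup>,\<^sup>\<infinity>\<^sub>0\<close>\<close>

primrec Ck :: "nat \<Rightarrow> (real^'d::finite \<Rightarrow> real) \<Rightarrow> bool" where
  "Ck 0 f \<longleftrightarrow> continuous_on UNIV f"
| "Ck (Suc k) f \<longleftrightarrow> (\<forall>x. f differentiable (at x)) \<and>
     (\<forall>j. Ck k (\<lambda>x. frechet_derivative f (at x) (axis j 1)))"

definition test_functions :: "(real^'d::finite) set \<Rightarrow> (real^'d \<Rightarrow> real) set" where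
  "test_functions D = {\<psi>. (\<forall>k. Ck k \<psi>) \<and>
     compact (closure {x. \<psi> x \<noteq> 0}) \<and> closure {x. \<psi> x \<noteq> 0} \<subseteq> D}"

definition Linfty :: "(real^'d::finite) set \<Rightarrow> (real^'d \<Rightarrow> 'b::euclidean_space) set" where
  "Linfty D = {f. f \<in> borel_measurable (lebesgue_on D) \<and>
     (\<exists>M::real. AE x in lebesgue_on D. norm (f x) \<le> M)}"

text \<open>\<open>G x $ i $ j\<close> is the weak partial derivative of the \<open>i\<close>-th component of \<open>\<phi>\<close> in the
  \<open>j\<close>-th variable. Both functions are required to be essentially bounded where this notion is
  used, so that the Bochner integrals below exist.\<close>

definition weak_gradient ::
  "(real^'d::finite) set \<Rightarrow> (real^'d \<Rightarrow> real^'m::finite) \<Rightarrow> (real^'d \<Rightarrow> real^'d^'m) \<Rightarrow> bool" where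
  "weak_gradient D \<phi> G \<longleftrightarrow> (\<forall>\<psi>\<in>test_functions D. \<forall>i j.
     (\<integral>x. \<phi> x $ i * frechet_derivative \<psi> (at x) (axis j 1) \<partial>lebesgue_on D)
       = - (\<integral>x. G x $ i $ j * \<psi> x \<partial>lebesgue_on D))"

definition W1inf :: "(real^'d::finite) set \<Rightarrow> (real^'d \<Rightarrow> real^'m::finite) set" where
  "W1inf D = {\<phi> \<in> Linfty D. \<exists>G\<in>Linfty D. weak_gradient D \<phi> G}"

text \<open>The boundary condition refers to the continuous representative; hence the elements are
  required to be continuous up to the boundary. Values outside \<open>closure D\<close> are irrelevant.\<close>

definition W1inf0 :: "(real^'d::finite) set \<Rightarrow> (real^'d \<Rightarrow> real^'m::finite) set" where
  "W1inf0 D = {\<phi> \<in> W1inf D. continuous_on (closure D) \<phi> \<and> (\<forall>x\<in>frontier D. \<phi> x = 0)}"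

text \<open>The infimum of \<open>\<integral>\<^sub>D F (x, \<nabla>\<phi> x) dx\<close> over \<open>\<phi> \<in> W\<^sup>1\<^sup>,\<^sup>\<infinity>\<^sub>0(D)\<close>. Weak gradients are
  unique only up to null sets, so \<open>G\<close> runs over all versions of \<open>\<nabla>\<phi>\<close>; these
  give the same value of the integral.\<close>

definition inf_energy ::
  "(real^'d::finite) set \<Rightarrow> (real^'d \<Rightarrow> real^'d^'m::finite \<Rightarrow> ennreal) \<Rightarrow> ennreal" where
  "inf_energy D F = Inf {\<integral>\<^sup>+x. F x (G x) \<partial>lebesgue_on D | \<phi> G.
     \<phi> \<in> W1inf0 D \<and> G \<in> Linfty D \<and> weak_gradient D \<phi> G}"

subsection \<open>Homogenization and quasiconvexity\<close>

definition cube :: "nat \<Rightarrow> (real^'d::finite) set" where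
  "cube n = {x. \<forall>i. 0 < x $ i \<and> x $ i < real n}"

definition homog ::
  "(real^'d::finite \<Rightarrow> real^'d^'m::finite \<Rightarrow> ennreal) \<Rightarrow> real^'d^'m \<Rightarrow> ennreal" where
  "homog W \<xi> = (INF n\<in>{1..}.
     inf_energy (cube n) (\<lambda>x \<zeta>. W x (\<xi> + \<zeta>)) / ennreal (real n ^ CARD('d)))"

definition quasiconvex :: "(real^'d::finite^'m::finite \<Rightarrow> real) \<Rightarrow> bool" where
  "quasiconvex g \<longleftrightarrow> (\<forall>\<xi>. 0 \<le> g \<xi>) \<and> g \<in> borel_measurable borel \<and>
     (\<forall>\<xi>. ennreal (g \<xi>) = inf_energy (cube 1) (\<lambda>x \<zeta>. ennreal (g (\<xi> + \<zeta>))))"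

definition sup_quasiconvex :: "real \<Rightarrow> (real^'d::finite^'m::finite \<Rightarrow> ennreal) \<Rightarrow> bool" where
  "sup_quasiconvex p h \<longleftrightarrow> h \<in> borel_measurable borel \<and>
     (\<exists>hs :: nat \<Rightarrow> real^'d^'m \<Rightarrow> real.
        (\<forall>n \<xi>. hs n \<xi> \<le> hs (Suc n) \<xi>) \<and>
        (\<forall>n. quasiconvex (hs n)) \<and>
        (\<forall>n. \<exists>\<alpha>>0. \<forall>\<xi>. hs n \<xi> \<le> \<alpha> * (1 + norm \<xi> powr p)) \<and>
        (\<forall>\<xi>. (SUP n. ennreal (hs n \<xi>)) = h \<xi>))"

subsection \<open>Extended-valued functions\<close>

definition edom :: "('a \<Rightarrow> ennreal) \<Rightarrow> 'a set" where
  "edom f = {\<xi>. f \<xi> < \<infinity>}"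

definition Linfty_loc :: "(real^'d::finite \<Rightarrow> ennreal) set" where
  "Linfty_loc = {f. f \<in> borel_measurable lebesgue \<and>
     (\<forall>K. compact K \<longrightarrow> (\<exists>M::real. AE x in lebesgue_on K. f x \<le> ennreal M))}"

definition lsc :: "('a::topological_space \<Rightarrow> ennreal) \<Rightarrow> bool" where
  "lsc f \<longleftrightarrow> (\<forall>a. open {x. a < f x})"

definition lsc_envelope :: "('a::topological_space \<Rightarrow> ennreal) \<Rightarrow> 'a \<Rightarrow> ennreal" where
  "lsc_envelope f x = (SUP g\<in>{g. lsc g \<and> (\<forall>y. g y \<le> f y)}. g x)"

end

theory Submission
  imports Defs
begin

text \<open>Let \<open>H = homog W\<close> and let \<open>g\<^sub>k\<close> be the largest \<open>k\<close>-Lipschitz function below \<open>H\<close>. Its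
  homogenization \<open>h\<^sub>k\<close>, which is its quasiconvex envelope, is \<open>k\<close>-Lipschitz and quasiconvex, increases with
  \<open>k\<close> and is continuous, so \<open>sup\<^sub>k h\<^sub>k\<close> lies below the lower semicontinuous envelope of \<open>H\<close>. For the
  converse suppose that \<open>h\<^sub>k \<xi> \<le> m\<close> for all \<open>k\<close>. There are \<open>C\<^sup>1\<close> test maps \<open>\<phi>\<^sub>k\<close> on the unit cube with
  \<open>\<integral> g\<^sub>k (\<xi> + \<nabla>\<phi>\<^sub>k) \<le> m + o(1)\<close>, and then \<open>\<xi> + \<nabla>\<phi>\<^sub>k\<close> is close to \<open>closure C\<close> in \<open>L\<^sup>1\<close>, because
  \<open>g\<^sub>k \<ge> k dist(\<cdot>, closure C)\<close>. A truncation changes \<open>\<nabla>\<phi>\<^sub>k\<close> noticeably only on a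
  small set and brings \<open>\<xi> + \<nabla>\<phi>\<^sub>k\<close> uniformly close to \<open>closure C\<close> everywhere. After multiplication by \<open>t < 1\<close> the gradient lies
  in a compact subset of \<open>interior C\<close>, where \<open>H\<close> is bounded, continuous and satisfies Jensen's
  inequality, and the radial condition yields \<open>H (t \<xi>) \<le> m + o(1)\<close> as \<open>t\<close> tends to \<open>1\<close>.\<close>

subsection \<open>Test functions and mollification\<close>

text \<open>The obstacle is the value \<infinity>: \<open>H\<close> satisfies Jensen's inequality
  only along gradients that stay in a compact part of \<open>interior C\<close>, whereas bounded
  energies of the Lipschitz functions control the distance of the gradient to
  \<open>closure C\<close> only in mean. A truncation that merely bounds the norm of the gradient
  would not be enough; the new gradient has to come close to the convex set itself. Averaging over
  cubes achieves this, since the mean of matrices is no farther from a convex set than they are in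
  mean. The factor \<open>t < 1\<close> absorbs the remaining distance: it moves a neighbourhood of
  \<open>closure C\<close> into \<open>interior C\<close>, because 0 is an interior point. Gluing,
  continuity and Jensen's inequality are proved for a periodic integrand that is locally bounded on
  an open set \<open>U\<close> of slopes. The choice \<open>U = interior C\<close> yields the
  statements about \<open>H\<close>, and \<open>U = UNIV\<close> those about the envelopes of the
  Lipschitz functions, which do not depend on \<open>x\<close>.\<close>

lemma frechet_derivative_eqI:
  "(f has_derivative f') (at x) \<Longrightarrow> frechet_derivative f (at x) = f'"
  by (metis frechet_derivative_at)

lemma Ck_SucI:
  assumes "\<And>x. (f has_derivative f' x) (at x)" "\<And>j. Ck k (\<lambda>x. f' x (axis j 1))"
  shows "Ck (Suc k) f"
proof -
  have "frechet_derivative f (at x) = f' x" for x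
    using assms(1) by (rule frechet_derivative_eqI)
  then show ?thesis
    using assms by (auto simp: differentiable_def)
qed

text \<open>The successor clause of \<open>Ck\<close> does not mention continuity of
  \<open>f\<close>; at level 0 it is recovered from differentiability.\<close>

lemma Ck_SucD: "Ck (Suc k) f \<Longrightarrow> Ck k f"
proof (induction k arbitrary: f)
  case 0
  then show ?case
    by (auto intro!: continuous_at_imp_continuous_on differentiable_imp_continuous_within)
next
  case (Suc k)
  then show ?case by auto
qed

lemma Ck_continuous: "Ck k f \<Longrightarrow> continuous_on UNIV f"
  by (induction k) (auto dest: Ck_SucD simp del: Ck.simps(2))

lemma Ck_has_derivative:
  "Ck (Suc k) f \<Longrightarrow> (f has_derivative frechet_derivative f (at x)) (at x)"
  by (auto simp: frechet_derivative_works)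

lemma Ck_const: "Ck k (\<lambda>x. c)"
proof (induction k arbitrary: c)
  case 0 then show ?case by simp
next
  case (Suc k)
  show ?case
    by (rule Ck_SucI[where f' = "\<lambda>x h. 0"]) (auto simp: Suc)
qed

lemma Ck_add: "Ck k f \<Longrightarrow> Ck k g \<Longrightarrow> Ck k (\<lambda>x. f x + g x)"
proof (induction k arbitrary: f g)
  case 0 then show ?case by (auto intro: continuous_intros)
next
  case (Suc k)
  show ?case
    by (rule Ck_SucI, rule has_derivative_add[OF Ck_has_derivative[OF Suc.prems(1)] Ck_has_derivative[OF Suc.prems(2)]])
       (use Suc in auto)
qed

lemma Ck_mult: "Ck k f \<Longrightarrow> Ck k g \<Longrightarrow> Ck k (\<lambda>x. f x * g x)"
proof (induction k arbitrary: f g)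
  case 0 then show ?case by (auto intro: continuous_intros)
next
  case (Suc k)
  have "Ck k f" "Ck k g" using Suc.prems by (auto dest: Ck_SucD simp del: Ck.simps(2))
  show ?case
    by (rule Ck_SucI, rule has_derivative_mult[OF Ck_has_derivative[OF Suc.prems(1)] Ck_has_derivative[OF Suc.prems(2)]])
       (use Suc \<open>Ck k f\<close> \<open>Ck k g\<close> in \<open>auto intro!: Ck_add Suc.IH\<close>)
qed

lemma Ck_prod: "finite I \<Longrightarrow> (\<And>i. i \<in> I \<Longrightarrow> Ck k (f i)) \<Longrightarrow> Ck k (\<lambda>x. \<Prod>i\<in>I. f i x)"
  by (induction rule: finite_induct) (auto intro: Ck_const Ck_mult)

lemma Ck_affine:
  fixes f :: "real^'d::finite \<Rightarrow> real"
  shows "Ck k f \<Longrightarrow> Ck k (\<lambda>x. f (a + c *\<^sub>R x))"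
proof (induction k arbitrary: f)
  case 0
  have "continuous_on UNIV f" using 0 by simp
  then show ?case by (auto intro!: continuous_on_compose2[of UNIV f] continuous_intros)
next
  case (Suc k)
  let ?D = "\<lambda>x. frechet_derivative f (at x)"
  have d: "((\<lambda>x. f (a + c *\<^sub>R x)) has_derivative (\<lambda>h. ?D (a + c *\<^sub>R x) (c *\<^sub>R h))) (at x)" for x
    by (rule has_derivative_compose[where g = f and f = "\<lambda>x. a + c *\<^sub>R x"])
       (use Ck_has_derivative[OF Suc.prems] in \<open>auto intro!: derivative_eq_intros\<close>)
  have lin: "?D y (c *\<^sub>R h) = c * ?D y h" for y h
    using has_derivative_linear[OF Ck_has_derivative[OF Suc.prems]]
    by (simp add: linear_scale)
  show ?case
    by (rule Ck_SucI[OF d]) (use Suc in \<open>auto simp: lin intro!: Ck_mult Ck_const\<close>)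
qed

text \<open>The powers of \<open>1/t\<close> make the span of this family closed under differentiation.\<close>

definition bumpfun :: "nat \<Rightarrow> real \<Rightarrow> real" where
  "bumpfun n t = (if t > 0 then (1/t)^n * exp (-(1/t)) else 0)"

lemma bumpfun_tendsto_0: "(bumpfun n \<longlongrightarrow> 0) (at_right 0)"
proof -
  have "((\<lambda>x::real. inverse x ^ n / exp (inverse x)) \<longlongrightarrow> 0) (at_right 0)"
    by (rule filterlim_compose[OF tendsto_power_div_exp_0 filterlim_inverse_at_top_right])
  then show ?thesis
  proof (rule Lim_transform_eventually)
    show "\<forall>\<^sub>F x in at_right 0. inverse x ^ n / exp (inverse x) = bumpfun n x"
      using eventually_at_right_less[of "0::real"]
      by eventually_elim (auto simp: bumpfun_def exp_minus field_simps)
  qed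
qed

lemma bumpfun_deriv:
  "(bumpfun n has_real_derivative (- real n * bumpfun (Suc n) t + bumpfun (n + 2) t)) (at t)"
proof -
  consider "t > 0" | "t < 0" | "t = 0" by linarith
  then show ?thesis
  proof cases
    case 1
    have *: "((\<lambda>t. (1/t)^n * exp (-(1/t))) has_real_derivative
      (- real n * bumpfun (Suc n) t + bumpfun (n + 2) t)) (at t)"
    proof (cases n)
      case 0
      show ?thesis using 1 unfolding bumpfun_def 0
        by (auto intro!: derivative_eq_intros simp: power2_eq_square field_simps)
    next
      case (Suc m)
      show ?thesis using 1 unfolding bumpfun_def Suc
        by (auto intro!: derivative_eq_intros simp: power2_eq_square field_simps) (cases m; simp)
    qed
    show ?thesis
      by (rule has_field_derivative_transform_within_open[OF *, of "{0<..}"])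
         (use 1 in \<open>auto simp: bumpfun_def\<close>)
  next
    case 2
    show ?thesis
      by (rule has_field_derivative_transform_within_open[where f = "\<lambda>_. 0" and S = "{..<0}"])
         (use 2 in \<open>auto simp: bumpfun_def\<close>)
  next
    case 3
    \<comment> \<open>To the right of 0 the difference quotient is \<open>bumpfun (Suc n) h\<close>,
      to the left it vanishes.\<close>
    have "((\<lambda>h. (bumpfun n h - bumpfun n 0) / (h - 0)) \<longlongrightarrow> 0) (at 0)"
    proof (rule filterlim_split_at)
      show "((\<lambda>h. (bumpfun n h - bumpfun n 0) / (h - 0)) \<longlongrightarrow> 0) (at_left 0)"
        by (rule Lim_transform_eventually[where f = "\<lambda>_. 0"])
           (auto simp: eventually_at_left_field bumpfun_def intro!: exI[of _ "-1"])
      show "((\<lambda>h. (bumpfun n h - bumpfun n 0) / (h - 0)) \<longlongrightarrow> 0) (at_right 0)"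
        by (rule Lim_transform_eventually[OF bumpfun_tendsto_0[of "Suc n"]])
           (auto simp: eventually_at_right_field bumpfun_def intro!: exI[of _ "1"])
    qed
    then show ?thesis unfolding has_field_derivative_iff 3
      by (simp add: bumpfun_def)
  qed
qed

lemma Ck_bumpfun: "Ck k (\<lambda>x::real^'d::finite. bumpfun n (x $ i))"
proof (induction k arbitrary: n)
  case 0
  have "continuous_on UNIV (bumpfun n)"
    by (rule continuous_at_imp_continuous_on) (auto intro: DERIV_isCont bumpfun_deriv)
  then show ?case by (auto intro!: continuous_on_compose2[of UNIV "bumpfun n"] continuous_intros)
next
  case (Suc k)
  let ?b = "\<lambda>t. - real n * bumpfun (Suc n) t + bumpfun (n + 2) t"
  show ?case
  proof (rule Ck_SucI)
    fix x :: "real^'d"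
    have "(bumpfun n has_derivative (\<lambda>h. h * ?b (x $ i))) (at (x $ i))"
      using bumpfun_deriv[of n "x $ i"] by (simp add: has_field_derivative_def mult.commute[of "- real n * bumpfun (Suc n) (x $ i) + bumpfun (n + 2) (x $ i)"] mult_commute_abs)
    then show "((\<lambda>x. bumpfun n (x $ i)) has_derivative (\<lambda>h. (h $ i) * ?b (x $ i))) (at x)"
      by (rule has_derivative_compose[rotated])
         (rule bounded_linear_imp_has_derivative[OF bounded_linear_vec_nth])
  next
    fix j
    show "Ck k (\<lambda>x. axis j 1 $ i * ?b (x $ i))"
      by (intro Ck_mult Ck_add Ck_const Suc)
  qed
qed

section \<open>Functions of compact support and closure properties of test functions\<close>

lemma compact_support_uniformly_continuous:
  fixes f :: "'a::euclidean_space \<Rightarrow> 'b::metric_space"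
  assumes "continuous_on UNIV f" and "\<And>x. norm x > R \<Longrightarrow> f x = z"
  shows "uniformly_continuous_on UNIV f"
  unfolding uniformly_continuous_on_def
proof (intro allI impI)
  fix e :: real assume "e > 0"
  \<comment> \<open>The extra 1 ensures that two points at distance below 1 lie either both in this
    ball or both where \<open>f\<close> equals \<open>z\<close>.\<close>
  have "uniformly_continuous_on (cball 0 (R+1)) f"
    by (rule compact_uniformly_continuous[OF continuous_on_subset[OF assms(1)]]) auto
  then obtain d where d: "d > 0" "\<And>x y. norm x \<le> R + 1 \<Longrightarrow> norm y \<le> R+1 \<Longrightarrow> dist y x < d \<Longrightarrow> dist (f y) (f x) < e"
    unfolding uniformly_continuous_on_def using \<open>e > 0\<close> by (metis mem_cball_0)
  show "\<exists>d>0. \<forall>x\<in>UNIV. \<forall>x'\<in>UNIV. dist x' x < d \<longrightarrow> dist (f x') (f x) < e"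
  proof (intro exI[of _ "min d 1"] conjI ballI impI)
    fix x y :: 'a assume xy: "dist y x < min d 1"
    have "norm x \<le> norm y + dist y x" "norm y \<le> norm x + dist y x"
      using norm_triangle_sub[of x y] norm_triangle_sub[of y x] by (auto simp: dist_norm norm_minus_commute)
    then consider "norm x \<le> R + 1 \<and> norm y \<le> R + 1" | "norm x > R \<and> norm y > R"
      using xy by linarith
    then show "dist (f y) (f x) < e"
      using d xy assms(2) \<open>e > 0\<close> by cases auto
  qed (use d in auto)
qed

lemma compact_support_bounded:
  fixes f :: "'a::euclidean_space \<Rightarrow> 'b::real_normed_vector"
  assumes "continuous_on UNIV f" and "\<And>x. norm x > R \<Longrightarrow> f x = 0"
  obtains M where "M > 0" "\<And>x. norm (f x) \<le> M"
proof -
  have "compact (f ` cball 0 R)"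
    by (rule compact_continuous_image[OF continuous_on_subset[OF assms(1)]]) auto
  then obtain M where "M > 0" "\<And>x. norm x \<le> R \<Longrightarrow> norm (f x) \<le> M"
    by (metis compact_imp_bounded bounded_pos imageI mem_cball_0)
  then show ?thesis
    using assms(2) by (intro that[of M]) (auto, metis linorder_not_le norm_zero less_imp_le)
qed

lemma compact_support_integrable:
  fixes f :: "'a::euclidean_space \<Rightarrow> 'b::euclidean_space"
  assumes "continuous_on UNIV f" and "\<And>x. norm x > R \<Longrightarrow> f x = 0"
  shows "integrable lborel f"
proof -
  have "integrable lborel (\<lambda>x. indicator (cball 0 R) x *\<^sub>R f x)"
    by (rule borel_integrable_compact[OF compact_cball continuous_on_subset[OF assms(1)]]) simp
  moreover have "(\<lambda>x. indicator (cball 0 R) x *\<^sub>R f x) = f"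
    using assms(2) by (auto simp: indicator_def)
  ultimately show ?thesis by simp
qed

lemma test_functions_bounded_support:
  assumes "\<psi> \<in> test_functions D"
  obtains R where "\<And>x. norm x > R \<Longrightarrow> \<psi> x = 0"
proof -
  have "bounded {x. \<psi> x \<noteq> 0}"
    using assms by (auto simp: test_functions_def intro: bounded_subset[OF compact_imp_bounded closure_subset])
  then obtain R where "\<And>x. \<psi> x \<noteq> 0 \<Longrightarrow> norm x \<le> R" by (auto simp: bounded_iff)
  then show ?thesis using that[of R] by (metis linorder_not_le)
qed

lemma frechet_derivative_eq_0:
  assumes "open S" "x \<in> S" "\<And>y. y \<in> S \<Longrightarrow> f y = 0"
  shows "frechet_derivative f (at x) = (\<lambda>h. 0)"
  by (rule frechet_derivative_eqI, rule has_derivative_transform_within_open[of "\<lambda>_. 0" _ _ _ S])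
     (use assms in auto)

lemma frechet_derivative_support:
  assumes "\<And>x::'a::real_normed_vector. norm x > R \<Longrightarrow> f x = 0" "norm x > R"
  shows "frechet_derivative f (at x) = (\<lambda>h. 0)"
  by (rule frechet_derivative_eq_0[of "- cball 0 R"]) (use assms in \<open>auto simp: open_Compl\<close>)

lemma test_functionsI:
  assumes "\<And>k. Ck k \<psi>" "compact K" "K \<subseteq> D" "\<And>x. x \<notin> K \<Longrightarrow> \<psi> x = 0"
  shows "\<psi> \<in> test_functions D"
proof -
  have "closure {x. \<psi> x \<noteq> 0} \<subseteq> K"
    using assms by (intro closure_minimal compact_imp_closed) auto
  moreover have "compact (closure {x. \<psi> x \<noteq> 0})"
    using bounded_subset[OF compact_imp_bounded[OF assms(2)], of "{x. \<psi> x \<noteq> 0}"] assms(4) by auto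
  ultimately show ?thesis
    using assms(1,3) by (auto simp: test_functions_def)
qed

lemma test_function_UNIV_I:
  assumes "\<And>k. Ck k \<psi>" "\<And>x::real^'d::finite. norm x > R \<Longrightarrow> \<psi> x = 0"
  shows "\<psi> \<in> test_functions UNIV"
  by (rule test_functionsI[of _ "cball 0 R"]) (use assms in auto)

lemma test_functions_mono: "D \<subseteq> D' \<Longrightarrow> test_functions D \<subseteq> test_functions D'"
  by (auto simp: test_functions_def)

lemma test_function_pd:
  assumes "\<psi> \<in> test_functions UNIV"
  shows "(\<lambda>x. frechet_derivative \<psi> (at x) (axis j 1)) \<in> test_functions UNIV"
proof -
  obtain R where R: "\<And>x. norm x > R \<Longrightarrow> \<psi> x = 0"
    using test_functions_bounded_support[OF assms] by blast
  have "Ck (Suc k) \<psi>" for k using assms by (auto simp: test_functions_def simp del: Ck.simps)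
  then show ?thesis
    by (intro test_function_UNIV_I[of _ R]) (auto simp: frechet_derivative_support[OF R])
qed

lemma test_function_affine:
  assumes "\<psi> \<in> test_functions UNIV" "c \<noteq> 0"
  shows "(\<lambda>x. \<psi> (a + c *\<^sub>R x)) \<in> test_functions UNIV"
proof -
  obtain R where R: "\<And>x. norm x > R \<Longrightarrow> \<psi> x = 0"
    using test_functions_bounded_support[OF assms(1)] by blast
  have "\<psi> (a + c *\<^sub>R x) = 0" if "norm x > (R + norm a) / \<bar>c\<bar>" for x
  proof (rule R)
    have "R + norm a < norm (c *\<^sub>R x)" using that assms(2) by (simp add: field_simps)
    then show "R < norm (a + c *\<^sub>R x)" using norm_triangle_sub[of "c *\<^sub>R x" "a + c *\<^sub>R x"] by simp
  qed
  then show ?thesis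
    by (intro test_function_UNIV_I) (use assms in \<open>auto simp: test_functions_def intro!: Ck_affine\<close>)
qed

lemma test_function_continuous: "\<psi> \<in> test_functions D \<Longrightarrow> continuous_on UNIV \<psi>"
  by (auto simp: test_functions_def intro: Ck_continuous)

lemma test_function_integrable: "\<psi> \<in> test_functions UNIV \<Longrightarrow> integrable lborel \<psi>"
  by (meson compact_support_integrable test_function_continuous test_functions_bounded_support)

lemma test_function_has_derivative:
  "\<psi> \<in> test_functions D \<Longrightarrow> (\<psi> has_derivative frechet_derivative \<psi> (at x)) (at x)"
  using Ck_has_derivative[of 0 \<psi>] by (simp add: test_functions_def del: Ck.simps)

lemma test_function_bounded:
  assumes "\<psi> \<in> test_functions D" obtains M where "M > 0" "\<And>x. \<bar>\<psi> x\<bar> \<le> M"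
proof -
  obtain R where R: "\<And>x. norm x > R \<Longrightarrow> \<psi> x = 0"
    using test_functions_bounded_support[OF assms] by blast
  show ?thesis
    by (rule compact_support_bounded[OF test_function_continuous[OF assms] R]) (use that in auto)
qed

section \<open>Mollifiers\<close>

definition mollifier :: "real \<Rightarrow> (real^'d::finite \<Rightarrow> real) \<Rightarrow> bool" where
  "mollifier \<tau> \<eta> \<longleftrightarrow> \<eta> \<in> test_functions UNIV \<and> (\<forall>x. \<eta> x \<ge> 0) \<and>
    (\<forall>x. norm x \<ge> \<tau> \<longrightarrow> \<eta> x = 0) \<and> integral\<^sup>L lborel \<eta> = 1"

lemma mollifierD:
  assumes "mollifier \<tau> \<eta>"
  shows "\<eta> \<in> test_functions UNIV" "\<eta> x \<ge> 0" "norm x \<ge> \<tau> \<Longrightarrow> \<eta> x = 0" "integral\<^sup>L lborel \<eta> = 1"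
  using assms by (auto simp: mollifier_def)

lemma exists_mollifier:
  assumes "\<tau> > 0"
  obtains \<eta> :: "real^'d::finite \<Rightarrow> real" where "mollifier \<tau> \<eta>"
proof -
  \<comment> \<open>The two factors confine each coordinate to the open interval from -1 to 1. Their
    arguments have the shape required by \<open>Ck_affine\<close>.\<close>
  define b :: "real^'d \<Rightarrow> real" where
    "b x = (\<Prod>i\<in>UNIV. bumpfun 0 ((1 + (-1) *\<^sub>R x) $ i) * bumpfun 0 ((1 + 1 *\<^sub>R x) $ i))" for x
  \<comment> \<open>A point of norm at least \<tau> has a coordinate of modulus at least
    \<open>\<tau> / CARD('d)\<close>, and this factor stretches it to modulus at least 1, where
    \<open>b\<close> vanishes.\<close>
  define c where "c = real CARD('d) / \<tau>"
  have c: "c > 0" using assms by (simp add: c_def)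
  have Ckb: "Ck k b" for k
    unfolding b_def
    by (intro Ck_prod Ck_mult Ck_affine[of _ "\<lambda>x. bumpfun 0 (x $ i)" for i] Ck_bumpfun) auto
  have Ckc: "Ck k (\<lambda>x. b (0 + c *\<^sub>R x))" for k by (intro Ck_affine Ckb)
  have b0: "b x \<ge> 0" for x by (auto simp: b_def bumpfun_def intro!: prod_nonneg)
  have bz: "b (0 + c *\<^sub>R x) = 0" if "norm x \<ge> \<tau>" for x
  proof -
    have "\<exists>i. \<bar>x $ i\<bar> \<ge> \<tau> / CARD('d)"
    proof (rule ccontr)
      assume "\<not> ?thesis"
      then have "(\<Sum>i\<in>UNIV. \<bar>x $ i\<bar>) < (\<Sum>i\<in>(UNIV::'d set). \<tau> / CARD('d))"
        by (intro sum_strict_mono) (auto simp: not_le)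
      then show False using norm_le_l1_cart[of x] that by simp
    qed
    then obtain i where i: "\<bar>x $ i\<bar> \<ge> \<tau> / CARD('d)" by blast
    have "\<bar>c * x $ i\<bar> \<ge> 1"
      using i assms by (simp add: c_def abs_mult field_simps)
    then have "bumpfun 0 (1 - c * x $ i) * bumpfun 0 (1 + c * x $ i) = 0"
      by (auto simp: bumpfun_def)
    then show ?thesis unfolding b_def by (auto simp: prod_zero_iff)
  qed
  define \<eta>0 where "\<eta>0 x = b (0 + c *\<^sub>R x)" for x
  have t: "\<eta>0 \<in> test_functions UNIV" unfolding \<eta>0_def
    by (rule test_function_UNIV_I[of _ \<tau>]) (use Ckc bz in auto)
  have int: "integrable lborel \<eta>0" by (rule test_function_integrable[OF t])
  have nn: "\<eta>0 x \<ge> 0" for x by (simp add: \<eta>0_def b0)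
  have cont: "continuous_on UNIV \<eta>0" by (rule test_function_continuous[OF t])
  \<comment> \<open>If the integral were zero, the open set where the function is nonzero would be
    negligible; but that set contains 0.\<close>
  have "integral\<^sup>L lborel \<eta>0 \<noteq> 0"
  proof
    assume "integral\<^sup>L lborel \<eta>0 = 0"
    then have "AE x in lborel. \<eta>0 x = 0"
      using int nn by (subst (asm) integral_nonneg_eq_0_iff_AE) auto
    then have ae: "AE x in lebesgue. \<eta>0 x = 0" by (rule AE_completion)
    have op: "open {x. \<eta>0 x \<noteq> 0}"
      using open_Collect_neq[OF cont continuous_on_const] by simp
    have "{x. \<eta>0 x \<noteq> 0} \<in> null_sets lebesgue"
      using ae AE_iff_null_sets[OF sets_completionI_sets[of "{x. \<eta>0 x \<noteq> 0}" lborel]] op by simp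
    then have "negligible {x. \<eta>0 x \<noteq> 0}"
      by (simp add: negligible_iff_null_sets)
    moreover have "\<eta>0 0 \<noteq> 0" by (simp add: \<eta>0_def b_def bumpfun_def)
    ultimately show False using open_not_negligible[OF op] by blast
  qed
  moreover have "integral\<^sup>L lborel \<eta>0 \<ge> 0" using nn by simp
  ultimately have pos: "integral\<^sup>L lborel \<eta>0 > 0" by simp
  define \<eta> where "\<eta> x = inverse (integral\<^sup>L lborel \<eta>0) * \<eta>0 x" for x
  have bz': "\<eta>0 x = 0" if "norm x \<ge> \<tau>" for x using bz[OF that] by (simp add: \<eta>0_def)
  have t1: "\<eta> \<in> test_functions UNIV" unfolding \<eta>_def
    by (rule test_function_UNIV_I[of _ \<tau>]) (use bz' t in \<open>auto simp: test_functions_def intro!: Ck_mult Ck_const\<close>)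
  have t2: "integral\<^sup>L lborel \<eta> = 1" unfolding \<eta>_def using pos by simp
  show ?thesis
    by (rule that) (use t1 t2 nn pos bz' in \<open>auto simp: mollifier_def \<eta>_def\<close>)
qed

section \<open>Affine changes of variables\<close>

lemma lborel_distr_unit_affine:
  fixes t :: "'a::euclidean_space"
  assumes "\<bar>c\<bar> = 1"
  shows "distr lborel borel (\<lambda>x. t + c *\<^sub>R x) = (lborel :: 'a measure)"
  using lborel_affine[of c t] assms by (auto simp: density_1)

lemma lborel_integral_unit_affine:
  fixes f :: "'a::euclidean_space \<Rightarrow> 'b::euclidean_space"
  assumes f: "f \<in> borel_measurable borel" and c: "\<bar>c\<bar> = 1"
  shows "(\<integral>x. f (t + c *\<^sub>R x) \<partial>lborel) = integral\<^sup>L lborel f"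
    and "integrable lborel (\<lambda>x. f (t + c *\<^sub>R x)) \<longleftrightarrow> integrable lborel f"
proof -
  have m: "(\<lambda>x. t + c *\<^sub>R x) \<in> borel_measurable lborel" by measurable
  show "(\<integral>x. f (t + c *\<^sub>R x) \<partial>lborel) = integral\<^sup>L lborel f"
    using integral_distr[OF m, of f] f by (simp add: lborel_distr_unit_affine[OF c])
  show "integrable lborel (\<lambda>x. f (t + c *\<^sub>R x)) \<longleftrightarrow> integrable lborel f"
    using integrable_distr_eq[OF m, of f] f by (simp add: lborel_distr_unit_affine[OF c])
qed

lemma lborel_integral_translate:
  fixes f :: "'a::euclidean_space \<Rightarrow> 'b::euclidean_space"
  assumes "f \<in> borel_measurable borel"
  shows "(\<integral>x. f (x + t) \<partial>lborel) = integral\<^sup>L lborel f"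
    and "integrable lborel (\<lambda>x. f (x + t)) \<longleftrightarrow> integrable lborel f"
  using lborel_integral_unit_affine[OF assms, of 1 t] by (simp_all add: add.commute)

lemma lborel_integral_reflect:
  fixes f :: "'a::euclidean_space \<Rightarrow> 'b::euclidean_space"
  assumes "f \<in> borel_measurable borel"
  shows "(\<integral>x. f (t - x) \<partial>lborel) = integral\<^sup>L lborel f"
    and "integrable lborel (\<lambda>x. f (t - x)) \<longleftrightarrow> integrable lborel f"
  using lborel_integral_unit_affine[OF assms, of "-1" t] by simp_all

lemma lborel_nn_integral_affine:
  fixes f :: "'a::euclidean_space \<Rightarrow> ennreal"
  assumes f[measurable]: "f \<in> borel_measurable borel" and c: "c \<noteq> 0"
  shows "(\<integral>\<^sup>+x. f x \<partial>lborel) = ennreal (\<bar>c\<bar> ^ DIM('a)) * (\<integral>\<^sup>+x. f (t + c *\<^sub>R x) \<partial>lborel)"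
  by (subst lborel_affine[OF c, of t])
     (simp add: nn_integral_density nn_integral_distr nn_integral_cmult)

lemma lborel_nn_integral_translate:
  fixes f :: "'a::euclidean_space \<Rightarrow> ennreal"
  assumes "f \<in> borel_measurable borel"
  shows "(\<integral>\<^sup>+x. f (x + t) \<partial>lborel) = (\<integral>\<^sup>+x. f x \<partial>lborel)"
  using lborel_nn_integral_affine[OF assms, of 1 t] by (simp add: add.commute)

lemma lborel_nn_integral_reflect:
  fixes f :: "'a::euclidean_space \<Rightarrow> ennreal"
  assumes "f \<in> borel_measurable borel"
  shows "(\<integral>\<^sup>+x. f (t - x) \<partial>lborel) = (\<integral>\<^sup>+x. f x \<partial>lborel)"
  using lborel_nn_integral_affine[OF assms, of "-1" t] by simp

section \<open>Gradients and convolution\<close>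

definition gradient :: "(real^'d::finite \<Rightarrow> real) \<Rightarrow> real^'d \<Rightarrow> real^'d" where
  "gradient \<eta> x = (\<chi> j. frechet_derivative \<eta> (at x) (axis j 1))"

lemma frechet_derivative_gradient:
  assumes "\<psi> \<in> test_functions D"
  shows "frechet_derivative \<psi> (at x) h = gradient \<psi> x \<bullet> h"
proof -
  interpret linear "frechet_derivative \<psi> (at x)"
    by (rule has_derivative_linear[OF test_function_has_derivative[OF assms]])
  have "frechet_derivative \<psi> (at x) h = frechet_derivative \<psi> (at x) (\<Sum>j\<in>UNIV. h $ j *\<^sub>R axis j 1)"
    using basis_expansion[of h] by (simp add: scalar_mult_eq_scaleR)
  also have "\<dots> = gradient \<psi> x \<bullet> h"
    by (simp add: sum scaleR gradient_def inner_vec_def mult.commute)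
  finally show ?thesis .
qed

lemma test_function_has_gradient:
  assumes "\<psi> \<in> test_functions D"
  shows "(\<psi> has_derivative (\<lambda>h. gradient \<psi> x \<bullet> h)) (at x)"
proof -
  have "frechet_derivative \<psi> (at x) = (\<lambda>h. gradient \<psi> x \<bullet> h)"
    by (rule ext) (rule frechet_derivative_gradient[OF assms])
  then show ?thesis using test_function_has_derivative[OF assms, of x] by simp
qed

lemma gradient_support:
  "(\<And>x. norm x > R \<Longrightarrow> \<psi> x = 0) \<Longrightarrow> norm x > R \<Longrightarrow> gradient \<psi> x = 0"
  by (simp add: gradient_def frechet_derivative_support[of R \<psi> x] vec_eq_iff)

lemma test_function_gradient_continuous:
  assumes "\<psi> \<in> test_functions UNIV"
  shows "continuous_on UNIV (gradient \<psi>)"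
  unfolding gradient_def
  by (intro continuous_on_vec_lambda test_function_continuous[OF test_function_pd[OF assms]])

text \<open>The point is that \<open>d\<close> does not depend on \<open>z\<close>. It comes from
  the uniform continuity of the compactly supported gradient and is what allows differentiation
  under the integral sign in \<open>mollify_has_derivative\<close>.\<close>

lemma test_function_linearization:
  assumes \<psi>: "\<psi> \<in> test_functions (UNIV :: (real^'d::finite) set)" and "e > 0"
  obtains d where "d > 0"
    "\<And>w z. norm (w - z) < d \<Longrightarrow> \<bar>\<psi> w - \<psi> z - gradient \<psi> z \<bullet> (w - z)\<bar> \<le> e * norm (w - z)"
proof -
  obtain R where R: "\<And>x. norm x > R \<Longrightarrow> \<psi> x = 0"
    using test_functions_bounded_support[OF \<psi>] by blast
  have "uniformly_continuous_on UNIV (gradient \<psi>)"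
    by (rule compact_support_uniformly_continuous[OF test_function_gradient_continuous[OF \<psi>]])
       (rule gradient_support[OF R])
  then obtain d where d: "d > 0" "\<And>x y. dist y x < d \<Longrightarrow> dist (gradient \<psi> y) (gradient \<psi> x) < e"
    by (rule uniformly_continuous_onE[OF _ \<open>e > 0\<close>]) (use UNIV_I in blast)
  show ?thesis
  proof (rule that[OF d(1)])
    fix w z :: "real^'d" assume wz: "norm (w - z) < d"
    have "norm (\<psi> w - \<psi> z - (\<lambda>h. gradient \<psi> z \<bullet> h) (w - z)) \<le> norm (w - z) * e"
    proof (rule differentiable_bound_linearization[where S = "ball z d" and f' = "\<lambda>x h. gradient \<psi> x \<bullet> h"])
      show "z + t *\<^sub>R (w - z) \<in> ball z d" if "t \<in> {0..1}" for t :: real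
      proof -
        have "norm (t *\<^sub>R (w - z)) \<le> norm (w - z)" using that by (simp add: mult_left_le_one_le)
        then show ?thesis using wz by (simp add: dist_norm)
      qed
      show "(\<psi> has_derivative (\<lambda>h. gradient \<psi> x \<bullet> h)) (at x within ball z d)" for x
        by (rule has_derivative_at_withinI[OF test_function_has_gradient[OF \<psi>]])
      show "onorm ((\<lambda>h. gradient \<psi> x \<bullet> h) - (\<lambda>h. gradient \<psi> z \<bullet> h)) \<le> e" if "x \<in> ball z d" for x
      proof (rule onorm_le)
        fix h :: "real^'d"
        have "norm (gradient \<psi> x - gradient \<psi> z) < e"
          using d(2)[of x z] that by (simp add: dist_norm norm_minus_commute)
        then have "norm (gradient \<psi> x - gradient \<psi> z) * norm h \<le> e * norm h"
          by (intro mult_right_mono) auto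
        then show "norm (((\<lambda>h. gradient \<psi> x \<bullet> h) - (\<lambda>h. gradient \<psi> z \<bullet> h)) h) \<le> e * norm h"
          using Cauchy_Schwarz_ineq2[of "gradient \<psi> x - gradient \<psi> z" h]
          by (simp add: inner_diff_left)
      qed
    qed (use d in auto)
    then show "\<bar>\<psi> w - \<psi> z - gradient \<psi> z \<bullet> (w - z)\<bar> \<le> e * norm (w - z)"
      by (simp add: mult.commute)
  qed
qed

lemma sum_axis_scaleR:
  fixes F :: "'d::finite \<Rightarrow> 'b::real_vector"
  shows "(\<Sum>i\<in>UNIV. (axis j 1 :: real^'d) $ i *\<^sub>R F i) = F j"
proof -
  have "(\<Sum>i\<in>UNIV. (axis j 1 :: real^'d) $ i *\<^sub>R F i) = (\<Sum>i\<in>UNIV. if i = j then F i else 0)"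
    by (intro sum.cong) (auto simp: axis_def)
  then show ?thesis by simp
qed

text \<open>The kernel may be any function, because the derivative of a convolution is again of this
  form, with a differentiated kernel of no fixed sign.\<close>

definition mollify :: "(real^'d::finite \<Rightarrow> real) \<Rightarrow> (real^'d \<Rightarrow> 'b::euclidean_space) \<Rightarrow> real^'d \<Rightarrow> 'b" where
  "mollify \<eta> f x = (\<integral>y. \<eta> (x - y) *\<^sub>R f y \<partial>lborel)"

lemma mollify_integrable:
  fixes f :: "real^'d::finite \<Rightarrow> 'b::euclidean_space"
  assumes f: "integrable lborel f" and g: "continuous_on UNIV g" and M: "\<And>x. \<bar>g x\<bar> \<le> M"
  shows "integrable lborel (\<lambda>y. (g (x - y) :: real) *\<^sub>R f y)"
proof (rule Bochner_Integration.integrable_bound[where f = "\<lambda>y. M *\<^sub>R f y"])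
  have [measurable]: "g \<in> borel_measurable borel" by (rule borel_measurable_continuous_onI[OF g])
  have [measurable]: "f \<in> borel_measurable borel" using f by auto
  show "(\<lambda>y. g (x - y) *\<^sub>R f y) \<in> borel_measurable lborel" by measurable
  have "M \<ge> 0" using M[of 0] by linarith
  then show "AE y in lborel. norm (g (x - y) *\<^sub>R f y) \<le> norm (M *\<^sub>R f y)"
    using M by (auto intro!: mult_right_mono)
qed (use f in simp)

lemma mollify_integrable_test:
  fixes f :: "real^'d::finite \<Rightarrow> 'b::euclidean_space"
  assumes "integrable lborel f" "\<eta> \<in> test_functions UNIV"
  shows "integrable lborel (\<lambda>y. \<eta> (x - y) *\<^sub>R f y)"
proof -
  obtain M where "\<And>x. \<bar>\<eta> x\<bar> \<le> M" using test_function_bounded[OF assms(2)] by blast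
  then show ?thesis by (intro mollify_integrable test_function_continuous[OF assms(2)] assms(1))
qed

lemma mollify_has_derivative:
  fixes f :: "real^'d::finite \<Rightarrow> 'b::euclidean_space"
  assumes f: "integrable lborel f" and \<eta>: "\<eta> \<in> test_functions UNIV"
  shows "(mollify \<eta> f has_derivative
    (\<lambda>h. \<Sum>j\<in>UNIV. h $ j *\<^sub>R mollify (\<lambda>x. frechet_derivative \<eta> (at x) (axis j 1)) f x)) (at x)"
    (is "(_ has_derivative ?D) _")
proof -
  have i1: "integrable lborel (\<lambda>y. \<eta> (x - y) *\<^sub>R f y)" for x
    by (rule mollify_integrable_test[OF f \<eta>])
  have i2: "integrable lborel (\<lambda>y. frechet_derivative \<eta> (at (x - y)) (axis j 1) *\<^sub>R f y)" for x j
    by (rule mollify_integrable_test[OF f test_function_pd[OF \<eta>]])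
  have D: "?D h = (\<integral>y. (gradient \<eta> (x - y) \<bullet> h) *\<^sub>R f y \<partial>lborel)"
    and i3: "integrable lborel (\<lambda>y. (gradient \<eta> (x - y) \<bullet> h) *\<^sub>R f y)" for h
  proof -
    have eq: "(gradient \<eta> (x - y) \<bullet> h) *\<^sub>R f y =
      (\<Sum>j\<in>UNIV. h $ j *\<^sub>R (frechet_derivative \<eta> (at (x - y)) (axis j 1) *\<^sub>R f y))" for y
      by (simp add: gradient_def inner_vec_def scaleR_sum_left mult.commute)
    show "?D h = (\<integral>y. (gradient \<eta> (x - y) \<bullet> h) *\<^sub>R f y \<partial>lborel)"
      unfolding eq mollify_def using i2 by (subst Bochner_Integration.integral_sum) (auto simp del: scaleR_scaleR)
    show "integrable lborel (\<lambda>y. (gradient \<eta> (x - y) \<bullet> h) *\<^sub>R f y)"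
      unfolding eq using i2 by (intro Bochner_Integration.integrable_sum integrable_scaleR_right)
  qed
  \<comment> \<open>The first-order remainder of the kernel is small uniformly in \<open>y\<close>,
    so the remainder of the convolution is at most a small multiple of this constant;
    \<open>I + 1\<close> below guards against \<open>I = 0\<close>.\<close>
  define I where "I = (\<integral>y. norm (f y) \<partial>lborel)"
  have I: "I \<ge> 0" by (simp add: I_def)
  show ?thesis
    unfolding has_derivative_at_alt
  proof (intro conjI allI impI)
    show "bounded_linear ?D"
      by (intro bounded_linear_sum bounded_linear_scaleR_const[OF bounded_linear_vec_nth])
    fix e :: real assume "e > 0"
    then have e': "e / (I + 1) > 0" using I by simp
    obtain d where d: "d > 0" "\<And>w z. norm (w - z) < d \<Longrightarrow>
        \<bar>\<eta> w - \<eta> z - gradient \<eta> z \<bullet> (w - z)\<bar> \<le> e / (I + 1) * norm (w - z)"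
      using test_function_linearization[OF \<eta> e'] by blast
    show "\<exists>d>0. \<forall>y. norm (y - x) < d \<longrightarrow> norm (mollify \<eta> f y - mollify \<eta> f x - ?D (y - x)) \<le> e * norm (y - x)"
    proof (intro exI[of _ d] conjI allI impI d(1))
      fix x' assume x': "norm (x' - x) < d"
      let ?r = "\<lambda>y. \<eta> (x' - y) - \<eta> (x - y) - gradient \<eta> (x - y) \<bullet> (x' - x)"
      have "integrable lborel (\<lambda>y. \<eta> (x' - y) *\<^sub>R f y - \<eta> (x - y) *\<^sub>R f y
            - (gradient \<eta> (x - y) \<bullet> (x' - x)) *\<^sub>R f y)"
        using i1[of x'] i1[of x] i3[of "x' - x"] by (rule Bochner_Integration.integrable_diff[OF Bochner_Integration.integrable_diff])
      then have r1: "integrable lborel (\<lambda>y. norm (?r y *\<^sub>R f y))"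
        unfolding scaleR_diff_left by (rule integrable_norm)
      have r2: "norm (?r y *\<^sub>R f y) \<le> (e / (I + 1) * norm (x' - x)) * norm (f y)" for y
      proof -
        have "\<bar>?r y\<bar> \<le> e / (I + 1) * norm (x' - x)"
          using d(2)[of "x' - y" "x - y"] x' by simp
        then show ?thesis unfolding norm_scaleR by (rule mult_right_mono) simp
      qed
      have eq: "mollify \<eta> f x' - mollify \<eta> f x - ?D (x' - x) = (\<integral>y. ?r y *\<^sub>R f y \<partial>lborel)"
      proof -
        have "(\<integral>y. ?r y *\<^sub>R f y \<partial>lborel) = (\<integral>y. \<eta> (x' - y) *\<^sub>R f y - \<eta> (x - y) *\<^sub>R f y
            - (gradient \<eta> (x - y) \<bullet> (x' - x)) *\<^sub>R f y \<partial>lborel)"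
          by (simp add: scaleR_diff_left)
        also have "\<dots> = mollify \<eta> f x' - mollify \<eta> f x - ?D (x' - x)"
          unfolding D unfolding mollify_def using i1 i3[of "x' - x"] by simp
        finally show ?thesis by simp
      qed
      have "norm (mollify \<eta> f x' - mollify \<eta> f x - ?D (x' - x)) \<le> (\<integral>y. norm (?r y *\<^sub>R f y) \<partial>lborel)"
        unfolding eq by (rule integral_norm_bound)
      also have "\<dots> \<le> (\<integral>y. (e / (I + 1) * norm (x' - x)) * norm (f y) \<partial>lborel)"
      proof (rule integral_mono[OF r1 _ r2])
        show "integrable lborel (\<lambda>y. e / (I + 1) * norm (x' - x) * norm (f y))"
          by (intro integrable_mult_right integrable_norm f)
      qed
      also have "\<dots> = e * norm (x' - x) * (I / (I + 1))" by (simp add: I_def)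
      also have "\<dots> \<le> e * norm (x' - x) * 1"
        using I \<open>e > 0\<close> by (intro mult_left_mono) auto
      finally show "norm (mollify \<eta> f x' - mollify \<eta> f x - ?D (x' - x)) \<le> e * norm (x' - x)" by simp
    qed
  qed
qed

lemma mollify_continuous:
  fixes f :: "real^'d::finite \<Rightarrow> 'b::euclidean_space"
  assumes "integrable lborel f" "\<eta> \<in> test_functions UNIV"
  shows "continuous_on UNIV (mollify \<eta> f)"
  using mollify_has_derivative[OF assms]
  by (intro continuous_at_imp_continuous_on ballI has_derivative_continuous)

lemma mollify_support:
  assumes "\<And>z. norm z \<ge> \<tau> \<Longrightarrow> \<eta> z = 0" "\<And>y. y \<in> ball x \<tau> \<Longrightarrow> f y = 0"
  shows "mollify \<eta> f x = 0"
proof -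
  have "\<eta> (x - y) *\<^sub>R f y = 0" for y
    using assms(1)[of "x - y"] assms(2)[of y] by (cases "norm (x - y) < \<tau>") (auto simp: dist_norm)
  then have "(\<lambda>y. \<eta> (x - y) *\<^sub>R f y) = (\<lambda>y. 0)" by blast
  then show ?thesis by (simp add: mollify_def)
qed

lemma mollify_const:
  fixes \<eta> :: "real^'d::finite \<Rightarrow> real" and c :: "'b::euclidean_space"
  assumes \<eta>: "\<eta> \<in> test_functions UNIV" "integral\<^sup>L lborel \<eta> = 1"
  shows "(\<integral>y. \<eta> (x - y) *\<^sub>R c \<partial>lborel) = c" "integrable lborel (\<lambda>y. \<eta> (x - y))"
proof -
  have m: "\<eta> \<in> borel_measurable borel"
    by (rule borel_measurable_continuous_onI[OF test_function_continuous[OF \<eta>(1)]])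
  show *: "integrable lborel (\<lambda>y. \<eta> (x - y))"
    using lborel_integral_reflect(2)[OF m] test_function_integrable[OF \<eta>(1)] by simp
  show "(\<integral>y. \<eta> (x - y) *\<^sub>R c \<partial>lborel) = c"
    using lborel_integral_reflect(1)[OF m, of x] \<eta>(2) * by simp
qed

text \<open>A mollification is a weighted average of nearby values and so stays in any closed ball
  that contains them. Different choices of \<open>c\<close> and \<open>B\<close> give bounds on the
  range as well as closeness to \<open>f\<close>.\<close>

lemma mollify_dist_le:
  fixes f :: "real^'d::finite \<Rightarrow> 'b::euclidean_space"
  assumes m: "mollifier \<tau> \<eta>"
    and f: "integrable lborel f" and le: "\<And>y. y \<in> ball x \<tau> \<Longrightarrow> norm (f y - c) \<le> B"
  shows "norm (mollify \<eta> f x - c) \<le> B"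
proof -
  note \<eta> = mollifierD[OF m]
  note i = mollify_integrable_test[OF f \<eta>(1), of x]
  note c = mollify_const[OF \<eta>(1,4), of x]
  have eq: "mollify \<eta> f x - c = (\<integral>y. \<eta> (x - y) *\<^sub>R (f y - c) \<partial>lborel)"
    unfolding mollify_def using i c(2) c(1)[of c] by (simp add: scaleR_diff_right)
  have "norm (mollify \<eta> f x - c) \<le> (\<integral>y. norm (\<eta> (x - y) *\<^sub>R (f y - c)) \<partial>lborel)"
    unfolding eq by (rule integral_norm_bound)
  also have "\<dots> \<le> (\<integral>y. \<eta> (x - y) *\<^sub>R B \<partial>lborel)"
  proof (rule integral_mono)
    show "integrable lborel (\<lambda>y. norm (\<eta> (x - y) *\<^sub>R (f y - c)))"
      using i c(2) by (auto simp: scaleR_diff_right)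
    show "norm (\<eta> (x - y) *\<^sub>R (f y - c)) \<le> \<eta> (x - y) *\<^sub>R B" for y
      using le[of y] \<eta>(2,3)[of "x - y"] by (cases "norm (x - y) < \<tau>") (auto simp: dist_norm intro!: mult_left_mono)
  qed (use c(2) in auto)
  also have "\<dots> = B" using c(1)[of B] by simp
  finally show ?thesis .
qed

lemma Ck_mollify:
  fixes f :: "real^'d::finite \<Rightarrow> real"
  assumes f: "integrable lborel f" and \<eta>: "\<eta> \<in> test_functions UNIV"
  shows "Ck k (mollify \<eta> f)"
  using \<eta>
proof (induction k arbitrary: \<eta>)
  case 0
  then show ?case using mollify_continuous[OF f] by simp
next
  case (Suc k)
  show ?case
  proof (rule Ck_SucI[OF mollify_has_derivative[OF f Suc.prems]])
    fix j
    have "(\<lambda>x. \<Sum>i\<in>UNIV. axis j 1 $ i *\<^sub>R mollify (\<lambda>x. frechet_derivative \<eta> (at x) (axis i 1)) f x)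
      = mollify (\<lambda>x. frechet_derivative \<eta> (at x) (axis j 1)) f"
      by (rule ext) (rule sum_axis_scaleR)
    then show "Ck k (\<lambda>x. \<Sum>i\<in>UNIV. axis j 1 $ i *\<^sub>R mollify (\<lambda>x. frechet_derivative \<eta> (at x) (axis i 1)) f x)"
      using Suc.IH[OF test_function_pd[OF Suc.prems]] by simp
  qed
qed

lemma frechet_derivative_mollify:
  fixes f :: "real^'d::finite \<Rightarrow> real"
  assumes f: "integrable lborel f" and \<eta>: "\<eta> \<in> test_functions UNIV"
  shows "frechet_derivative (mollify \<eta> f) (at x) (axis j 1) = mollify (\<lambda>x. frechet_derivative \<eta> (at x) (axis j 1)) f x"
  unfolding frechet_derivative_eqI[OF mollify_has_derivative[OF f \<eta>]]
  by (rule sum_axis_scaleR)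

section \<open>Continuity of translations in the mean\<close>

text \<open>\<open>A\<close> is squeezed between a compact set \<open>K\<close> and an open set
  \<open>T\<close> of nearly the same measure. A translation by less than the distance from
  \<open>K\<close> to the complement of \<open>T\<close> keeps \<open>K\<close> inside
  \<open>T\<close>, so the indicators differ only on \<open>T - K\<close> or on its
  translate.\<close>

lemma L1_translation_indicator:
  fixes A :: "'a::euclidean_space set"
  assumes A: "A \<in> sets lborel" "emeasure lborel A < \<infinity>" and "e > 0"
  shows "\<exists>d>0. \<forall>z. norm z < d \<longrightarrow> (\<integral>x. \<bar>indicator A (x + z) - indicator A x\<bar> \<partial>lborel) \<le> (e::real)"
proof -
  have Ab [measurable]: "A \<in> sets borel" using A by simp
  \<comment> \<open>Three gaps of size \<open>e/8\<close> add up to less than \<open>e/2\<close>,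
    and the measure of \<open>T - K\<close> is counted twice at the end.\<close>
  have e8: "e/8 > 0" using \<open>e > 0\<close> by simp
  obtain T where T: "open T" "A \<subseteq> T" "emeasure lborel (T - A) < ennreal (e/8)"
    using outer_regular_lborel[OF Ab e8] by blast
  \<comment> \<open>Outer regularity of the complement gives inner approximation of \<open>A\<close>
    by the closed set \<open>- V\<close>; intersecting with large balls makes it compact.\<close>
  obtain V where V: "open V" "- A \<subseteq> V" "emeasure lborel (V - (- A)) < ennreal (e/8)"
    using outer_regular_lborel[OF _ e8, of "- A"] by auto
  have [measurable]: "T \<in> sets borel" "V \<in> sets borel" using T(1) V(1) by auto
  define F where "F n = - V \<inter> cball 0 (real n)" for n :: nat
  have F: "compact (F n)" "F n \<subseteq> A" for n
    using V(1,2) by (auto simp: F_def intro!: closed_Int_compact)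
  have Fb [measurable]: "F n \<in> sets borel" for n using F(1) borel_compact by blast
  have fT: "emeasure lborel T < \<infinity>"
  proof -
    have "emeasure lborel T \<le> emeasure lborel A + emeasure lborel (T - A)"
      using emeasure_subadditive[of A lborel "T - A"] T(2) by (simp add: Un_absorb1)
    also have "\<dots> < \<infinity>" using A(2) T(3) by (auto simp: less_top[symmetric] top_unique)
    finally show ?thesis .
  qed
  have fV: "emeasure lborel (- V) < \<infinity>"
    using A(2) emeasure_mono[of "- V" A lborel] V(2) A(1) by (auto intro: le_less_trans)
  have "(\<lambda>n. emeasure lborel (F n)) \<longlonglongrightarrow> emeasure lborel (\<Union>n. F n)"
    by (rule Lim_emeasure_incseq) (auto simp: F_def incseq_def)
  moreover have "(\<Union>n. F n) = - V"
    by (auto simp: F_def intro: real_arch_simple)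
  ultimately have "(\<lambda>n. measure lborel (F n)) \<longlonglongrightarrow> measure lborel (- V)"
    using fV unfolding measure_def by (intro tendsto_enn2real) auto
  then have "\<forall>\<^sub>F n in sequentially. measure lborel (- V) - e/8 < measure lborel (F n)"
    using e8 by (intro order_tendstoD(1)) auto
  then obtain n where n: "measure lborel (- V) - e/8 < measure lborel (F n)"
    by (auto simp: eventually_sequentially)
  define K where "K = F n"
  have K: "compact K" "K \<subseteq> A" using F by (auto simp: K_def)
  have fin: "emeasure lborel T < \<infinity>" "emeasure lborel K < \<infinity>"
    using fT emeasure_mono[of K A lborel] K(2) A by auto
  have mT: "measure lborel T - measure lborel A < e/8"
  proof -
    have "measure lborel (T - A) = measure lborel T - measure lborel A"
      using fin A T(2) by (intro measure_Diff) auto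
    then show ?thesis
      using T(3) \<open>e > 0\<close> by (metis (no_types) e8 enn2real_ennreal enn2real_less_iff ennreal_less_top less_imp_le measure_def top.not_eq_extremum order_less_trans)
  qed
  have mA: "measure lborel A - measure lborel (- V) < e/8"
  proof -
    have "V - (- A) = A - (- V)" by auto
    moreover have "measure lborel (A - (- V)) = measure lborel A - measure lborel (- V)"
      using A V(2) by (intro measure_Diff) auto
    ultimately show ?thesis
      using V(3) \<open>e > 0\<close> by (metis (no_types) e8 enn2real_ennreal enn2real_less_iff ennreal_less_top less_imp_le measure_def top.not_eq_extremum order_less_trans)
  qed
  have mTK: "measure lborel T - measure lborel K < e/2"
    using mT mA n \<open>e > 0\<close> unfolding K_def by linarith
  obtain d where d: "d > 0" "(\<Union>x\<in>K. ball x d) \<subseteq> T"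
    using compact_subset_open_imp_ball_epsilon_subset[OF K(1) T(1)] K(2) T(2) by blast
  let ?g = "\<lambda>x. indicator T x - indicator K x :: real"
  have [measurable]: "K \<in> sets borel" by (simp add: K_def)
  have gi: "integrable lborel ?g"
    using fin by (auto intro!: Bochner_Integration.integrable_diff)
  have gm: "?g \<in> borel_measurable borel" by measurable
  have gI: "integral\<^sup>L lborel ?g = measure lborel T - measure lborel K"
    using fin by (subst Bochner_Integration.integral_diff) auto
  show ?thesis
  proof (intro exI[of _ d] conjI allI impI d(1))
    fix z :: 'a assume z: "norm z < d"
    have "(\<integral>x. \<bar>indicator A (x + z) - indicator A x\<bar> \<partial>lborel) \<le> (\<integral>x. ?g (x + z) + ?g x \<partial>lborel)"
    proof (rule integral_mono_AE')
      show "integrable lborel (\<lambda>x. ?g (x + z) + ?g x)"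
        using lborel_integral_translate(2)[OF gm, of z] gi by auto
      have "x \<in> T" if "x + z \<in> K" for x
      proof -
        have "x \<in> ball (x + z) d" using z by (simp add: dist_norm)
        then show ?thesis using d(2) that by blast
      qed
      moreover have "x + z \<in> T" if "x \<in> K" for x
      proof -
        have "x + z \<in> ball x d" using z by (simp add: dist_norm)
        then show ?thesis using d(2) that by blast
      qed
      ultimately show "AE x in lborel. \<bar>indicator A (x + z) - indicator A x\<bar> \<le> ?g (x + z) + ?g x"
        using T(2) K(2) by (intro AE_I2) (auto simp: indicator_def)
      show "AE x in lborel. 0 \<le> ?g (x + z) + ?g x"
        using T(2) K(2) by (intro AE_I2) (auto simp: indicator_def)
    qed
    also have "\<dots> = 2 * integral\<^sup>L lborel ?g"
      using lborel_integral_translate[OF gm, of z] gi by simp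
    also have "\<dots> \<le> e" unfolding gI using mTK by simp
    finally show "(\<integral>x. \<bar>indicator A (x + z) - indicator A x\<bar> \<partial>lborel) \<le> e" .
  qed
qed

lemma L1_translation_continuous:
  fixes f :: "'a::euclidean_space \<Rightarrow> 'b::euclidean_space"
  assumes "integrable lborel f" "e > 0"
  shows "\<exists>d>0. \<forall>z. norm z < d \<longrightarrow> (\<integral>x. norm (f (x + z) - f x) \<partial>lborel) \<le> e"
  using assms
proof (induction arbitrary: e rule: integrable_induct)
  case (base A c)
  have "e / (norm c + 1) > 0" using base.prems by (simp add: add_nonneg_pos)
  then obtain d where d: "d > 0" "\<And>z. norm z < d \<Longrightarrow>
      (\<integral>x. \<bar>indicator A (x + z) - indicator A x\<bar> \<partial>lborel) \<le> e / (norm c + 1)"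
    using L1_translation_indicator[OF base(1,2)] by blast
  show ?case
  proof (intro exI[of _ d] conjI allI impI d(1))
    fix z :: 'a assume "norm z < d"
    have "norm c / (norm c + 1) \<le> 1"
      by (subst divide_le_eq_1_pos) (auto simp: add_nonneg_pos)
    have "(\<integral>x. norm (indicator A (x + z) *\<^sub>R c - indicator A x *\<^sub>R c) \<partial>lborel)
      = (\<integral>x. \<bar>indicator A (x + z) - indicator A x\<bar> \<partial>lborel) * norm c"
      by (simp flip: scaleR_diff_left)
    also have "\<dots> \<le> e / (norm c + 1) * norm c"
      by (intro mult_right_mono d \<open>norm z < d\<close>) auto
    also have "\<dots> = e * (norm c / (norm c + 1))" by simp
    also have "\<dots> \<le> e * 1"
      using base.prems \<open>norm c / (norm c + 1) \<le> 1\<close> by (intro mult_left_mono) auto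
    finally show "(\<integral>x. norm (indicator A (x + z) *\<^sub>R c - indicator A x *\<^sub>R c) \<partial>lborel) \<le> e" by simp
  qed
next
  case (add f g)
  have fm: "f \<in> borel_measurable borel" "g \<in> borel_measurable borel" using add by auto
  obtain d1 where d1: "d1 > 0" "\<And>z. norm z < d1 \<Longrightarrow> (\<integral>x. norm (f (x + z) - f x) \<partial>lborel) \<le> e/2"
    using add.IH(1)[of "e/2"] add.prems by auto
  obtain d2 where d2: "d2 > 0" "\<And>z. norm z < d2 \<Longrightarrow> (\<integral>x. norm (g (x + z) - g x) \<partial>lborel) \<le> e/2"
    using add.IH(2)[of "e/2"] add.prems by auto
  show ?case
  proof (intro exI[of _ "min d1 d2"] conjI allI impI)
    fix z :: 'a assume z: "norm z < min d1 d2"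
    have i: "integrable lborel (\<lambda>x. norm (f (x + z) - f x))" "integrable lborel (\<lambda>x. norm (g (x + z) - g x))"
      using add.hyps lborel_integral_translate(2)[OF fm(1), of z] lborel_integral_translate(2)[OF fm(2), of z] by auto
    have "(\<integral>x. norm (f (x + z) + g (x + z) - (f x + g x)) \<partial>lborel)
      \<le> (\<integral>x. norm (f (x + z) - f x) + norm (g (x + z) - g x) \<partial>lborel)"
      by (rule integral_mono_AE', use i in simp) (auto simp: norm_diff_triangle_ineq)
    also have "\<dots> \<le> e" using i d1(2)[of z] d2(2)[of z] z by simp
    finally show "(\<integral>x. norm (f (x + z) + g (x + z) - (f x + g x)) \<partial>lborel) \<le> e" .
  qed (use d1 d2 in auto)
next
  case (lim f s)
  have [measurable]: "f \<in> borel_measurable borel" "\<And>i. s i \<in> borel_measurable borel" using lim by auto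
  have "(\<lambda>i. \<integral>x. norm (s i x - f x) \<partial>lborel) \<longlonglongrightarrow> (\<integral>x. 0 \<partial>(lborel :: 'a measure))"
  \<comment> \<open>The approximants of \<open>integrable_induct\<close> satisfy
    \<open>norm (s i x) \<le> 2 * norm (f x)\<close>, hence the factor 3.\<close>
  proof (rule integral_dominated_convergence[where w = "\<lambda>x. 3 * norm (f x)"])
    show "AE x in lborel. (\<lambda>i. norm (s i x - f x)) \<longlonglongrightarrow> 0"
      using lim.hyps(2) by (auto simp: tendsto_norm_zero_iff LIM_zero_iff)
    show "AE x in lborel. norm (norm (s i x - f x)) \<le> 3 * norm (f x)" for i
    proof (rule AE_I2)
      fix x show "norm (norm (s i x - f x)) \<le> 3 * norm (f x)"
        using lim.hyps(3)[of x i] norm_triangle_ineq4[of "s i x" "f x"] by simp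
    qed
  qed (use lim in auto)
  then have "\<forall>\<^sub>F i in sequentially. (\<integral>x. norm (s i x - f x) \<partial>lborel) < e/3"
    using lim.prems by (intro order_tendstoD(2)) auto
  then obtain i where i: "(\<integral>x. norm (s i x - f x) \<partial>lborel) < e/3"
    by (auto simp: eventually_sequentially)
  obtain d where d: "d > 0" "\<And>z. norm z < d \<Longrightarrow> (\<integral>x. norm (s i (x + z) - s i x) \<partial>lborel) \<le> e/3"
    using lim.IH[of "e/3" i] lim.prems by auto
  let ?h = "\<lambda>x. norm (s i x - f x)"
  have hm: "?h \<in> borel_measurable borel" by measurable
  have hi: "integrable lborel ?h" using lim by auto
  show ?case
  proof (intro exI[of _ d] conjI allI impI d(1))
    fix z :: 'a assume z: "norm z < d"
    have si: "integrable lborel (\<lambda>x. s i (x + z) - s i x)"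
      using lim.hyps(1)[of i] lborel_integral_translate(2)[of "s i" z] by simp
    have hz: "integrable lborel (\<lambda>x. ?h (x + z))"
      using lborel_integral_translate(2)[OF hm, of z] hi by simp
    have "(\<integral>x. norm (f (x + z) - f x) \<partial>lborel) \<le> (\<integral>x. ?h (x + z) + norm (s i (x + z) - s i x) + ?h x \<partial>lborel)"
    proof (rule integral_mono_AE')
      show "integrable lborel (\<lambda>x. ?h (x + z) + norm (s i (x + z) - s i x) + ?h x)"
        using si hz hi by auto
      show "AE x in lborel. norm (f (x + z) - f x) \<le> ?h (x + z) + norm (s i (x + z) - s i x) + ?h x"
      proof (rule AE_I2)
        fix x
        have eq: "f (x + z) - f x = - (s i (x + z) - f (x + z)) + (s i (x + z) - s i x) + (s i x - f x)" by simp
        show "norm (f (x + z) - f x) \<le> ?h (x + z) + norm (s i (x + z) - s i x) + ?h x"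
          unfolding eq
          using norm_triangle_ineq[of "- (s i (x + z) - f (x + z)) + (s i (x + z) - s i x)" "s i x - f x"]
            norm_triangle_ineq[of "- (s i (x + z) - f (x + z))" "s i (x + z) - s i x"]
            norm_minus_cancel[of "s i (x + z) - f (x + z)"] by linarith
      qed
    qed auto
    also have "\<dots> = 2 * integral\<^sup>L lborel ?h + (\<integral>x. norm (s i (x + z) - s i x) \<partial>lborel)"
      using lborel_integral_translate(1)[OF hm, of z] si hz hi by simp
    also have "\<dots> \<le> e" using i d(2)[OF z] by simp
    finally show "(\<integral>x. norm (f (x + z) - f x) \<partial>lborel) \<le> e" .
  qed
qed

text \<open>By Fubini the error is at most an \<eta>-weighted average of the distances in the mean
  between \<open>f\<close> and its translates by vectors shorter than \<tau>. Thus \<open>d\<close>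
  depends on \<open>f\<close> and \<open>e\<close> only, and not on the mollifier.\<close>

lemma mollify_L1_close:
  fixes f :: "real^'d::finite \<Rightarrow> 'b::euclidean_space"
  assumes f: "integrable lborel f" and "e > 0"
  obtains d where "d > 0" "\<And>\<tau> \<eta>. \<tau> \<le> d \<Longrightarrow> mollifier \<tau> \<eta> \<Longrightarrow> (\<integral>\<^sup>+x. ennreal (norm (mollify \<eta> f x - f x)) \<partial>lborel) \<le> ennreal e"
proof -
  obtain d where d: "d > 0" "\<And>z. norm z < d \<Longrightarrow> (\<integral>x. norm (f (x + z) - f x) \<partial>lborel) \<le> e"
    using L1_translation_continuous[OF assms] by blast
  have [measurable]: "f \<in> borel_measurable borel" using f by auto
  show ?thesis
  proof (rule that[OF d(1)])
    fix \<tau> and \<eta> :: "real^'d \<Rightarrow> real"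
    assume \<tau>: "\<tau> \<le> d" and "mollifier \<tau> \<eta>"
    note \<eta> = mollifierD[OF this(2)]
    have [measurable]: "\<eta> \<in> borel_measurable borel"
      by (rule borel_measurable_continuous_onI[OF test_function_continuous[OF \<eta>(1)]])
    have "ennreal (norm (mollify \<eta> f x - f x)) \<le> (\<integral>\<^sup>+z. ennreal (\<eta> z * norm (f (x - z) - f x)) \<partial>lborel)" for x
    proof -
      note i = mollify_integrable_test[OF f \<eta>(1), of x]
      note c = mollify_const[OF \<eta>(1,4), of x]
      have i': "integrable lborel (\<lambda>y. \<eta> (x - y) *\<^sub>R (f y - f x))"
        using i c(2) by (auto simp: scaleR_diff_right)
      have "mollify \<eta> f x - f x = (\<integral>y. \<eta> (x - y) *\<^sub>R (f y - f x) \<partial>lborel)"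
        unfolding mollify_def using i c(2) c(1)[of "f x"] by (simp add: scaleR_diff_right)
      then have "ennreal (norm (mollify \<eta> f x - f x)) \<le> (\<integral>\<^sup>+y. ennreal (norm (\<eta> (x - y) *\<^sub>R (f y - f x))) \<partial>lborel)"
        using integral_norm_bound_ennreal[OF i'] by simp
      also have "\<dots> = (\<integral>\<^sup>+y. (\<lambda>z. ennreal (\<eta> z * norm (f (x - z) - f x))) (x - y) \<partial>lborel)"
        using \<eta>(2) by (intro nn_integral_cong) auto
      also have "\<dots> = (\<integral>\<^sup>+z. ennreal (\<eta> z * norm (f (x - z) - f x)) \<partial>lborel)"
        by (rule lborel_nn_integral_reflect) measurable
      finally show ?thesis .
    qed
    then have "(\<integral>\<^sup>+x. ennreal (norm (mollify \<eta> f x - f x)) \<partial>lborel)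
        \<le> (\<integral>\<^sup>+x. (\<integral>\<^sup>+z. ennreal (\<eta> z * norm (f (x - z) - f x)) \<partial>lborel) \<partial>lborel)"
      by (intro nn_integral_mono) auto
    also have "\<dots> = (\<integral>\<^sup>+z. (\<integral>\<^sup>+x. ennreal (\<eta> z * norm (f (x - z) - f x)) \<partial>lborel) \<partial>lborel)"
      by (rule lborel_pair.Fubini'[symmetric]) measurable
    also have "\<dots> \<le> (\<integral>\<^sup>+z. ennreal (\<eta> z) * ennreal e \<partial>lborel)"
    proof (rule nn_integral_mono)
      fix z :: "real^'d"
      show "(\<integral>\<^sup>+x. ennreal (\<eta> z * norm (f (x - z) - f x)) \<partial>lborel) \<le> ennreal (\<eta> z) * ennreal e"
      proof (cases "norm z < \<tau>")
        case True
        have i: "integrable lborel (\<lambda>x. norm (f (x - z) - f x))"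
          using f lborel_integral_translate(2)[of f "-z"] by auto
        have "(\<integral>\<^sup>+x. ennreal (\<eta> z * norm (f (x - z) - f x)) \<partial>lborel)
          = ennreal (\<eta> z) * (\<integral>\<^sup>+x. ennreal (norm (f (x - z) - f x)) \<partial>lborel)"
          using \<eta>(2) by (simp add: ennreal_mult' nn_integral_cmult)
        also have "\<dots> = ennreal (\<eta> z) * ennreal (\<integral>x. norm (f (x - z) - f x) \<partial>lborel)"
          by (subst nn_integral_eq_integral[OF i]) auto
        also have "\<dots> \<le> ennreal (\<eta> z) * ennreal e"
          using d(2)[of "-z"] True \<tau> by (intro mult_left_mono ennreal_leI) auto
        finally show ?thesis .
      qed (use \<eta>(3)[of z] in auto)
    qed
    also have "\<dots> = ennreal (integral\<^sup>L lborel \<eta>) * ennreal e"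
      using test_function_integrable[OF \<eta>(1)] \<eta>(2) by (simp add: nn_integral_multc nn_integral_eq_integral)
    finally show "(\<integral>\<^sup>+x. ennreal (norm (mollify \<eta> f x - f x)) \<partial>lborel) \<le> ennreal e"
      using \<eta>(4) by simp
  qed
qed

text \<open>This bounds the volume of a boundary layer between two cubes of sides \<open>a\<close>
  and \<open>b\<close>.\<close>

lemma power_diff_le:
  fixes a b :: real
  assumes "0 \<le> b" "b \<le> a"
  shows "a ^ k - b ^ k \<le> real k * a ^ (k - 1) * (a - b)"
proof (induction k)
  case (Suc k)
  have "a ^ Suc k - b ^ Suc k = a * (a ^ k - b ^ k) + b ^ k * (a - b)" by (simp add: algebra_simps)
  also have "\<dots> \<le> a * (real k * a ^ (k - 1) * (a - b)) + a ^ k * (a - b)"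
    using mult_left_mono[OF Suc, of a] mult_right_mono[OF power_mono[OF assms(2,1), of k], of "a - b"] assms
    by linarith
  also have "\<dots> = real (Suc k) * a ^ (Suc k - 1) * (a - b)"
    by (cases k) (simp_all add: algebra_simps)
  finally show ?case .
qed simp

lemma lborel_integral_affine:
  fixes f :: "'a::euclidean_space \<Rightarrow> 'b::euclidean_space"
  assumes f[measurable]: "f \<in> borel_measurable borel" and c: "c \<noteq> 0"
  shows "(\<integral>x. f x \<partial>lborel) = \<bar>c\<bar> ^ DIM('a) *\<^sub>R (\<integral>x. f (t + c *\<^sub>R x) \<partial>lborel)"
proof -
  let ?D = "distr lborel borel (\<lambda>x. t + c *\<^sub>R x) :: 'a measure"
  have "integral\<^sup>L lborel f = integral\<^sup>L (density ?D (\<lambda>_. ennreal (\<bar>c\<bar> ^ DIM('a)))) f"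
    using lborel_affine[OF c, of t] by simp
  also have "\<dots> = (\<integral>x. \<bar>c\<bar> ^ DIM('a) *\<^sub>R f x \<partial>?D)"
    by (rule integral_density) auto
  also have "\<dots> = (\<integral>x. \<bar>c\<bar> ^ DIM('a) *\<^sub>R f (t + c *\<^sub>R x) \<partial>lborel)"
    by (rule integral_distr) auto
  finally show ?thesis by simp
qed

text \<open>All of them are rescalings of a single mollifier: the substitution cancels the
  normalizing factor, while the derivative gains \<open>1 / \<tau>\<close>. This rate is later
  balanced by the volume of a layer of width proportional to \<tau>.\<close>

lemma exists_mollifiers:
  obtains c :: real where "c \<ge> 0" "\<And>\<tau>. \<tau> > 0 \<Longrightarrow> \<exists>\<eta> :: real^'d::finite \<Rightarrow> real. mollifier \<tau> \<eta> \<and>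
    (\<forall>j. (\<integral>x. \<bar>frechet_derivative \<eta> (at x) (axis j 1)\<bar> \<partial>lborel) \<le> c / \<tau>)"
proof -
  obtain \<eta> :: "real^'d \<Rightarrow> real" where "mollifier 1 \<eta>"
    using exists_mollifier[of 1] by auto
  note \<eta> = mollifierD[OF this]
  define c where "c = (\<Sum>j\<in>UNIV. (\<integral>x. \<bar>frechet_derivative \<eta> (at x) (axis j 1)\<bar> \<partial>lborel))"
  have m[measurable]: "\<eta> \<in> borel_measurable borel"
    by (rule borel_measurable_continuous_onI[OF test_function_continuous[OF \<eta>(1)]])
  have mj[measurable]: "(\<lambda>x. frechet_derivative \<eta> (at x) (axis j 1)) \<in> borel_measurable borel" for j
    by (rule borel_measurable_continuous_onI[OF test_function_continuous[OF test_function_pd[OF \<eta>(1)]]])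
  show ?thesis
  proof (rule that[of c])
    show "c \<ge> 0" unfolding c_def by (intro sum_nonneg) simp
    fix \<tau> :: real assume \<tau>: "\<tau> > 0"
    define k where "k = (1 / \<tau>) ^ CARD('d)"
    have k: "k > 0" using \<tau> by (simp add: k_def)
    define \<theta> where "\<theta> x = k * \<eta> (0 + (1/\<tau>) *\<^sub>R x)" for x
    have t0: "(\<lambda>x. \<eta> (0 + (1/\<tau>) *\<^sub>R x)) \<in> test_functions UNIV"
      by (rule test_function_affine[OF \<eta>(1)]) (use \<tau> in simp)
    have z: "\<theta> x = 0" if "norm x \<ge> \<tau>" for x
      using \<eta>(3)[of "(1/\<tau>) *\<^sub>R x"] that \<tau> by (simp add: \<theta>_def field_simps)
    have t: "\<theta> \<in> test_functions UNIV"
      by (rule test_function_UNIV_I[of _ \<tau>]) (use t0 z in \<open>auto simp: \<theta>_def[abs_def] test_functions_def intro!: Ck_mult Ck_const\<close>)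
    have I: "integral\<^sup>L lborel \<theta> = 1"
      using lborel_integral_affine[OF m, of "1/\<tau>" 0] \<eta>(4) \<tau> k by (simp add: \<theta>_def[abs_def] k_def)
    have D: "frechet_derivative \<theta> (at x) (axis j 1) = k * (1/\<tau>) * frechet_derivative \<eta> (at (0 + (1/\<tau>) *\<^sub>R x)) (axis j 1)" for x j
    proof -
      have "(\<theta> has_derivative (\<lambda>h. k * (gradient \<eta> (0 + (1/\<tau>) *\<^sub>R x) \<bullet> ((1/\<tau>) *\<^sub>R h)))) (at x)"
        unfolding \<theta>_def
        by (intro has_derivative_mult_right has_derivative_compose[OF _ test_function_has_gradient[OF \<eta>(1)]])
           (auto intro!: derivative_eq_intros)
      then show ?thesis
        by (simp add: frechet_derivative_eqI frechet_derivative_gradient[OF \<eta>(1)])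
    qed
    have "(\<integral>x. \<bar>frechet_derivative \<theta> (at x) (axis j 1)\<bar> \<partial>lborel) \<le> c / \<tau>" for j
    proof -
      have "(\<integral>x. \<bar>frechet_derivative \<theta> (at x) (axis j 1)\<bar> \<partial>lborel)
        = (\<integral>x. (k * (1/\<tau>)) * \<bar>frechet_derivative \<eta> (at (0 + (1/\<tau>) *\<^sub>R x)) (axis j 1)\<bar> \<partial>lborel)"
        unfolding D abs_mult using k \<tau> by simp
      also have "\<dots> = (1/\<tau>) * (k * (\<integral>x. \<bar>frechet_derivative \<eta> (at (0 + (1/\<tau>) *\<^sub>R x)) (axis j 1)\<bar> \<partial>lborel))"
        by simp
      also have "\<dots> = (1/\<tau>) * (\<integral>x. \<bar>frechet_derivative \<eta> (at x) (axis j 1)\<bar> \<partial>lborel)"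
        using lborel_integral_affine[of "\<lambda>x. \<bar>frechet_derivative \<eta> (at x) (axis j 1)\<bar>" "1/\<tau>" 0] \<tau>
        by (simp add: k_def)
      also have "\<dots> \<le> (1/\<tau>) * c"
        unfolding c_def using \<tau> by (intro mult_left_mono member_le_sum) auto
      finally show ?thesis by simp
    qed
    then show "\<exists>\<eta> :: real^'d \<Rightarrow> real. mollifier \<tau> \<eta> \<and>
      (\<forall>j. (\<integral>x. \<bar>frechet_derivative \<eta> (at x) (axis j 1)\<bar> \<partial>lborel) \<le> c / \<tau>)"
      using t z I k \<eta>(2) by (intro exI[of _ \<theta>]) (auto simp: mollifier_def \<theta>_def)
  qed
qed

lemma integrable_bounded_support:
  fixes f :: "'a::euclidean_space \<Rightarrow> 'b::euclidean_space"
  assumes [measurable]: "f \<in> borel_measurable borel" and D: "D \<in> sets borel" "emeasure lborel D < \<infinity>"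
    and B: "\<And>x. norm (f x) \<le> B" and z: "\<And>x. x \<notin> D \<Longrightarrow> f x = 0"
  shows "integrable lborel f" and "norm (integral\<^sup>L lborel f) \<le> B * measure lborel D"
proof -
  have le: "norm (f x) \<le> indicator D x * B" for x
    using B[of x] z[of x] by (auto simp: indicator_def)
  have "0 \<le> B" using B[of undefined] norm_ge_zero order_trans by blast
  have i: "integrable lborel (\<lambda>x. indicator D x * B)"
    using D by (intro integrable_mult_left integrable_real_indicator) auto
  show int: "integrable lborel f"
    by (rule Bochner_Integration.integrable_bound[OF i]) (use le \<open>0 \<le> B\<close> in auto)
  have "norm (integral\<^sup>L lborel f) \<le> (\<integral>x. norm (f x) \<partial>lborel)" by (rule integral_norm_bound)
  also have "\<dots> \<le> (\<integral>x. indicator D x * B \<partial>lborel)"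
    by (rule integral_mono[OF integrable_norm[OF int] i le])
  also have "\<dots> = B * measure lborel D" using D by simp
  finally show "norm (integral\<^sup>L lborel f) \<le> B * measure lborel D" .
qed

section \<open>Cutoff functions\<close>

lemma mollify_indicator:
  fixes K :: "(real^'d::finite) set"
  assumes m: "mollifier \<tau> \<eta>" and K: "compact K"
  defines "\<theta> \<equiv> mollify \<eta> (indicator K :: _ \<Rightarrow> real)"
  shows "\<theta> \<in> test_functions UNIV" "0 \<le> \<theta> x" "\<theta> x \<le> 1"
    "ball x \<tau> \<subseteq> K \<Longrightarrow> \<theta> x = 1" "ball x \<tau> \<inter> K = {} \<Longrightarrow> \<theta> x = 0" "integrable lborel (indicator K :: _ \<Rightarrow> real)"
proof -
  note \<eta> = mollifierD[OF m]
  have i: "integrable lborel (indicator K :: _ \<Rightarrow> real)"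
    using K by (intro integrable_real_indicator) (use emeasure_bounded_finite[OF compact_imp_bounded[OF K]] K in \<open>auto simp: borel_compact\<close>)
  then show "integrable lborel (indicator K :: _ \<Rightarrow> real)" .
  have d: "norm (\<theta> x - c) \<le> B" if "\<And>y. y \<in> ball x \<tau> \<Longrightarrow> norm (indicator K y - c) \<le> B" for c B
    unfolding \<theta>_def by (rule mollify_dist_le[OF m i that])
  \<comment> \<open>The interval from 0 to 1 is the closed ball of radius 1/2 around 1/2, so the
    averaging bound applies.\<close>
  have "norm (\<theta> x - 1/2) \<le> 1/2" by (rule d) (auto simp: indicator_def)
  then have "\<bar>\<theta> x - 1/2\<bar> \<le> 1/2" by (simp only: real_norm_def)
  then show "0 \<le> \<theta> x" "\<theta> x \<le> 1" by linarith+
  show "\<theta> x = 1" if "ball x \<tau> \<subseteq> K"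
  proof -
    have "norm (\<theta> x - 1) \<le> 0" by (rule d) (use that in \<open>auto simp: indicator_def\<close>)
    then show ?thesis by simp
  qed
  have *: "\<theta> x = 0" if "ball x \<tau> \<inter> K = {}" for x
    unfolding \<theta>_def by (rule mollify_support[of \<tau>]) (use \<eta>(3) that in \<open>auto simp: indicator_def\<close>)
  then show "ball x \<tau> \<inter> K = {} \<Longrightarrow> \<theta> x = 0" .
  obtain R where R: "K \<subseteq> ball 0 R"
    using compact_imp_bounded[OF K] bounded_subset_ballD by blast
  show "\<theta> \<in> test_functions UNIV"
  proof (rule test_function_UNIV_I)
    show "Ck k \<theta>" for k unfolding \<theta>_def by (rule Ck_mollify[OF i \<eta>(1)])
    show "\<theta> x = 0" if "norm x > R + \<tau>" for x
    proof (rule *, rule ccontr)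
      assume "ball x \<tau> \<inter> K \<noteq> {}"
      then obtain y where "y \<in> ball x \<tau>" "y \<in> K" by blast
      then have "dist x y < \<tau>" "norm y < R" using R by auto
      then show False using norm_triangle_sub[of x y] that by (simp add: dist_norm)
    qed
  qed
qed

lemma exists_cutoff:
  fixes K :: "(real^'d::finite) set"
  assumes "compact K" "open U" "K \<subseteq> U"
  obtains \<theta> where "\<theta> \<in> test_functions U" "\<And>x. 0 \<le> \<theta> x \<and> \<theta> x \<le> 1" "\<And>x. x \<in> K \<Longrightarrow> \<theta> x = 1"
proof -
  obtain d where d: "d > 0" "(\<Union>x\<in>K. cball x d) \<subseteq> U"
    using compact_subset_open_imp_cball_epsilon_subset[OF assms] by blast
  \<comment> \<open>Smearing the indicator of the \<open>t\<close>-neighbourhood of \<open>K\<close>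
    over radius \<open>t\<close> reaches no farther than \<open>2 * t\<close> from \<open>K\<close>,
    which is below \<open>d\<close>.\<close>
  define t where "t = d / 3"
  have t: "t > 0" using d by (simp add: t_def)
  obtain \<eta> :: "real^'d \<Rightarrow> real" where \<eta>: "mollifier t \<eta>"
    using exists_mollifier[OF t] by auto
  define K' where "K' = {x + y |x y. x \<in> K \<and> y \<in> cball 0 t}"
  define K'' where "K'' = {x + y |x y. x \<in> K \<and> y \<in> cball 0 d}"
  have K': "compact K'" "compact K''" unfolding K'_def K''_def
    by (intro compact_sums assms(1) compact_cball)+
  have "K'' \<subseteq> U" using d(2) unfolding K''_def
    by (force simp: dist_norm)
  let ?\<theta> = "mollify \<eta> (indicator K' :: _ \<Rightarrow> real)"
  note m = mollify_indicator[OF \<eta> K'(1)]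
  show ?thesis
  proof (rule that[of ?\<theta>])
    show "0 \<le> ?\<theta> x \<and> ?\<theta> x \<le> 1" for x using m(2,3) by auto
    show "?\<theta> x = 1" if "x \<in> K" for x
    proof (rule m(4))
      show "ball x t \<subseteq> K'"
      proof
        fix y assume "y \<in> ball x t"
        then have "y = x + (y - x)" "y - x \<in> cball 0 t" by (auto simp: dist_norm norm_minus_commute)
        then show "y \<in> K'" unfolding K'_def using that by blast
      qed
    qed
    show "?\<theta> \<in> test_functions U"
    proof (rule test_functionsI[OF _ K'(2) \<open>K'' \<subseteq> U\<close>])
      show "Ck k ?\<theta>" for k using m(1) by (simp add: test_functions_def)
      show "?\<theta> x = 0" if "x \<notin> K''" for x
      proof -
        have "y \<notin> K'" if y: "y \<in> ball x t" for y
        proof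
          assume "y \<in> K'"
          then obtain a b where ab: "a \<in> K" "norm b \<le> t" "y = a + b" by (auto simp: K'_def)
          have "norm (x - a) \<le> norm (x - (a + b)) + norm b"
            using norm_triangle_ineq[of "x - (a + b)" b] by simp
          moreover have "norm (x - (a + b)) < t" using y ab(3) by (simp add: dist_norm)
          ultimately have "norm (x - a) \<le> d" using ab(2) t by (simp add: t_def)
          then have "x - a \<in> cball 0 d" by simp
          moreover have "x = a + (x - a)" by simp
          ultimately have "x \<in> K''" unfolding K''_def using ab(1) by blast
          then show False using \<open>x \<notin> K''\<close> by simp
        qed
        then have "ball x t \<inter> K' = {}" by blast
        then show ?thesis by (rule m(5))
      qed
    qed
  qed
qed

subsection \<open>Smooth and weakly differentiable maps\<close>

text \<open>The Jacobian is carried along as a matrix field, parallel to the chosen version of the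
  weak gradient in \<open>grad_pair\<close>.\<close>

definition C1_map :: "(real^'d::finite \<Rightarrow> real^'m::finite) \<Rightarrow> (real^'d \<Rightarrow> real^'d^'m) \<Rightarrow> bool" where
  "C1_map \<phi> G \<longleftrightarrow> (\<forall>x. (\<phi> has_derivative (\<lambda>h. G x *v h)) (at x)) \<and> continuous_on UNIV G"

text \<open>The zero extension of an element of \<open>W\<^sup>1\<^sup>,\<^sup>\<infinity>\<^sub>0(D)\<close> with a bounded Borel version of its gradient; unlike
  in \<^const>\<open>weak_gradient\<close>, the test functions need not be supported in \<open>D\<close>.\<close>

definition grad_pair :: "(real^'d::finite) set \<Rightarrow> (real^'d \<Rightarrow> real^'m::finite) \<Rightarrow> (real^'d \<Rightarrow> real^'d^'m) \<Rightarrow> bool" where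
  "grad_pair D \<phi> G \<longleftrightarrow> continuous_on UNIV \<phi> \<and> (\<forall>x. x \<notin> D \<longrightarrow> \<phi> x = 0) \<and>
    G \<in> borel_measurable borel \<and> (\<exists>M. \<forall>x. norm (G x) \<le> M) \<and> (\<forall>x. x \<notin> D \<longrightarrow> G x = 0) \<and>
    (\<forall>\<psi>\<in>test_functions UNIV. \<forall>i j.
      (\<integral>x. \<phi> x $ i * frechet_derivative \<psi> (at x) (axis j 1) \<partial>lborel) = - (\<integral>x. G x $ i $ j * \<psi> x \<partial>lborel))"

lemma C1_map_continuous: "C1_map \<phi> G \<Longrightarrow> continuous_on UNIV \<phi>"
  unfolding C1_map_def by (auto intro!: continuous_at_imp_continuous_on intro: has_derivative_continuous)

lemma C1_map_gradient_support:
  assumes "C1_map \<phi> G" "closed K" "\<And>x. x \<notin> K \<Longrightarrow> \<phi> x = 0" "x \<notin> K"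
  shows "G x = 0"
proof -
  have "(\<phi> has_derivative (\<lambda>h. 0)) (at x)"
    by (rule has_derivative_transform_within_open[of "\<lambda>_. 0" _ _ _ "- K"]) (use assms in auto)
  moreover have "(\<phi> has_derivative (\<lambda>h. G x *v h)) (at x)" using assms by (simp add: C1_map_def)
  ultimately have "(\<lambda>h. G x *v h) = (\<lambda>h. 0)" by (metis has_derivative_unique)
  then show ?thesis by (metis matrix_eq matrix_vector_mult_0)
qed

text \<open>By translation invariance every difference quotient of \<open>f\<close> has integral
  zero, and the quotients converge uniformly to the partial derivative on a fixed bounded set. This
  avoids iterated integrals.\<close>

lemma integral_partial_derivative_eq_0:
  fixes f :: "real^'d::finite \<Rightarrow> real"
  assumes f: "\<And>x. (f has_derivative f' x) (at x)" and cont: "continuous_on UNIV (\<lambda>x. f' x (axis j 1))"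
    and R: "\<And>x. norm x > R \<Longrightarrow> f x = 0"
  shows "(\<integral>x. f' x (axis j 1) \<partial>lborel) = 0"
proof -
  let ?p = "\<lambda>x. f' x (axis j 1)" and ?e = "axis j 1 :: real^'d"
  have pz: "?p x = 0" if "norm x > R" for x
    using frechet_derivative_support[OF R that, of "\<lambda>x. x"] frechet_derivative_eqI[OF f[of x]] by simp
  have fc: "continuous_on UNIV f"
    by (intro continuous_at_imp_continuous_on ballI has_derivative_continuous[OF f])
  have pu: "uniformly_continuous_on UNIV ?p"
    by (rule compact_support_uniformly_continuous[OF cont pz])
  have fi: "integrable lborel f" and pi: "integrable lborel ?p"
    using compact_support_integrable[OF fc R] compact_support_integrable[OF cont pz] by auto
  have [measurable]: "f \<in> borel_measurable borel" "?p \<in> borel_measurable borel"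
    by (rule borel_measurable_continuous_onI, fact)+
  \<comment> \<open>Contains the supports of all translates of \<open>f\<close> by vectors of length
    at most 1.\<close>
  let ?D = "cball 0 (R + 1) :: (real^'d) set"
  have "\<bar>integral\<^sup>L lborel ?p\<bar> \<le> e * measure lborel ?D" if "e > 0" for e
  proof -
    obtain d where d: "d > 0" "\<And>x y. dist y x < d \<Longrightarrow> dist (?p y) (?p x) < e"
      by (rule uniformly_continuous_onE[OF pu \<open>e > 0\<close>]) (use UNIV_I in blast)
    define t where "t = min (d/2) 1"
    have t: "0 < t" "t < d" "t \<le> 1" using d(1) by (auto simp: t_def)
    let ?r = "\<lambda>x. f (x + t *\<^sub>R ?e) - f x - t * ?p x"
    have ft: "integrable lborel (\<lambda>x. f (x + t *\<^sub>R ?e))" "(\<integral>x. f (x + t *\<^sub>R ?e) \<partial>lborel) = integral\<^sup>L lborel f"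
      using lborel_integral_translate[of f "t *\<^sub>R ?e"] fi by simp_all
    have "norm (integral\<^sup>L lborel ?r) \<le> (t * e) * measure lborel ?D"
    proof (rule integrable_bounded_support(2))
      show "?r \<in> borel_measurable borel" by measurable
      show "emeasure lborel ?D < \<infinity>" by (rule emeasure_bounded_finite) simp
      show "norm (?r x) \<le> t * e" for x
      proof -
        have der: "((\<lambda>s. f (x + s *\<^sub>R ?e)) has_real_derivative ?p (x + s *\<^sub>R ?e)) (at s)" for s :: real
        proof -
          have "((\<lambda>s. f (x + s *\<^sub>R ?e)) has_derivative (\<lambda>h. f' (x + s *\<^sub>R ?e) (h *\<^sub>R ?e))) (at s)"
            by (rule has_derivative_compose[OF _ f]) (auto intro!: derivative_eq_intros)
          moreover have "f' (x + s *\<^sub>R ?e) (h *\<^sub>R ?e) = h * ?p (x + s *\<^sub>R ?e)" for h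
            using linear_scale[OF has_derivative_linear[OF f]] by simp
          ultimately show ?thesis by (simp add: has_field_derivative_def mult_commute_abs)
        qed
        obtain s where s: "0 < s" "s < t" "f (x + t *\<^sub>R ?e) - f (x + 0 *\<^sub>R ?e) = (t - 0) * ?p (x + s *\<^sub>R ?e)"
          using MVT2[OF t(1), of "\<lambda>s. f (x + s *\<^sub>R ?e)" "\<lambda>s. ?p (x + s *\<^sub>R ?e)"] der by blast
        have "dist (x + s *\<^sub>R ?e) x < d" using s t by (simp add: dist_norm norm_axis_1)
        then have "\<bar>?p (x + s *\<^sub>R ?e) - ?p x\<bar> < e" using d(2) by (simp add: dist_real_def)
        then have "t * \<bar>?p (x + s *\<^sub>R ?e) - ?p x\<bar> \<le> t * e" using t by (intro mult_left_mono) auto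
        moreover have "?r x = t * (?p (x + s *\<^sub>R ?e) - ?p x)" using s(3) by (simp add: algebra_simps)
        ultimately show ?thesis using t by (simp add: abs_mult)
      qed
      show "?r x = 0" if "x \<notin> ?D" for x
      proof -
        have "norm x > R + 1" using that by simp
        moreover have "norm x \<le> norm (x + t *\<^sub>R ?e) + t"
          using norm_triangle_sub[of x "x + t *\<^sub>R ?e"] t by (simp add: norm_axis_1)
        ultimately show ?thesis using R[of x] R[of "x + t *\<^sub>R ?e"] pz[of x] t by simp
      qed
    qed simp
    moreover have "integral\<^sup>L lborel ?r = - (t * integral\<^sup>L lborel ?p)"
      using ft fi pi by simp
    ultimately have "t * \<bar>integral\<^sup>L lborel ?p\<bar> \<le> t * (e * measure lborel ?D)"
      using t by (simp add: abs_mult mult.assoc)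
    then show ?thesis using t by simp
  qed
  then have *: "\<bar>integral\<^sup>L lborel ?p\<bar> \<le> e * measure lborel ?D" if "e > 0" for e using that by blast
  have "\<bar>integral\<^sup>L lborel ?p\<bar> \<le> 0 + e" if "e > 0" for e
  proof -
    have "\<bar>integral\<^sup>L lborel ?p\<bar> \<le> e / (measure lborel ?D + 1) * measure lborel ?D"
      by (rule *) (use that in \<open>simp add: add_nonneg_pos\<close>)
    also have "\<dots> = e * (measure lborel ?D / (measure lborel ?D + 1))" by simp
    also have "\<dots> \<le> e * 1" using that by (intro mult_left_mono) (auto simp: divide_le_eq_1 add_nonneg_pos)
    finally show ?thesis by simp
  qed
  then show ?thesis using field_le_epsilon[of "\<bar>integral\<^sup>L lborel ?p\<bar>" 0] by simp
qed

lemma borel_measurable_vec_nth [measurable (raw)]: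
  fixes f :: "'a \<Rightarrow> 'b::euclidean_space ^ 'n::finite"
  assumes "f \<in> borel_measurable M"
  shows "(\<lambda>x. f x $ i) \<in> borel_measurable M"
  by (rule measurable_compose[OF assms borel_measurable_continuous_onI]) (intro continuous_intros)

lemma grad_pair_test_integrable:
  assumes "grad_pair D \<phi> G" "\<psi> \<in> test_functions UNIV"
  shows "integrable lborel (\<lambda>x. \<phi> x $ i * frechet_derivative \<psi> (at x) (axis j 1))"
    and "integrable lborel (\<lambda>x. G x $ i $ j * \<psi> x)"
proof -
  obtain R where R: "\<And>x. norm x > R \<Longrightarrow> \<psi> x = 0"
    using test_functions_bounded_support[OF assms(2)] by blast
  show "integrable lborel (\<lambda>x. \<phi> x $ i * frechet_derivative \<psi> (at x) (axis j 1))"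
  proof (rule compact_support_integrable)
    show "continuous_on UNIV (\<lambda>x. \<phi> x $ i * frechet_derivative \<psi> (at x) (axis j 1))"
      using assms(1) test_function_continuous[OF test_function_pd[OF assms(2)]]
      by (auto simp: grad_pair_def intro!: continuous_intros)
    show "\<phi> x $ i * frechet_derivative \<psi> (at x) (axis j 1) = 0" if "norm x > R" for x
      by (simp add: frechet_derivative_support[of R \<psi> x, OF R that])
  qed
  obtain M where M: "\<And>x. norm (G x) \<le> M" using assms(1) by (auto simp: grad_pair_def)
  obtain P where P: "P > 0" "\<And>x. \<bar>\<psi> x\<bar> \<le> P" using test_function_bounded[OF assms(2)] by blast
  have [measurable]: "G \<in> borel_measurable borel" "\<psi> \<in> borel_measurable borel"
    using assms borel_measurable_continuous_onI[OF test_function_continuous[OF assms(2)]]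
    by (auto simp: grad_pair_def)
  show "integrable lborel (\<lambda>x. G x $ i $ j * \<psi> x)"
  proof (rule integrable_bounded_support(1))
    show "emeasure lborel (cball 0 R :: (real^'a) set) < \<infinity>" by (rule emeasure_bounded_finite) simp
    show "norm (G x $ i $ j * \<psi> x) \<le> M * P" for x
    proof -
      have "\<bar>G x $ i $ j\<bar> \<le> M"
        using order_trans[OF component_le_norm_cart order_trans[OF Finite_Cartesian_Product.norm_nth_le M]] .
      then show ?thesis unfolding real_norm_def abs_mult by (intro mult_mono P) auto
    qed
    show "G x $ i $ j * \<psi> x = 0" if "x \<notin> cball 0 R" for x using R[of x] that by simp
    show "(\<lambda>x. G x $ i $ j * \<psi> x) \<in> borel_measurable borel" by measurable
  qed auto
qed

lemma grad_pair_integrable: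
  assumes "grad_pair D \<phi> G" "bounded D"
  shows "integrable lborel \<phi>" "integrable lborel G"
proof -
  obtain R where "D \<subseteq> ball 0 R" using assms(2) bounded_subset_ballD by blast
  then have R: "D \<subseteq> cball 0 R" using ball_subset_cball by blast
  show "integrable lborel \<phi>"
    by (rule compact_support_integrable[of _ R]) (use assms(1) R in \<open>auto simp: grad_pair_def\<close>)
  obtain M where M: "\<And>x. norm (G x) \<le> M" using assms(1) by (auto simp: grad_pair_def)
  show "integrable lborel G"
  proof (rule integrable_bounded_support(1))
    show "emeasure lborel (cball 0 R :: (real^'a) set) < \<infinity>" by (rule emeasure_bounded_finite) simp
  qed (use assms(1) M R in \<open>auto simp: grad_pair_def\<close>)
qed

text \<open>Integration by parts: the product of a component of \<phi> with a test function has
  compact support because \<phi> has, so its partial derivative integrates to zero.\<close>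

lemma C1_map_grad_pair:
  assumes c: "C1_map \<phi> G" and K: "compact K" "K \<subseteq> D" "\<And>x. x \<notin> K \<Longrightarrow> \<phi> x = 0"
  shows "grad_pair D \<phi> G"
  unfolding grad_pair_def
proof (intro conjI allI impI ballI)
  obtain R where R: "K \<subseteq> ball 0 R" using compact_imp_bounded[OF K(1)] bounded_subset_ballD by blast
  have nK: "x \<notin> K" if "norm x > R" for x using subsetD[OF R, of x] that by auto
  have Gz: "G x = 0" if "x \<notin> K" for x
    by (rule C1_map_gradient_support[OF c compact_imp_closed[OF K(1)] K(3) that])
  have Gc: "continuous_on UNIV G" using c by (simp add: C1_map_def)
  show "continuous_on UNIV \<phi>" by (rule C1_map_continuous[OF c])
  show "G \<in> borel_measurable borel" by (rule borel_measurable_continuous_onI[OF Gc])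
  have "G x = 0" if "norm x > R" for x using Gz[OF nK[OF that]] .
  then show "\<exists>M. \<forall>x. norm (G x) \<le> M" using compact_support_bounded[OF Gc] by metis
  show "\<phi> x = 0" "G x = 0" if "x \<notin> D" for x using that K Gz by auto
  fix \<psi> :: "real^'a \<Rightarrow> real" and i j assume \<psi>: "\<psi> \<in> test_functions UNIV"
  let ?f' = "\<lambda>x h. \<phi> x $ i * (gradient \<psi> x \<bullet> h) + (G x *v h) $ i * \<psi> x"
  have pd: "frechet_derivative \<psi> (at x) (axis j 1) = gradient \<psi> x \<bullet> axis j 1" for x
    by (rule frechet_derivative_gradient[OF \<psi>])
  have comp: "(G x *v axis j 1) $ i = G x $ i $ j" for x
    by (simp add: matrix_vector_mult_basis column_def)
  have pc: "continuous_on UNIV (\<lambda>x. \<phi> x $ i * (gradient \<psi> x \<bullet> axis j 1))" "continuous_on UNIV (\<lambda>x. G x $ i $ j * \<psi> x)"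
    using C1_map_continuous[OF c] Gc test_function_gradient_continuous[OF \<psi>] test_function_continuous[OF \<psi>]
    by (auto intro!: continuous_intros)
  have i1: "integrable lborel (\<lambda>x. \<phi> x $ i * (gradient \<psi> x \<bullet> axis j 1))"
    by (rule compact_support_integrable[OF pc(1), of R]) (use K(3)[OF nK] in simp)
  have i2: "integrable lborel (\<lambda>x. G x $ i $ j * \<psi> x)"
    by (rule compact_support_integrable[OF pc(2), of R]) (use Gz[OF nK] in simp)
  have "(\<integral>x. ?f' x (axis j 1) \<partial>lborel) = 0"
  proof (rule integral_partial_derivative_eq_0)
    fix x
    have "((\<lambda>x. \<phi> x $ i) has_derivative (\<lambda>h. (G x *v h) $ i)) (at x)"
      using c by (intro bounded_linear.has_derivative[OF bounded_linear_vec_nth]) (simp add: C1_map_def)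
    then show "((\<lambda>x. \<phi> x $ i * \<psi> x) has_derivative ?f' x) (at x)"
      by (rule has_derivative_mult[OF _ test_function_has_gradient[OF \<psi>]])
    show "continuous_on UNIV (\<lambda>x. ?f' x (axis j 1))" unfolding comp by (intro continuous_on_add pc)
    show "\<phi> x $ i * \<psi> x = 0" if "norm x > R" for x using K(3)[OF nK[OF that]] by simp
  qed
  then show "(\<integral>x. \<phi> x $ i * frechet_derivative \<psi> (at x) (axis j 1) \<partial>lborel) = - (\<integral>x. G x $ i $ j * \<psi> x \<partial>lborel)"
    unfolding comp pd using i1 i2 by simp
qed

section \<open>Sums and translates of admissible pairs\<close>

lemma grad_pair_mono: "grad_pair D \<phi> G \<Longrightarrow> D \<subseteq> D' \<Longrightarrow> grad_pair D' \<phi> G"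
  by (auto simp: grad_pair_def)

lemma grad_pair_0: "grad_pair D (\<lambda>x. 0) (\<lambda>x. 0)"
  by (auto simp: grad_pair_def)

lemma grad_pair_add:
  assumes "grad_pair D \<phi> G" "grad_pair D \<phi>' G'"
  shows "grad_pair D (\<lambda>x. \<phi> x + \<phi>' x) (\<lambda>x. G x + G' x)"
  unfolding grad_pair_def
proof (intro conjI allI impI ballI)
  obtain M M' where M: "\<And>x. norm (G x) \<le> M" "\<And>x. norm (G' x) \<le> M'"
    using assms by (auto simp: grad_pair_def)
  show "\<exists>M. \<forall>x. norm (G x + G' x) \<le> M"
    by (intro exI[of _ "M + M'"] allI norm_triangle_mono M)
  fix \<psi> :: "real^'a \<Rightarrow> real" and i j assume \<psi>: "\<psi> \<in> test_functions UNIV"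
  note I = grad_pair_test_integrable[OF assms(1) \<psi>, of i j] grad_pair_test_integrable[OF assms(2) \<psi>, of i j]
  show "(\<integral>x. (\<phi> x + \<phi>' x) $ i * frechet_derivative \<psi> (at x) (axis j 1) \<partial>lborel) = - (\<integral>x. (G x + G' x) $ i $ j * \<psi> x \<partial>lborel)"
    using assms \<psi> I by (simp add: distrib_right grad_pair_def)
qed (use assms in \<open>auto simp: grad_pair_def intro!: continuous_intros\<close>)

lemma grad_pair_sum:
  assumes "finite A" "\<And>a. a \<in> A \<Longrightarrow> grad_pair D (\<phi> a) (G a)"
  shows "grad_pair D (\<lambda>x. \<Sum>a\<in>A. \<phi> a x) (\<lambda>x. \<Sum>a\<in>A. G a x)"
  using assms by (induction rule: finite_induct) (auto intro: grad_pair_0 grad_pair_add)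

lemma grad_pair_translate:
  assumes "grad_pair D \<phi> G"
  shows "grad_pair ((+) a ` D) (\<lambda>x. \<phi> (x - a)) (\<lambda>x. G (x - a))"
  unfolding grad_pair_def
proof (intro conjI allI impI ballI)
  have [measurable]: "G \<in> borel_measurable borel" and cont: "continuous_on UNIV \<phi>"
    using assms by (auto simp: grad_pair_def)
  show "continuous_on UNIV (\<lambda>x. \<phi> (x - a))"
    by (intro continuous_on_compose2[OF cont] continuous_intros) auto
  show "(\<lambda>x. G (x - a)) \<in> borel_measurable borel" by measurable
  show "\<exists>M. \<forall>x. norm (G (x - a)) \<le> M" using assms by (auto simp: grad_pair_def)
  have "x - a \<notin> D" if "x \<notin> (+) a ` D" for x
    using that by (auto simp: image_iff)
  then show "\<phi> (x - a) = 0" "G (x - a) = 0" if "x \<notin> (+) a ` D" for x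
    using assms that by (auto simp: grad_pair_def)
  fix \<psi> :: "real^'a \<Rightarrow> real" and i j assume \<psi>: "\<psi> \<in> test_functions UNIV"
  let ?\<psi> = "\<lambda>x. \<psi> (a + x)"
  have \<psi>': "?\<psi> \<in> test_functions UNIV" using test_function_affine[OF \<psi>, of 1 a] by simp
  have d: "frechet_derivative ?\<psi> (at x) = frechet_derivative \<psi> (at (a + x))" for x
  proof -
    have "(?\<psi> has_derivative (\<lambda>h. frechet_derivative \<psi> (at (a + x)) h)) (at x)"
      by (rule has_derivative_compose[OF _ test_function_has_derivative[OF \<psi>]])
         (auto intro!: derivative_eq_intros)
    then show ?thesis by (simp add: frechet_derivative_eqI)
  qed
  have m: "(\<lambda>x. \<phi> x $ i * frechet_derivative ?\<psi> (at x) (axis j 1)) \<in> borel_measurable borel"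
    "(\<lambda>x. G x $ i $ j * ?\<psi> x) \<in> borel_measurable borel"
    using borel_measurable_integrable[OF grad_pair_test_integrable(1)[OF assms \<psi>', of i j]]
      borel_measurable_integrable[OF grad_pair_test_integrable(2)[OF assms \<psi>', of i j]] by simp_all
  have "(\<integral>x. \<phi> x $ i * frechet_derivative ?\<psi> (at x) (axis j 1) \<partial>lborel) = - (\<integral>x. G x $ i $ j * ?\<psi> x \<partial>lborel)"
    using assms \<psi>' by (auto simp: grad_pair_def)
  then show "(\<integral>x. \<phi> (x - a) $ i * frechet_derivative \<psi> (at x) (axis j 1) \<partial>lborel) = - (\<integral>x. G (x - a) $ i $ j * \<psi> x \<partial>lborel)"
    using lborel_integral_translate(1)[OF m(1), of "- a"] lborel_integral_translate(1)[OF m(2), of "- a"]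
    by (simp add: d)
qed

section \<open>Mollification of admissible pairs\<close>

lemma mollify_nth:
  assumes "integrable lborel f" "\<eta> \<in> test_functions UNIV"
  shows "mollify \<eta> f x $ i = (\<integral>y. f y $ i * \<eta> (x - y) \<partial>lborel)"
proof -
  have "mollify \<eta> f x $ i = (\<integral>y. (\<eta> (x - y) *\<^sub>R f y) $ i \<partial>lborel)"
    unfolding mollify_def
    by (rule integral_bounded_linear[OF bounded_linear_vec_nth mollify_integrable_test[OF assms], symmetric])
  then show ?thesis by (simp add: mult.commute)
qed

text \<open>The weak identity is tested with the reflected kernel \<open>\<eta> (x - y)\<close> as a
  function of \<open>y\<close>, whose support need not lie in \<open>D\<close>. This is why
  \<open>grad_pair\<close> admits test functions on the whole space.\<close>

lemma grad_pair_mollify: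
  assumes p: "grad_pair D \<phi> G" and D: "bounded D" and \<eta>: "\<eta> \<in> test_functions UNIV"
  shows "C1_map (mollify \<eta> \<phi>) (mollify \<eta> G)"
  unfolding C1_map_def
proof (intro conjI allI)
  note i = grad_pair_integrable[OF p D]
  show "continuous_on UNIV (mollify \<eta> G)" by (rule mollify_continuous[OF i(2) \<eta>])
  fix x
  let ?D = "\<lambda>h. \<Sum>j\<in>UNIV. h $ j *\<^sub>R mollify (\<lambda>x. frechet_derivative \<eta> (at x) (axis j 1)) \<phi> x"
  have "?D h = mollify \<eta> G x *v h" for h
  proof (subst vec_eq_iff, rule allI)
    fix k
    let ?\<psi> = "\<lambda>y. \<eta> (x + (-1) *\<^sub>R y)"
    have \<psi>: "?\<psi> \<in> test_functions UNIV" by (rule test_function_affine[OF \<eta>]) simp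
    have d: "frechet_derivative ?\<psi> (at y) h = - frechet_derivative \<eta> (at (x - y)) h" for y h
    proof -
      have "(?\<psi> has_derivative (\<lambda>h. gradient \<eta> (x + (-1) *\<^sub>R y) \<bullet> ((-1) *\<^sub>R h))) (at y)"
        by (rule has_derivative_compose[OF _ test_function_has_gradient[OF \<eta>]])
           (auto intro!: derivative_eq_intros)
      then show ?thesis by (simp add: frechet_derivative_eqI frechet_derivative_gradient[OF \<eta>])
    qed
    have "mollify (\<lambda>x. frechet_derivative \<eta> (at x) (axis j 1)) \<phi> x $ k = mollify \<eta> G x $ k $ j" for j
    proof -
      have "(\<integral>y. \<phi> y $ k * frechet_derivative ?\<psi> (at y) (axis j 1) \<partial>lborel) = - (\<integral>y. G y $ k $ j * ?\<psi> y \<partial>lborel)"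
        using p \<psi> by (auto simp: grad_pair_def)
      then have *: "(\<integral>y. \<phi> y $ k * frechet_derivative \<eta> (at (x - y)) (axis j 1) \<partial>lborel) = (\<integral>y. G y $ k $ j * \<eta> (x - y) \<partial>lborel)"
        unfolding d by simp
      have "integrable lborel (\<lambda>y. G y $ k)"
        by (rule integrable_bounded_linear[OF bounded_linear_vec_nth i(2)])
      have "mollify \<eta> G x $ k = mollify \<eta> (\<lambda>y. G y $ k) x"
        unfolding mollify_def
        by (subst integral_bounded_linear[OF bounded_linear_vec_nth mollify_integrable_test[OF i(2) \<eta>], symmetric]) simp
      then have "mollify \<eta> G x $ k $ j = (\<integral>y. G y $ k $ j * \<eta> (x - y) \<partial>lborel)"
        using mollify_nth[OF \<open>integrable lborel (\<lambda>y. G y $ k)\<close> \<eta>] by simp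
      then show ?thesis
        using * mollify_nth[OF i(1) test_function_pd[OF \<eta>]] by simp
    qed
    then show "?D h $ k = (mollify \<eta> G x *v h) $ k"
      by (simp add: matrix_vector_mult_def mult.commute)
  qed
  then show "(mollify \<eta> \<phi> has_derivative (\<lambda>h. mollify \<eta> G x *v h)) (at x)"
    using mollify_has_derivative[OF i(1) \<eta>, of x] by simp
qed

text \<open>The single parameter \<open>e\<close> bounds both the error in the mean and the
  spreading of the support beyond \<open>D\<close>.\<close>

lemma grad_pair_approx:
  assumes p: "grad_pair D \<phi> G" and D: "bounded D" and "e > 0"
  obtains \<phi>' G' where "C1_map \<phi>' G'" "\<And>x. ball x e \<inter> D = {} \<Longrightarrow> \<phi>' x = 0"
    "(\<integral>\<^sup>+x. ennreal (norm (G' x - G x)) \<partial>lborel) \<le> ennreal e"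
proof -
  note i = grad_pair_integrable[OF p D]
  obtain d where d: "d > 0" "\<And>\<tau> \<eta>. \<tau> \<le> d \<Longrightarrow> mollifier \<tau> \<eta> \<Longrightarrow>
      (\<integral>\<^sup>+x. ennreal (norm (mollify \<eta> G x - G x)) \<partial>lborel) \<le> ennreal e"
    using mollify_L1_close[OF i(2) \<open>e > 0\<close>] by blast
  obtain \<eta> :: "real^'a \<Rightarrow> real" where \<eta>: "mollifier (min d e) \<eta>"
    using exists_mollifier[of "min d e"] d(1) \<open>e > 0\<close> by auto
  show ?thesis
  proof (rule that)
    show "C1_map (mollify \<eta> \<phi>) (mollify \<eta> G)"
      by (rule grad_pair_mollify[OF p D mollifierD(1)[OF \<eta>]])
    show "(\<integral>\<^sup>+x. ennreal (norm (mollify \<eta> G x - G x)) \<partial>lborel) \<le> ennreal e"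
      by (rule d(2)[OF _ \<eta>]) simp
    fix x assume x: "ball x e \<inter> D = {}"
    show "mollify \<eta> \<phi> x = 0"
    proof (rule mollify_support[OF mollifierD(3)[OF \<eta>]])
      fix y assume "y \<in> ball x (min d e)"
      then have "y \<notin> D" using x by auto
      then show "\<phi> y = 0" using p by (simp add: grad_pair_def)
    qed
  qed
qed

text \<open>The weak identity is tested with a cutoff that equals 1 around \<open>D\<close>: its
  derivative vanishes on \<open>D\<close>, and outside \<open>D\<close> both \<phi> and
  \<open>G\<close> vanish.\<close>

lemma grad_pair_integral_eq_0:
  assumes p: "grad_pair D \<phi> G" and D: "bounded D"
  shows "integral\<^sup>L lborel G = 0"
proof -
  note i = grad_pair_integrable(2)[OF p D]
  obtain R where R: "D \<subseteq> ball 0 R" using D bounded_subset_ballD by blast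
  obtain \<psi> :: "real^'a \<Rightarrow> real" where \<psi>: "\<psi> \<in> test_functions UNIV" "\<And>x. x \<in> cball 0 R \<Longrightarrow> \<psi> x = 1"
    by (rule exists_cutoff[OF compact_cball open_UNIV subset_UNIV]) blast
  have gi: "integrable lborel (\<lambda>x. G x $ i)" for i
    by (rule integrable_bounded_linear[OF bounded_linear_vec_nth i])
  have "(\<integral>x. G x $ i $ j \<partial>lborel) = 0" for i j
  proof -
    have e1: "\<phi> x $ i * frechet_derivative \<psi> (at x) (axis j 1) = 0" for x
    proof (cases "x \<in> D")
      case True
      have "(\<psi> has_derivative (\<lambda>h. 0)) (at x)"
        by (rule has_derivative_transform_within_open[of "\<lambda>_. 1" _ _ _ "ball 0 R"])
           (use True R \<psi>(2) in auto)
      then show ?thesis by (simp add: frechet_derivative_eqI)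
    next
      case False
      then show ?thesis using p by (simp add: grad_pair_def)
    qed
    have e2: "(\<integral>x. \<phi> x $ i * frechet_derivative \<psi> (at x) (axis j 1) \<partial>lborel) = - (\<integral>x. G x $ i $ j * \<psi> x \<partial>lborel)"
      using p \<psi>(1) by (auto simp: grad_pair_def)
    have e3: "G x $ i $ j * \<psi> x = G x $ i $ j" for x
      using p \<psi>(2)[of x] R by (cases "x \<in> D") (auto simp: grad_pair_def)
    show ?thesis using e2 unfolding e1 e3 by simp
  qed
  moreover have "integral\<^sup>L lborel G $ i $ j = (\<integral>x. G x $ i $ j \<partial>lborel)" for i j
    using integral_bounded_linear[OF bounded_linear_vec_nth i, of i]
      integral_bounded_linear[OF bounded_linear_vec_nth gi[of i], of j] by simp
  ultimately show ?thesis by (simp add: vec_eq_iff)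
qed

subsection \<open>Admissible maps on cubes\<close>

lemma uniformly_continuous_UNIV_E:
  assumes "uniformly_continuous_on UNIV f" "e > 0"
  obtains d where "d > 0" "\<And>x y. dist y x < d \<Longrightarrow> dist (f y) (f x) < e"
  using assms unfolding uniformly_continuous_on_def by (metis UNIV_I)

lemma cube_eq_box: "cube n = box 0 (vec (real n))"
  by (auto simp: cube_def mem_box_cart)

lemma open_cube: "open (cube n)" and bounded_cube: "bounded (cube n)" and cube_borel [measurable]: "cube n \<in> sets borel"
  by (simp_all add: cube_eq_box open_box)

lemma prod_Basis_vec:
  "(\<Prod>b\<in>Basis. f (b :: real^'d::finite)) = (\<Prod>i\<in>UNIV. f (axis i 1))"
proof -
  have B: "(Basis :: (real^'d) set) = (\<lambda>i. axis i 1) ` UNIV"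
    by (auto simp: Basis_vec_def)
  have "inj (\<lambda>i. axis i 1 :: real^'d)"
    by (auto simp: inj_on_def axis_eq_axis)
  then show ?thesis unfolding B by (subst prod.reindex) auto
qed

lemma emeasure_box_vec:
  fixes a b :: "real^'d::finite"
  assumes "\<And>i. a $ i \<le> b $ i"
  shows "emeasure lborel (box a b) = ennreal (\<Prod>i\<in>UNIV. b $ i - a $ i)"
    and "emeasure lborel (cbox a b) = ennreal (\<Prod>i\<in>UNIV. b $ i - a $ i)"
proof -
  have "x \<bullet> c \<le> y \<bullet> c" if "c \<in> Basis" "\<And>i. x $ i \<le> y $ i" for x y c :: "real^'d"
    using that by (auto simp: Basis_vec_def inner_axis)
  then have *: "a \<bullet> c \<le> b \<bullet> c" if "c \<in> Basis" for c using that assms by blast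
  show "emeasure lborel (box a b) = ennreal (\<Prod>i\<in>UNIV. b $ i - a $ i)"
    using * by (simp add: prod_Basis_vec inner_axis)
  show "emeasure lborel (cbox a b) = ennreal (\<Prod>i\<in>UNIV. b $ i - a $ i)"
    using * by (simp add: prod_Basis_vec inner_axis)
qed

lemma emeasure_box_const:
  assumes "a \<le> b"
  shows "emeasure lborel (box (vec a) (vec b) :: (real^'d::finite) set) = ennreal ((b - a) ^ CARD('d))"
    "emeasure lborel (cbox (vec a) (vec b) :: (real^'d::finite) set) = ennreal ((b - a) ^ CARD('d))"
  using assms by (simp_all add: emeasure_box_vec)

lemma emeasure_cube: "emeasure lborel (cube n :: (real^'d::finite) set) = ennreal (real n ^ CARD('d))"
  using emeasure_box_const(1)[of 0 "real n", where 'd = 'd] by (simp add: cube_eq_box zero_vec_def vec_def)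

lemma lebesgue_on_integral_eq_lborel:
  fixes f :: "'a::euclidean_space \<Rightarrow> 'b::euclidean_space"
  assumes D: "D \<in> sets borel" and f: "f \<in> borel_measurable borel" and z: "\<And>x. x \<notin> D \<Longrightarrow> f x = 0"
  shows "(\<integral>x. f x \<partial>lebesgue_on D) = (\<integral>x. f x \<partial>lborel)"
proof -
  have "(\<integral>x. f x \<partial>lebesgue_on D) = (\<integral>x. indicator D x *\<^sub>R f x \<partial>lebesgue)"
    using D by (intro integral_restrict_space) (auto simp: sets_completionI_sets)
  also have "(\<lambda>x. indicator D x *\<^sub>R f x) = f" using z by (auto simp: indicator_def)
  also have "(\<integral>x. f x \<partial>lebesgue) = (\<integral>x. f x \<partial>lborel)"
    using f by (intro integral_completion) simp
  finally show ?thesis .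
qed

lemma nn_integral_lebesgue_on:
  assumes "D \<in> sets borel"
  shows "(\<integral>\<^sup>+x. f x \<partial>lebesgue_on D) = (\<integral>\<^sup>+x\<in>D. f x \<partial>lborel)"
  using assms by (subst nn_integral_restrict_space) (auto simp: sets_completionI_sets nn_integral_completion)

text \<open>Together with its converse on cubes, \<open>W1inf0_cube_grad_pair\<close>, this permits
  working only with globally defined continuous maps and bounded Borel gradients.\<close>

lemma grad_pair_W1inf0:
  assumes p: "grad_pair D \<phi> G" and D: "open D" "bounded D"
  shows "\<phi> \<in> W1inf0 D" "G \<in> Linfty D" "weak_gradient D \<phi> G"
proof -
  have Db: "D \<in> sets borel" using D by auto
  obtain M where M: "\<And>x. norm (G x) \<le> M" using p by (auto simp: grad_pair_def)
  have cont: "continuous_on UNIV \<phi>" using p by (simp add: grad_pair_def)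
  obtain R where R: "D \<subseteq> ball 0 R" using D(2) bounded_subset_ballD by blast
  have "\<phi> x = 0" if "norm x > R" for x
  proof -
    have "x \<notin> D" using subsetD[OF R, of x] that by auto
    then show ?thesis using p by (simp add: grad_pair_def)
  qed
  then obtain A where A: "\<And>x. norm (\<phi> x) \<le> A" using compact_support_bounded[OF cont] by metis
  have meas: "f \<in> borel_measurable (lebesgue_on D)" if "f \<in> borel_measurable borel" for f :: "real^'a \<Rightarrow> 'c::euclidean_space"
    using that by (intro measurable_restrict_space1 measurable_completion) simp
  show G: "G \<in> Linfty D" unfolding Linfty_def
    using p M by (auto intro!: meas simp: grad_pair_def)
  have \<phi>: "\<phi> \<in> Linfty D" unfolding Linfty_def
    using A by (auto intro!: meas borel_measurable_continuous_onI[OF cont])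
  show w: "weak_gradient D \<phi> G"
    unfolding weak_gradient_def
  proof (intro ballI allI)
    fix \<psi> i j assume "\<psi> \<in> test_functions D"
    then have \<psi>: "\<psi> \<in> test_functions UNIV" using test_functions_mono[of D UNIV] by auto
    have "(\<integral>x. \<phi> x $ i * frechet_derivative \<psi> (at x) (axis j 1) \<partial>lebesgue_on D)
       = (\<integral>x. \<phi> x $ i * frechet_derivative \<psi> (at x) (axis j 1) \<partial>lborel)"
      using borel_measurable_integrable[OF grad_pair_test_integrable(1)[OF p \<psi>]] p Db
      by (intro lebesgue_on_integral_eq_lborel) (auto simp: grad_pair_def)
    also have "\<dots> = - (\<integral>x. G x $ i $ j * \<psi> x \<partial>lborel)"
      using p \<psi> by (auto simp: grad_pair_def)
    also have "(\<integral>x. G x $ i $ j * \<psi> x \<partial>lborel) = (\<integral>x. G x $ i $ j * \<psi> x \<partial>lebesgue_on D)"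
      using borel_measurable_integrable[OF grad_pair_test_integrable(2)[OF p \<psi>]] p Db
      by (intro lebesgue_on_integral_eq_lborel[symmetric]) (auto simp: grad_pair_def)
    finally show "(\<integral>x. \<phi> x $ i * frechet_derivative \<psi> (at x) (axis j 1) \<partial>lebesgue_on D)
      = - (\<integral>x. G x $ i $ j * \<psi> x \<partial>lebesgue_on D)" .
  qed
  show "\<phi> \<in> W1inf0 D"
    unfolding W1inf0_def W1inf_def
    using \<phi> G w p D continuous_on_subset[OF cont] by (auto simp: grad_pair_def frontier_def interior_open)
qed

lemma borel_representative:
  fixes f :: "'a::euclidean_space \<Rightarrow> 'b::euclidean_space"
  assumes "f \<in> borel_measurable lebesgue"
  obtains f' where "f' \<in> borel_measurable borel" "AE x in lborel. f x = f' x"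
proof -
  have "\<exists>g\<in>borel_measurable lborel. AE x in lborel. f x \<bullet> b = g x" for b
    using assms by (intro completion_ex_borel_measurable_real) auto
  then obtain g where g: "\<And>b. g b \<in> borel_measurable lborel" "\<And>b. AE x in lborel. f x \<bullet> b = g b x"
    by metis
  have [measurable]: "g b \<in> borel_measurable borel" for b using g(1)[of b] by simp
  show ?thesis
  proof (rule that)
    show "(\<lambda>x. \<Sum>b\<in>Basis. g b x *\<^sub>R b) \<in> borel_measurable borel" by measurable
    have "AE x in lborel. \<forall>b\<in>Basis. f x \<bullet> b = g b x"
      using g(2) by (intro AE_finite_allI) auto
    then show "AE x in lborel. f x = (\<Sum>b\<in>Basis. g b x *\<^sub>R b)"
    proof eventually_elim
      case (elim x)
      have "f x = (\<Sum>b\<in>Basis. (f x \<bullet> b) *\<^sub>R b)" by (simp add: euclidean_representation)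
      also have "\<dots> = (\<Sum>b\<in>Basis. g b x *\<^sub>R b)" using elim by (intro sum.cong) auto
      finally show ?case .
    qed
  qed
qed

text \<open>Young's inequality for a summable kernel and a function bounded by 1; it is applied with
  a partial derivative of a mollifier as kernel.\<close>

lemma mollify_indicator_derivative_bound:
  fixes K :: "(real^'d::finite) set"
  assumes k: "integrable lborel k" and K: "K \<in> sets borel"
  shows "\<bar>mollify k (indicator K :: _ \<Rightarrow> real) x\<bar> \<le> (\<integral>y. \<bar>k y\<bar> \<partial>lborel)"
proof -
  have [measurable]: "k \<in> borel_measurable borel" using k by auto
  have i: "integrable lborel (\<lambda>y. \<bar>k (x - y)\<bar>)"
    using lborel_integral_reflect(2)[of "\<lambda>y. \<bar>k y\<bar>" x] k by simp
  have "\<bar>mollify k (indicator K :: _ \<Rightarrow> real) x\<bar> \<le> (\<integral>y. norm (k (x - y) *\<^sub>R indicator K y :: real) \<partial>lborel)"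
    unfolding mollify_def real_norm_def[symmetric] by (rule integral_norm_bound)
  also have "\<dots> \<le> (\<integral>y. \<bar>k (x - y)\<bar> \<partial>lborel)"
    by (rule integral_mono_AE'[OF i]) (auto simp: indicator_def)
  also have "\<dots> = (\<integral>y. \<bar>k y\<bar> \<partial>lborel)" by (rule lborel_integral_reflect(1)) measurable
  finally show ?thesis .
qed

section \<open>Boundary layers of a cube and extension by zero\<close>

lemma measure_cube_layer:
  assumes "0 \<le> s" "2 * s \<le> real n"
  shows "emeasure lborel (cube n - box (vec s) (vec (real n - s)) :: (real^'d::finite) set) < \<infinity>"
    "measure lborel (cube n - box (vec s) (vec (real n - s)) :: (real^'d::finite) set)
      \<le> real CARD('d) * real n ^ (CARD('d) - 1) * (2 * s)"
proof -
  let ?B = "box (vec s) (vec (real n - s)) :: (real^'d) set"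
  have sub: "?B \<subseteq> cube n"
  proof
    fix x assume x: "x \<in> ?B"
    have "0 < x $ i \<and> x $ i < real n" for i
    proof -
      have "s < x $ i \<and> x $ i < real n - s" using x by (simp add: mem_box_cart)
      then show ?thesis using assms by linarith
    qed
    then show "x \<in> cube n" by (simp add: cube_def)
  qed
  have fin: "emeasure lborel (cube n :: (real^'d) set) < \<infinity>" "emeasure lborel ?B < \<infinity>"
    using emeasure_box_const(1)[of s "real n - s", where 'd = 'd] assms by (simp_all add: emeasure_cube)
  show "emeasure lborel (cube n - ?B) < \<infinity>"
    using emeasure_mono[of "cube n - ?B" "cube n" lborel] fin(1) by (auto intro: le_less_trans)
  have "measure lborel (cube n - ?B) = measure lborel (cube n :: (real^'d) set) - measure lborel ?B"
    using fin sub by (intro measure_Diff) auto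
  also have "\<dots> = real n ^ CARD('d) - (real n - 2 * s) ^ CARD('d)"
    using emeasure_box_const(1)[of s "real n - s", where 'd = 'd] assms
    by (simp add: measure_def emeasure_cube)
  also have "\<dots> \<le> real CARD('d) * real n ^ (CARD('d) - 1) * (real n - (real n - 2 * s))"
    using assms by (intro power_diff_le) auto
  finally show "measure lborel (cube n - ?B) \<le> real CARD('d) * real n ^ (CARD('d) - 1) * (2 * s)" by simp
qed

lemma continuous_on_zero_extension:
  fixes \<phi> :: "'a::topological_space \<Rightarrow> 'b::real_normed_vector"
  assumes "continuous_on (closure D) \<phi>" "\<And>x. x \<in> frontier D \<Longrightarrow> \<phi> x = 0" "open D"
  shows "continuous_on UNIV (\<lambda>x. if x \<in> D then \<phi> x else 0)"
proof -
  have "continuous_on (closure D \<union> - D) (\<lambda>x. if x \<in> D then \<phi> x else 0)"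
    by (rule continuous_on_cases) (use assms in \<open>auto simp: frontier_def interior_open\<close>)
  moreover have "closure D \<union> - D = UNIV" using closure_subset by auto
  ultimately show ?thesis by simp
qed

lemma cube_boundary_close:
  assumes x: "x \<in> cube n" "x \<notin> box (vec s) (vec (real n - s))"
  obtains y where "y \<notin> cube n" "dist y x \<le> s"
proof -
  obtain i where i: "x $ i \<le> s \<or> real n - s \<le> x $ i"
    using x(2) by (auto simp: mem_box_cart not_less)
  have xi: "0 < x $ i" "x $ i < real n" using x(1) by (auto simp: cube_def)
  from i show ?thesis
  proof
    assume "x $ i \<le> s"
    moreover have "x - (x $ i) *\<^sub>R axis i 1 \<notin> cube n"
      by (auto simp: cube_def axis_def intro!: exI[of _ i])
    ultimately show ?thesis
      using xi by (intro that[of "x - (x $ i) *\<^sub>R axis i 1"]) (auto simp: dist_norm norm_axis_1)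
  next
    assume "real n - s \<le> x $ i"
    moreover have "x + (real n - x $ i) *\<^sub>R axis i 1 \<notin> cube n"
      by (auto simp: cube_def axis_def intro!: exI[of _ i])
    ultimately show ?thesis
      using xi by (intro that[of "x + (real n - x $ i) *\<^sub>R axis i 1"]) (auto simp: dist_norm norm_axis_1)
  qed
qed

text \<open>The indicator of the cube shrunk by \<open>2 * \<tau>\<close> is smeared over radius
  \<tau>, which leaves a margin of \<tau> to the boundary on the outside and reaches the value 1
  after \<open>3 * \<tau>\<close>. The constant \<open>c\<close> is the same for all \<tau>.\<close>

lemma cube_cutoff:
  obtains c :: real where "c \<ge> 0" "\<And>\<tau>. 0 < \<tau> \<Longrightarrow> \<exists>\<theta>. \<theta> \<in> test_functions (cube n :: (real^'d::finite) set) \<and>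
     (\<forall>x. 0 \<le> \<theta> x \<and> \<theta> x \<le> 1) \<and> (\<forall>x\<in>box (vec (3*\<tau>)) (vec (real n - 3*\<tau>)). \<theta> x = 1) \<and>
     (\<forall>x j. \<bar>frechet_derivative \<theta> (at x) (axis j 1)\<bar> \<le> c / \<tau>)"
proof -
  obtain c :: real where c: "c \<ge> 0" "\<And>\<tau>. \<tau> > 0 \<Longrightarrow> \<exists>\<eta> :: real^'d \<Rightarrow> real. mollifier \<tau> \<eta> \<and>
    (\<forall>j. (\<integral>x. \<bar>frechet_derivative \<eta> (at x) (axis j 1)\<bar> \<partial>lborel) \<le> c / \<tau>)"
    by (rule exists_mollifiers) blast
  show ?thesis
  proof (rule that[OF c(1)])
    fix \<tau> :: real assume "\<tau> > 0"
    then obtain \<eta> :: "real^'d \<Rightarrow> real" where \<eta>: "mollifier \<tau> \<eta>"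
      and \<eta>c: "\<And>j. (\<integral>x. \<bar>frechet_derivative \<eta> (at x) (axis j 1)\<bar> \<partial>lborel) \<le> c / \<tau>"
      using c(2) by blast
    define K :: "(real^'d) set" where "K = cbox (vec (2*\<tau>)) (vec (real n - 2*\<tau>))"
    let ?K' = "cbox (vec \<tau>) (vec (real n - \<tau>)) :: (real^'d) set"
    define \<theta> where "\<theta> = mollify \<eta> (indicator K :: _ \<Rightarrow> real)"
    have "compact K" by (simp add: K_def)
    note m = mollify_indicator[OF \<eta> this, folded \<theta>_def]
    have comp: "\<bar>x $ i - y $ i\<bar> < \<tau>" if "y \<in> ball x \<tau>" for x y :: "real^'d" and i
      using component_le_norm_cart[of "x - y" i] that by (simp add: dist_norm)
    have "\<theta> x = 0" if x: "x \<notin> ?K'" for x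
    proof (rule m(5))
      obtain i where i: "x $ i < \<tau> \<or> real n - \<tau> < x $ i" using x by (auto simp: mem_box_cart not_le)
      have "y \<notin> K" if "y \<in> ball x \<tau>" for y
      proof
        assume "y \<in> K"
        then have "2*\<tau> \<le> y $ i" "y $ i \<le> real n - 2*\<tau>" by (auto simp: K_def mem_box_cart)
        then show False using comp[OF that, of i] i by linarith
      qed
      then show "ball x \<tau> \<inter> K = {}" by blast
    qed
    moreover have "?K' \<subseteq> cube n"
    proof
      fix x assume x: "x \<in> ?K'"
      have "0 < x $ i \<and> x $ i < real n" for i
      proof -
        have "\<tau> \<le> x $ i \<and> x $ i \<le> real n - \<tau>" using x by (simp add: mem_box_cart)
        then show ?thesis using \<open>\<tau> > 0\<close> by linarith
      qed
      then show "x \<in> cube n" by (simp add: cube_def)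
    qed
    ultimately have "\<theta> \<in> test_functions (cube n)"
      using m(1) by (intro test_functionsI[of _ ?K']) (auto simp: test_functions_def)
    moreover have "\<theta> x = 1" if "x \<in> box (vec (3*\<tau>)) (vec (real n - 3*\<tau>))" for x
    proof (rule m(4), rule subsetI)
      fix y assume y: "y \<in> ball x \<tau>"
      have "2*\<tau> \<le> y $ i \<and> y $ i \<le> real n - 2*\<tau>" for i
      proof -
        have "3*\<tau> < x $ i \<and> x $ i < real n - 3*\<tau>" using that by (simp add: mem_box_cart)
        then show ?thesis using comp[OF y, of i] by linarith
      qed
      then show "y \<in> K" by (simp add: K_def mem_box_cart)
    qed
    moreover have "\<bar>frechet_derivative \<theta> (at x) (axis j 1)\<bar> \<le> c / \<tau>" for x j
      unfolding \<theta>_def frechet_derivative_mollify[OF m(6) mollifierD(1)[OF \<eta>]]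
      using mollify_indicator_derivative_bound[OF test_function_integrable[OF test_function_pd[OF mollifierD(1)[OF \<eta>]]], of K j x]
        \<eta>c[of j] borel_compact[OF \<open>compact K\<close>] by linarith
    ultimately show "\<exists>\<theta>. \<theta> \<in> test_functions (cube n :: (real^'d::finite) set) \<and>
     (\<forall>x. 0 \<le> \<theta> x \<and> \<theta> x \<le> 1) \<and> (\<forall>x\<in>box (vec (3*\<tau>)) (vec (real n - 3*\<tau>)). \<theta> x = 1) \<and>
     (\<forall>x j. \<bar>frechet_derivative \<theta> (at x) (axis j 1)\<bar> \<le> c / \<tau>)"
      using m(2,3) by blast
  qed
qed

text \<open>A weak identity tested only inside the cube extends to all test functions: for a cutoff \<open>\<theta>\<close>
  at distance \<open>\<tau>\<close> from the boundary, \<open>\<integral> \<bar>\<nabla>\<theta>\<bar>\<close> stays bounded as \<open>\<tau> \<rightarrow> 0\<close> while \<open>q\<close> tends to 0 uniformly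
  on the support of \<open>\<nabla>\<theta>\<close>.\<close>

lemma weak_derivative_zero_extension:
  fixes q g :: "real^'d::finite \<Rightarrow> real"
  assumes n: "n \<ge> 1" and q: "continuous_on UNIV q" "\<And>x. x \<notin> cube n \<Longrightarrow> q x = 0"
    and g: "g \<in> borel_measurable borel" "\<And>x. \<bar>g x\<bar> \<le> M" "\<And>x. x \<notin> cube n \<Longrightarrow> g x = 0"
    and weak: "\<And>\<psi>. \<psi> \<in> test_functions (cube n) \<Longrightarrow>
      (\<integral>x. q x * frechet_derivative \<psi> (at x) (axis j 1) \<partial>lborel) = - (\<integral>x. g x * \<psi> x \<partial>lborel)"
    and \<psi>: "\<psi> \<in> test_functions UNIV"
  shows "(\<integral>x. q x * frechet_derivative \<psi> (at x) (axis j 1) \<partial>lborel) = - (\<integral>x. g x * \<psi> x \<partial>lborel)"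
proof -
  let ?C = "cube n :: (real^'d) set"
  let ?p = "\<lambda>x. frechet_derivative \<psi> (at x) (axis j 1)"
  have fC: "emeasure lborel ?C < \<infinity>" by (simp add: emeasure_cube)
  have qz: "q x = 0" if "norm x > real n * CARD('d)" for x
  proof (rule q(2), rule notI)
    assume x: "x \<in> ?C"
    have "\<bar>x $ i\<bar> \<le> real n" for i
    proof -
      have "0 < x $ i \<and> x $ i < real n" using x by (simp add: cube_def)
      then show ?thesis by linarith
    qed
    then have "(\<Sum>i\<in>UNIV. \<bar>x $ i\<bar>) \<le> (\<Sum>i\<in>(UNIV::'d set). real n)"
      by (intro sum_mono)
    then show False using that norm_le_l1_cart[of x] by (simp add: mult.commute)
  qed
  obtain A where A: "A > 0" "\<And>x. \<bar>q x\<bar> \<le> A" using compact_support_bounded[OF q(1) qz] by auto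
  obtain P where P: "P > 0" "\<And>x. \<bar>?p x\<bar> \<le> P" using test_function_bounded[OF test_function_pd[OF \<psi>]] by blast
  obtain S where S: "S > 0" "\<And>x. \<bar>\<psi> x\<bar> \<le> S" using test_function_bounded[OF \<psi>] by blast
  have [measurable]: "q \<in> borel_measurable borel" "g \<in> borel_measurable borel" "\<psi> \<in> borel_measurable borel"
      "?p \<in> borel_measurable borel"
    using q(1) g(1) test_function_continuous[OF \<psi>] test_function_continuous[OF test_function_pd[OF \<psi>]]
    by (auto intro: borel_measurable_continuous_onI)
  have M0: "M \<ge> 0" using g(2)[of 0] by linarith
  have qp: "\<bar>q x * ?p x\<bar> \<le> A * P" for x unfolding abs_mult by (intro mult_mono A P) (use A in auto)
  have gp: "\<bar>g x * \<psi> x\<bar> \<le> M * S" for x unfolding abs_mult by (intro mult_mono g S) (use M0 in auto)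
  have iqp: "integrable lborel (\<lambda>x. q x * ?p x)"
    by (rule integrable_bounded_support(1)[where D = ?C and B = "A * P"]) (use fC qp q(2) in auto)
  have igp: "integrable lborel (\<lambda>x. g x * \<psi> x)"
    by (rule integrable_bounded_support(1)[where D = ?C and B = "M * S"]) (use fC gp g(3) in auto)
  define B where "B = A * P + M * S"
  define F where "F x = q x * ?p x + g x * \<psi> x" for x
  have [measurable]: "F \<in> borel_measurable borel" unfolding F_def by measurable
  have FB: "\<bar>F x\<bar> \<le> B" for x using qp[of x] gp[of x] unfolding F_def B_def by linarith
  have B0: "B \<ge> 0" using FB[of 0] by linarith
  have Fz: "F x = 0" if "x \<notin> ?C" for x using q(2)[OF that] g(3)[OF that] by (simp add: F_def)
  have iF: "integrable lborel F" unfolding F_def using iqp igp by simp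
  obtain c where c: "c \<ge> 0" "\<And>\<tau>. 0 < \<tau> \<Longrightarrow> \<exists>\<theta>. \<theta> \<in> test_functions ?C \<and>
     (\<forall>x. 0 \<le> \<theta> x \<and> \<theta> x \<le> 1) \<and> (\<forall>x\<in>box (vec (3*\<tau>)) (vec (real n - 3*\<tau>)). \<theta> x = 1) \<and>
     (\<forall>x j. \<bar>frechet_derivative \<theta> (at x) (axis j 1)\<bar> \<le> c / \<tau>)"
    by (rule cube_cutoff[of n]) blast
  \<comment> \<open>The layer has width \<open>3 * \<tau>\<close> at each of two opposite faces,
    hence the factor 6; its volume is at most \<open>\<kappa> * \<tau>\<close>.\<close>
  define \<kappa> where "\<kappa> = real CARD('d) * real n ^ (CARD('d) - 1) * 6"
  have k0: "\<kappa> \<ge> 0" by (simp add: \<kappa>_def)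
  have main: "\<bar>integral\<^sup>L lborel F\<bar> \<le> e * (B * \<kappa> + S * c * \<kappa>)" if "e > 0" for e
  proof -
    obtain d where d: "d > 0" "\<And>x y. dist y x < d \<Longrightarrow> dist (q y) (q x) < e"
      using uniformly_continuous_UNIV_E[OF compact_support_uniformly_continuous[OF q(1) qz] \<open>e > 0\<close>] by metis
    \<comment> \<open>The three bounds make \<open>q\<close> small on the layer of width
      \<open>3 * \<tau>\<close>, keep that layer inside the cube, and make the volume of the layer
      small.\<close>
    define \<tau> where "\<tau> = min (d/6) (min (real n / 6) e)"
    have \<tau>: "\<tau> > 0" "3 * \<tau> < d" "2 * (3 * \<tau>) \<le> real n" "\<tau> \<le> e"
      using d(1) n \<open>e > 0\<close> by (auto simp: \<tau>_def)
    obtain \<theta> where t: "\<theta> \<in> test_functions ?C" "\<And>x. 0 \<le> \<theta> x" "\<And>x. \<theta> x \<le> 1"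
      "\<And>x. x \<in> box (vec (3*\<tau>)) (vec (real n - 3*\<tau>)) \<Longrightarrow> \<theta> x = 1"
      "\<And>x j. \<bar>frechet_derivative \<theta> (at x) (axis j 1)\<bar> \<le> c / \<tau>"
      using c(2)[OF \<tau>(1)] by blast
    have tU: "\<theta> \<in> test_functions UNIV" using t(1) test_functions_mono[of ?C UNIV] by auto
    let ?r = "\<lambda>x. frechet_derivative \<theta> (at x) (axis j 1)"
    define L where "L = ?C - box (vec (3*\<tau>)) (vec (real n - 3*\<tau>))"
    have L: "L \<in> sets borel" "emeasure lborel L < \<infinity>" "measure lborel L \<le> \<kappa> * \<tau>"
      using measure_cube_layer[of "3 * \<tau>" n, where 'd = 'd] \<tau> by (auto simp: L_def \<kappa>_def mult.assoc)
    have [measurable]: "\<theta> \<in> borel_measurable borel" "?r \<in> borel_measurable borel"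
      using test_function_continuous[OF tU] test_function_continuous[OF test_function_pd[OF tU]]
      by (auto intro: borel_measurable_continuous_onI)
    have Ck: "Ck k (\<lambda>x. \<psi> x * \<theta> x)" for k using \<psi> t(1) by (intro Ck_mult) (auto simp: test_functions_def)
    have pt: "(\<lambda>x. \<psi> x * \<theta> x) \<in> test_functions ?C"
    proof (rule test_functionsI[OF Ck])
      show "compact (closure {x. \<theta> x \<noteq> 0})" "closure {x. \<theta> x \<noteq> 0} \<subseteq> ?C"
        using t(1) by (auto simp: test_functions_def)
      show "\<psi> x * \<theta> x = 0" if "x \<notin> closure {x. \<theta> x \<noteq> 0}" for x
        using that closure_subset[of "{x. \<theta> x \<noteq> 0}"] by auto
    qed
    have der: "frechet_derivative (\<lambda>x. \<psi> x * \<theta> x) (at x) (axis j 1) = \<psi> x * ?r x + ?p x * \<theta> x" for x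
      by (subst frechet_derivative_eqI[OF has_derivative_mult[OF test_function_has_derivative[OF \<psi>]
          test_function_has_derivative[OF tU]]]) simp
    have ab: "\<bar>a * \<theta> x\<bar> \<le> \<bar>a\<bar>" for a x
      using t(2,3)[of x] by (simp add: abs_mult mult_left_le)
    have i1: "integrable lborel (\<lambda>x. q x * ?p x * \<theta> x)"
      by (rule integrable_bounded_support(1)[where D = ?C and B = "A * P"]) (use fC order_trans[OF ab qp] q(2) in auto)
    have i2: "integrable lborel (\<lambda>x. g x * \<psi> x * \<theta> x)"
      by (rule integrable_bounded_support(1)[where D = ?C and B = "M * S"]) (use fC order_trans[OF ab gp] g(3) in auto)
    have small: "\<bar>q x\<bar> \<le> e" if x: "x \<in> L" for x
    proof -
      have "x \<in> ?C" "x \<notin> box (vec (3*\<tau>)) (vec (real n - 3*\<tau>))" using x by (auto simp: L_def)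
      then obtain y where y: "y \<notin> ?C" "dist y x \<le> 3 * \<tau>"
        by (rule cube_boundary_close)
      then show ?thesis using d(2)[of y x] \<tau>(2) q(2)[OF y(1)] by (simp add: dist_real_def)
    qed
    have rz: "?r x = 0" if "x \<in> box (vec (3*\<tau>)) (vec (real n - 3*\<tau>))" for x
    proof -
      have "(\<theta> has_derivative (\<lambda>h. 0)) (at x)"
        by (rule has_derivative_transform_within_open[OF has_derivative_const open_box that, of 1]) (use t(4) in auto)
      then show ?thesis by (simp add: frechet_derivative_eqI)
    qed
    have qr: "norm (q x * \<psi> x * ?r x) \<le> e * S * (c / \<tau>)" "x \<notin> L \<Longrightarrow> q x * \<psi> x * ?r x = 0" for x
    proof -
      show "q x * \<psi> x * ?r x = 0" if "x \<notin> L"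
        using that rz[of x] q(2)[of x] by (auto simp: L_def)
      then show "norm (q x * \<psi> x * ?r x) \<le> e * S * (c / \<tau>)"
      proof (cases "x \<in> L")
        case True
        show ?thesis unfolding real_norm_def abs_mult
          by (intro mult_mono small[OF True] S(2) t(5)) (use \<open>e > 0\<close> S in auto)
      qed (use \<open>e > 0\<close> S c \<tau> in auto)
    qed
    note iqr = integrable_bounded_support[where f = "\<lambda>x. q x * \<psi> x * ?r x" and D = L and B = "e * S * (c / \<tau>)", OF _ L(1,2) qr]
    have iqr1: "integrable lborel (\<lambda>x. q x * \<psi> x * ?r x)" by (rule iqr(1)) measurable
    have iqr2: "norm (\<integral>x. q x * \<psi> x * ?r x \<partial>lborel) \<le> e * S * (c / \<tau>) * measure lborel L" by (rule iqr(2)) measurable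
    have "(\<integral>x. q x * (\<psi> x * ?r x + ?p x * \<theta> x) \<partial>lborel) = - (\<integral>x. g x * (\<psi> x * \<theta> x) \<partial>lborel)"
      using weak[OF pt] unfolding der .
    moreover have "(\<integral>x. q x * (\<psi> x * ?r x + ?p x * \<theta> x) \<partial>lborel) = (\<integral>x. q x * \<psi> x * ?r x + q x * ?p x * \<theta> x \<partial>lborel)"
      by (intro Bochner_Integration.integral_cong) (auto simp: algebra_simps)
    ultimately have w: "(\<integral>x. q x * \<psi> x * ?r x \<partial>lborel) + (\<integral>x. q x * ?p x * \<theta> x \<partial>lborel) = - (\<integral>x. g x * \<psi> x * \<theta> x \<partial>lborel)"
      using iqr1 i1 by (simp add: mult.assoc)
    have F1B: "norm (F x * (1 - \<theta> x)) \<le> B" for x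
    proof -
      have "\<bar>F x\<bar> * \<bar>1 - \<theta> x\<bar> \<le> B * 1" using t(2,3)[of x] FB[of x] by (intro mult_mono) auto
      then show ?thesis by (simp add: abs_mult)
    qed
    have F1z: "F x * (1 - \<theta> x) = 0" if "x \<notin> L" for x
      using that Fz[of x] t(4)[of x] by (auto simp: L_def)
    have F1m: "(\<lambda>x. F x * (1 - \<theta> x)) \<in> borel_measurable borel" by measurable
    note iF1 = integrable_bounded_support[OF F1m L(1,2) F1B F1z]
    \<comment> \<open>The identity for the test function \<open>\<psi> * \<theta>\<close> removes
      the part weighted with \<theta>. What remains is the part carried by the layer and the
      commutator term with the derivative of \<theta>.\<close>
    have "integral\<^sup>L lborel F = (\<integral>x. F x * (1 - \<theta> x) + (q x * ?p x * \<theta> x + g x * \<psi> x * \<theta> x) \<partial>lborel)"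
      by (intro Bochner_Integration.integral_cong) (auto simp: F_def algebra_simps)
    also have "\<dots> = (\<integral>x. F x * (1 - \<theta> x) \<partial>lborel) + ((\<integral>x. q x * ?p x * \<theta> x \<partial>lborel) + (\<integral>x. g x * \<psi> x * \<theta> x \<partial>lborel))"
      using iF1(1) i1 i2 by simp
    also have "\<dots> = (\<integral>x. F x * (1 - \<theta> x) \<partial>lborel) - (\<integral>x. q x * \<psi> x * ?r x \<partial>lborel)" using w by simp
    finally have eqF: "integral\<^sup>L lborel F = (\<integral>x. F x * (1 - \<theta> x) \<partial>lborel) - (\<integral>x. q x * \<psi> x * ?r x \<partial>lborel)" .
    have "\<bar>integral\<^sup>L lborel F\<bar> \<le> B * measure lborel L + e * S * (c / \<tau>) * measure lborel L"
      using iF1(2) iqr2 unfolding eqF real_norm_def by linarith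
    also have "\<dots> \<le> B * (\<kappa> * \<tau>) + e * S * (c / \<tau>) * (\<kappa> * \<tau>)"
      using B0 L(3) \<open>e > 0\<close> S c \<tau> by (intro add_mono mult_left_mono) auto
    also have "\<dots> = \<tau> * (B * \<kappa>) + e * (S * c * \<kappa>)" using \<tau>(1) by simp
    also have "\<dots> \<le> e * (B * \<kappa>) + e * (S * c * \<kappa>)" using \<tau>(4) B0 k0 by (intro add_right_mono mult_right_mono) auto
    finally show ?thesis by (simp add: algebra_simps)
  qed
  have "\<bar>integral\<^sup>L lborel F\<bar> \<le> 0 + e" if "e > 0" for e
  proof -
    let ?K = "B * \<kappa> + S * c * \<kappa>"
    have K: "?K \<ge> 0" using B0 k0 c S by auto
    then have "\<bar>integral\<^sup>L lborel F\<bar> \<le> e / (?K + 1) * ?K" by (intro main) (use that in auto)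
    also have "\<dots> = e * (?K / (?K + 1))" by simp
    also have "\<dots> \<le> e * 1" using that K by (intro mult_left_mono) (auto simp: divide_le_eq_1)
    finally show ?thesis by simp
  qed
  then have "integral\<^sup>L lborel F = 0" using field_le_epsilon[of "\<bar>integral\<^sup>L lborel F\<bar>" 0] by simp
  then show ?thesis unfolding F_def using iqp igp by simp
qed

section \<open>Infima of energies in terms of admissible pairs\<close>

lemma W1inf0_cube_grad_pair:
  assumes n: "n \<ge> 1" and \<phi>: "\<phi> \<in> W1inf0 (cube n)" and G: "G \<in> Linfty (cube n)" and w: "weak_gradient (cube n) \<phi> G"
  obtains \<phi>' G' where "grad_pair (cube n) \<phi>' G'" "AE x in lebesgue_on (cube n). G' x = G x"
proof -
  let ?C = "cube n :: (real^'a) set"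
  have CL: "?C \<in> sets lebesgue" by (simp add: sets_completionI_sets)
  define \<phi>' where "\<phi>' x = (if x \<in> ?C then \<phi> x else 0)" for x
  define G0 where "G0 x = (if x \<in> ?C then G x else 0)" for x
  obtain M0 where M0: "AE x in lebesgue_on ?C. norm (G x) \<le> M0" using G by (auto simp: Linfty_def)
  define M where "M = max M0 0"
  have "G0 \<in> borel_measurable lebesgue"
    using G CL unfolding G0_def Linfty_def by (subst borel_measurable_if) auto
  then obtain G1 where G1 [measurable]: "G1 \<in> borel_measurable borel" and G1e: "AE x in lborel. G0 x = G1 x"
    using borel_representative by blast
  \<comment> \<open>The gradient is cut off where it exceeds its essential bound. This changes it on
    a null set only and makes it bounded everywhere, as \<open>grad_pair\<close> demands.\<close>
  define G' where "G' x = (if x \<in> ?C \<and> norm (G1 x) \<le> M then G1 x else 0)" for x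
  have "AE x in lebesgue. x \<in> ?C \<longrightarrow> norm (G x) \<le> M0"
    using M0 CL by (subst (asm) AE_restrict_space_iff) auto
  then have "AE x in lborel. x \<in> ?C \<longrightarrow> norm (G x) \<le> M0" by (simp add: AE_completion_iff)
  then have G'e: "AE x in lborel. G' x = G0 x"
    using G1e by eventually_elim (auto simp: G'_def G0_def M_def split: if_splits)
  have G'm: "G' \<in> borel_measurable borel" unfolding G'_def by measurable
  have G'b: "norm (G' x) \<le> M" for x by (auto simp: G'_def M_def)
  have G'z: "G' x = 0" if "x \<notin> ?C" for x using that by (simp add: G'_def)
  have \<phi>'c: "continuous_on UNIV \<phi>'"
    unfolding \<phi>'_def[abs_def] by (rule continuous_on_zero_extension) (use \<phi> open_cube in \<open>auto simp: W1inf0_def\<close>)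
  have pair: "grad_pair ?C \<phi>' G'"
    unfolding grad_pair_def
  proof (intro conjI allI impI ballI \<phi>'c G'm)
    show "\<phi>' x = 0" if "x \<notin> ?C" for x using that by (simp add: \<phi>'_def)
    show "\<exists>M. \<forall>x. norm (G' x) \<le> M" using G'b by blast
    show "G' x = 0" if "x \<notin> ?C" for x using that by (rule G'z)
    fix \<psi> :: "real^'a \<Rightarrow> real" and i j assume \<psi>: "\<psi> \<in> test_functions UNIV"
    show "(\<integral>x. \<phi>' x $ i * frechet_derivative \<psi> (at x) (axis j 1) \<partial>lborel) = - (\<integral>x. G' x $ i $ j * \<psi> x \<partial>lborel)"
    proof (rule weak_derivative_zero_extension[OF n _ _ _ _ _ _ \<psi>, where M = M])
      show "continuous_on UNIV (\<lambda>x. \<phi>' x $ i)" by (intro continuous_intros \<phi>'c)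
      show "(\<lambda>x. G' x $ i $ j) \<in> borel_measurable borel" using G'm by measurable
      show "\<bar>G' x $ i $ j\<bar> \<le> M" for x
        using order_trans[OF component_le_norm_cart order_trans[OF Finite_Cartesian_Product.norm_nth_le G'b]] .
      fix \<psi> assume \<psi>: "\<psi> \<in> test_functions ?C"
      have \<psi>U: "\<psi> \<in> test_functions UNIV" using \<psi> test_functions_mono[of ?C UNIV] by auto
      have [measurable]: "G' \<in> borel_measurable borel" by (rule G'm)
      have [measurable]: "\<phi>' \<in> borel_measurable borel" "\<psi> \<in> borel_measurable borel"
         "(\<lambda>x. frechet_derivative \<psi> (at x) (axis j 1)) \<in> borel_measurable borel"
        using \<phi>'c test_function_continuous[OF \<psi>U] test_function_continuous[OF test_function_pd[OF \<psi>U]]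
        by (auto intro: borel_measurable_continuous_onI)
      have "(\<integral>x. \<phi>' x $ i * frechet_derivative \<psi> (at x) (axis j 1) \<partial>lborel)
        = (\<integral>x. \<phi>' x $ i * frechet_derivative \<psi> (at x) (axis j 1) \<partial>lebesgue_on ?C)"
      proof (rule lebesgue_on_integral_eq_lborel[symmetric])
        show "(\<lambda>x. \<phi>' x $ i * frechet_derivative \<psi> (at x) (axis j 1)) \<in> borel_measurable borel" by measurable
      qed (auto simp: \<phi>'_def)
      also have "\<dots> = (\<integral>x. \<phi> x $ i * frechet_derivative \<psi> (at x) (axis j 1) \<partial>lebesgue_on ?C)"
        by (intro Bochner_Integration.integral_cong) (auto simp: \<phi>'_def)
      also have "\<dots> = - (\<integral>x. G x $ i $ j * \<psi> x \<partial>lebesgue_on ?C)" using w \<psi> by (auto simp: weak_gradient_def)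
      also have "(\<integral>x. G x $ i $ j * \<psi> x \<partial>lebesgue_on ?C) = (\<integral>x. G' x $ i $ j * \<psi> x \<partial>lebesgue_on ?C)"
      proof (rule Bochner_Integration.integral_cong_AE)
        have "\<psi> \<in> borel_measurable (lebesgue_on ?C)"
          by (intro measurable_restrict_space1 measurable_completion) simp
        then show "(\<lambda>x. G x $ i $ j * \<psi> x) \<in> borel_measurable (lebesgue_on ?C)"
          using G by (auto simp: Linfty_def)
        show "(\<lambda>x. G' x $ i $ j * \<psi> x) \<in> borel_measurable (lebesgue_on ?C)"
          by (intro measurable_restrict_space1 measurable_completion) simp
        have "AE x in lebesgue. x \<in> ?C \<longrightarrow> G x $ i $ j * \<psi> x = G' x $ i $ j * \<psi> x"
          using AE_completion[OF G'e] by eventually_elim (auto simp: G0_def)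
        then show "AE x in lebesgue_on ?C. G x $ i $ j * \<psi> x = G' x $ i $ j * \<psi> x"
          using CL by (subst AE_restrict_space_iff) auto
      qed
      also have "\<dots> = (\<integral>x. G' x $ i $ j * \<psi> x \<partial>lborel)"
        by (rule lebesgue_on_integral_eq_lborel) (auto simp: G'z)
      finally show "(\<integral>x. \<phi>' x $ i * frechet_derivative \<psi> (at x) (axis j 1) \<partial>lborel) = - (\<integral>x. G' x $ i $ j * \<psi> x \<partial>lborel)" .
    qed (auto simp: \<phi>'_def G'z)
  qed
  have "AE x in lebesgue. x \<in> ?C \<longrightarrow> G' x = G x"
    using AE_completion[OF G'e] by eventually_elim (auto simp: G0_def)
  then have "AE x in lebesgue_on ?C. G' x = G x"
    using CL by (subst AE_restrict_space_iff) auto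
  then show ?thesis using pair that by blast
qed

lemma inf_energy_cube_le:
  assumes "grad_pair (cube n) \<phi> G"
  shows "inf_energy (cube n) F \<le> (\<integral>\<^sup>+x\<in>cube n. F x (G x) \<partial>lborel)"
  unfolding inf_energy_def nn_integral_lebesgue_on[OF cube_borel, symmetric]
  using grad_pair_W1inf0[OF assms open_cube bounded_cube] by (intro Inf_lower) blast

lemma inf_energy_cube_less:
  assumes "n \<ge> 1" "inf_energy (cube n) F < c"
  obtains \<phi> G where "grad_pair (cube n) \<phi> G" "(\<integral>\<^sup>+x\<in>cube n. F x (G x) \<partial>lborel) < c"
proof -
  obtain \<phi> G where p: "\<phi> \<in> W1inf0 (cube n)" "G \<in> Linfty (cube n)" "weak_gradient (cube n) \<phi> G"
    and less: "(\<integral>\<^sup>+x. F x (G x) \<partial>lebesgue_on (cube n)) < c"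
    using assms(2) unfolding inf_energy_def Inf_less_iff by blast
  obtain \<phi>' G' where p': "grad_pair (cube n) \<phi>' G'" and e: "AE x in lebesgue_on (cube n). G' x = G x"
    using W1inf0_cube_grad_pair[OF assms(1) p] by blast
  have "(\<integral>\<^sup>+x. F x (G' x) \<partial>lebesgue_on (cube n)) = (\<integral>\<^sup>+x. F x (G x) \<partial>lebesgue_on (cube n))"
    using e by (intro nn_integral_cong_AE) auto
  then show ?thesis
    using that[OF p'] less by (simp add: nn_integral_lebesgue_on)
qed

subsection \<open>Gluing on grids\<close>

text \<open>The rank-one matrix that appears in the product rule for a scalar function times a
  map.\<close>

definition outer :: "real^'m::finite \<Rightarrow> real^'d::finite \<Rightarrow> real^'d^'m" where
  "outer a b = (\<chi> i. a $ i *\<^sub>R b)"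

lemma outer_mult_vec: "outer a b *v h = (b \<bullet> h) *\<^sub>R a"
  by (simp add: outer_def vec_eq_iff matrix_vector_mult_def inner_vec_def sum_distrib_left mult.commute mult.left_commute)

lemma norm_outer: "norm (outer a b) = norm a * norm b"
proof -
  have "norm (outer a b) = L2_set (\<lambda>i. norm b * norm (a $ i)) UNIV"
    by (simp add: outer_def norm_vec_def[of "\<chi> i. a $ i *\<^sub>R b"] mult.commute)
  also have "\<dots> = norm b * norm a"
    by (simp add: L2_set_right_distrib norm_vec_def[of a])
  finally show ?thesis by simp
qed

lemma outer_zero [simp]: "outer a 0 = 0" "outer 0 b = 0"
  by (simp_all add: outer_def vec_eq_iff)

lemma continuous_on_outer [continuous_intros]:
  "continuous_on S f \<Longrightarrow> continuous_on S g \<Longrightarrow> continuous_on S (\<lambda>x. outer (f x) (g x))"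
  unfolding outer_def by (intro continuous_intros)

section \<open>Calculus of continuously differentiable maps\<close>

lemma C1_map_has_derivative: "C1_map \<phi> G \<Longrightarrow> (\<phi> has_derivative (\<lambda>h. G x *v h)) (at x)"
  by (simp add: C1_map_def)

lemma C1_map_gradient_continuous: "C1_map \<phi> G \<Longrightarrow> continuous_on UNIV G"
  by (simp add: C1_map_def)

lemma C1_map_zero: "C1_map (\<lambda>x. 0) (\<lambda>x. 0)"
  by (simp add: C1_map_def)

lemma C1_map_add:
  assumes "C1_map \<phi> G" "C1_map \<psi> H" shows "C1_map (\<lambda>x. \<phi> x + \<psi> x) (\<lambda>x. G x + H x)"
proof -
  have "((\<lambda>x. \<phi> x + \<psi> x) has_derivative (\<lambda>h. G x *v h + H x *v h)) (at x)" for x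
    by (intro has_derivative_add C1_map_has_derivative assms)
  moreover have "(\<lambda>h. G x *v h + H x *v h) = (\<lambda>h. (G x + H x) *v h)" for x
    by (simp add: matrix_vector_mult_add_rdistrib fun_eq_iff)
  ultimately show ?thesis
    unfolding C1_map_def by (auto intro!: continuous_intros C1_map_gradient_continuous[OF assms(1)] C1_map_gradient_continuous[OF assms(2)])
qed

lemma C1_map_sum:
  "finite A \<Longrightarrow> (\<And>a. a \<in> A \<Longrightarrow> C1_map (\<phi> a) (G a)) \<Longrightarrow> C1_map (\<lambda>x. \<Sum>a\<in>A. \<phi> a x) (\<lambda>x. \<Sum>a\<in>A. G a x)"
  by (induction rule: finite_induct) (auto intro: C1_map_zero C1_map_add)

lemma C1_map_affine: "C1_map (\<lambda>x. b + A *v (x - c)) (\<lambda>x. A)"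
proof -
  have "((\<lambda>x. b + A *v (x - c)) has_derivative (\<lambda>h. 0 + A *v (h - 0))) (at x)" for x
    by (intro derivative_intros bounded_linear.has_derivative[OF matrix_vector_mul_bounded_linear])
  then show ?thesis by (simp add: C1_map_def)
qed

lemma C1_map_diff:
  assumes "C1_map \<phi> G" "C1_map \<psi> H" shows "C1_map (\<lambda>x. \<phi> x - \<psi> x) (\<lambda>x. G x - H x)"
proof -
  have "((\<lambda>x. \<phi> x - \<psi> x) has_derivative (\<lambda>h. G x *v h - H x *v h)) (at x)" for x
    by (intro has_derivative_diff C1_map_has_derivative assms)
  moreover have "(\<lambda>h. G x *v h - H x *v h) = (\<lambda>h. (G x - H x) *v h)" for x
    by (simp add: matrix_vector_mult_diff_rdistrib fun_eq_iff)
  ultimately show ?thesis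
    unfolding C1_map_def by (auto intro!: continuous_intros C1_map_gradient_continuous[OF assms(1)] C1_map_gradient_continuous[OF assms(2)])
qed

lemma C1_map_mult_test:
  assumes t: "\<theta> \<in> test_functions UNIV" and c: "C1_map \<phi> G"
  shows "C1_map (\<lambda>x. \<theta> x *\<^sub>R \<phi> x) (\<lambda>x. \<theta> x *\<^sub>R G x + outer (\<phi> x) (gradient \<theta> x))"
  unfolding C1_map_def
proof (intro conjI allI)
  fix x
  have "((\<lambda>x. \<theta> x *\<^sub>R \<phi> x) has_derivative (\<lambda>h. \<theta> x *\<^sub>R (G x *v h) + (gradient \<theta> x \<bullet> h) *\<^sub>R \<phi> x)) (at x)"
    by (rule has_derivative_scaleR[OF test_function_has_gradient[OF t] C1_map_has_derivative[OF c]])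
  then show "((\<lambda>x. \<theta> x *\<^sub>R \<phi> x) has_derivative (\<lambda>h. (\<theta> x *\<^sub>R G x + outer (\<phi> x) (gradient \<theta> x)) *v h)) (at x)"
    by (simp add: matrix_vector_mult_add_rdistrib outer_mult_vec scaleR_matrix_vector_assoc)
next
  show "continuous_on UNIV (\<lambda>x. \<theta> x *\<^sub>R G x + outer (\<phi> x) (gradient \<theta> x))"
    by (intro continuous_intros test_function_continuous[OF t] C1_map_continuous[OF c]
        C1_map_gradient_continuous[OF c] test_function_gradient_continuous[OF t])
qed

lemma C1_map_scale:
  assumes c: "C1_map \<phi> G" and s: "s \<noteq> 0"
  shows "C1_map (\<lambda>x. (1/s) *\<^sub>R \<phi> (a + s *\<^sub>R x)) (\<lambda>x. G (a + s *\<^sub>R x))"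
  unfolding C1_map_def
proof (intro conjI allI)
  fix x
  have "((\<lambda>x. \<phi> (a + s *\<^sub>R x)) has_derivative (\<lambda>h. G (a + s *\<^sub>R x) *v (s *\<^sub>R h))) (at x)"
    by (rule has_derivative_compose[OF _ C1_map_has_derivative[OF c]]) (auto intro!: derivative_eq_intros)
  then have "((\<lambda>x. (1/s) *\<^sub>R \<phi> (a + s *\<^sub>R x)) has_derivative (\<lambda>h. (1/s) *\<^sub>R (G (a + s *\<^sub>R x) *v (s *\<^sub>R h)))) (at x)"
    by (rule has_derivative_scaleR_right)
  then show "((\<lambda>x. (1/s) *\<^sub>R \<phi> (a + s *\<^sub>R x)) has_derivative (\<lambda>h. G (a + s *\<^sub>R x) *v h)) (at x)"
    using s by (simp add: matrix_vector_mult_scaleR)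
next
  show "continuous_on UNIV (\<lambda>x. G (a + s *\<^sub>R x))"
    by (intro continuous_on_compose2[OF C1_map_gradient_continuous[OF c]] continuous_intros) auto
qed

section \<open>Attainable mean energies\<close>

text \<open>Up to strictness of inequalities \<open>homog W \<xi>\<close> is the infimum of all
  \<open>c\<close> reached for some \<open>N\<close>. Unlike that infimum, the predicate records the
  side of the cube, which is needed for fitting maps into the cells of a grid.\<close>

definition reach :: "(real^'d::finite \<Rightarrow> real^'d^'m::finite \<Rightarrow> ennreal) \<Rightarrow> nat \<Rightarrow> real^'d^'m \<Rightarrow> ennreal \<Rightarrow> bool" where
  "reach W N \<xi> c \<longleftrightarrow> N \<ge> 1 \<and> (\<exists>\<phi> G. grad_pair (cube N) \<phi> G \<and>
     (\<integral>\<^sup>+x\<in>cube N. W x (\<xi> + G x) \<partial>lborel) \<le> c * ennreal (real N ^ CARD('d)))"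

lemma homog_less_reach:
  fixes W :: "real^'d::finite \<Rightarrow> real^'d^'m::finite \<Rightarrow> ennreal"
  assumes "homog W \<xi> < c"
  obtains N where "reach W N \<xi> c"
proof -
  obtain N where N: "N \<ge> 1" "inf_energy (cube N) (\<lambda>x \<zeta>. W x (\<xi> + \<zeta>)) / ennreal (real N ^ CARD('d)) < c"
    using assms unfolding homog_def INF_less_iff by auto
  let ?E = "inf_energy (cube N) (\<lambda>x \<zeta>. W x (\<xi> + \<zeta>))" and ?b = "ennreal (real N ^ CARD('d))"
  have b: "?b \<noteq> 0" "?b \<noteq> top" using N(1) by simp_all
  have "?E < c * ?b"
  proof (rule ccontr)
    assume "\<not> ?E < c * ?b"
    then have "c * ?b / ?b \<le> ?E / ?b" by (intro divide_right_mono_ennreal) simp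
    moreover have "c * ?b / ?b = c" using b by (simp add: ennreal_divide_times ennreal_times_divide[symmetric])
    ultimately show False using N(2) by simp
  qed
  then obtain \<phi> G where "grad_pair (cube N) \<phi> G" "(\<integral>\<^sup>+x\<in>cube N. W x (\<xi> + G x) \<partial>lborel) < c * ?b"
    by (rule inf_energy_cube_less[OF N(1)])
  then show ?thesis using that[of N] N(1) unfolding reach_def by (auto intro: less_imp_le)
qed

lemma reach_homog_le:
  fixes W :: "real^'d::finite \<Rightarrow> real^'d^'m::finite \<Rightarrow> ennreal"
  assumes "reach W N \<xi> c"
  shows "homog W \<xi> \<le> c"
proof -
  obtain \<phi> G where N: "N \<ge> 1" and p: "grad_pair (cube N) \<phi> G"
    and le: "(\<integral>\<^sup>+x\<in>cube N. W x (\<xi> + G x) \<partial>lborel) \<le> c * ennreal (real N ^ CARD('d))"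
    using assms by (auto simp: reach_def)
  let ?E = "inf_energy (cube N) (\<lambda>x \<zeta>. W x (\<xi> + \<zeta>))" and ?b = "ennreal (real N ^ CARD('d))"
  have b: "?b \<noteq> 0" "?b \<noteq> top" using N(1) by simp_all
  have "homog W \<xi> \<le> ?E / ?b" unfolding homog_def using N by (intro INF_lower) auto
  also have "\<dots> \<le> c * ?b / ?b"
    by (intro divide_right_mono_ennreal order_trans[OF inf_energy_cube_le[OF p, of "\<lambda>x \<zeta>. W x (\<xi> + \<zeta>)"] le])
  also have "\<dots> = c" using b by (simp add: ennreal_divide_times ennreal_times_divide[symmetric])
  finally show ?thesis .
qed

lemma homog_le_const:
  fixes W :: "real^'d::finite \<Rightarrow> real^'d^'m::finite \<Rightarrow> ennreal"
  assumes "AE x in lborel. W x \<xi> \<le> c"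
  shows "homog W \<xi> \<le> c"
proof (rule reach_homog_le[of _ 1])
  have "(\<integral>\<^sup>+x\<in>cube 1. W x (\<xi> + 0) \<partial>lborel) \<le> (\<integral>\<^sup>+x. c * indicator (cube 1 :: (real^'d) set) x \<partial>lborel)"
    by (rule nn_integral_mono_AE, use assms in eventually_elim) (simp add: mult_right_mono)
  also have "\<dots> = c * ennreal (real 1 ^ CARD('d))"
    by (subst nn_integral_cmult_indicator) (simp_all add: emeasure_cube)
  finally show "reach W 1 \<xi> c"
    unfolding reach_def by (intro conjI exI[of _ "\<lambda>x. 0"]) (auto intro: grad_pair_0)
qed

section \<open>Grids of cells\<close>

definition natvec :: "('d::finite \<Rightarrow> nat) \<Rightarrow> real^'d" where "natvec f = (\<chi> i. real (f i))"

definition grid :: "nat \<Rightarrow> ('d::finite \<Rightarrow> nat) set" where "grid k = {f. \<forall>i. f i < k}"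

lemma grid_eq: "grid k = PiE UNIV (\<lambda>_. {..<k})"
  by (auto simp: grid_def PiE_UNIV_domain)

lemma finite_grid: "finite (grid k :: ('d::finite \<Rightarrow> nat) set)"
  unfolding grid_eq by (intro finite_PiE) auto

lemma card_grid: "card (grid k :: ('d::finite \<Rightarrow> nat) set) = k ^ CARD('d)"
  unfolding grid_eq by (subst card_PiE) auto

lemma translate_cube: "(+) a ` cube p = box a (a + vec (real p))"
proof (intro set_eqI iffI)
  fix x assume "x \<in> box a (a + vec (real p))"
  then have "x - a \<in> cube p" by (auto simp: cube_def mem_box_cart algebra_simps)
  then show "x \<in> (+) a ` cube p" by (intro image_eqI[of _ _ "x - a"]) auto
qed (auto simp: cube_def mem_box_cart)

lemma emeasure_translate_cube: "emeasure lborel ((+) a ` cube p :: (real^'d::finite) set) = ennreal (real p ^ CARD('d))"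
  unfolding translate_cube by (subst emeasure_box_vec) auto

text \<open>Each cell of side \<open>p\<close> sits at offset \<open>l\<close> inside a period of
  length \<open>q\<close>; the bound \<open>l + p \<le> q\<close> keeps it there. Two different
  indices are separated in a coordinate in which they differ.\<close>

lemma grid_cells_disjoint:
  fixes f g :: "'d::finite \<Rightarrow> nat"
  assumes "f \<noteq> g" "l + p \<le> q"
  shows "(+) (natvec (\<lambda>i. q * f i + l)) ` cube p \<inter> (+) (natvec (\<lambda>i. q * g i + l)) ` cube p = {}"
proof -
  have *: False if x: "x \<in> (+) (natvec (\<lambda>i. q * f i + l)) ` cube p" "x \<in> (+) (natvec (\<lambda>i. q * g i + l)) ` cube p"
    and less: "f i < g i" for x and i :: 'd and f g
  proof -
    have "x $ i < real (q * f i + l) + real p" "real (q * g i + l) < x $ i"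
      using x by (auto simp: translate_cube mem_box_cart natvec_def)
    then have "q * g i + l < q * f i + l + p" by linarith
    moreover have "q * f i + q \<le> q * g i" using less by (metis Suc_leI mult_Suc_right mult_le_mono2 add.commute)
    ultimately show False using assms(2) by linarith
  qed
  obtain i where "f i \<noteq> g i" using assms(1) by auto
  then show ?thesis using *[of _ f g i] *[of _ g f i] by (cases "f i < g i") force+
qed

lemma grid_cell_subset:
  assumes "f \<in> grid k" "l + p \<le> q"
  shows "(+) (natvec (\<lambda>i. q * f i + l)) ` cube p \<subseteq> cube (k * q)"
proof
  fix x assume x: "x \<in> (+) (natvec (\<lambda>i. q * f i + l)) ` cube p"
  have "0 < x $ i \<and> x $ i < real (k * q)" for i
  proof -
    have "x $ i < real (q * f i + l) + real p" "real (q * f i + l) < x $ i"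
      using x by (auto simp: translate_cube mem_box_cart natvec_def)
    moreover have "q * f i + l + p \<le> k * q"
    proof -
      have "q * f i + q = q * Suc (f i)" by simp
      also have "\<dots> \<le> q * k" using assms(1) by (intro mult_le_mono2) (auto simp: grid_def Suc_le_eq)
      finally show ?thesis using assms(2) by (simp add: mult.commute)
    qed
    then have "real (q * f i + l) + real p \<le> real (k * q)" by (metis of_nat_add of_nat_mono)
    ultimately show ?thesis by linarith
  qed
  then show "x \<in> cube (k * q)" by (simp add: cube_def)
qed

lemma borel_measurable_compose_pair:
  fixes W :: "'a::second_countable_topology \<Rightarrow> 'b::second_countable_topology \<Rightarrow> 'c::topological_space"
  assumes "(\<lambda>(x, \<xi>). W x \<xi>) \<in> borel_measurable borel" "F \<in> borel_measurable M" "G \<in> borel_measurable M"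
  shows "(\<lambda>x. W (F x) (G x)) \<in> borel_measurable M"
  using measurable_compose[OF borel_measurable_Pair[OF assms(2,3)] assms(1)] by simp

definition periodic_integrand :: "(real^'d::finite \<Rightarrow> real^'d^'m::finite \<Rightarrow> ennreal) \<Rightarrow> bool" where
  "periodic_integrand W \<longleftrightarrow> (\<lambda>(x, \<xi>). W x \<xi>) \<in> borel_measurable borel \<and>
    (\<forall>x z \<xi>. (\<forall>i. z $ i \<in> \<int>) \<longrightarrow> W (x + z) \<xi> = W x \<xi>)"

lemma periodic_integrand_measurable:
  assumes "periodic_integrand W" "G \<in> borel_measurable borel"
  shows "(\<lambda>x. W x (G x)) \<in> borel_measurable borel"
  using borel_measurable_compose_pair[of W "\<lambda>x. x" borel G] assms by (simp add: periodic_integrand_def)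

text \<open>On every cell the base map is affine with slope \<open>e f\<close>, so a good competitor
  for that slope can be added there. Its translation is by an integer vector, and periodicity of
  \<open>W\<close> makes its energy the same as at the origin. Outside the cells only the base map
  acts, which costs at most \<open>M\<close> per volume.\<close>

lemma glue_grid:
  fixes W :: "real^'d::finite \<Rightarrow> real^'d^'m::finite \<Rightarrow> ennreal"
  assumes W: "periodic_integrand W"
    and lp: "l + p \<le> q"
    and base: "grad_pair (cube (k * q)) \<phi>b Gb"
    and slope: "\<And>f x. f \<in> grid k \<Longrightarrow> x \<in> cube p \<Longrightarrow> \<xi> + Gb (natvec (\<lambda>i. q * f i + l) + x) = e f"
    and cell: "\<And>f. f \<in> grid k \<Longrightarrow> reach W p (e f) (c f)"
    and rest: "AE x in lborel. x \<in> cube (k * q) \<longrightarrow> W x (\<xi> + Gb x) \<le> M \<or>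
      x \<in> (\<Union>f\<in>grid k. (+) (natvec (\<lambda>i. q * f i + l)) ` cube p)"
  obtains \<phi> G where "grad_pair (cube (k * q)) \<phi> G"
    "(\<integral>\<^sup>+x\<in>cube (k * q). W x (\<xi> + G x) \<partial>lborel) \<le>
      (\<Sum>f\<in>grid k. c f) * ennreal (real p ^ CARD('d)) + M * ennreal (real (k * q) ^ CARD('d) - real (k * p) ^ CARD('d))"
proof -
  let ?a = "\<lambda>f. natvec (\<lambda>i. q * f i + l) :: real^'d"
  let ?Q = "cube (k * q) :: (real^'d) set"
  let ?T = "\<lambda>f. (+) (?a f) ` cube p"
  let ?I = "grid k :: ('d \<Rightarrow> nat) set"
  have "\<exists>s. \<forall>f\<in>?I. grad_pair (cube p) (fst (s f)) (snd (s f)) \<and>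
      (\<integral>\<^sup>+x\<in>cube p. W x (e f + snd (s f) x) \<partial>lborel) \<le> c f * ennreal (real p ^ CARD('d))"
  proof (rule bchoice, rule ballI)
    fix f assume "f \<in> ?I"
    from cell[OF this] obtain \<phi> G where "grad_pair (cube p) \<phi> G"
      "(\<integral>\<^sup>+x\<in>cube p. W x (e f + G x) \<partial>lborel) \<le> c f * ennreal (real p ^ CARD('d))"
      unfolding reach_def by blast
    then show "\<exists>y. grad_pair (cube p) (fst y) (snd y) \<and>
      (\<integral>\<^sup>+x\<in>cube p. W x (e f + snd y x) \<partial>lborel) \<le> c f * ennreal (real p ^ CARD('d))"
      by (intro exI[of _ "(\<phi>, G)"]) simp
  qed
  then obtain s where s: "\<forall>f\<in>?I. grad_pair (cube p) (fst (s f)) (snd (s f)) \<and>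
      (\<integral>\<^sup>+x\<in>cube p. W x (e f + snd (s f) x) \<partial>lborel) \<le> c f * ennreal (real p ^ CARD('d))"
    by (rule exE)
  define \<phi>' G' where "\<phi>' f = fst (s f)" and "G' f = snd (s f)" for f
  have p: "grad_pair (cube p) (\<phi>' f) (G' f)"
    and en: "(\<integral>\<^sup>+x\<in>cube p. W x (e f + G' f x) \<partial>lborel) \<le> c f * ennreal (real p ^ CARD('d))" if "f \<in> ?I" for f
    using bspec[OF s that] by (simp_all add: \<phi>'_def G'_def)
  define G where "G x = Gb x + (\<Sum>f\<in>?I. G' f (x - ?a f))" for x
  have pair: "grad_pair ?Q (\<lambda>x. \<phi>b x + (\<Sum>f\<in>?I. \<phi>' f (x - ?a f))) G"
    unfolding G_def
    by (intro grad_pair_add base grad_pair_sum finite_grid grad_pair_mono[OF grad_pair_translate[OF p] grid_cell_subset[OF _ lp]])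
  have out: "x - ?a f \<notin> cube p" if "x \<notin> ?T f" for x f
    using that by (force simp: image_iff)
  have G'z: "G' f (x - ?a f) = 0" if "f \<in> ?I" "x \<notin> ?T f" for x f
    using p[OF that(1)] out[OF that(2)] by (simp add: grad_pair_def)
  have Gin: "G x = Gb x + G' f (x - ?a f)" if f: "f \<in> ?I" and x: "x \<in> ?T f" for x f
  proof -
    have "G' g (x - ?a g) = 0" if "g \<in> ?I - {f}" for g
      using grid_cells_disjoint[of g f l p q] that lp x by (intro G'z) auto
    then have "(\<Sum>g\<in>?I. G' g (x - ?a g)) = G' f (x - ?a f)"
      using f by (subst sum.remove[OF finite_grid f]) simp
    then show ?thesis by (simp add: G_def)
  qed
  have Gout: "G x = Gb x" if "x \<notin> (\<Union>f\<in>?I. ?T f)" for x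
    using that G'z by (simp add: G_def)
  have Tb [measurable]: "?T f \<in> sets borel" for f by (simp add: translate_cube)
  have [measurable]: "G \<in> borel_measurable borel" "Gb \<in> borel_measurable borel" using pair base by (auto simp: grad_pair_def)
  have G'm: "G' f \<in> borel_measurable borel" if "f \<in> ?I" for f using p[OF that] by (auto simp: grad_pair_def)
  define F where "F x = W x (\<xi> + G x)" for x
  have [measurable]: "F \<in> borel_measurable borel"
    unfolding F_def by (rule periodic_integrand_measurable[OF W]) measurable
  \<comment> \<open>The part left uncovered; even for \<open>p = q\<close> it contains the walls of
    the cells, which are then all of it and have measure zero.\<close>
  define R where "R = ?Q - (\<Union>f\<in>?I. ?T f)"
  have [measurable]: "R \<in> sets borel" unfolding R_def using finite_grid[of k, where 'd = 'd] by measurable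
  have sub: "(\<Union>f\<in>?I. ?T f) \<subseteq> ?Q" using grid_cell_subset[OF _ lp, of _ k] by blast
  have disj: "disjoint_family_on ?T ?I"
    unfolding disjoint_family_on_def using grid_cells_disjoint[of _ _ l p q] lp by blast
  have split: "F x * indicator ?Q x = (\<Sum>f\<in>?I. F x * indicator (?T f) x) + F x * indicator R x" for x
  proof -
    have "(\<Sum>f\<in>?I. indicator (?T f) x :: ennreal) = indicator (\<Union>f\<in>?I. ?T f) x"
      by (rule indicator_UN_disjoint[OF finite_grid disj, symmetric])
    moreover have "indicator ?Q x = (indicator (\<Union>f\<in>?I. ?T f) x + indicator R x :: ennreal)"
      using sub by (auto simp: R_def indicator_def)
    ultimately show ?thesis by (simp add: sum_distrib_left[symmetric] distrib_left)
  qed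
  have cells: "(\<integral>\<^sup>+x\<in>?T f. F x \<partial>lborel) \<le> c f * ennreal (real p ^ CARD('d))" if f: "f \<in> ?I" for f
  proof -
    have "(\<integral>\<^sup>+x\<in>?T f. F x \<partial>lborel) = (\<integral>\<^sup>+x. F (x + ?a f) * indicator (?T f) (x + ?a f) \<partial>lborel)"
      by (rule lborel_nn_integral_translate[symmetric]) measurable
    also have "\<dots> = (\<integral>\<^sup>+x\<in>cube p. W x (e f + G' f x) \<partial>lborel)"
    proof (rule nn_integral_cong)
      fix x
      have "F (x + ?a f) = W x (e f + G' f x)" if x: "x \<in> cube p"
      proof -
        have "x + ?a f \<in> ?T f" using x by (auto simp: add.commute)
        then have "G (x + ?a f) = Gb (?a f + x) + G' f x"
          using Gin[OF f, of "x + ?a f"] by (simp add: add.commute)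
        then have "\<xi> + G (x + ?a f) = (\<xi> + Gb (?a f + x)) + G' f x" by (simp only: add.assoc)
        then have "F (x + ?a f) = W (x + ?a f) (e f + G' f x)"
          unfolding F_def slope[OF f x] by (rule arg_cong)
        also have "\<dots> = W x (e f + G' f x)" using W by (simp add: periodic_integrand_def natvec_def)
        finally show ?thesis .
      qed
      moreover have "(x + ?a f \<in> ?T f) = (x \<in> cube p)" by (auto simp: add.commute)
      ultimately show "F (x + ?a f) * indicator (?T f) (x + ?a f) = W x (e f + G' f x) * indicator (cube p) x"
        by (simp add: indicator_def)
    qed
    finally show ?thesis using en[OF f] by simp
  qed
  have mR: "emeasure lborel R = ennreal (real (k * q) ^ CARD('d) - real (k * p) ^ CARD('d))"
  proof -
    have "emeasure lborel (\<Union>f\<in>?I. ?T f) = (\<Sum>f\<in>?I. emeasure lborel (?T f))"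
      by (rule sum_emeasure[symmetric]) (use disj finite_grid in auto)
    also have "\<dots> = ennreal (real (k * p) ^ CARD('d))"
      by (simp add: emeasure_translate_cube card_grid ennreal_of_nat_eq_real_of_nat power_mult_distrib ennreal_mult flip: ennreal_mult)
    finally have mU: "emeasure lborel (\<Union>f\<in>?I. ?T f) = ennreal (real (k * p) ^ CARD('d))" .
    have "emeasure lborel R = emeasure lborel ?Q - emeasure lborel (\<Union>f\<in>?I. ?T f)"
      unfolding R_def by (rule emeasure_Diff) (use sub mU finite_grid in auto)
    then show ?thesis unfolding mU emeasure_cube by (simp add: ennreal_minus)
  qed
  have restR: "(\<integral>\<^sup>+x\<in>R. F x \<partial>lborel) \<le> M * ennreal (real (k * q) ^ CARD('d) - real (k * p) ^ CARD('d))"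
  proof -
    have "AE x in lborel. F x * indicator R x \<le> M * indicator R x"
      using rest
    proof eventually_elim
      case (elim x)
      then show ?case using Gout[of x] by (auto simp: R_def F_def indicator_def)
    qed
    then have "(\<integral>\<^sup>+x\<in>R. F x \<partial>lborel) \<le> (\<integral>\<^sup>+x. M * indicator R x \<partial>lborel)" by (rule nn_integral_mono_AE)
    also have "\<dots> = M * emeasure lborel R" by (rule nn_integral_cmult_indicator) simp
    finally show ?thesis using mR by simp
  qed
  have "(\<integral>\<^sup>+x\<in>?Q. F x \<partial>lborel) = (\<Sum>f\<in>?I. (\<integral>\<^sup>+x\<in>?T f. F x \<partial>lborel)) + (\<integral>\<^sup>+x\<in>R. F x \<partial>lborel)"
    unfolding split by (subst nn_integral_add, measurable) (subst nn_integral_sum, auto)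
  also have "\<dots> \<le> (\<Sum>f\<in>?I. c f * ennreal (real p ^ CARD('d))) + M * ennreal (real (k * q) ^ CARD('d) - real (k * p) ^ CARD('d))"
    by (intro add_mono sum_mono cells restR)
  finally show ?thesis
    using pair by (intro that) (auto simp: F_def sum_distrib_right)
qed

text \<open>Gluing onto the zero base map with cells that fill the cube. The uncovered part has
  measure zero, so even the bound \<open>top\<close> costs nothing there, as
  \<open>top * 0 = 0\<close>.\<close>

lemma reach_multiple:
  fixes W :: "real^'d::finite \<Rightarrow> real^'d^'m::finite \<Rightarrow> ennreal"
  assumes W: "periodic_integrand W"
    and r: "reach W p \<xi> c" and k: "k \<ge> 1"
  shows "reach W (k * p) \<xi> c"
proof -
  obtain \<phi> G where "grad_pair (cube (k * p)) \<phi> G" and le: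
    "(\<integral>\<^sup>+x\<in>cube (k * p). W x (\<xi> + G x) \<partial>lborel) \<le>
      (\<Sum>f\<in>(grid k :: ('d \<Rightarrow> nat) set). c) * ennreal (real p ^ CARD('d)) + top * ennreal (real (k * p) ^ CARD('d) - real (k * p) ^ CARD('d))"
    by (rule glue_grid[OF W, where l = 0 and p = p and q = p and k = k and \<phi>b = "\<lambda>x. 0" and Gb = "\<lambda>x. 0" and \<xi> = \<xi>
        and e = "\<lambda>_. \<xi>" and c = "\<lambda>_. c" and M = top])
       (use r in \<open>auto intro: grad_pair_0\<close>)
  moreover have "(\<Sum>f\<in>(grid k :: ('d \<Rightarrow> nat) set). c) * ennreal (real p ^ CARD('d)) = c * ennreal (real (k * p) ^ CARD('d))"
    by (simp add: card_grid ennreal_of_nat_eq_real_of_nat power_mult_distrib ennreal_mult mult.commute mult.left_commute)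
  ultimately show ?thesis
    using r k unfolding reach_def by (auto intro!: exI[of _ \<phi>] exI[of _ G])
qed

lemma C1_map_compact_support_grad_pair_scale:
  assumes c: "C1_map \<phi> G" and K: "compact K" "K \<subseteq> cube N" "\<And>x. x \<notin> K \<Longrightarrow> \<phi> x = 0" and P: "P \<ge> 1"
  shows "grad_pair (cube (P * N)) (\<lambda>x. real P *\<^sub>R \<phi> ((1 / real P) *\<^sub>R x)) (\<lambda>x. G ((1 / real P) *\<^sub>R x))"
proof (rule C1_map_grad_pair)
  show "C1_map (\<lambda>x. real P *\<^sub>R \<phi> ((1 / real P) *\<^sub>R x)) (\<lambda>x. G ((1 / real P) *\<^sub>R x))"
    using C1_map_scale[OF c, of "1 / real P" 0] P by simp
  show "compact ((\<lambda>x. real P *\<^sub>R x) ` K)" by (intro compact_scaling K)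
  show "(\<lambda>x. real P *\<^sub>R x) ` K \<subseteq> cube (P * N)"
    using K(2) P by (auto simp: cube_def subset_iff)
  fix x assume "x \<notin> (\<lambda>x. real P *\<^sub>R x) ` K"
  then have "(1 / real P) *\<^sub>R x \<notin> K" using P by (auto simp: image_iff)
  then show "real P *\<^sub>R \<phi> ((1 / real P) *\<^sub>R x) = 0" using K(3) by simp
qed

text \<open>The slopes \<open>e f\<close> are attained exactly on the inner cells of side \<open>j\<close>; the surrounding layers
  of width one carry a bounded integrand and a volume fraction that vanishes as \<open>j \<rightarrow> \<infinity>\<close>.\<close>

lemma homog_le_grid:
  fixes W :: "real^'d::finite \<Rightarrow> real^'d^'m::finite \<Rightarrow> ennreal" and c :: "('d \<Rightarrow> nat) \<Rightarrow> real"
  assumes W: "periodic_integrand W"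
    and C: "C1_map \<phi> G" "compact K" "K \<subseteq> cube (k * (j + 2))" "\<And>x. x \<notin> K \<Longrightarrow> \<phi> x = 0"
    and kj: "k \<ge> 1" "j \<ge> 1"
    and slope: "\<And>f x. f \<in> grid k \<Longrightarrow> x \<in> cube j \<Longrightarrow> \<xi> + G (natvec (\<lambda>i. (j + 2) * f i + 1) + x) = e f"
    and c: "\<And>f. f \<in> grid k \<Longrightarrow> homog W (e f) < ennreal (c f)"
    and M: "0 \<le> M" "AE x in lborel. \<forall>y. W x (\<xi> + G y) \<le> ennreal M"
  shows "homog W \<xi> \<le> ennreal ((real j / real (j + 2)) ^ CARD('d) * ((\<Sum>f\<in>grid k. c f) / real k ^ CARD('d))
    + M * (1 - (real j / real (j + 2)) ^ CARD('d)))"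
proof -
  let ?I = "grid k :: ('d \<Rightarrow> nat) set"
  have "\<exists>N. reach W N (e f) (ennreal (c f))" if "f \<in> ?I" for f
    using homog_less_reach[OF c[OF that]] by blast
  then have "\<exists>p. \<forall>f\<in>?I. reach W (p f) (e f) (ennreal (c f))" by (intro bchoice ballI)
  then obtain p where p: "\<And>f. f \<in> ?I \<Longrightarrow> reach W (p f) (e f) (ennreal (c f))" by blast
  \<comment> \<open>A common multiple of the sides of all cells: after periodic repetition the
    competitors for all slopes live on cubes of the same side \<open>P * j\<close>.\<close>
  define P where "P = (\<Prod>f\<in>?I. p f)"
  have p1: "p f \<ge> 1" if "f \<in> ?I" for f using p[OF that] by (simp add: reach_def)
  have P1: "P \<ge> 1" unfolding P_def using p1 by (auto simp: Suc_le_eq intro!: prod_pos)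
  have cell: "reach W (P * j) (e f) (ennreal (c f))" if f: "f \<in> ?I" for f
  proof -
    have "p f dvd P" unfolding P_def using f finite_grid by (rule dvd_prodI[rotated])
    then obtain r where r: "P = p f * r" by (elim dvdE)
    then have "r \<ge> 1" using P1 by (cases r) auto
    then have "reach W ((r * j) * p f) (e f) (ennreal (c f))"
      using kj by (intro reach_multiple[OF W p[OF f]]) auto
    then show ?thesis by (simp add: r mult.commute mult.left_commute)
  qed
  \<comment> \<open>The base map is blown up by \<open>P\<close>, which leaves its slopes unchanged.
    The grid now has period \<open>P * (j + 2)\<close>, with inner cells of side
    \<open>P * j\<close> and layers of integer width \<open>P\<close> around them.\<close>
  define N where "N = k * (P * (j + 2))"
  have N1: "N \<ge> 1" using kj P1 by (simp add: N_def)
  have Neq: "P * (k * (j + 2)) = N" by (simp add: N_def algebra_simps)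
  have base: "grad_pair (cube N) (\<lambda>x. real P *\<^sub>R \<phi> ((1 / real P) *\<^sub>R x)) (\<lambda>x. G ((1 / real P) *\<^sub>R x))"
    unfolding Neq[symmetric]
    by (rule C1_map_compact_support_grad_pair_scale[OF C(1-3) _ P1]) (rule C(4))
  have sl: "\<xi> + G ((1 / real P) *\<^sub>R (natvec (\<lambda>i. P * (j + 2) * f i + P) + x)) = e f"
    if f: "f \<in> ?I" and x: "x \<in> cube (P * j)" for f x
  proof -
    have "(1 / real P) *\<^sub>R (natvec (\<lambda>i. P * (j + 2) * f i + P) + x) = natvec (\<lambda>i. (j + 2) * f i + 1) + (1 / real P) *\<^sub>R x"
      using P1 by (simp add: natvec_def vec_eq_iff field_simps)
    moreover have "(1 / real P) *\<^sub>R x \<in> cube j" using x P1 by (auto simp: cube_def field_simps)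
    ultimately show ?thesis using slope[OF f] by simp
  qed
  have restAE: "AE x in lborel. x \<in> cube (k * (P * (j + 2))) \<longrightarrow> W x (\<xi> + G ((1 / real P) *\<^sub>R x)) \<le> ennreal M \<or>
      x \<in> (\<Union>f\<in>?I. (+) (natvec (\<lambda>i. P * (j + 2) * f i + P)) ` cube (P * j))"
    using M(2) by eventually_elim blast
  have lp: "P + P * j \<le> P * (j + 2)" by (simp add: algebra_simps)
  obtain \<phi>' G' where g: "grad_pair (cube (k * (P * (j + 2)))) \<phi>' G'"
    and le: "(\<integral>\<^sup>+x\<in>cube (k * (P * (j + 2))). W x (\<xi> + G' x) \<partial>lborel) \<le>
      (\<Sum>f\<in>?I. ennreal (c f)) * ennreal (real (P * j) ^ CARD('d))
      + ennreal M * ennreal (real (k * (P * (j + 2))) ^ CARD('d) - real (k * (P * j)) ^ CARD('d))"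
    by (rule glue_grid[OF W lp base[unfolded N_def] sl cell restAE])
  let ?t = "real j / real (j + 2)" and ?d = "CARD('d)"
  let ?R = "?t ^ ?d * ((\<Sum>f\<in>?I. c f) / real k ^ ?d) + M * (1 - ?t ^ ?d)"
  have c0: "c f > 0" if "f \<in> ?I" for f
    using c[OF that] by (metis ennreal_neg not_less not_less_zero zero_less_iff_neq_zero linorder_not_le)
  have S0: "0 \<le> (\<Sum>f\<in>?I. c f)" using c0 by (intro sum_nonneg) (auto intro: less_imp_le)
  have t1: "?t ^ ?d \<le> 1" by (intro power_le_one) auto
  have jN: "real N = real k * real P * real (j + 2)" by (simp add: N_def algebra_simps)
  have kP: "real (k * (P * j)) = ?t * real N"
    unfolding jN by (simp del: of_nat_add)
  have "k * (P * j) \<le> N" unfolding N_def by (intro mult_le_mono) auto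
  then have "real (k * (P * j)) ^ ?d \<le> real N ^ ?d" by (intro power_mono of_nat_mono) auto
  have e1: "(\<Sum>f\<in>?I. ennreal (c f)) = ennreal (\<Sum>f\<in>?I. c f)"
    by (rule sum_ennreal) (rule less_imp_le[OF c0])
  have e2: "ennreal (\<Sum>f\<in>?I. c f) * ennreal (real (P * j) ^ ?d) = ennreal ((\<Sum>f\<in>?I. c f) * real (P * j) ^ ?d)"
    by (rule ennreal_mult[OF S0, symmetric]) simp
  have e3: "ennreal M * ennreal (real N ^ ?d - real (k * (P * j)) ^ ?d) = ennreal (M * (real N ^ ?d - real (k * (P * j)) ^ ?d))"
    by (rule ennreal_mult[OF M(1), symmetric]) (use \<open>real (k * (P * j)) ^ ?d \<le> real N ^ ?d\<close> in linarith)
  have "(\<Sum>f\<in>?I. ennreal (c f)) * ennreal (real (P * j) ^ ?d) + ennreal M * ennreal (real N ^ ?d - real (k * (P * j)) ^ ?d)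
    = ennreal ((\<Sum>f\<in>?I. c f) * real (P * j) ^ ?d + M * (real N ^ ?d - real (k * (P * j)) ^ ?d))"
    unfolding e1 e2 e3
    by (rule ennreal_plus[symmetric]) (use S0 M(1) \<open>real (k * (P * j)) ^ ?d \<le> real N ^ ?d\<close> in \<open>auto intro!: mult_nonneg_nonneg\<close>)
  also have "(\<Sum>f\<in>?I. c f) * real (P * j) ^ ?d + M * (real N ^ ?d - real (k * (P * j)) ^ ?d) = ?R * real N ^ ?d"
  proof -
    have "real (P * j) ^ ?d = ?t ^ ?d * real N ^ ?d / real k ^ ?d"
    proof -
      have "real (P * j) = ?t * real N / real k" unfolding jN using kj by (simp del: of_nat_add)
      then show ?thesis by (simp add: power_mult_distrib power_divide)
    qed
    moreover have "real (k * (P * j)) ^ ?d = ?t ^ ?d * real N ^ ?d" unfolding kP by (rule power_mult_distrib)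
    ultimately show ?thesis by (simp add: algebra_simps)
  qed
  finally have "(\<integral>\<^sup>+x\<in>cube N. W x (\<xi> + G' x) \<partial>lborel) \<le> ennreal (?R * real N ^ ?d)"
    using le by (simp add: N_def)
  also have "\<dots> = ennreal ?R * ennreal (real N ^ ?d)"
    using t1 S0 M(1) by (intro ennreal_mult) auto
  finally have "reach W N \<xi> (ennreal ?R)"
    unfolding reach_def using N1 g by (auto simp: N_def)
  then show ?thesis by (rule reach_homog_le)
qed

subsection \<open>Continuity and Jensen's inequality for the homogenized integrand\<close>

lemma norm_matrix_vector_le:
  fixes A :: "real^'d::finite^'m::finite"
  shows "norm (A *v x) \<le> norm A * norm x"
proof -
  have "norm (A *v x) = L2_set (\<lambda>i. norm ((A *v x) $ i)) UNIV" by (rule norm_vec_def)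
  also have "\<dots> \<le> L2_set (\<lambda>i. norm (A $ i) * norm x) UNIV"
  proof (rule L2_set_mono)
    show "norm ((A *v x) $ i) \<le> norm (A $ i) * norm x" for i
      using Cauchy_Schwarz_ineq2[of "A $ i" x] by (simp add: matrix_vector_mult_def inner_vec_def)
  qed simp
  also have "\<dots> = norm A * norm x"
    by (simp add: L2_set_left_distrib norm_vec_def[of A])
  finally show ?thesis .
qed

lemma norm_cube_le:
  fixes x :: "real^'d::finite"
  assumes "x \<in> cube n" shows "norm x \<le> real CARD('d) * real n"
proof -
  have "\<bar>x $ i\<bar> \<le> real n" for i
  proof -
    have "0 < x $ i \<and> x $ i < real n" using assms by (simp add: cube_def)
    then show ?thesis by linarith
  qed
  then have "(\<Sum>i\<in>UNIV. \<bar>x $ i\<bar>) \<le> (\<Sum>i\<in>(UNIV::'d set). real n)" by (intro sum_mono)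
  then show ?thesis using norm_le_l1_cart[of x] by simp
qed

text \<open>The layers occupy at most the fraction \<open>2 * d / (j + 2)\<close> of the
  volume.\<close>

lemma exists_layer:
  assumes "0 \<le> M" "0 < e"
  obtains j :: nat where "j \<ge> 1" "M * (1 - (real j / real (j + 2)) ^ d) \<le> e"
proof -
  obtain j :: nat where j: "real j > 2 * real d * M / e + 1" using reals_Archimedean2 by blast
  have "0 \<le> 2 * real d * M / e" using assms by simp
  then have j1: "j \<ge> 1" using j by linarith
  have "1 ^ d - (real j / real (j + 2)) ^ d \<le> real d * 1 ^ (d - 1) * (1 - real j / real (j + 2))"
    by (rule power_diff_le) auto
  also have "1 - real j / real (j + 2) = 2 / real (j + 2)" by (simp add: field_simps)
  finally have "M * (1 - (real j / real (j + 2)) ^ d) \<le> M * (real d * (2 / real (j + 2)))"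
    using assms by (intro mult_left_mono) auto
  also have "\<dots> \<le> e"
  proof -
    have "2 * real d * M / e \<le> real (j + 2)" using j by simp
    then have "2 * real d * M \<le> e * real (j + 2)" using assms by (simp add: field_simps)
    then show ?thesis by (simp add: field_simps)
  qed
  finally show ?thesis using that j1 by blast
qed

text \<open>\<open>natvec (\<lambda>_. 1)\<close> is the corner of the inner cell of side
  \<open>j\<close> in a period cell of side \<open>j + 2\<close>. The cutoff is constantly 1 on that
  open cell, so an affine map multiplied by it keeps its slope there.\<close>

lemma cell_cutoff:
  obtains \<theta> :: "real^'d::finite \<Rightarrow> real" and B :: real where "\<theta> \<in> test_functions (cube (j + 2))" "\<And>x. 0 \<le> \<theta> x \<and> \<theta> x \<le> 1"
    "\<And>y. y \<in> cube j \<Longrightarrow> \<theta> (natvec (\<lambda>_. 1) + y) = 1 \<and> gradient \<theta> (natvec (\<lambda>_. 1) + y) = 0"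
    "\<And>x. x \<notin> cube (j + 2) \<Longrightarrow> \<theta> x = 0 \<and> gradient \<theta> x = 0" "0 < B" "\<And>x. norm (gradient \<theta> x) \<le> B"
proof -
  let ?K = "cbox (vec 1) (vec (real j + 1)) :: (real^'d) set"
  have sub: "?K \<subseteq> cube (j + 2)"
  proof
    fix x assume x: "x \<in> ?K"
    have "0 < x $ i \<and> x $ i < real (j + 2)" for i
    proof -
      have "1 \<le> x $ i \<and> x $ i \<le> real j + 1" using x by (simp add: mem_box_cart)
      then show ?thesis by simp
    qed
    then show "x \<in> cube (j + 2)" by (simp add: cube_def)
  qed
  obtain \<theta> where t: "\<theta> \<in> test_functions (cube (j + 2))" "\<And>x. 0 \<le> \<theta> x \<and> \<theta> x \<le> 1"
    "\<And>x. x \<in> ?K \<Longrightarrow> \<theta> x = 1"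
    by (rule exists_cutoff[OF compact_cbox open_cube sub]) (rule that)
  have tU: "\<theta> \<in> test_functions UNIV" using t(1) test_functions_mono[of "cube (j + 2)" UNIV] by auto
  obtain R where R: "\<And>x. norm x > R \<Longrightarrow> \<theta> x = 0" using test_functions_bounded_support[OF tU] by blast
  have gz: "gradient \<theta> x = 0" if "norm x > R" for x by (rule gradient_support[OF R that])
  have "\<exists>B>0. \<forall>x. norm (gradient \<theta> x) \<le> B"
  proof (rule compact_support_bounded[OF test_function_gradient_continuous[OF tU]])
    show "gradient \<theta> x = 0" if "norm x > R" for x using that by (rule gz)
  qed blast
  then obtain B where B: "0 < B" "\<And>x. norm (gradient \<theta> x) \<le> B" by blast
  have inner: "\<theta> (natvec (\<lambda>_. 1) + y) = 1 \<and> gradient \<theta> (natvec (\<lambda>_. 1) + y) = 0" if y: "y \<in> cube j" for y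
  proof -
    let ?x = "natvec (\<lambda>_. 1) + y" and ?O = "box (vec 1) (vec (real j + 1)) :: (real^'d) set"
    have x: "?x \<in> ?O" using y by (auto simp: cube_def mem_box_cart natvec_def)
    have 1: "\<theta> z = 1" if "z \<in> ?O" for z using t(3) that box_subset_cbox by blast
    have "(\<theta> has_derivative (\<lambda>h. 0)) (at ?x)"
      by (rule has_derivative_transform_within_open[OF has_derivative_const open_box x]) (use 1 in auto)
    then show ?thesis using 1[OF x] by (simp add: gradient_def frechet_derivative_eqI vec_eq_iff)
  qed
  have outer: "\<theta> x = 0 \<and> gradient \<theta> x = 0" if x: "x \<notin> cube (j + 2)" for x
  proof -
    let ?S = "- closure {x. \<theta> x \<noteq> 0}"
    have xS: "x \<in> ?S" using x t(1) by (auto simp: test_functions_def)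
    have 0: "\<theta> z = 0" if "z \<in> ?S" for z using that closure_subset[of "{x. \<theta> x \<noteq> 0}"] by auto
    have "frechet_derivative \<theta> (at x) = (\<lambda>h. 0)" by (rule frechet_derivative_eq_0[OF open_Compl[OF closed_closure] xS 0])
    then show ?thesis using 0[OF xS] by (simp add: gradient_def vec_eq_iff)
  qed
  show ?thesis by (rule that[OF t(1,2) inner outer B])
qed

lemma gradient_translate:
  assumes "\<theta> \<in> test_functions UNIV"
  shows "(\<lambda>x. \<theta> (x - a)) \<in> test_functions UNIV" "gradient (\<lambda>x. \<theta> (x - a)) x = gradient \<theta> (x - a)"
proof -
  show "(\<lambda>x. \<theta> (x - a)) \<in> test_functions UNIV"
    using test_function_affine[OF assms, of 1 "- a"] by simp
  have "((\<lambda>x. \<theta> (x - a)) has_derivative (\<lambda>h. gradient \<theta> (x - a) \<bullet> h)) (at x)"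
    by (rule has_derivative_compose[OF _ test_function_has_gradient[OF assms]]) (auto intro!: derivative_eq_intros)
  then show "gradient (\<lambda>x. \<theta> (x - a)) x = gradient \<theta> (x - a)"
    by (simp add: gradient_def[of "\<lambda>x. \<theta> (x - a)"] frechet_derivative_eqI inner_axis vec_eq_iff)
qed

section \<open>Local boundedness and continuity\<close>

text \<open>The exceptional null set does not depend on \<zeta>, since slopes that vary with the
  position are inserted into \<open>W\<close>.\<close>

definition loc_bounded :: "(real^'d::finite \<Rightarrow> real^'d^'m::finite \<Rightarrow> ennreal) \<Rightarrow> (real^'d^'m) set \<Rightarrow> bool" where
  "loc_bounded W U \<longleftrightarrow> open U \<and> (\<forall>K. compact K \<longrightarrow> K \<subseteq> U \<longrightarrow> (\<exists>M::real. AE x in lborel. \<forall>\<zeta>\<in>K. W x \<zeta> \<le> ennreal M))"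

lemma loc_boundedE:
  assumes "loc_bounded W U" "compact K" "K \<subseteq> U"
  obtains M :: real where "0 \<le> M" "AE x in lborel. \<forall>\<zeta>\<in>K. W x \<zeta> \<le> ennreal M"
proof -
  obtain M where M: "AE x in lborel. \<forall>\<zeta>\<in>K. W x \<zeta> \<le> ennreal M"
    using assms unfolding loc_bounded_def by blast
  have "AE x in lborel. \<forall>\<zeta>\<in>K. W x \<zeta> \<le> ennreal (max M 0)"
    using M
  proof eventually_elim
    case (elim x)
    moreover have "ennreal M \<le> ennreal (max M 0)" by (intro ennreal_leI) simp
    ultimately show ?case by (blast intro: order_trans)
  qed
  then show ?thesis using that[of "max M 0"] by simp
qed

lemma homog_finite:
  assumes "loc_bounded W U" "\<xi> \<in> U"
  shows "homog W \<xi> < \<infinity>" "homog W \<xi> = ennreal (enn2real (homog W \<xi>))"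
proof -
  obtain M where "AE x in lborel. \<forall>\<zeta>\<in>{\<xi>}. W x \<zeta> \<le> ennreal M"
    using loc_boundedE[OF assms(1), of "{\<xi>}"] assms(2) by auto
  then have "homog W \<xi> \<le> ennreal M" by (intro homog_le_const) simp
  also have "\<dots> < \<infinity>" by simp
  finally show "homog W \<xi> < \<infinity>" .
  then show "homog W \<xi> = ennreal (enn2real (homog W \<xi>))" by (simp add: ennreal_enn2real)
qed

text \<open>The slope \<xi> is joined to \<eta> on a single cell: the base map is the linear map
  \<open>\<eta> - \<xi>\<close> times a cutoff, so the total slope is \<eta> on the inner cell. The
  width ratio of the layer is chosen by \<open>j\<close> so that the bound \<open>M\<close> costs at
  most \<open>e/2\<close> there, and the slopes in the layer stay in the ball where \<open>M\<close>
  is valid as soon as \<open>\<eta> - \<xi>\<close> is small.\<close>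

lemma homog_local_estimate:
  fixes W :: "real^'d::finite \<Rightarrow> real^'d^'m::finite \<Rightarrow> ennreal"
  assumes W: "periodic_integrand W"
    and lb: "loc_bounded W U" and r: "r > 0" "cball \<xi>0 (2 * r) \<subseteq> U" and e: "e > 0"
  obtains d where "d > 0" "\<And>\<xi> \<eta>. \<lbrakk>\<xi> \<in> cball \<xi>0 r; \<eta> \<in> cball \<xi>0 r; norm (\<eta> - \<xi>) \<le> d\<rbrakk> \<Longrightarrow>
    enn2real (homog W \<xi>) \<le> enn2real (homog W \<eta>) + e"
proof -
  obtain M where M: "0 \<le> M" "AE x in lborel. \<forall>\<zeta>\<in>cball \<xi>0 (2 * r). W x \<zeta> \<le> ennreal M"
    using loc_boundedE[OF lb compact_cball r(2)] by blast
  obtain j where j: "j \<ge> 1" "M * (1 - (real j / real (j + 2)) ^ CARD('d)) \<le> e/2"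
    using exists_layer[OF M(1), of "e/2"] e by auto
  obtain \<theta> :: "real^'d \<Rightarrow> real" and B where t: "\<theta> \<in> test_functions (cube (j + 2))" "\<And>x. 0 \<le> \<theta> x \<and> \<theta> x \<le> 1"
    "\<And>y. y \<in> cube j \<Longrightarrow> \<theta> (natvec (\<lambda>_. 1) + y) = 1 \<and> gradient \<theta> (natvec (\<lambda>_. 1) + y) = 0"
    "\<And>x. x \<notin> cube (j + 2) \<Longrightarrow> \<theta> x = 0 \<and> gradient \<theta> x = 0" "0 < B" "\<And>x. norm (gradient \<theta> x) \<le> B"
    by (rule cell_cutoff[of j]) (rule that)
  have tU: "\<theta> \<in> test_functions UNIV" using t(1) test_functions_mono[of "cube (j + 2)" UNIV] by auto
  define R where "R = real CARD('d) * real (j + 2)"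
  have R: "R \<ge> 0" by (simp add: R_def)
  \<comment> \<open>The gradient of the cutoff times a linear map \<open>A\<close> is at most
    \<open>norm A * (1 + R * B)\<close>, where \<open>R\<close> bounds the points of the cell and
    \<open>B\<close> the gradient of the cutoff.\<close>
  define d where "d = r / (1 + R * B)"
  have RB: "1 + R * B > 0" using R t(5) by (simp add: add_pos_nonneg)
  show ?thesis
  proof (rule that)
    show "d > 0" using r RB by (simp add: d_def)
    fix \<xi> \<eta> assume xi: "\<xi> \<in> cball \<xi>0 r" and eta: "\<eta> \<in> cball \<xi>0 r" and le: "norm (\<eta> - \<xi>) \<le> d"
    define A where "A = \<eta> - \<xi>"
    let ?\<phi> = "\<lambda>x. \<theta> x *\<^sub>R (0 + A *v (x - 0))"
    let ?G = "\<lambda>x. \<theta> x *\<^sub>R A + outer (0 + A *v (x - 0)) (gradient \<theta> x)"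
    have c: "C1_map ?\<phi> ?G" by (intro C1_map_mult_test tU C1_map_affine)
    have Gn: "norm (?G x) \<le> r" for x
    proof (cases "x \<in> cube (j + 2)")
      case True
      have "norm (?G x) \<le> \<bar>\<theta> x\<bar> * norm A + norm (A *v x) * norm (gradient \<theta> x)"
        using norm_triangle_ineq[of "\<theta> x *\<^sub>R A" "outer (A *v x) (gradient \<theta> x)"] by (simp add: norm_outer)
      also have "\<dots> \<le> 1 * norm A + (norm A * R) * B"
      proof (intro add_mono mult_mono)
        show "norm (A *v x) \<le> norm A * R"
          using norm_matrix_vector_le[of A x] mult_left_mono[OF norm_cube_le[OF True], of "norm A"] by (simp add: R_def)
      qed (use t(2)[of x] t(6) R in auto)
      also have "\<dots> = norm A * (1 + R * B)" by (simp add: algebra_simps)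
      also have "\<dots> \<le> d * (1 + R * B)" using le RB by (intro mult_right_mono) (auto simp: A_def)
      finally show ?thesis using RB by (simp add: d_def)
    next
      case False
      then show ?thesis using t(4) r by simp
    qed
    have U: "\<xi> \<in> U" "\<eta> \<in> U" using xi eta r subset_cball[of r "2 * r" \<xi>0] by auto
    let ?h = "\<lambda>\<xi>. enn2real (homog W \<xi>)"
    have "homog W \<xi> \<le> ennreal ((real j / real (j + 2)) ^ CARD('d) * ((\<Sum>f\<in>(grid 1 :: ('d \<Rightarrow> nat) set). ?h \<eta> + e/2) / real 1 ^ CARD('d))
      + M * (1 - (real j / real (j + 2)) ^ CARD('d)))"
    proof (rule homog_le_grid[OF W c, where k = 1 and j = j and \<xi> = \<xi> and e = "\<lambda>_. \<eta>" and M = M and c = "\<lambda>_. ?h \<eta> + e/2"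
          and K = "closure {x. \<theta> x \<noteq> 0}"])
      show "compact (closure {x. \<theta> x \<noteq> 0})" "closure {x. \<theta> x \<noteq> 0} \<subseteq> cube (1 * (j + 2))"
        using t(1) by (auto simp: test_functions_def)
      show "?\<phi> x = 0" if "x \<notin> closure {x. \<theta> x \<noteq> 0}" for x
        using that closure_subset[of "{x. \<theta> x \<noteq> 0}"] by auto
      show "\<xi> + ?G (natvec (\<lambda>i. (j + 2) * f i + 1) + x) = \<eta>" if "f \<in> grid 1" "x \<in> cube j" for f x
      proof -
        have "(\<lambda>i. (j + 2) * f i + 1) = (\<lambda>_. 1)" using that(1) by (auto simp: grid_def)
        then show ?thesis using t(3)[OF that(2)] by (simp add: A_def)
      qed
      have "ennreal (?h \<eta>) < ennreal (?h \<eta> + e/2)" using e by (intro ennreal_lessI) (auto simp: add_nonneg_pos)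
      then show "homog W \<eta> < ennreal (?h \<eta> + e/2)" using homog_finite(2)[OF lb U(2)] by simp
      show "AE x in lborel. \<forall>y. W x (\<xi> + ?G y) \<le> ennreal M"
        using M(2)
      proof eventually_elim
        case (elim x)
        have "\<xi> + ?G y \<in> cball \<xi>0 (2 * r)" for y
          using norm_triangle_ineq[of "\<xi> - \<xi>0" "?G y"] Gn[of y] xi
          by (simp add: dist_norm norm_minus_commute[of \<xi>0] add_diff_eq)
            (simp add: algebra_simps)
        then show ?case using elim by blast
      qed
    qed (use j M in auto)
    also have "(\<Sum>f\<in>(grid 1 :: ('d \<Rightarrow> nat) set). ?h \<eta> + e/2) / real 1 ^ CARD('d) = ?h \<eta> + e/2" by (simp add: card_grid)
    also have "ennreal ((real j / real (j + 2)) ^ CARD('d) * (?h \<eta> + e/2) + M * (1 - (real j / real (j + 2)) ^ CARD('d)))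
      \<le> ennreal (1 * (?h \<eta> + e/2) + e/2)"
      using j(2) e by (intro ennreal_leI add_mono mult_right_mono power_le_one) (auto simp: add_nonneg_nonneg)
    finally have "homog W \<xi> \<le> ennreal (?h \<eta> + e)" by (simp add: add.commute)
    then have "?h \<xi> \<le> enn2real (ennreal (?h \<eta> + e))" by (rule enn2real_mono) simp
    moreover have "enn2real (ennreal (?h \<eta> + e)) = ?h \<eta> + e"
      by (rule enn2real_ennreal) (use e in \<open>simp add: add_nonneg_nonneg\<close>)
    ultimately show "?h \<xi> \<le> ?h \<eta> + e" by (simp only:)
  qed
qed

lemma homog_continuous_on:
  fixes W :: "real^'d::finite \<Rightarrow> real^'d^'m::finite \<Rightarrow> ennreal"
  assumes W: "periodic_integrand W"
    and lb: "loc_bounded W U"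
  shows "continuous_on U (\<lambda>\<xi>. enn2real (homog W \<xi>))"
proof (rule continuous_at_imp_continuous_on, rule ballI)
  fix \<xi>0 assume "\<xi>0 \<in> U"
  moreover have "open U" using lb by (simp add: loc_bounded_def)
  ultimately obtain s where s: "s > 0" "cball \<xi>0 s \<subseteq> U"
    by (meson open_contains_cball)
  have r: "s/2 > 0" "cball \<xi>0 (2 * (s/2)) \<subseteq> U" using s by auto
  let ?h = "\<lambda>\<xi>. enn2real (homog W \<xi>)"
  show "isCont ?h \<xi>0"
    unfolding continuous_at_eps_delta
  proof (intro allI impI)
    fix e :: real assume "e > 0"
    then have "e/2 > 0" by simp
    obtain d where d: "d > 0" "\<And>\<xi> \<eta>. \<lbrakk>\<xi> \<in> cball \<xi>0 (s/2); \<eta> \<in> cball \<xi>0 (s/2); norm (\<eta> - \<xi>) \<le> d\<rbrakk> \<Longrightarrow> ?h \<xi> \<le> ?h \<eta> + e/2"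
      by (rule homog_local_estimate[OF W lb r \<open>e/2 > 0\<close>]) (rule that)
    show "\<exists>d>0. \<forall>\<xi>. dist \<xi> \<xi>0 < d \<longrightarrow> dist (?h \<xi>) (?h \<xi>0) < e"
    proof (intro exI[of _ "min d (s/2)"] conjI allI impI)
      fix \<xi> assume "dist \<xi> \<xi>0 < min d (s/2)"
      then have *: "\<xi> \<in> cball \<xi>0 (s/2)" "\<xi>0 \<in> cball \<xi>0 (s/2)" "norm (\<xi> - \<xi>0) \<le> d" "norm (\<xi>0 - \<xi>) \<le> d"
        using s by (auto simp: dist_norm norm_minus_commute)
      show "dist (?h \<xi>) (?h \<xi>0) < e"
        using d(2)[OF *(1,2,4)] d(2)[OF *(2,1,3)] \<open>e > 0\<close> by (simp add: dist_real_def abs_le_iff)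
    qed (use d s in auto)
  qed
qed

section \<open>Jensen's inequality\<close>

lemma C1_map_linearization_error:
  fixes \<phi> :: "real^'d::finite \<Rightarrow> real^'m::finite"
  assumes c: "C1_map \<phi> G" and close: "\<And>z. z \<in> cball a R \<Longrightarrow> norm (G z - G a) \<le> w" and x: "x \<in> cball a R"
  shows "norm (\<phi> a + G a *v (x - a) - \<phi> x) \<le> w * norm (x - a)"
proof -
  have "dist a x \<le> R" using x by simp
  then have R: "R \<ge> 0" using zero_le_dist[of a x] by linarith
  have "norm (\<phi> x - \<phi> a - (\<lambda>h. G a *v h) (x - a)) \<le> norm (x - a) * w"
  proof (rule differentiable_bound_linearization[where S = "cball a R" and f' = "\<lambda>z h. G z *v h"])
    show "a + t *\<^sub>R (x - a) \<in> cball a R" if "t \<in> {0..1}" for t :: real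
    proof -
      have "norm (t *\<^sub>R (x - a)) \<le> norm (x - a)" using that by (simp add: mult_left_le_one_le)
      then show ?thesis using x by (simp add: dist_norm norm_minus_commute)
    qed
    show "(\<phi> has_derivative (\<lambda>h. G z *v h)) (at z within cball a R)" for z
      by (rule has_derivative_at_withinI[OF C1_map_has_derivative[OF c]])
    show "onorm ((\<lambda>h. G z *v h) - (\<lambda>h. G a *v h)) \<le> w" if "z \<in> cball a R" for z
    proof (rule onorm_le)
      fix h
      have "norm ((G z - G a) *v h) \<le> w * norm h"
        using norm_matrix_vector_le[of "G z - G a" h] mult_right_mono[OF close[OF that] norm_ge_zero[of h]] by linarith
      then show "norm (((\<lambda>h. G z *v h) - (\<lambda>h. G a *v h)) h) \<le> w * norm h"
        by (simp add: matrix_vector_mult_diff_rdistrib)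
    qed
    show "a \<in> cball a R" using R by simp
  qed
  moreover have "norm (\<phi> a + G a *v (x - a) - \<phi> x) = norm (\<phi> x - \<phi> a - G a *v (x - a))"
    by (metis diff_diff_eq norm_minus_commute)
  ultimately show ?thesis by (simp add: mult.commute)
qed

text \<open>Each cell has all its points within \<open>CARD('d) / k\<close> of its corner. The
  comparison is one-sided, so disjoint open boxes suffice and nothing has to be said about their
  walls.\<close>

lemma grid_riemann_sum_le:
  fixes g :: "real^'d::finite \<Rightarrow> real" and c :: "('d \<Rightarrow> nat) \<Rightarrow> real"
  assumes k: "k \<ge> 1" and g: "g \<in> borel_measurable borel" "\<And>x. 0 \<le> g x" and c: "\<And>f. f \<in> grid k \<Longrightarrow> 0 \<le> c f"
    and e: "0 \<le> e" and close: "\<And>f x. f \<in> grid k \<Longrightarrow> norm (x - (1 / real k) *\<^sub>R natvec f) \<le> real CARD('d) / real k \<Longrightarrow> c f \<le> g x + e"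
  shows "ennreal ((\<Sum>f\<in>grid k. c f) / real k ^ CARD('d)) \<le> (\<integral>\<^sup>+x\<in>cube 1. ennreal (g x) \<partial>lborel) + ennreal e"
proof -
  let ?I = "grid k :: ('d \<Rightarrow> nat) set"
  define Q :: "('d \<Rightarrow> nat) \<Rightarrow> (real^'d) set" where "Q f = box ((1 / real k) *\<^sub>R natvec f) ((1 / real k) *\<^sub>R (natvec f + vec 1))" for f
  have Qiff: "x \<in> Q f \<longleftrightarrow> real k *\<^sub>R x \<in> (+) (natvec f) ` cube 1" for x f
    unfolding Q_def translate_cube using k by (simp add: mem_box_cart field_simps)
  have [measurable]: "Q f \<in> sets borel" for f by (simp add: Q_def)
  have [measurable]: "g \<in> borel_measurable borel" by (rule g(1))
  have mQ: "emeasure lborel (Q f) = ennreal ((1 / real k) ^ CARD('d))" for f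
    unfolding Q_def by (subst emeasure_box_vec) (auto simp: field_simps)
  have disj: "disjoint_family_on Q ?I"
    unfolding disjoint_family_on_def
  proof (intro ballI impI)
    fix f f' :: "'d \<Rightarrow> nat" assume "f \<noteq> f'"
    then have e0: "(+) (natvec f) ` cube 1 \<inter> (+) (natvec f') ` cube 1 = {}"
      using grid_cells_disjoint[of f f' 0 1 1] by simp
    show "Q f \<inter> Q f' = {}"
    proof (rule equals0I)
      fix x assume "x \<in> Q f \<inter> Q f'"
      then have "real k *\<^sub>R x \<in> (+) (natvec f) ` cube 1 \<inter> (+) (natvec f') ` cube 1" unfolding Int_iff Qiff .
      then show False unfolding e0 by (rule emptyE)
    qed
  qed
  have sub: "x \<in> cube 1" if "f \<in> ?I" "x \<in> Q f" for f x
  proof -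
    have "real k *\<^sub>R x \<in> cube (k * 1)"
      using grid_cell_subset[OF that(1), of 0 1 1] that(2) Qiff by auto
    then show ?thesis using k by (simp add: cube_def zero_less_mult_iff)
  qed
  have cls: "c f \<le> g x + e" if "f \<in> ?I" "x \<in> Q f" for f x
  proof (rule close[OF that(1)])
    have "real k *\<^sub>R x - natvec f \<in> cube 1" using that(2) Qiff by auto
    then have "norm (real k *\<^sub>R x - natvec f) \<le> real CARD('d)" using norm_cube_le by fastforce
    moreover have "x - (1 / real k) *\<^sub>R natvec f = (1 / real k) *\<^sub>R (real k *\<^sub>R x - natvec f)"
      using k by (simp add: scaleR_diff_right)
    ultimately show "norm (x - (1 / real k) *\<^sub>R natvec f) \<le> real CARD('d) / real k"
      using k by (simp add: divide_right_mono)
  qed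
  have pw: "(\<Sum>f\<in>?I. ennreal (c f) * indicator (Q f) x) \<le> (ennreal (g x) + ennreal e) * indicator (cube 1) x" for x
  proof (cases "\<exists>f\<in>?I. x \<in> Q f")
    case True
    then obtain f where f: "f \<in> ?I" "x \<in> Q f" by blast
    have "ennreal (c f') * indicator (Q f') x = 0" if "f' \<in> ?I - {f}" for f'
      using disj f that unfolding disjoint_family_on_def by (auto simp: indicator_def)
    then have "(\<Sum>f'\<in>?I - {f}. ennreal (c f') * indicator (Q f') x) = 0" by (rule sum.neutral[OF ballI])
    then have "(\<Sum>f\<in>?I. ennreal (c f) * indicator (Q f) x) = ennreal (c f)"
      using f(2) by (subst sum.remove[OF finite_grid f(1)]) simp
    also have "\<dots> \<le> ennreal (g x + e)" by (rule ennreal_leI[OF cls[OF f]])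
    also have "\<dots> = (ennreal (g x) + ennreal e) * indicator (cube 1) x"
      using sub[OF f] g(2) e by simp
    finally show ?thesis .
  next
    case False
    then have "(\<Sum>f\<in>?I. ennreal (c f) * indicator (Q f) x) = 0" by (intro sum.neutral) (auto simp: indicator_def)
    then show ?thesis by simp
  qed
  have "ennreal ((\<Sum>f\<in>?I. c f) / real k ^ CARD('d)) = (\<Sum>f\<in>?I. ennreal (c f)) * ennreal ((1 / real k) ^ CARD('d))"
    using c by (subst sum_ennreal) (auto simp: power_divide sum_nonneg simp flip: ennreal_mult)
  also have "\<dots> = (\<Sum>f\<in>?I. \<integral>\<^sup>+x. ennreal (c f) * indicator (Q f) x \<partial>lborel)"
    by (simp add: nn_integral_cmult_indicator mQ sum_distrib_right)
  also have "\<dots> = (\<integral>\<^sup>+x. (\<Sum>f\<in>?I. ennreal (c f) * indicator (Q f) x) \<partial>lborel)"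
    by (rule nn_integral_sum[symmetric]) measurable
  also have "\<dots> \<le> (\<integral>\<^sup>+x. (ennreal (g x) + ennreal e) * indicator (cube 1) x \<partial>lborel)"
    by (intro nn_integral_mono pw)
  also have "\<dots> = (\<integral>\<^sup>+x\<in>cube 1. ennreal (g x) \<partial>lborel) + (\<integral>\<^sup>+x\<in>cube 1. ennreal e \<partial>(lborel :: (real^'d) measure))"
    unfolding distrib_right by (rule nn_integral_add) measurable
  also have "(\<integral>\<^sup>+x\<in>cube 1. ennreal e \<partial>(lborel :: (real^'d) measure)) = ennreal e"
    by (subst nn_integral_cmult_indicator) (simp_all add: emeasure_cube)
  finally show ?thesis .
qed

text \<open>The map is replaced on each cell of a fine grid by its affine Taylor polynomial, cut off near the
  cell boundary; by uniform continuity of \<open>G\<close> all gradients stay near the range of \<open>\<xi> + G\<close>, where \<open>W\<close> is bounded.\<close>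

lemma homog_jensen_C1:
  fixes W :: "real^'d::finite \<Rightarrow> real^'d^'m::finite \<Rightarrow> ennreal"
  assumes W: "periodic_integrand W" and lb: "loc_bounded W U"
    and c: "C1_map \<phi> G" and K0: "compact K0" "K0 \<subseteq> cube 1" "\<And>x. x \<notin> K0 \<Longrightarrow> \<phi> x = 0"
    and U: "\<And>x. \<xi> + G x \<in> U"
  shows "homog W \<xi> \<le> (\<integral>\<^sup>+x\<in>cube 1. homog W (\<xi> + G x) \<partial>lborel)"
proof -
  define h where "h \<zeta> = enn2real (homog W \<zeta>)" for \<zeta>
  have hc: "continuous_on U h" unfolding h_def[abs_def] by (rule homog_continuous_on[OF W lb])
  have h0: "h \<zeta> \<ge> 0" for \<zeta> by (simp add: h_def)
  have Hh: "homog W \<zeta> = ennreal (h \<zeta>)" if "\<zeta> \<in> U" for \<zeta>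
    unfolding h_def by (rule homog_finite(2)[OF lb that])
  have Gc: "continuous_on UNIV G" by (rule C1_map_gradient_continuous[OF c])
  have Gz: "G x = 0" if "x \<notin> K0" for x
    by (rule C1_map_gradient_support[OF c compact_imp_closed[OF K0(1)] K0(3) that])
  have G0: "G 0 = 0" using K0(2) by (intro Gz) (auto simp: cube_def)
  \<comment> \<open>The point 0 lies outside the open cube and stands for all points off
    \<open>K0\<close>, where the gradient vanishes. Thus \<open>S\<close> is the whole range of
    \<open>\<xi> + G\<close> and compact.\<close>
  define S where "S = (\<lambda>x. \<xi> + G x) ` (insert 0 K0)"
  have Sc: "compact S"
    unfolding S_def using K0(1) by (intro compact_continuous_image continuous_intros continuous_on_subset[OF Gc]) auto
  have GS: "\<xi> + G x \<in> S" for x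
    using Gz[of x] G0 by (cases "x \<in> K0") (auto simp: S_def)
  have SU: "S \<subseteq> U" using U by (auto simp: S_def)
  have "open U" using lb by (simp add: loc_bounded_def)
  obtain r where r: "r > 0" "(\<Union>x\<in>S. cball x r) \<subseteq> U"
    by (rule compact_subset_open_imp_cball_epsilon_subset[OF Sc \<open>open U\<close> SU])
  \<comment> \<open>The closed \<open>r\<close>-neighbourhood of the range; all slopes of the
    modified map will stay in it, so \<open>M\<close> bounds the integrand in the layers.\<close>
  define K' where "K' = {x + y |x y. x \<in> S \<and> y \<in> cball 0 r}"
  have K'c: "compact K'" unfolding K'_def by (intro compact_sums Sc compact_cball)
  have K'U: "K' \<subseteq> U"
  proof
    fix z assume "z \<in> K'"
    then obtain x y where "x \<in> S" "norm y \<le> r" "z = x + y" by (auto simp: K'_def)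
    then have "z \<in> cball x r" by (simp add: dist_norm)
    then show "z \<in> U" using r(2) \<open>x \<in> S\<close> by blast
  qed
  obtain M where M: "0 \<le> M" "AE x in lborel. \<forall>\<zeta>\<in>K'. W x \<zeta> \<le> ennreal M"
    by (rule loc_boundedE[OF lb K'c K'U])
  obtain R0 where R0: "K0 \<subseteq> ball 0 R0" using compact_imp_bounded[OF K0(1)] bounded_subset_ballD by blast
  have Guc: "uniformly_continuous_on UNIV G"
  proof (rule compact_support_uniformly_continuous[OF Gc])
    fix x :: "real^'d" assume "norm x > R0"
    then have "x \<notin> K0" using subsetD[OF R0, of x] by auto
    then show "G x = 0" by (rule Gz)
  qed
  have huc: "uniformly_continuous_on S h"
    by (rule compact_uniformly_continuous[OF continuous_on_subset[OF hc SU] Sc])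
  \<comment> \<open>The three errors of size \<open>e\<close> come from choosing constants strictly
    above the values of \<open>homog W\<close>, from the layers, and from the Riemann sum.\<close>
  have main: "homog W \<xi> \<le> (\<integral>\<^sup>+x\<in>cube 1. homog W (\<xi> + G x) \<partial>lborel) + ennreal (3 * e)" if e: "e > 0" for e
  proof -
    obtain j where j: "j \<ge> 1" "M * (1 - (real j / real (j + 2)) ^ CARD('d)) \<le> e"
      using exists_layer[OF M(1) e] by auto
    obtain \<theta> :: "real^'d \<Rightarrow> real" and B where t: "\<theta> \<in> test_functions (cube (j + 2))" "\<And>x. 0 \<le> \<theta> x \<and> \<theta> x \<le> 1"
      "\<And>y. y \<in> cube j \<Longrightarrow> \<theta> (natvec (\<lambda>_. 1) + y) = 1 \<and> gradient \<theta> (natvec (\<lambda>_. 1) + y) = 0"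
      "\<And>x. x \<notin> cube (j + 2) \<Longrightarrow> \<theta> x = 0 \<and> gradient \<theta> x = 0" "0 < B" "\<And>x. norm (gradient \<theta> x) \<le> B"
      by (rule cell_cutoff[of j]) (rule that)
    have tU: "\<theta> \<in> test_functions UNIV" using t(1) test_functions_mono[of "cube (j + 2)" UNIV] by auto
    define L where "L = j + 2"
    define R where "R = real CARD('d) * real L"
    have R: "R \<ge> 0" by (simp add: R_def)
    have RB: "1 + R * B > 0" using R t(5) by (simp add: add_pos_nonneg)
    obtain d1 where d1: "d1 > 0" "\<And>a b. a \<in> S \<Longrightarrow> b \<in> S \<Longrightarrow> dist b a < d1 \<Longrightarrow> dist (h b) (h a) < e"
      by (rule uniformly_continuous_onE[OF huc e]) (rule that)
    \<comment> \<open>The tolerance for the oscillation of the gradient over a cell: below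
      \<open>d1\<close> it changes \<open>h\<close> by less than \<open>e\<close>, and multiplied by
      \<open>1 + R * B\<close> it bounds the correction \<open>Cf\<close> by
      \<open>r\<close>.\<close>
    define w where "w = min (d1 / 2) (r / (1 + R * B))"
    have w: "w > 0" "w < d1" "w * (1 + R * B) \<le> r"
    proof -
      show "w > 0" "w < d1" using d1(1) r(1) RB by (auto simp: w_def)
      have "w * (1 + R * B) \<le> r / (1 + R * B) * (1 + R * B)" using RB by (intro mult_right_mono) (auto simp: w_def)
      then show "w * (1 + R * B) \<le> r" using RB by simp
    qed
    obtain d where d: "d > 0" "\<And>x y. dist y x < d \<Longrightarrow> dist (G y) (G x) < w"
      by (rule uniformly_continuous_UNIV_E[OF Guc w(1)]) (rule that)
    obtain k where "real CARD('d) / d < real k" using reals_Archimedean2 by blast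
    then have kd: "real CARD('d) < real k * d" using d(1) by (simp add: pos_divide_less_eq)
    have k1: "k \<ge> 1" using kd by (cases k) auto
    then have k: "k \<ge> 1" "real CARD('d) / real k < d"
      using kd by (auto simp: pos_divide_less_eq mult.commute)
    have L: "real L > 0" by (simp add: L_def)
    \<comment> \<open>The map is blown up from the unit cube to the cube of side \<open>N\<close>,
      so that a cell of side \<open>L\<close> corresponds to one of side
      \<open>1 / k\<close>.\<close>
    define N where "N = k * L"
    have N: "real N > 0" using k L by (simp add: N_def)
    define X where "X f = (natvec (\<lambda>i. L * f i) :: real^'d)" for f
    define \<phi>t where "\<phi>t x = real N *\<^sub>R \<phi> ((1 / real N) *\<^sub>R x)" for x
    define Gt where "Gt x = G ((1 / real N) *\<^sub>R x)" for x
    have ct: "C1_map \<phi>t Gt"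
      using C1_map_scale[OF c, of "1 / real N" 0] N by (simp add: \<phi>t_def[abs_def] Gt_def[abs_def])
    have Gtclose: "norm (Gt x - Gt y) \<le> w" if "norm (x - y) \<le> R" for x y
    proof -
      have "dist ((1 / real N) *\<^sub>R x) ((1 / real N) *\<^sub>R y) = norm (x - y) / real N"
        using N by (simp add: dist_norm flip: scaleR_diff_right)
      also have "\<dots> \<le> R / real N" using that N by (intro divide_right_mono) auto
      also have "\<dots> = real CARD('d) / real k" using L by (simp add: R_def N_def)
      finally show ?thesis using d(2)[of "(1 / real N) *\<^sub>R x" "(1 / real N) *\<^sub>R y"] k(2)
        by (simp add: Gt_def dist_norm)
    qed
    define A where "A f x = \<phi>t (X f) + Gt (X f) *v (x - X f)" for f x
    \<comment> \<open>The gradient of the cutoff times the difference between the Taylor polynomial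
      \<open>A f\<close> and the map; the \<open>outer\<close> term is small because the
      linearization error is.\<close>
    define Cf where "Cf f x = \<theta> (x - X f) *\<^sub>R (Gt (X f) - Gt x) + outer (A f x - \<phi>t x) (gradient \<theta> (x - X f))" for f x
    define \<phi>n where "\<phi>n x = \<phi>t x + (\<Sum>f\<in>grid k. \<theta> (x - X f) *\<^sub>R (A f x - \<phi>t x))" for x
    define Gn where "Gn x = Gt x + (\<Sum>f\<in>grid k. Cf f x)" for x
    have cn: "C1_map \<phi>n Gn"
    proof -
      have "C1_map (\<lambda>x. \<theta> (x - X f) *\<^sub>R (A f x - \<phi>t x)) (Cf f)" for f
      proof -
        have "C1_map (A f) (\<lambda>x. Gt (X f))" unfolding A_def[abs_def] by (rule C1_map_affine)
        then show ?thesis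
          using C1_map_mult_test[OF gradient_translate(1)[OF tU, of "X f"] C1_map_diff[OF _ ct]]
          unfolding gradient_translate(2)[OF tU] Cf_def[abs_def] by blast
      qed
      then show ?thesis
        unfolding \<phi>n_def[abs_def] Gn_def[abs_def] by (intro C1_map_add[OF ct] C1_map_sum finite_grid)
    qed
    have Cz: "Cf f x = 0" if "x - X f \<notin> cube L" for f x
      using t(4)[of "x - X f"] that by (simp add: Cf_def L_def)
    have Cle: "norm (Cf f x) \<le> r" for f x
    proof (cases "x - X f \<in> cube L")
      case True
      have nR: "norm (x - X f) \<le> R" using norm_cube_le[OF True] by (simp add: R_def)
      have "norm (A f x - \<phi>t x) \<le> w * norm (x - X f)"
        unfolding A_def
      proof (rule C1_map_linearization_error[OF ct])
        show "norm (Gt z - Gt (X f)) \<le> w" if "z \<in> cball (X f) R" for z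
          using that by (intro Gtclose) (simp add: dist_norm norm_minus_commute)
        show "x \<in> cball (X f) R" using nR by (simp add: dist_norm norm_minus_commute)
      qed
      also have "\<dots> \<le> w * R" using nR w(1) by (intro mult_left_mono) auto
      finally have 1: "norm (A f x - \<phi>t x) \<le> w * R" .
      have 2: "norm (Gt (X f) - Gt x) \<le> w" using nR by (intro Gtclose) (simp add: norm_minus_commute)
      have "norm (Cf f x) \<le> \<bar>\<theta> (x - X f)\<bar> * norm (Gt (X f) - Gt x) + norm (A f x - \<phi>t x) * norm (gradient \<theta> (x - X f))"
        unfolding Cf_def
        using norm_triangle_ineq[of "\<theta> (x - X f) *\<^sub>R (Gt (X f) - Gt x)" "outer (A f x - \<phi>t x) (gradient \<theta> (x - X f))"]
        by (simp add: norm_outer)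
      also have "\<dots> \<le> 1 * w + (w * R) * B"
        by (intro add_mono mult_mono 1 2 t(6)) (use t(2)[of "x - X f"] w(1) R in auto)
      also have "\<dots> \<le> r" using w(3) by (simp add: algebra_simps)
      finally show ?thesis .
    next
      case False
      then show ?thesis using Cz r(1) by simp
    qed
    \<comment> \<open>The cutoffs belong to disjoint cells, so at most one correction is active at
      each point and the bound does not grow with the number of cells.\<close>
    have one: "(\<Sum>g\<in>grid k. Cf g x) = Cf f x" if f: "f \<in> grid k" "x - X f \<in> cube L" for f x
    proof -
      have "Cf g x = 0" if "g \<in> grid k - {f}" for g
      proof (rule Cz, rule notI)
        assume g: "x - X g \<in> cube L"
        have "x \<in> (+) (natvec (\<lambda>i. L * g i + 0)) ` cube L" "x \<in> (+) (natvec (\<lambda>i. L * f i + 0)) ` cube L"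
          using g f(2) by (auto simp: X_def image_iff intro: bexI[of _ "x - X g"] bexI[of _ "x - X f"])
        then show False using grid_cells_disjoint[of g f 0 L L] that by auto
      qed
      then show ?thesis using f by (subst sum.remove[OF finite_grid f(1)]) simp
    qed
    have sumle: "norm (\<Sum>g\<in>grid k. Cf g x) \<le> r" for x
    proof (cases "\<exists>f\<in>grid k. x - X f \<in> cube L")
      case True
      then show ?thesis using one Cle by auto
    next
      case False
      then have "(\<Sum>g\<in>grid k. Cf g x) = 0" using Cz by (intro sum.neutral) auto
      then show ?thesis using r(1) by simp
    qed
    have GnK: "\<xi> + Gn x \<in> K'" for x
    proof -
      have "\<xi> + Gt x \<in> S" unfolding Gt_def by (rule GS)
      moreover have "\<xi> + Gn x = (\<xi> + Gt x) + (\<Sum>g\<in>grid k. Cf g x)" by (simp add: Gn_def)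
      moreover have "(\<Sum>g\<in>grid k. Cf g x) \<in> cball 0 r" using sumle[of x] by simp
      ultimately show ?thesis unfolding K'_def by blast
    qed
    define Kn where "Kn = (\<lambda>x. real N *\<^sub>R x) ` K0 \<union> (\<Union>f\<in>grid k. (+) (X f) ` closure {x. \<theta> x \<noteq> 0})"
    have Kn: "compact Kn"
      unfolding Kn_def using t(1)
      by (intro compact_Un compact_scaling K0 compact_UN finite_grid compact_translation) (auto simp: test_functions_def)
    have KnN: "Kn \<subseteq> cube (k * (j + 2))"
    proof -
      have "(\<lambda>x. real N *\<^sub>R x) ` K0 \<subseteq> cube N" using K0(2) N by (auto simp: cube_def subset_iff)
      moreover have "(+) (X f) ` closure {x. \<theta> x \<noteq> 0} \<subseteq> cube N" if "f \<in> grid k" for f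
      proof -
        have "(+) (X f) ` closure {x. \<theta> x \<noteq> 0} \<subseteq> (+) (X f) ` cube L"
          using t(1) by (intro image_mono) (auto simp: test_functions_def L_def)
        also have "\<dots> \<subseteq> cube N" using grid_cell_subset[OF that, of 0 L L] by (simp add: X_def N_def)
        finally show ?thesis .
      qed
      ultimately have "Kn \<subseteq> cube N" unfolding Kn_def by blast
      then show ?thesis by (simp add: N_def L_def)
    qed
    have \<phi>nz: "\<phi>n x = 0" if "x \<notin> Kn" for x
    proof -
      have "(1 / real N) *\<^sub>R x \<notin> K0" using that N by (auto simp: Kn_def image_iff)
      then have "\<phi>t x = 0" by (simp add: \<phi>t_def K0(3))
      moreover have "\<theta> (x - X f) = 0" if "f \<in> grid k" for f
      proof (rule ccontr)
        assume "\<theta> (x - X f) \<noteq> 0"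
        then have "x - X f \<in> closure {x. \<theta> x \<noteq> 0}" using closure_subset[of "{x. \<theta> x \<noteq> 0}"] by auto
        then have "x \<in> (+) (X f) ` closure {x. \<theta> x \<noteq> 0}" by (intro image_eqI[of _ _ "x - X f"]) auto
        then show False using \<open>x \<notin> Kn\<close> \<open>f \<in> grid k\<close> by (auto simp: Kn_def)
      qed
      ultimately show ?thesis by (simp add: \<phi>n_def)
    qed
    have slope: "\<xi> + Gn (natvec (\<lambda>i. (j + 2) * f i + 1) + x) = \<xi> + Gt (X f)" if f: "f \<in> grid k" and x: "x \<in> cube j" for f x
    proof -
      let ?z = "natvec (\<lambda>i. (j + 2) * f i + 1) + x"
      have z: "?z - X f = natvec (\<lambda>_. 1) + x" by (simp add: X_def natvec_def L_def vec_eq_iff)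
      have "?z - X f \<in> cube L"
      proof -
        have "0 < (natvec (\<lambda>_. 1) + x) $ i \<and> (natvec (\<lambda>_. 1) + x) $ i < real L" for i
        proof -
          have "0 < x $ i \<and> x $ i < real j" using x by (simp add: cube_def)
          then show ?thesis by (simp add: natvec_def L_def)
        qed
        then show ?thesis unfolding z cube_def by blast
      qed
      then have "Gn ?z = Gt ?z + Cf f ?z" using one[OF f] by (simp add: Gn_def)
      also have "Cf f ?z = Gt (X f) - Gt ?z" unfolding Cf_def z using t(3)[OF x] by simp
      finally show ?thesis by simp
    qed
    have eS: "\<xi> + Gt (X f) \<in> S" for f unfolding Gt_def by (rule GS)
    have "homog W \<xi> \<le> ennreal ((real j / real (j + 2)) ^ CARD('d) * ((\<Sum>f\<in>(grid k :: ('d \<Rightarrow> nat) set). h (\<xi> + Gt (X f)) + e) / real k ^ CARD('d))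
      + M * (1 - (real j / real (j + 2)) ^ CARD('d)))"
    proof (rule homog_le_grid[OF W cn Kn KnN, where e = "\<lambda>f. \<xi> + Gt (X f)"])
      show "\<phi>n x = 0" if "x \<notin> Kn" for x using that by (rule \<phi>nz)
      show "\<xi> + Gn (natvec (\<lambda>i. (j + 2) * f i + 1) + x) = \<xi> + Gt (X f)" if "f \<in> grid k" "x \<in> cube j" for f x
        using that by (rule slope)
      show "homog W (\<xi> + Gt (X f)) < ennreal (h (\<xi> + Gt (X f)) + e)" for f
        unfolding Hh[OF subsetD[OF SU eS]] using e h0[of "\<xi> + Gt (X f)"] by (intro ennreal_lessI) auto
      show "AE x in lborel. \<forall>y. W x (\<xi> + Gn y) \<le> ennreal M"
        using M(2) by eventually_elim (use GnK in blast)
    qed (use k j M in auto)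
    also have "\<dots> \<le> ennreal ((\<Sum>f\<in>(grid k :: ('d \<Rightarrow> nat) set). h (\<xi> + Gt (X f))) / real k ^ CARD('d) + 2 * e)"
    proof (rule ennreal_leI)
      let ?s = "(\<Sum>f\<in>(grid k :: ('d \<Rightarrow> nat) set). h (\<xi> + Gt (X f))) / real k ^ CARD('d)"
      have s0: "0 \<le> ?s" using h0 by (intro divide_nonneg_nonneg sum_nonneg) auto
      have eq: "(\<Sum>f\<in>(grid k :: ('d \<Rightarrow> nat) set). h (\<xi> + Gt (X f)) + e) / real k ^ CARD('d) = ?s + e"
        using k by (simp add: sum.distrib card_grid add_divide_distrib)
      have le: "(real j / real (j + 2)) ^ CARD('d) * (?s + e) \<le> 1 * (?s + e)"
        using s0 e by (intro mult_right_mono power_le_one) auto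
      show "(real j / real (j + 2)) ^ CARD('d) * ((\<Sum>f\<in>(grid k :: ('d \<Rightarrow> nat) set). h (\<xi> + Gt (X f)) + e) / real k ^ CARD('d))
        + M * (1 - (real j / real (j + 2)) ^ CARD('d)) \<le> ?s + 2 * e"
        unfolding eq using add_mono[OF le j(2)] by (simp only: mult_1 add.assoc mult_2)
    qed
    also have "\<dots> = ennreal ((\<Sum>f\<in>(grid k :: ('d \<Rightarrow> nat) set). h (\<xi> + Gt (X f))) / real k ^ CARD('d)) + ennreal (2 * e)"
      using h0 e by (intro ennreal_plus divide_nonneg_nonneg sum_nonneg) auto
    also have "ennreal ((\<Sum>f\<in>(grid k :: ('d \<Rightarrow> nat) set). h (\<xi> + Gt (X f))) / real k ^ CARD('d))
      \<le> (\<integral>\<^sup>+x\<in>cube 1. ennreal (h (\<xi> + G x)) \<partial>lborel) + ennreal e"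
    proof (rule grid_riemann_sum_le[OF k(1)])
      have "continuous_on UNIV (\<lambda>x. h (\<xi> + G x))"
        by (rule continuous_on_compose2[OF hc]) (use U in \<open>auto intro!: continuous_intros Gc\<close>)
      then show "(\<lambda>x. h (\<xi> + G x)) \<in> borel_measurable borel" by (rule borel_measurable_continuous_onI)
      fix f :: "'d \<Rightarrow> nat" and x :: "real^'d"
      assume x: "norm (x - (1 / real k) *\<^sub>R natvec f) \<le> real CARD('d) / real k"
      have "(1 / real N) *\<^sub>R X f = (1 / real k) *\<^sub>R natvec f"
        using k L by (simp add: X_def N_def natvec_def vec_eq_iff)
      then have "dist ((1 / real N) *\<^sub>R X f) x < d"
        using x k(2) by (simp add: dist_norm norm_minus_commute)
      then have "dist (\<xi> + Gt (X f)) (\<xi> + G x) < d1"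
        using d(2) w(2) unfolding Gt_def by (force simp: dist_norm)
      then have "dist (h (\<xi> + Gt (X f))) (h (\<xi> + G x)) < e" by (rule d1(2)[OF GS eS])
      then show "h (\<xi> + Gt (X f)) \<le> h (\<xi> + G x) + e" by (simp add: dist_real_def)
    qed (use h0 e in auto)
    also have "(\<integral>\<^sup>+x\<in>cube 1. ennreal (h (\<xi> + G x)) \<partial>lborel) + ennreal e + ennreal (2 * e)
      = (\<integral>\<^sup>+x\<in>cube 1. homog W (\<xi> + G x) \<partial>lborel) + ennreal (3 * e)"
      using e by (simp add: Hh[OF U] add.assoc flip: ennreal_plus)
    finally show ?thesis by (simp add: add_right_mono)
  qed
  show ?thesis
  proof (rule ennreal_le_epsilon)
    fix e :: real assume "e > 0"
    then show "homog W \<xi> \<le> (\<integral>\<^sup>+x\<in>cube 1. homog W (\<xi> + G x) \<partial>lborel) + ennreal e"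
      using main[of "e/3"] by simp
  qed
qed

text \<open>Mollification and truncation push the support slightly beyond the unit cube, so the
  inequality is needed on enlarged cubes; it follows by rescaling, which does not change
  gradients.\<close>

lemma homog_jensen_box:
  fixes W :: "real^'d::finite \<Rightarrow> real^'d^'m::finite \<Rightarrow> ennreal"
  assumes W: "periodic_integrand W" and lb: "loc_bounded W U"
    and c: "C1_map \<phi> G" and K: "compact K" "K \<subseteq> box (vec a) (vec b)" "\<And>x. x \<notin> K \<Longrightarrow> \<phi> x = 0"
    and U: "\<And>x. \<xi> + G x \<in> U" and ab: "a < b"
  shows "homog W \<xi> * ennreal ((b - a) ^ CARD('d)) \<le> (\<integral>\<^sup>+x\<in>box (vec a) (vec b). homog W (\<xi> + G x) \<partial>lborel)"
proof -
  define s where "s = b - a"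
  have s: "s > 0" using ab by (simp add: s_def)
  let ?T = "\<lambda>x. vec a + s *\<^sub>R x :: real^'d"
  have c': "C1_map (\<lambda>x. (1/s) *\<^sub>R \<phi> (?T x)) (\<lambda>x. G (?T x))" by (rule C1_map_scale[OF c]) (use s in simp)
  have T: "?T x \<in> box (vec a) (vec b) \<longleftrightarrow> x \<in> cube 1" for x
  proof -
    have "(a < a + s * x $ i \<and> a + s * x $ i < b) \<longleftrightarrow> (0 < x $ i \<and> x $ i < 1)" for i
    proof -
      have "a + s * x $ i < b \<longleftrightarrow> s * x $ i < s * 1" by (auto simp: s_def)
      also have "\<dots> \<longleftrightarrow> x $ i < 1" using s by (subst mult_less_cancel_left_pos) auto
      finally show ?thesis using s by (simp add: zero_less_mult_iff)
    qed
    then show ?thesis by (simp add: mem_box_cart cube_def)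
  qed
  let ?S = "\<lambda>y. (1/s) *\<^sub>R (y - vec a)"
  have TS: "?T (?S y) = y" "?S (?T y) = y" for y using s by auto
  have "homog W \<xi> \<le> (\<integral>\<^sup>+x\<in>cube 1. homog W (\<xi> + G (?T x)) \<partial>lborel)"
  proof (rule homog_jensen_C1[OF W lb c'])
    show "compact (?S ` K)" by (intro compact_continuous_image K continuous_intros)
    show "?S ` K \<subseteq> cube 1"
    proof
      fix x assume "x \<in> ?S ` K"
      then obtain y where "y \<in> K" "x = ?S y" by blast
      then show "x \<in> cube 1" using K(2) T[of x] TS(1)[of y] by auto
    qed
    show "(1/s) *\<^sub>R \<phi> (?T x) = 0" if "x \<notin> ?S ` K" for x
    proof -
      have "?T x \<notin> K" using that TS(2)[of x] by (metis imageI)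
      then show ?thesis by (simp add: K(3))
    qed
    show "\<xi> + G (?T x) \<in> U" for x by (rule U)
  qed
  then have "homog W \<xi> * ennreal (s ^ CARD('d)) \<le> (\<integral>\<^sup>+x\<in>cube 1. homog W (\<xi> + G (?T x)) \<partial>lborel) * ennreal (s ^ CARD('d))"
    by (rule mult_right_mono) simp
  also have "\<dots> = (\<integral>\<^sup>+x\<in>box (vec a) (vec b). homog W (\<xi> + G x) \<partial>lborel)"
  proof -
    have hc: "continuous_on U (\<lambda>\<zeta>. enn2real (homog W \<zeta>))" by (rule homog_continuous_on[OF W lb])
    have "continuous_on UNIV (\<lambda>x. enn2real (homog W (\<xi> + G x)))"
      by (rule continuous_on_compose2[OF hc]) (use U in \<open>auto intro!: continuous_intros C1_map_gradient_continuous[OF c]\<close>)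
    then have m[measurable]: "(\<lambda>x. enn2real (homog W (\<xi> + G x))) \<in> borel_measurable borel"
      by (rule borel_measurable_continuous_onI)
    \<comment> \<open>Measurability along the gradient comes from the continuity of the real-valued
      version on \<open>U\<close>.\<close>
    have eq: "homog W (\<xi> + G x) = ennreal (enn2real (homog W (\<xi> + G x)))" for x
      by (rule homog_finite(2)[OF lb U])
    have "(\<lambda>x. homog W (\<xi> + G x) * indicator (box (vec a) (vec b)) x) \<in> borel_measurable borel"
      by (subst eq) measurable
    from lborel_nn_integral_affine[OF this, of s "vec a"]
    have "(\<integral>\<^sup>+x\<in>box (vec a) (vec b). homog W (\<xi> + G x) \<partial>lborel)
      = ennreal (s ^ CARD('d)) * (\<integral>\<^sup>+x. homog W (\<xi> + G (?T x)) * indicator (box (vec a) (vec b)) (?T x) \<partial>lborel)"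
      using s by simp
    also have "(\<lambda>x. homog W (\<xi> + G (?T x)) * indicator (box (vec a) (vec b)) (?T x))
      = (\<lambda>x. homog W (\<xi> + G (?T x)) * indicator (cube 1) x)"
      by (rule ext) (simp only: indicator_def T)
    finally show ?thesis by (simp only: mult.commute)
  qed
  finally show ?thesis by (simp add: s_def)
qed

subsection \<open>Homogenization of Lipschitz integrands\<close>

lemma lipschitz_nn_integral_le:
  fixes g :: "'b::euclidean_space \<Rightarrow> real" and F G :: "'a::euclidean_space \<Rightarrow> 'b"
  assumes lip: "\<And>a b. g a \<le> g b + n * norm (a - b)" and g0: "\<And>a. 0 \<le> g a" and n: "0 \<le> n"
    and [measurable]: "g \<in> borel_measurable borel" "F \<in> borel_measurable borel" "G \<in> borel_measurable borel" "B \<in> sets borel"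
  shows "(\<integral>\<^sup>+x\<in>B. ennreal (g (F x)) \<partial>lborel) \<le> (\<integral>\<^sup>+x\<in>B. ennreal (g (G x)) \<partial>lborel) + ennreal n * (\<integral>\<^sup>+x\<in>B. ennreal (norm (F x - G x)) \<partial>lborel)"
proof -
  have "(\<integral>\<^sup>+x\<in>B. ennreal (g (F x)) \<partial>lborel)
    \<le> (\<integral>\<^sup>+x. ennreal (g (G x)) * indicator B x + ennreal n * (ennreal (norm (F x - G x)) * indicator B x) \<partial>lborel)"
  proof (rule nn_integral_mono)
    fix x
    have "ennreal (g (F x)) \<le> ennreal (g (G x) + n * norm (F x - G x))" by (rule ennreal_leI[OF lip])
    also have "\<dots> = ennreal (g (G x)) + ennreal n * ennreal (norm (F x - G x))"
      using g0 n by (simp add: ennreal_mult)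
    finally show "ennreal (g (F x)) * indicator B x \<le> ennreal (g (G x)) * indicator B x + ennreal n * (ennreal (norm (F x - G x)) * indicator B x)"
      by (simp add: indicator_def)
  qed
  also have "\<dots> = (\<integral>\<^sup>+x\<in>B. ennreal (g (G x)) \<partial>lborel) + ennreal n * (\<integral>\<^sup>+x\<in>B. ennreal (norm (F x - G x)) \<partial>lborel)"
    by (subst nn_integral_add) (auto simp: nn_integral_cmult)
  finally show ?thesis .
qed

lemma ball_cube_disjoint:
  fixes x :: "real^'d::finite"
  assumes "x \<notin> cbox (vec (- e)) (vec (real n + e))"
  shows "ball x e \<inter> cube n = {}"
proof (rule equals0I)
  fix y assume y: "y \<in> ball x e \<inter> cube n"
  have "- e \<le> x $ i \<and> x $ i \<le> real n + e" for i
  proof -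
    have "\<bar>(x - y) $ i\<bar> < e" using component_le_norm_cart[of "x - y" i] y by (simp add: dist_norm)
    moreover have "0 < y $ i \<and> y $ i < real n" using y by (simp add: cube_def)
    ultimately show ?thesis by (simp add: abs_less_iff)
  qed
  then show False using assms by (simp add: mem_box_cart)
qed

text \<open>Such an integrand has linear growth and is thus locally bounded on the whole matrix
  space, so that the results above apply with \<open>U = UNIV\<close>. The one-sided inequality is
  for all pairs and hence two-sided.\<close>

locale lipschitz_integrand =
  fixes g :: "real^'d::finite^'m::finite \<Rightarrow> real" and n :: real
  assumes nonneg: "0 \<le> g a" and n0: "0 \<le> n" and lip: "g a \<le> g b + n * norm (a - b)"
begin

abbreviation "W \<equiv> \<lambda>(x :: real^'d) \<zeta>. ennreal (g \<zeta>)"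

definition h :: "real^'d^'m \<Rightarrow> real" where "h \<zeta> = enn2real (homog W \<zeta>)"

lemma lipschitz_continuous:
  assumes "\<And>a b. f a \<le> f b + n * norm (a - b :: real^'d^'m)"
  shows "continuous_on UNIV (f :: _ \<Rightarrow> real)"
proof (rule lipschitz_on_continuous_on[of n], rule lipschitz_onI)
  fix a b
  show "dist (f a) (f b) \<le> n * dist a b"
    using assms[of a b] assms[of b a] by (simp add: dist_real_def dist_norm norm_minus_commute abs_le_iff)
qed (rule n0)

lemma g_measurable [measurable]: "g \<in> borel_measurable borel"
  by (rule borel_measurable_continuous_onI[OF lipschitz_continuous[OF lip]])

lemma periodic: "periodic_integrand W"
proof -
  have "(\<lambda>p :: (real^'d) \<times> (real^'d^'m). g (snd p)) \<in> borel_measurable borel"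
    by (rule borel_measurable_continuous_onI, rule continuous_on_compose2[OF lipschitz_continuous[OF lip]])
       (auto intro: continuous_intros)
  then have "(\<lambda>p :: (real^'d) \<times> (real^'d^'m). ennreal (g (snd p))) \<in> borel_measurable borel"
    by measurable
  then show ?thesis by (simp add: periodic_integrand_def case_prod_unfold)
qed

lemma bounded: "loc_bounded W UNIV"
  unfolding loc_bounded_def
proof (intro conjI allI impI open_UNIV)
  fix K :: "(real^'d^'m) set" assume "compact K"
  then obtain R where R: "\<And>\<zeta>. \<zeta> \<in> K \<Longrightarrow> norm \<zeta> \<le> R" by (meson bounded_iff compact_imp_bounded)
  have "ennreal (g \<zeta>) \<le> ennreal (g 0 + n * R)" if "\<zeta> \<in> K" for \<zeta>
    using lip[of \<zeta> 0] mult_left_mono[OF R[OF that] n0] by (intro ennreal_leI) simp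
  then show "\<exists>M::real. AE x in lborel. \<forall>\<zeta>\<in>K. ennreal (g \<zeta>) \<le> ennreal M"
    by (intro exI[of _ "g 0 + n * R"] AE_I2) blast
qed

lemma homog_eq: "homog W \<zeta> = ennreal (h \<zeta>)"
  unfolding h_def by (rule homog_finite(2)[OF bounded UNIV_I])

lemma h_nonneg: "0 \<le> h \<zeta>"
  by (simp add: h_def)

lemma h_le: "h \<zeta> \<le> g \<zeta>"
proof -
  have "homog W \<zeta> \<le> ennreal (g \<zeta>)" by (rule homog_le_const) simp
  then show ?thesis unfolding homog_eq using nonneg by simp
qed

text \<open>The same test map serves for both slopes; the two energies differ by at most
  \<open>n * norm (a - b)\<close> times the volume.\<close>

lemma h_lipschitz: "h a \<le> h b + n * norm (a - b)"
proof -
  have "homog W a \<le> ennreal (h b + n * norm (a - b)) + ennreal e" if e: "e > 0" for e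
  proof -
    have "homog W b < ennreal (h b + e)" unfolding homog_eq using e h_nonneg by (intro ennreal_lessI) (auto simp: add_nonneg_pos)
    then obtain N where "reach W N b (ennreal (h b + e))" by (rule homog_less_reach)
    then obtain \<phi> G where N: "N \<ge> 1" and p: "grad_pair (cube N) \<phi> G"
      and le: "(\<integral>\<^sup>+x\<in>cube N. ennreal (g (b + G x)) \<partial>lborel) \<le> ennreal (h b + e) * ennreal (real N ^ CARD('d))"
      unfolding reach_def by blast
    have [measurable]: "G \<in> borel_measurable borel" using p by (simp add: grad_pair_def)
    have "(\<integral>\<^sup>+x\<in>cube N. ennreal (g (a + G x)) \<partial>lborel)
      \<le> (\<integral>\<^sup>+x\<in>cube N. ennreal (g (b + G x)) \<partial>lborel) + ennreal n * (\<integral>\<^sup>+x\<in>cube N. ennreal (norm (a + G x - (b + G x))) \<partial>lborel)"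
      by (rule lipschitz_nn_integral_le[OF lip nonneg n0]) measurable
    also have "(\<integral>\<^sup>+x\<in>cube N. ennreal (norm (a + G x - (b + G x))) \<partial>lborel) = ennreal (norm (a - b)) * ennreal (real N ^ CARD('d))"
      using nn_integral_cmult_indicator[of "cube N :: (real^'d) set" lborel "ennreal (norm (a - b))"] by (simp add: emeasure_cube)
    finally have "(\<integral>\<^sup>+x\<in>cube N. ennreal (g (a + G x)) \<partial>lborel)
      \<le> ennreal (h b + e) * ennreal (real N ^ CARD('d)) + ennreal n * (ennreal (norm (a - b)) * ennreal (real N ^ CARD('d)))"
      using le by (meson add_right_mono order_trans)
    also have "\<dots> = (ennreal (h b + n * norm (a - b)) + ennreal e) * ennreal (real N ^ CARD('d))"
      using h_nonneg[of b] n0 e by (simp add: ennreal_mult distrib_right mult.assoc add.assoc add.left_commute add.commute)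
    finally have "reach W N a (ennreal (h b + n * norm (a - b)) + ennreal e)"
      using N p unfolding reach_def by blast
    then show ?thesis by (rule reach_homog_le)
  qed
  then have "homog W a \<le> ennreal (h b + n * norm (a - b))" by (rule ennreal_le_epsilon)
  then show ?thesis
    unfolding homog_eq using ennreal_le_iff[of "h b + n * norm (a - b)" "h a"] h_nonneg[of b] n0
    by (simp add: add_nonneg_nonneg del: ennreal_plus)
qed

lemma h_measurable [measurable]: "h \<in> borel_measurable borel"
  by (rule borel_measurable_continuous_onI[OF lipschitz_continuous[OF h_lipschitz]])

text \<open>The map is mollified to reach the continuously differentiable case, and the Lipschitz
  bound turns closeness of gradients in the mean into closeness of energies.\<close>

lemma h_jensen:
  assumes p: "grad_pair (cube 1) \<phi> G"
  shows "ennreal (h \<xi>) \<le> (\<integral>\<^sup>+x\<in>cube 1. ennreal (h (\<xi> + G x)) \<partial>lborel)"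
proof -
  let ?d = "CARD('d)" and ?C = "cube 1 :: (real^'d) set"
  let ?E = "\<integral>\<^sup>+x\<in>?C. ennreal (h (\<xi> + G x)) \<partial>lborel"
  have Gz: "G x = 0" if "x \<notin> ?C" for x using p that by (simp add: grad_pair_def)
  have [measurable]: "G \<in> borel_measurable borel" using p by (simp add: grad_pair_def)
  have main: "ennreal (h \<xi>) \<le> ?E + ennreal (n * e)" if e: "e > 0" for e
  proof -
    obtain \<phi>' G' where c: "C1_map \<phi>' G'" and z: "\<And>x. ball x e \<inter> ?C = {} \<Longrightarrow> \<phi>' x = 0"
      and le: "(\<integral>\<^sup>+x. ennreal (norm (G' x - G x)) \<partial>lborel) \<le> ennreal e"
      using grad_pair_approx[OF p bounded_cube e] by blast
    have [measurable]: "G' \<in> borel_measurable borel"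
      by (rule borel_measurable_continuous_onI[OF C1_map_gradient_continuous[OF c]])
    \<comment> \<open>The volume of the enlarged cube \<open>B\<close>, whose open sides lie beyond
      the support of the mollified map.\<close>
    define q where "q = (1 + 2*e - (- (2*e))) ^ ?d"
    have q: "q \<ge> 1" unfolding q_def using e by (intro one_le_power) simp
    define B where "B = (box (vec (- (2*e))) (vec (1 + 2*e)) :: (real^'d) set)"
    have [measurable]: "B \<in> sets borel" by (simp add: B_def)
    have mB: "emeasure lborel B = ennreal q"
      unfolding B_def q_def by (rule emeasure_box_const) (use e in simp)
    have CB: "?C \<subseteq> B"
    proof
      fix x assume x: "x \<in> ?C"
      have "- (2*e) < x $ i \<and> x $ i < 1 + 2*e" for i
      proof -
        have "0 < x $ i \<and> x $ i < 1" using x by (simp add: cube_def)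
        then show ?thesis using e by simp
      qed
      then show "x \<in> B" by (simp add: B_def mem_box_cart)
    qed
    have "homog W \<xi> * ennreal q \<le> (\<integral>\<^sup>+x\<in>box (vec (- (2*e))) (vec (1 + 2*e)). homog W (\<xi> + G' x) \<partial>lborel)"
      unfolding q_def
    proof (rule homog_jensen_box[OF periodic bounded c])
      show "compact (cbox (vec (- e)) (vec (1 + e)) :: (real^'d) set)" by simp
      show "cbox (vec (- e)) (vec (1 + e)) \<subseteq> (box (vec (- (2*e))) (vec (1 + 2*e)) :: (real^'d) set)"
      proof
        fix x :: "real^'d" assume x: "x \<in> cbox (vec (- e)) (vec (1 + e))"
        have "- (2*e) < x $ i \<and> x $ i < 1 + 2*e" for i
        proof -
          have "- e \<le> x $ i \<and> x $ i \<le> 1 + e" using x by (simp add: mem_box_cart)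
          then show ?thesis using e by linarith
        qed
        then show "x \<in> box (vec (- (2*e))) (vec (1 + 2*e))" by (simp add: mem_box_cart)
      qed
      show "\<phi>' x = 0" if "x \<notin> cbox (vec (- e)) (vec (1 + e))" for x
        by (rule z, rule ball_cube_disjoint) (use that in simp)
    qed (use e in auto)
    then have "ennreal (h \<xi>) * ennreal q \<le> (\<integral>\<^sup>+x\<in>B. ennreal (h (\<xi> + G' x)) \<partial>lborel)"
      unfolding homog_eq by (simp add: B_def)
    also have "\<dots> \<le> (\<integral>\<^sup>+x\<in>B. ennreal (h (\<xi> + G x)) \<partial>lborel) + ennreal n * (\<integral>\<^sup>+x\<in>B. ennreal (norm (\<xi> + G' x - (\<xi> + G x))) \<partial>lborel)"
      by (rule lipschitz_nn_integral_le[OF h_lipschitz h_nonneg n0]) measurable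
    also have "(\<integral>\<^sup>+x\<in>B. ennreal (norm (\<xi> + G' x - (\<xi> + G x))) \<partial>lborel) \<le> ennreal e"
    proof -
      have "(\<integral>\<^sup>+x\<in>B. ennreal (norm (\<xi> + G' x - (\<xi> + G x))) \<partial>lborel) \<le> (\<integral>\<^sup>+x. ennreal (norm (G' x - G x)) \<partial>lborel)"
        by (intro nn_integral_mono) (simp add: indicator_def)
      then show ?thesis using le by (rule order_trans)
    qed
    also have "(\<integral>\<^sup>+x\<in>B. ennreal (h (\<xi> + G x)) \<partial>lborel) = ?E + ennreal (h \<xi>) * ennreal (q - 1)"
    proof -
      have "(\<integral>\<^sup>+x\<in>B. ennreal (h (\<xi> + G x)) \<partial>lborel)
        = (\<integral>\<^sup>+x. ennreal (h (\<xi> + G x)) * indicator ?C x + ennreal (h \<xi>) * indicator (B - ?C) x \<partial>lborel)"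
        using CB Gz by (intro nn_integral_cong) (auto simp: indicator_def)
      also have "\<dots> = ?E + (\<integral>\<^sup>+x. ennreal (h \<xi>) * indicator (B - ?C) x \<partial>lborel)"
        by (rule nn_integral_add) measurable
      also have "(\<integral>\<^sup>+x. ennreal (h \<xi>) * indicator (B - ?C) x \<partial>lborel) = ennreal (h \<xi>) * emeasure lborel (B - ?C)"
        by (rule nn_integral_cmult_indicator) measurable
      also have "emeasure lborel (B - ?C) = ennreal (q - 1)"
        using CB by (subst emeasure_Diff) (auto simp: mB emeasure_cube ennreal_minus simp flip: ennreal_1)
      finally show ?thesis .
    qed
    finally have 1: "ennreal (h \<xi>) * ennreal q \<le> ?E + ennreal (h \<xi>) * ennreal (q - 1) + ennreal n * ennreal e"
      by (simp add: mult_left_mono)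
    \<comment> \<open>Outside the unit cube \<open>G\<close> vanishes, so that region contributes
      \<open>h \<xi> * (q - 1)\<close> to both sides; the two terms cancel because they are
      finite.\<close>
    have "ennreal (h \<xi>) * ennreal q = ennreal (h \<xi>) * (1 + ennreal (q - 1))"
      using q ennreal_plus[of 1 "q - 1"] by simp
    then have "ennreal (h \<xi>) * ennreal q = ennreal (h \<xi>) + ennreal (h \<xi>) * ennreal (q - 1)"
      by (simp add: distrib_left)
    then have "ennreal (h \<xi>) * ennreal (q - 1) + ennreal (h \<xi>) \<le> ennreal (h \<xi>) * ennreal (q - 1) + (?E + ennreal n * ennreal e)"
      using 1 by (simp add: add.commute add.left_commute)
    then have "ennreal (h \<xi>) \<le> ?E + ennreal n * ennreal e"
      by (subst (asm) ennreal_add_left_cancel_le) (simp add: ennreal_mult_eq_top_iff)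
    then show ?thesis using n0 e by (simp add: ennreal_mult)
  qed
  show ?thesis
  proof (rule ennreal_le_epsilon)
    fix e :: real assume e: "e > 0"
    have "ennreal (h \<xi>) \<le> ?E + ennreal (n * (e / (n + 1)))" using e n0 by (intro main) auto
    also have "\<dots> \<le> ?E + ennreal e"
    proof (intro add_left_mono ennreal_leI)
      have "n * (e / (n + 1)) = e * (n / (n + 1))" by simp
      also have "\<dots> \<le> e * 1" using e n0 by (intro mult_left_mono) (auto simp: divide_le_eq_1)
      finally show "n * (e / (n + 1)) \<le> e" by simp
    qed
    finally show "ennreal (h \<xi>) \<le> ?E + ennreal e" .
  qed
qed

lemma h_quasiconvex: "quasiconvex h"
  unfolding quasiconvex_def
proof (intro conjI allI h_nonneg h_measurable antisym)
  fix \<xi>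
  let ?I = "inf_energy (cube 1 :: (real^'d) set) (\<lambda>x \<zeta>. ennreal (h (\<xi> + \<zeta>)))"
  show "ennreal (h \<xi>) \<le> ?I"
  proof (rule ccontr)
    assume "\<not> ?thesis"
    then have less: "?I < ennreal (h \<xi>)" by simp
    obtain \<phi> G where "grad_pair (cube 1) \<phi> G" "(\<integral>\<^sup>+x\<in>cube 1. ennreal (h (\<xi> + G x)) \<partial>lborel) < ennreal (h \<xi>)"
      by (rule inf_energy_cube_less[OF _ less]) simp_all
    then show False using h_jensen[of \<phi> G \<xi>] by simp
  qed
  have "?I \<le> (\<integral>\<^sup>+x\<in>cube 1. ennreal (h (\<xi> + 0)) \<partial>(lborel :: (real^'d) measure))"
    by (rule inf_energy_cube_le[OF grad_pair_0])
  also have "\<dots> = ennreal (h \<xi>)" by (subst nn_integral_cmult_indicator) (simp_all add: emeasure_cube)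
  finally show "?I \<le> ennreal (h \<xi>)" .
qed

text \<open>An almost optimal map on a large cube is mollified and scaled down to the unit cube. The
  last conclusion controls what mollification spills over the boundary; it makes an estimate of the
  distance to \<open>closure C\<close> on the whole space possible.\<close>

lemma h_less_C1:
  assumes less: "h \<xi> < c" and e: "e > 0"
  obtains \<phi> G where "C1_map \<phi> G" "\<And>x. x \<notin> cbox (vec (- e)) (vec (1 + e)) \<Longrightarrow> \<phi> x = 0"
    "(\<integral>\<^sup>+x\<in>cube 1. ennreal (g (\<xi> + G x)) \<partial>lborel) \<le> ennreal (c + e)"
    "(\<integral>\<^sup>+x\<in>- cube 1. ennreal (norm (G x)) \<partial>lborel) \<le> ennreal e"
proof -
  let ?d = "CARD('d)"
  have c0: "c > 0" using less h_nonneg[of \<xi>] by linarith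
  then have "homog W \<xi> < ennreal c" unfolding homog_eq using less by (rule ennreal_lessI)
  then obtain N where "reach W N \<xi> (ennreal c)" by (rule homog_less_reach)
  then obtain \<phi> G where N: "N \<ge> 1" and p: "grad_pair (cube N) \<phi> G"
    and le: "(\<integral>\<^sup>+x\<in>cube N. ennreal (g (\<xi> + G x)) \<partial>lborel) \<le> ennreal c * ennreal (real N ^ ?d)"
    unfolding reach_def by blast
  \<comment> \<open>Chosen so that both \<open>s\<close> itself, which bounds the spill, and
    \<open>n * s\<close>, which bounds the change in energy, are at most \<open>e\<close>.\<close>
  define s where "s = e / (n + 1)"
  have s: "s > 0" "s \<le> e" "n * s \<le> e"
  proof -
    show "s > 0" using e n0 by (simp add: s_def)
    have "e / (n + 1) \<le> e / 1" using e n0 by (intro divide_left_mono) auto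
    then show "s \<le> e" by (simp add: s_def)
    have "n * s = e * (n / (n + 1))" by (simp add: s_def)
    also have "\<dots> \<le> e * 1" using e n0 by (intro mult_left_mono) (auto simp: divide_le_eq_1)
    finally show "n * s \<le> e" by simp
  qed
  obtain \<phi>' G' where c': "C1_map \<phi>' G'" and z: "\<And>x. ball x s \<inter> cube N = {} \<Longrightarrow> \<phi>' x = 0"
    and L1: "(\<integral>\<^sup>+x. ennreal (norm (G' x - G x)) \<partial>lborel) \<le> ennreal s"
    using grad_pair_approx[OF p bounded_cube s(1)] by blast
  have [measurable]: "G' \<in> borel_measurable borel"
    by (rule borel_measurable_continuous_onI[OF C1_map_gradient_continuous[OF c']])
  have [measurable]: "G \<in> borel_measurable borel" using p by (simp add: grad_pair_def)
  have N0: "real N > 0" "real N \<noteq> 0" using N by auto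
  \<comment> \<open>Since the volume of the large cube is at least 1, absolute errors may be
    replaced by errors per volume.\<close>
  have Nd: "ennreal (real N ^ ?d) \<ge> 1" using N by simp
  have Nc: "real N *\<^sub>R x \<in> cube N \<longleftrightarrow> x \<in> cube 1" for x :: "real^'d"
    using N0 by (simp add: cube_def zero_less_mult_iff)
  have cancel: "a \<le> b" if "ennreal (real N ^ ?d) * a \<le> ennreal (real N ^ ?d) * b" for a b
    using that N0 by (subst (asm) ennreal_mult_le_mult_iff) auto
  have scale: "(\<integral>\<^sup>+x. F x \<partial>lborel) = ennreal (real N ^ ?d) * (\<integral>\<^sup>+x. F (0 + real N *\<^sub>R x) \<partial>lborel)"
    if "F \<in> borel_measurable borel" for F :: "real^'d \<Rightarrow> ennreal"
    using lborel_nn_integral_affine[OF that N0(2), of 0] by simp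
  show ?thesis
  proof (rule that)
    show "C1_map (\<lambda>x. (1 / real N) *\<^sub>R \<phi>' (0 + real N *\<^sub>R x)) (\<lambda>x. G' (0 + real N *\<^sub>R x))"
      by (rule C1_map_scale[OF c' N0(2)])
    show "(1 / real N) *\<^sub>R \<phi>' (0 + real N *\<^sub>R x) = 0" if x: "x \<notin> cbox (vec (- e)) (vec (1 + e))" for x
    proof -
      have "real N *\<^sub>R x \<notin> cbox (vec (- s)) (vec (real N + s))"
      proof
        assume a: "real N *\<^sub>R x \<in> cbox (vec (- s)) (vec (real N + s))"
        have "- e \<le> x $ i \<and> x $ i \<le> 1 + e" for i
        proof -
          have "- s \<le> real N * x $ i" "real N * x $ i \<le> real N + s" using a by (simp_all add: mem_box_cart)
          moreover have "s \<le> real N * e" using s e N mult_mono[of 1 "real N" s e] by auto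
          ultimately have "real N * (- e) \<le> real N * x $ i" "real N * x $ i \<le> real N * (1 + e)"
            by (simp_all add: distrib_left)
          then show ?thesis unfolding mult_le_cancel_left_pos[OF N0(1)] ..
        qed
        then show False using x by (simp add: mem_box_cart)
      qed
      then show ?thesis by (simp add: z[OF ball_cube_disjoint])
    qed
    have L1N: "(\<integral>\<^sup>+x\<in>cube N. ennreal (norm (\<xi> + G' x - (\<xi> + G x))) \<partial>lborel) \<le> ennreal s"
      by (rule order_trans[OF nn_integral_mono L1]) (simp add: indicator_def)
    have "(\<integral>\<^sup>+x\<in>cube N. ennreal (g (\<xi> + G' x)) \<partial>lborel)
      \<le> (\<integral>\<^sup>+x\<in>cube N. ennreal (g (\<xi> + G x)) \<partial>lborel) + ennreal n * (\<integral>\<^sup>+x\<in>cube N. ennreal (norm (\<xi> + G' x - (\<xi> + G x))) \<partial>lborel)"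
      by (rule lipschitz_nn_integral_le[OF lip nonneg n0]) measurable
    also have "\<dots> \<le> ennreal c * ennreal (real N ^ ?d) + ennreal n * ennreal s"
      by (intro add_mono le mult_left_mono L1N) simp
    also have "ennreal n * ennreal s \<le> ennreal e" using s n0 by (simp flip: ennreal_mult)
    also have "ennreal e \<le> ennreal e * ennreal (real N ^ ?d)" using mult_left_mono[OF Nd, of "ennreal e"] by simp
    also have "ennreal c * ennreal (real N ^ ?d) + ennreal e * ennreal (real N ^ ?d) = ennreal (real N ^ ?d) * ennreal (c + e)"
      using c0 e by (simp add: distrib_left distrib_right mult.commute)
    finally have A: "(\<integral>\<^sup>+x\<in>cube N. ennreal (g (\<xi> + G' x)) \<partial>lborel) \<le> ennreal (real N ^ ?d) * ennreal (c + e)"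
      by (simp add: add_left_mono)
    have "(\<integral>\<^sup>+x\<in>cube N. ennreal (g (\<xi> + G' x)) \<partial>lborel)
      = ennreal (real N ^ ?d) * (\<integral>\<^sup>+x. ennreal (g (\<xi> + G' (0 + real N *\<^sub>R x))) * indicator (cube N) (0 + real N *\<^sub>R x) \<partial>lborel)"
      by (rule scale) measurable
    also have "(\<lambda>x. ennreal (g (\<xi> + G' (0 + real N *\<^sub>R x))) * indicator (cube N) (0 + real N *\<^sub>R x :: real^'d))
      = (\<lambda>x. ennreal (g (\<xi> + G' (0 + real N *\<^sub>R x))) * indicator (cube 1) x)"
      by (rule ext) (simp add: indicator_def Nc)
    finally have eqA: "(\<integral>\<^sup>+x\<in>cube N. ennreal (g (\<xi> + G' x)) \<partial>lborel)
      = ennreal (real N ^ ?d) * (\<integral>\<^sup>+x\<in>cube 1. ennreal (g (\<xi> + G' (0 + real N *\<^sub>R x))) \<partial>lborel)" .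
    show "(\<integral>\<^sup>+x\<in>cube 1. ennreal (g (\<xi> + G' (0 + real N *\<^sub>R x))) \<partial>lborel) \<le> ennreal (c + e)"
      by (rule cancel[OF A[unfolded eqA]])
    have "(\<integral>\<^sup>+x\<in>- cube N. ennreal (norm (G' x)) \<partial>lborel) \<le> (\<integral>\<^sup>+x. ennreal (norm (G' x - G x)) \<partial>lborel)"
      using p by (intro nn_integral_mono) (auto simp: indicator_def grad_pair_def)
    also have "\<dots> \<le> ennreal e * ennreal (real N ^ ?d)"
      by (rule order_trans[OF L1 order_trans[OF ennreal_leI[OF s(2)]]])
         (use mult_left_mono[OF Nd, of "ennreal e"] in simp)
    finally have B: "(\<integral>\<^sup>+x\<in>- cube N. ennreal (norm (G' x)) \<partial>lborel) \<le> ennreal (real N ^ ?d) * ennreal e"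
      by (simp add: mult.commute)
    have "(\<integral>\<^sup>+x\<in>- cube N. ennreal (norm (G' x)) \<partial>lborel)
      = ennreal (real N ^ ?d) * (\<integral>\<^sup>+x. ennreal (norm (G' (0 + real N *\<^sub>R x))) * indicator (- cube N) (0 + real N *\<^sub>R x) \<partial>lborel)"
      by (rule scale) measurable
    also have "(\<lambda>x. ennreal (norm (G' (0 + real N *\<^sub>R x))) * indicator (- cube N) (0 + real N *\<^sub>R x :: real^'d))
      = (\<lambda>x. ennreal (norm (G' (0 + real N *\<^sub>R x))) * indicator (- cube 1) x)"
      by (rule ext) (simp add: indicator_def Nc)
    finally have eqB: "(\<integral>\<^sup>+x\<in>- cube N. ennreal (norm (G' x)) \<partial>lborel)
      = ennreal (real N ^ ?d) * (\<integral>\<^sup>+x\<in>- cube 1. ennreal (norm (G' (0 + real N *\<^sub>R x))) \<partial>lborel)" .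
    show "(\<integral>\<^sup>+x\<in>- cube 1. ennreal (norm (G' (0 + real N *\<^sub>R x))) \<partial>lborel) \<le> ennreal e"
      by (rule cancel[OF B[unfolded eqB]])
  qed
qed

end

subsection \<open>Truncation of gradients\<close>

lemma derivative_norm_le_one:
  fixes f :: "'a::euclidean_space \<Rightarrow> real"
  assumes der: "(f has_derivative (\<lambda>h. a \<bullet> h)) (at x)" and lip: "\<And>y z. \<bar>f y - f z\<bar> \<le> norm (y - z)"
  shows "norm a \<le> 1"
proof (rule field_le_epsilon)
  fix e :: real assume e: "e > 0"
  show "norm a \<le> 1 + e"
  proof (cases "a = 0")
    case False
    obtain d where d: "d > 0" "\<And>y. norm (y - x) < d \<Longrightarrow> norm (f y - f x - a \<bullet> (y - x)) \<le> e * norm (y - x)"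
      using der e unfolding has_derivative_at_alt by blast
    \<comment> \<open>The increment along \<open>a\<close> itself is tested, because in that
      direction the derivative attains its norm.\<close>
    define t where "t = d / (2 * norm a)"
    have t: "t > 0" "t * norm a < d" using d(1) False by (simp_all add: t_def)
    let ?y = "x + t *\<^sub>R a"
    have n: "norm (?y - x) = t * norm a" using t by simp
    have "norm (?y - x) < d" unfolding n by (rule t(2))
    then have "\<bar>f ?y - f x - a \<bullet> (?y - x)\<bar> \<le> e * (t * norm a)"
      unfolding n[symmetric] real_norm_def[symmetric] by (rule d(2))
    moreover have "\<bar>f ?y - f x\<bar> \<le> t * norm a" unfolding n[symmetric] by (rule lip)
    ultimately have "a \<bullet> (?y - x) \<le> t * norm a + e * (t * norm a)" by linarith
    moreover have "a \<bullet> (?y - x) = (t * norm a) * norm a" by (simp add: power2_norm_eq_inner[symmetric] power2_eq_square)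
    moreover have "(t * norm a) * (1 + e) = t * norm a + e * (t * norm a)" by (simp add: algebra_simps)
    ultimately have "(t * norm a) * norm a \<le> (t * norm a) * (1 + e)" by linarith
    moreover have "0 < t * norm a" using t False by simp
    ultimately show ?thesis by (simp only: mult_le_cancel_left_pos)
  qed (use e in simp)
qed

text \<open>With the shift moved from the kernel to the function, a convolution is an average of
  translates of \<open>D\<close>, and these share its Lipschitz constant.\<close>

lemma mollify_lipschitz:
  fixes D :: "real^'d::finite \<Rightarrow> real"
  assumes m: "mollifier \<tau> \<eta>" and i: "integrable lborel D" and lip: "\<And>y z. \<bar>D y - D z\<bar> \<le> norm (y - z)"
  shows "\<bar>mollify \<eta> D x - mollify \<eta> D x'\<bar> \<le> norm (x - x')"
proof -
  note \<eta> = mollifierD[OF m]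
  have [measurable]: "\<eta> \<in> borel_measurable borel"
    by (rule borel_measurable_continuous_onI[OF test_function_continuous[OF \<eta>(1)]])
  have [measurable]: "D \<in> borel_measurable borel" using i by auto
  have eq: "mollify \<eta> D x = (\<integral>z. \<eta> z * D (x - z) \<partial>lborel)" and ii: "integrable lborel (\<lambda>z. \<eta> z * D (x - z))" for x
  proof -
    have fm: "(\<lambda>z. \<eta> z * D (x - z)) \<in> borel_measurable borel" by measurable
    show "mollify \<eta> D x = (\<integral>z. \<eta> z * D (x - z) \<partial>lborel)"
      using lborel_integral_reflect(1)[OF fm, of x] by (simp add: mollify_def)
    show "integrable lborel (\<lambda>z. \<eta> z * D (x - z))"
      using lborel_integral_reflect(2)[OF fm, of x] mollify_integrable_test[OF i \<eta>(1), of x] by simp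
  qed
  have "mollify \<eta> D x - mollify \<eta> D x' = (\<integral>z. \<eta> z * (D (x - z) - D (x' - z)) \<partial>lborel)"
    unfolding eq using ii by (simp add: right_diff_distrib)
  then have "\<bar>mollify \<eta> D x - mollify \<eta> D x'\<bar> \<le> (\<integral>z. \<bar>\<eta> z * (D (x - z) - D (x' - z))\<bar> \<partial>lborel)"
    by (simp add: integral_abs_bound)
  also have "\<dots> \<le> (\<integral>z. \<eta> z * norm (x - x') \<partial>lborel)"
  proof (rule integral_mono_AE')
    show "integrable lborel (\<lambda>z. \<eta> z * norm (x - x'))" using test_function_integrable[OF \<eta>(1)] by simp
    show "AE z in lborel. \<bar>\<eta> z * (D (x - z) - D (x' - z))\<bar> \<le> \<eta> z * norm (x - x')"
    proof (rule AE_I2)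
      fix z
      have "\<bar>D (x - z) - D (x' - z)\<bar> \<le> norm (x - x')" using lip[of "x - z" "x' - z"] by simp
      then show "\<bar>\<eta> z * (D (x - z) - D (x' - z))\<bar> \<le> \<eta> z * norm (x - x')"
        using \<eta>(2)[of z] by (simp add: abs_mult mult_left_mono)
    qed
  qed (use \<eta>(2) in auto)
  also have "\<dots> = norm (x - x')" using \<eta>(4) by simp
  finally show ?thesis .
qed

section \<open>The maximal function\<close>

text \<open>The weak-type estimate of Hardy and Littlewood by Vitali covering: \<open>B\<close> is
  the union of the fivefold enlargements of disjoint balls on which the mean of \<open>f\<close> is
  too large. Since the threshold is \<open>l * r ^ CARD('d)\<close> and not a multiple of the volume
  of the ball, \<open>unit_ball_vol\<close> appears in the bound.\<close>

lemma maximal_function_bound: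
  fixes f :: "real^'d::finite \<Rightarrow> real"
  assumes f [measurable]: "f \<in> borel_measurable borel" and fJ: "(\<integral>\<^sup>+x. ennreal (f x) \<partial>lborel) \<le> ennreal J" and J: "0 \<le> J" and l: "0 < l"
  obtains B :: "(real^'d) set" where "open B"
    "emeasure lborel B \<le> ennreal (unit_ball_vol (real CARD('d)) * 5 ^ CARD('d) * J / l)"
    "\<And>x r. x \<notin> B \<Longrightarrow> 0 < r \<Longrightarrow> (\<integral>\<^sup>+y\<in>ball x r. ennreal (f y) \<partial>lborel) \<le> ennreal (l * r ^ CARD('d))"
proof -
  let ?d = "CARD('d)" and ?w = "unit_ball_vol (real CARD('d))"
  define \<nu> where "\<nu> = density lborel (\<lambda>x. ennreal (f x))"
  have \<nu>: "emeasure \<nu> A = (\<integral>\<^sup>+y\<in>A. ennreal (f y) \<partial>lborel)" if "A \<in> sets borel" for A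
    unfolding \<nu>_def using that by (simp add: emeasure_density)
  have \<nu>s: "sets \<nu> = sets borel" by (simp add: \<nu>_def)
  define K :: "((real^'d) \<times> real) set" where "K = {(x, r). 0 < r \<and> ennreal (l * r ^ ?d) < emeasure \<nu> (ball x r)}"
  have tot: "emeasure \<nu> A \<le> ennreal J" if "A \<in> sets borel" for A
  proof -
    have "emeasure \<nu> A \<le> (\<integral>\<^sup>+y. ennreal (f y) \<partial>lborel)"
      unfolding \<nu>[OF that] by (intro nn_integral_mono) (simp add: indicator_def)
    then show ?thesis using fJ by (rule order_trans)
  qed
  \<comment> \<open>The covering lemma needs bounded radii: a radius of at least 1 is at most
    \<open>J / l\<close>, because the whole mass is at most \<open>J\<close>.\<close>
  have bnd: "0 < snd i \<and> snd i \<le> max 1 (J / l)" if "i \<in> K" for i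
  proof -
    obtain x r where i: "i = (x, r)" by (cases i)
    have r: "0 < r" "ennreal (l * r ^ ?d) < emeasure \<nu> (ball x r)" using that by (auto simp: K_def i)
    have "ennreal (l * r ^ ?d) < ennreal J" using r(2) tot[of "ball x r"] by (simp add: less_le_trans)
    then have "l * r ^ ?d < J" using r l by (simp add: ennreal_less_iff)
    have "r \<le> J / l" if "r \<ge> 1"
    proof -
      have "l * r \<le> l * r ^ ?d" using that l by (intro mult_left_mono self_le_power) auto
      then have "r * l \<le> J" using \<open>l * r ^ ?d < J\<close> by (simp add: mult.commute)
      then show ?thesis using l by (simp add: pos_le_divide_eq)
    qed
    then show ?thesis using r i by (cases "r \<ge> 1") auto
  qed
  obtain C where C: "countable C" "C \<subseteq> K"
     "pairwise (\<lambda>i j. disjnt (cball (fst i) (snd i)) (cball (fst j) (snd j))) C"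
     "\<And>i. i \<in> K \<Longrightarrow> \<exists>j. j \<in> C \<and> \<not> disjnt (cball (fst i) (snd i)) (cball (fst j) (snd j)) \<and>
                        cball (fst i) (snd i) \<subseteq> ball (fst j) (5 * snd j)"
    by (rule Vitali_covering_lemma_cballs_balls[where K = K and r = snd and a = fst and B = "max 1 (J / l)"], erule bnd, rule that)
  define B where "B = (\<Union>j\<in>C. ball (fst j) (5 * snd j))"
  let ?t = "to_nat_on C"
  define A where "A n = (if n \<in> ?t ` C then ball (fst (from_nat_into C n)) (5 * snd (from_nat_into C n)) else {})" for n
  define E where "E n = (if n \<in> ?t ` C then ball (fst (from_nat_into C n)) (snd (from_nat_into C n)) else {})" for n
  have BA: "B = (\<Union>n. A n)"
  proof
    show "B \<subseteq> (\<Union>n. A n)"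
    proof
      fix x assume "x \<in> B"
      then obtain j where j: "j \<in> C" "x \<in> ball (fst j) (5 * snd j)" by (auto simp: B_def)
      then have "x \<in> A (?t j)" using C(1) by (simp add: A_def)
      then show "x \<in> (\<Union>n. A n)" by blast
    qed
    show "(\<Union>n. A n) \<subseteq> B"
    proof
      fix x assume "x \<in> (\<Union>n. A n)"
      then obtain n where "x \<in> A n" by blast
      then obtain j where "j \<in> C" "x \<in> ball (fst j) (5 * snd j)"
        using C(1) by (auto simp: A_def split: if_splits)
      then show "x \<in> B" unfolding B_def by blast
    qed
  qed
  have disj: "disjoint_family E"
    unfolding disjoint_family_on_def
  proof (intro ballI impI)
    fix m n :: nat assume mn: "m \<noteq> n"
    show "E m \<inter> E n = {}"
    proof (cases "m \<in> ?t ` C \<and> n \<in> ?t ` C")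
      case True
      then obtain i j where ij: "i \<in> C" "j \<in> C" "m = ?t i" "n = ?t j" by blast
      then have "i \<noteq> j" using mn by auto
      then have "disjnt (cball (fst i) (snd i)) (cball (fst j) (snd j))"
        using C(3) ij unfolding pairwise_def by blast
      moreover have "E m = ball (fst i) (snd i)" "E n = ball (fst j) (snd j)"
        using ij C(1) by (auto simp: E_def)
      ultimately show ?thesis unfolding disjnt_def using ball_subset_cball by blast
    qed (auto simp: E_def)
  qed
  have le: "emeasure lborel (A n) \<le> ennreal (?w * 5 ^ ?d / l) * emeasure \<nu> (E n)" for n
  proof (cases "n \<in> ?t ` C")
    case True
    then obtain j where j: "j \<in> C" "n = ?t j" by blast
    then have jK: "0 < snd j" "ennreal (l * snd j ^ ?d) < emeasure \<nu> (ball (fst j) (snd j))"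
      using C(2) by (auto simp: K_def)
    have e: "A n = ball (fst j) (5 * snd j)" "E n = ball (fst j) (snd j)" using j C(1) by (auto simp: A_def E_def)
    have "emeasure lborel (A n) = ennreal (?w * (5 * snd j) ^ ?d)"
      unfolding e using jK(1) by (subst emeasure_ball) auto
    also have "\<dots> = ennreal ((?w * 5 ^ ?d / l) * (l * snd j ^ ?d))" using l by (simp add: power_mult_distrib)
    also have "\<dots> = ennreal (?w * 5 ^ ?d / l) * ennreal (l * snd j ^ ?d)"
      using l jK(1) by (intro ennreal_mult) auto
    also have "\<dots> \<le> ennreal (?w * 5 ^ ?d / l) * emeasure \<nu> (E n)"
      unfolding e using jK(2) by (intro mult_left_mono) auto
    finally show ?thesis .
  qed (simp add: A_def)
  have Em: "range E \<subseteq> sets \<nu>" unfolding \<nu>s by (auto simp: E_def)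
  have "emeasure lborel B \<le> (\<Sum>n. emeasure lborel (A n))"
    unfolding BA by (rule emeasure_subadditive_countably) (auto simp: A_def)
  also have "\<dots> \<le> (\<Sum>n. ennreal (?w * 5 ^ ?d / l) * emeasure \<nu> (E n))"
    by (intro suminf_le le) auto
  also have "\<dots> = ennreal (?w * 5 ^ ?d / l) * emeasure \<nu> (\<Union>n. E n)"
    by (simp add: ennreal_suminf_cmult suminf_emeasure[OF Em disj])
  also have "\<dots> \<le> ennreal (?w * 5 ^ ?d / l) * ennreal J"
    using Em unfolding \<nu>s by (intro mult_left_mono tot) auto
  also have "\<dots> = ennreal (?w * 5 ^ ?d * J / l)"
    using l J by (subst ennreal_mult[symmetric]) auto
  finally have mB: "emeasure lborel B \<le> ennreal (?w * 5 ^ ?d * J / l)" .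
  show ?thesis
  proof (rule that[OF _ mB])
    show "open B" unfolding B_def by (intro open_UN ballI open_ball)
    fix x r assume x: "x \<notin> B" and r: "0 < (r::real)"
    show "(\<integral>\<^sup>+y\<in>ball x r. ennreal (f y) \<partial>lborel) \<le> ennreal (l * r ^ ?d)"
    proof (rule ccontr)
      assume "\<not> ?thesis"
      then have "(x, r) \<in> K" using r by (simp add: K_def \<nu> not_le)
      then obtain j where "j \<in> C" "cball x r \<subseteq> ball (fst j) (5 * snd j)" using C(4) by fastforce
      then have "x \<in> B" using r unfolding B_def by force
      then show False using x by simp
    qed
  qed
qed

section \<open>Averages over cubes of variable size\<close>

abbreviation ucube :: "(real^'d::finite) set" where "ucube \<equiv> cbox (vec (-(1/2))) (vec (1/2))"

lemma content_ucube: "measure lborel (ucube :: (real^'d::finite) set) = 1"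
  using emeasure_box_const(2)[of "-(1/2)" "1/2", where 'd = 'd] by (simp add: measure_def)

lemma norm_ucube: "x \<in> ucube \<Longrightarrow> norm (x :: real^'d::finite) \<le> real CARD('d) / 2"
proof -
  assume x: "x \<in> ucube"
  have "\<bar>x $ i\<bar> \<le> 1/2" for i
  proof -
    have "-(1/2) \<le> x $ i \<and> x $ i \<le> 1/2" using x by (simp add: mem_box_cart)
    then show ?thesis by linarith
  qed
  then have "(\<Sum>i\<in>UNIV. \<bar>x $ i\<bar>) \<le> (\<Sum>i\<in>(UNIV::'d set). 1/2)" by (intro sum_mono)
  then show "norm x \<le> real CARD('d) / 2" using norm_le_l1_cart[of x] by simp
qed

lemma integral_ucube_const: "integral ucube (\<lambda>z :: real^'d::finite. c) = (c :: 'b::euclidean_space)"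
  by (simp add: content_ucube)

lemma integral_ucube_add_const:
  fixes F :: "real^'d::finite \<Rightarrow> 'b::euclidean_space"
  assumes "continuous_on ucube F"
  shows "integral ucube (\<lambda>z. c + F z) = c + integral ucube F"
  using Henstock_Kurzweil_Integration.integral_add[OF integrable_continuous[OF continuous_on_const[of _ c]] integrable_continuous[OF assms]]
  by (simp only: integral_ucube_const)

lemma integral_ucube_norm_le:
  fixes F :: "real^'d::finite \<Rightarrow> 'b::euclidean_space"
  assumes "continuous_on ucube F" "continuous_on ucube p" "\<And>z. z \<in> ucube \<Longrightarrow> norm (F z) \<le> p z"
  shows "norm (integral ucube F) \<le> integral ucube p"
  by (rule Henstock_Kurzweil_Integration.integral_norm_bound_integral) (use assms in \<open>auto intro: integrable_continuous\<close>)

text \<open>Otherwise a hyperplane separates the average strictly from \<open>S\<close>; integrating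
  the linear functional over the cube of volume 1 gives a contradiction.\<close>

lemma integral_ucube_in_closed_convex:
  fixes F :: "real^'d::finite \<Rightarrow> 'b::euclidean_space"
  assumes F: "continuous_on ucube F" "\<And>z. z \<in> ucube \<Longrightarrow> F z \<in> S" and S: "convex S" "closed S"
  shows "integral ucube F \<in> S"
proof (rule ccontr)
  assume "integral ucube F \<notin> S"
  then obtain a b where ab: "a \<bullet> integral ucube F < b" "\<And>x. x \<in> S \<Longrightarrow> b < a \<bullet> x"
    using separating_hyperplane_closed_point[OF S] by blast
  have i: "F integrable_on ucube" by (rule integrable_continuous[OF F(1)])
  have "b = integral ucube (\<lambda>z :: real^'d. b)" by (simp add: content_ucube)
  also have "\<dots> \<le> integral ucube (\<lambda>z. a \<bullet> F z)"
    by (rule integral_le) (use F ab(2) in \<open>auto intro!: integrable_continuous continuous_intros intro: less_imp_le\<close>)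
  also have "\<dots> = a \<bullet> integral ucube F"
    using integral_linear[OF i bounded_linear_inner_right, of a] by (simp add: o_def)
  finally show False using ab(1) by simp
qed

text \<open>Jensen's inequality for the distance to a convex set: the average of the nearest points
  lies in \<open>S\<close> and can be compared with the average of the values.\<close>

lemma infdist_integral_ucube_le:
  fixes F :: "real^'d::finite \<Rightarrow> 'b::euclidean_space"
  assumes F: "continuous_on ucube F" and S: "convex S" "closed S" "S \<noteq> {}"
  shows "infdist (integral ucube F) S \<le> integral ucube (\<lambda>z. infdist (F z) S)"
proof -
  let ?P = "\<lambda>z. closest_point S (F z)"
  have Pc: "continuous_on ucube ?P"
    by (rule continuous_on_compose2[OF continuous_on_closest_point[OF S, of UNIV] F]) auto
  have y: "integral ucube ?P \<in> S"
    by (rule integral_ucube_in_closed_convex[OF Pc _ S(1,2)]) (rule closest_point_in_set[OF S(2,3)])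
  have le: "norm (F z - ?P z) \<le> infdist (F z) S" for z
    unfolding infdist_notempty[OF S(3)] using closest_point_le[OF S(2)]
    by (intro cINF_greatest S(3)) (simp add: dist_norm)
  have "infdist (integral ucube F) S \<le> dist (integral ucube F) (integral ucube ?P)" by (rule infdist_le[OF y])
  also have "\<dots> = norm (integral ucube (\<lambda>z. F z - ?P z))"
    by (simp add: dist_norm Henstock_Kurzweil_Integration.integral_diff integrable_continuous F Pc)
  also have "\<dots> \<le> integral ucube (\<lambda>z. infdist (F z) S)"
    by (rule integral_ucube_norm_le) (use F Pc le in \<open>auto intro!: continuous_intros\<close>)
  finally show ?thesis .
qed

text \<open>The link between the gauge integral, in which averages are written, and the Lebesgue
  integral of the maximal estimate; the averaging cube is enclosed in a set \<open>S\<close> of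
  controlled mass.\<close>

lemma integral_ucube_average_le:
  fixes f :: "real^'d::finite \<Rightarrow> real"
  assumes f: "continuous_on UNIV f" "\<And>x. 0 \<le> f x" and r: "0 < r"
    and sub: "\<And>z. z \<in> ucube \<Longrightarrow> x + r *\<^sub>R z \<in> S" and S: "S \<in> sets borel"
    and le: "(\<integral>\<^sup>+y\<in>S. ennreal (f y) \<partial>lborel) \<le> ennreal (e * r ^ CARD('d))" and e: "0 \<le> e"
  shows "integral ucube (\<lambda>z. f (x + r *\<^sub>R z)) \<le> e"
proof -
  let ?F = "\<lambda>z. f (x + r *\<^sub>R z)"
  have [measurable]: "f \<in> borel_measurable borel" by (rule borel_measurable_continuous_onI[OF f(1)])
  have Fc: "continuous_on ucube ?F" by (intro continuous_on_compose2[OF f(1)] continuous_intros) auto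
  have "ennreal (integral ucube ?F) = (\<integral>\<^sup>+z\<in>ucube. ennreal (?F z) \<partial>lborel)"
    using nn_integral_has_integral_lebesgue'[of ucube ?F] f(2) integrable_integral[OF integrable_continuous[OF Fc]] by simp
  also have "ennreal (r ^ CARD('d)) * \<dots> \<le> ennreal (r ^ CARD('d)) * (\<integral>\<^sup>+z. ennreal (?F z) * indicator S (x + r *\<^sub>R z) \<partial>lborel)"
    by (intro mult_left_mono nn_integral_mono) (use sub in \<open>auto simp: indicator_def\<close>)
  also have "\<dots> = (\<integral>\<^sup>+y\<in>S. ennreal (f y) \<partial>lborel)"
    using lborel_nn_integral_affine[of "\<lambda>y. ennreal (f y) * indicator S y" r x] r S by simp
  finally have "ennreal (r ^ CARD('d)) * ennreal (integral ucube ?F) \<le> ennreal (e * r ^ CARD('d))"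
    using le by simp
  moreover have "0 \<le> integral ucube ?F" using f(2) by (intro integral_nonneg integrable_continuous Fc) auto
  ultimately have "r ^ CARD('d) * integral ucube ?F \<le> r ^ CARD('d) * e"
    using r e by (simp add: mult.commute flip: ennreal_mult)
  then show ?thesis using r by simp
qed

text \<open>Differentiation under the integral sign. The \<open>outer\<close> term arises because
  the size \<open>r x\<close> of the cube varies with \<open>x\<close>; it is small when the
  gradient of \<open>r\<close> is.\<close>

lemma C1_map_variable_average:
  fixes \<phi> :: "real^'d::finite \<Rightarrow> real^'m::finite" and r :: "real^'d \<Rightarrow> real"
  assumes c: "C1_map \<phi> G" and r: "\<And>x. (r has_derivative (\<lambda>h. gr x \<bullet> h)) (at x)" and gr: "continuous_on UNIV gr"
  defines "M \<equiv> \<lambda>x z. G (x + r x *\<^sub>R z) + outer (G (x + r x *\<^sub>R z) *v z) (gr x)"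
  shows "C1_map (\<lambda>x. integral ucube (\<lambda>z. \<phi> (x + r x *\<^sub>R z))) (\<lambda>x. integral ucube (M x))"
    "continuous_on ucube (M x)"
proof -
  have Gc: "continuous_on UNIV G" and \<phi>c: "continuous_on UNIV \<phi>"
    by (rule C1_map_gradient_continuous[OF c], rule C1_map_continuous[OF c])
  have rc: "continuous_on UNIV r"
    using r by (intro continuous_at_imp_continuous_on ballI has_derivative_continuous) auto
  have c1: "continuous_on UNIV (\<lambda>p :: (real^'d) \<times> (real^'d). fst p + r (fst p) *\<^sub>R snd p)"
    by (intro continuous_intros continuous_on_compose2[OF rc]) auto
  have GP: "continuous_on UNIV (\<lambda>p :: (real^'d) \<times> (real^'d). G (fst p + r (fst p) *\<^sub>R snd p))"
    by (rule continuous_on_compose2[OF Gc c1]) auto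
  have mv: "continuous_on UNIV (\<lambda>p :: (real^'d) \<times> (real^'d). G (fst p + r (fst p) *\<^sub>R snd p) *v snd p)"
    unfolding matrix_vector_mult_def by (intro continuous_intros GP)
  have Mc: "continuous_on UNIV (\<lambda>p. M (fst p) (snd p))"
    unfolding M_def
    by (intro continuous_on_add GP continuous_on_outer mv continuous_on_compose2[OF gr continuous_on_fst[OF continuous_on_id]]) auto
  have Mc': "continuous_on (UNIV \<times> ucube) (\<lambda>(x, z). M x z)"
    using continuous_on_subset[OF Mc] by (simp add: case_prod_unfold)
  show Mx: "continuous_on ucube (M x)" for x
  proof -
    have "continuous_on ucube (\<lambda>z. (x, z))" by (intro continuous_intros)
    then show ?thesis using continuous_on_compose2[OF Mc, of ucube "\<lambda>z. (x, z)"] by simp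
  qed
  \<comment> \<open>The rule for differentiating under the integral works with bounded linear
    functions; \<open>T\<close> transports matrices there, and being linear it commutes with the
    integral.\<close>
  define T :: "real^'d^'m \<Rightarrow> ((real^'d) \<Rightarrow>\<^sub>L (real^'m))" where "T A = Blinfun (\<lambda>h. A *v h)" for A
  have T: "blinfun_apply (T A) h = A *v h" for A h
    unfolding T_def by (simp add: bounded_linear_Blinfun_apply matrix_vector_mul_bounded_linear)
  have "linear T"
    by (rule linearI) (auto intro!: blinfun_eqI simp: T matrix_vector_mult_add_rdistrib scaleR_matrix_vector_assoc
        blinfun.add_left blinfun.scaleR_left)
  then have Tb: "bounded_linear T" by (simp add: linear_conv_bounded_linear)
  have der: "((\<lambda>x. \<phi> (x + r x *\<^sub>R z)) has_derivative (\<lambda>h. M x z *v h)) (at x)" for x z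
  proof -
    have "((\<lambda>x. x + r x *\<^sub>R z) has_derivative (\<lambda>h. h + (gr x \<bullet> h) *\<^sub>R z)) (at x)"
      by (intro has_derivative_add has_derivative_ident has_derivative_scaleR_left r)
    then have "((\<lambda>x. \<phi> (x + r x *\<^sub>R z)) has_derivative (\<lambda>h. G (x + r x *\<^sub>R z) *v (h + (gr x \<bullet> h) *\<^sub>R z))) (at x)"
      by (rule has_derivative_compose[OF _ C1_map_has_derivative[OF c]])
    moreover have "G (x + r x *\<^sub>R z) *v (h + (gr x \<bullet> h) *\<^sub>R z) = M x z *v h" for h
      unfolding M_def by (simp add: matrix_vector_right_distrib matrix_vector_mult_add_rdistrib outer_mult_vec matrix_vector_mult_scaleR)
    ultimately show ?thesis by simp
  qed
  have TM: "continuous_on (UNIV \<times> ucube) (\<lambda>(x, z). T (M x z))"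
    using continuous_on_compose2[OF linear_continuous_on[OF Tb, of UNIV] Mc'] by (simp add: case_prod_unfold)
  have "((\<lambda>x. integral ucube (\<lambda>z. \<phi> (x + r x *\<^sub>R z))) has_derivative blinfun_apply (integral ucube (\<lambda>z. T (M x z)))) (at x within UNIV)" for x
  proof (rule leibniz_rule[where U = UNIV])
    show "((\<lambda>x. \<phi> (x + r x *\<^sub>R t)) has_derivative blinfun_apply (T (M x t))) (at x within UNIV)" for x t
      using der[where z = t and x = x] by (simp add: T[abs_def])
    show "(\<lambda>z. \<phi> (x + r x *\<^sub>R z)) integrable_on ucube" for x
      by (intro integrable_continuous continuous_on_compose2[OF \<phi>c] continuous_intros) auto
  qed (use TM in auto)
  moreover have "integral ucube (\<lambda>z. T (M x z)) = T (integral ucube (M x))" for x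
    using integral_linear[OF integrable_continuous[OF Mx] Tb] by (simp add: o_def)
  ultimately have "((\<lambda>x. integral ucube (\<lambda>z. \<phi> (x + r x *\<^sub>R z))) has_derivative (\<lambda>h. integral ucube (M x) *v h)) (at x)" for x
    by (simp add: T[abs_def])
  moreover have "continuous_on UNIV (\<lambda>x. integral ucube (M x))"
    by (rule integral_continuous_on_param[OF Mc'])
  ultimately show "C1_map (\<lambda>x. integral ucube (\<lambda>z. \<phi> (x + r x *\<^sub>R z))) (\<lambda>x. integral ucube (M x))"
    by (simp add: C1_map_def)
qed

text \<open>Truncation by averaging over cubes of variable size \<open>r x\<close>, where \<open>r\<close> is comparable to \<open>\<epsilon>\<close> times the
  distance to the set on which the maximal function of \<open>infdist (\<xi> + G x) C\<close> is small: each average is then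
  dominated by an average over a ball centred at a good point, and \<open>\<bar>\<nabla>r\<bar> \<le> \<epsilon>\<close> controls the commutator term.\<close>

lemma lipschitz_truncation:
  fixes C :: "(real^'d::finite^'m::finite) set"
  assumes C: "compact C" "convex C" "C \<noteq> {}" and k: "0 < k"
  obtains c :: real where "0 < c"
    "\<And>\<xi> \<phi> G I s a b. \<lbrakk>\<xi> \<in> C; C1_map \<phi> G; \<forall>x. x \<notin> cbox (vec a) (vec b) \<longrightarrow> \<phi> x = 0;
      (\<integral>\<^sup>+x. ennreal (infdist (\<xi> + G x) C) \<partial>lborel) \<le> ennreal I; 0 \<le> I; 0 < s; I < c * s ^ CARD('d)\<rbrakk>
    \<Longrightarrow> \<exists>\<phi>' G' B. C1_map \<phi>' G' \<and> (\<forall>x. x \<notin> cbox (vec (a - s)) (vec (b + s)) \<longrightarrow> \<phi>' x = 0) \<and> open B \<and>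
      emeasure lborel B \<le> ennreal (I / c) \<and> (\<forall>x. infdist (\<xi> + G' x) C \<le> k) \<and> (\<forall>x. x \<notin> B \<longrightarrow> norm (G' x - G x) \<le> k)"
proof -
  let ?n = "CARD('d)" and ?d = "real CARD('d)" and ?w = "unit_ball_vol (real CARD('d))"
  obtain R where R: "0 < R" "\<And>\<zeta>. \<zeta> \<in> C \<Longrightarrow> norm \<zeta> \<le> R"
    using compact_imp_bounded[OF C(1)] unfolding bounded_pos by blast
  \<comment> \<open>Large enough that \<open>e * q0 \<le> k / 3\<close> bounds both the mean
    distance \<open>e\<close> and the commutator term \<open>(2 * R + 1) * CARD('d) * e\<close> by
    \<open>k / 3\<close>.\<close>
  define q0 where "q0 = 1 + (2 * R + 1) * ?d"
  have q0: "q0 \<ge> 1" "(2 * R + 1) * ?d \<le> q0" using R(1) by (auto simp: q0_def)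
  define e where "e = min 1 (k / (3 * q0))"
  have e: "0 < e" "e \<le> 1" "e * q0 \<le> k / 3"
  proof -
    show "0 < e" "e \<le> 1" using k q0 by (auto simp: e_def)
    have "e * q0 \<le> k / (3 * q0) * q0" using q0 by (intro mult_right_mono) (auto simp: e_def)
    then show "e * q0 \<le> k / 3" using q0 by simp
  qed
  have e3: "e \<le> k / 3" "(2 * R + 1) * ?d * e \<le> k / 3"
  proof -
    have "e * 1 \<le> e * q0" "e * ((2 * R + 1) * ?d) \<le> e * q0" using q0 e(1) by (auto intro!: mult_left_mono)
    then show "e \<le> k / 3" "(2 * R + 1) * ?d * e \<le> k / 3"
      using e(3) unfolding mult.commute[of _ e] by linarith+
  qed
  \<comment> \<open>The nearest good point is within \<open>r x / e\<close> of \<open>x\<close>, and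
    the averaging cube is within \<open>r x * CARD('d)\<close>; the ball of radius
    \<open>r x * q\<close> around the good point therefore contains the cube.\<close>
  define q where "q = 1 / e + ?d"
  have q: "0 < q" using e(1) by (simp add: q_def add_pos_nonneg)
  \<comment> \<open>With this level the mass of a ball of radius \<open>r x * q\<close> around a
    good point is at most \<open>e * r x ^ CARD('d)\<close>, so the mean over the averaging cube is
    at most \<open>e\<close>.\<close>
  define l where "l = e / q ^ ?n"
  have l: "0 < l" using e(1) q by (simp add: l_def)
  have w: "0 < ?w" by (rule unit_ball_vol_pos) simp
  \<comment> \<open>The first entry bounds the measure of the bad set by \<open>I / c\<close>; the
    second prevents it from containing a ball of radius \<open>s / 2\<close>.\<close>
  define c where "c = min (l / (?w * 5 ^ ?n)) (l / 10 ^ ?n)"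
  have c: "0 < c" "c \<le> l / (?w * 5 ^ ?n)" "c \<le> l / 10 ^ ?n" using l w by (auto simp: c_def)
  show ?thesis
  proof (rule that[OF c(1)])
    fix \<xi> and \<phi> :: "real^'d \<Rightarrow> real^'m" and G I s and a b :: real
    assume xi: "\<xi> \<in> C" and cm: "C1_map \<phi> G" and supp: "\<forall>x. x \<notin> cbox (vec a) (vec b) \<longrightarrow> \<phi> x = 0"
      and fI: "(\<integral>\<^sup>+x. ennreal (infdist (\<xi> + G x) C) \<partial>lborel) \<le> ennreal I" and I: "0 \<le> I" and s: "0 < s"
      and small: "I < c * s ^ CARD('d)"
    define f where "f x = infdist (\<xi> + G x) C" for x
    have Gc: "continuous_on UNIV G" by (rule C1_map_gradient_continuous[OF cm])
    have fc: "continuous_on UNIV f" unfolding f_def[abs_def] by (intro continuous_intros Gc)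
    have f0: "0 \<le> f x" for x by (simp add: f_def infdist_nonneg)
    have fm: "f \<in> borel_measurable borel" by (rule borel_measurable_continuous_onI[OF fc])
    have fI': "(\<integral>\<^sup>+x. ennreal (f x) \<partial>lborel) \<le> ennreal I" using fI by (simp add: f_def)
    obtain B where B: "open B" "emeasure lborel B \<le> ennreal (?w * 5 ^ ?n * I / l)"
      "\<And>x r. x \<notin> B \<Longrightarrow> 0 < r \<Longrightarrow> (\<integral>\<^sup>+y\<in>ball x r. ennreal (f y) \<partial>lborel) \<le> ennreal (l * r ^ ?n)"
      by (rule maximal_function_bound[OF fm fI' I l]) (rule that)
    have BIc: "emeasure lborel B \<le> ennreal (I / c)"
    proof (rule order_trans[OF B(2)], rule ennreal_leI)
      have "?w * 5 ^ ?n * I / l = I / (l / (?w * 5 ^ ?n))" by simp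
      also have "\<dots> \<le> I / c" using c I by (intro divide_left_mono) (auto intro!: mult_pos_pos divide_pos_pos l w)
      finally show "?w * 5 ^ ?n * I / l \<le> I / c" .
    qed
    define A where "A = - B"
    have Ac: "closed A" using B(1) by (simp add: A_def closed_Compl)
    \<comment> \<open>A ball of radius \<open>s / 2\<close> inside \<open>B\<close> would have too
      much measure since \<open>I\<close> is small. So good points are everywhere close, and the
      averaging cubes stay small compared with \<open>s\<close>.\<close>
    have near: "\<exists>y\<in>A. dist x y < s / 2" for x
    proof (rule ccontr)
      assume "\<not> ?thesis"
      then have "ball x (s/2) \<subseteq> B" by (auto simp: A_def)
      then have "emeasure lborel (ball x (s/2)) \<le> ennreal (?w * 5 ^ ?n * I / l)"
        using emeasure_mono[of "ball x (s/2)" B lborel] B(1,2) by (auto intro: order_trans)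
      then have "ennreal (?w * (s/2) ^ ?n) \<le> ennreal (?w * 5 ^ ?n * I / l)"
        using s by (subst (asm) emeasure_ball) auto
      then have "?w * (s/2) ^ ?n \<le> ?w * (5 ^ ?n * I / l)" using w l I by (simp add: mult.assoc)
      then have "(s/2) ^ ?n \<le> 5 ^ ?n * I / l" using w by (simp only: mult_le_cancel_left_pos)
      then have "l * (s/2) ^ ?n \<le> 5 ^ ?n * I" using l by (simp add: pos_le_divide_eq mult.commute)
      moreover have "10 ^ ?n * (s/2) ^ ?n = 5 ^ ?n * s ^ ?n"
        unfolding power_mult_distrib[symmetric] by simp
      moreover have "5 ^ ?n * I < 5 ^ ?n * (l / 10 ^ ?n * s ^ ?n)"
        using small mult_right_mono[OF c(3), of "s ^ ?n"] s by (intro mult_strict_left_mono) auto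
      ultimately have "l * (s/2) ^ ?n < l / 10 ^ ?n * (10 ^ ?n * (s/2) ^ ?n)" by (simp add: mult_ac)
      then show False by simp
    qed
    then have Ane: "A \<noteq> {}" by blast
    define D where "D x = infdist x A" for x
    have D0: "0 \<le> D x" for x by (simp add: D_def infdist_nonneg)
    have Ds: "D x \<le> s / 2" for x
    proof -
      obtain y where "y \<in> A" "dist x y < s/2" using near by blast
      then show ?thesis using infdist_le[of y A x] by (simp add: D_def)
    qed
    have DA: "D x = 0" if "x \<notin> B" for x using that by (simp add: D_def A_def)
    have Dl: "\<bar>D y - D z\<bar> \<le> norm (y - z)" for y z
      using infdist_triangle_abs[of y A z] by (simp add: D_def dist_norm)
    have Dc: "continuous_on UNIV D" unfolding D_def[abs_def] by (intro continuous_intros)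
    have iD: "integrable lborel D"
    proof (rule integrable_bounded_support(1)[where D = B and B = "s/2"])
      show "emeasure lborel B < \<infinity>" using B(2) by (auto intro: le_less_trans)
    qed (use B(1) D0 Ds DA borel_measurable_continuous_onI[OF Dc] in auto)
    obtain R0 where R0: "cbox (vec a) (vec b) \<subseteq> (ball 0 R0 :: (real^'d) set)" using bounded_subset_ballD[OF bounded_cbox] by blast
    have Guc: "uniformly_continuous_on UNIV G"
    proof (rule compact_support_uniformly_continuous[OF Gc])
      fix x :: "real^'d" assume "norm x > R0"
      then have "x \<notin> cbox (vec a) (vec b)" using subsetD[OF R0, of x] by auto
      then show "G x = 0" by (rule C1_map_gradient_support[OF cm closed_cbox, rotated]) (use supp in blast)
    qed
    have k3: "k / 3 > 0" using k by simp
    obtain \<delta> where \<delta>: "\<delta> > 0" "\<And>x y. dist y x < \<delta> \<Longrightarrow> dist (G y) (G x) < k / 3"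
      by (rule uniformly_continuous_UNIV_E[OF Guc k3]) (rule that)
    \<comment> \<open>At good points \<open>r\<close> is at most \<open>2 * \<tau>\<close>, so the
      averaging cube lies within distance \<delta>, where \<open>G\<close> varies by less than
      \<open>k / 3\<close>.\<close>
    define \<tau> where "\<tau> = min s (\<delta> / (2 * (?d + 1)))"
    have \<tau>: "0 < \<tau>" "\<tau> \<le> s" "\<tau> * ?d < \<delta>"
    proof -
      show "0 < \<tau>" "\<tau> \<le> s" using s \<delta>(1) by (auto simp: \<tau>_def add_nonneg_pos)
      have "\<tau> * ?d \<le> \<delta> / (2 * (?d + 1)) * ?d" by (intro mult_right_mono) (auto simp: \<tau>_def)
      also have "\<dots> = (\<delta> / 2) * (?d / (?d + 1))" by simp
      also have "\<dots> \<le> (\<delta> / 2) * 1" using \<delta>(1) by (intro mult_left_mono) auto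
      finally show "\<tau> * ?d < \<delta>" using \<delta>(1) by linarith
    qed
    obtain \<eta> :: "real^'d \<Rightarrow> real" where \<eta>: "mollifier \<tau> \<eta>" using exists_mollifier[OF \<tau>(1)] by blast
    define rt where "rt = mollify \<eta> D"
    define gr0 where "gr0 x = (\<chi> j. mollify (\<lambda>x. frechet_derivative \<eta> (at x) (axis j 1)) D x)" for x
    have rt_der: "(rt has_derivative (\<lambda>h. gr0 x \<bullet> h)) (at x)" for x
      using mollify_has_derivative[OF iD mollifierD(1)[OF \<eta>], of x]
      by (simp add: rt_def gr0_def inner_vec_def mult.commute)
    have gr0c: "continuous_on UNIV gr0"
      unfolding gr0_def[abs_def]
      by (intro continuous_on_vec_lambda mollify_continuous[OF iD test_function_pd[OF mollifierD(1)[OF \<eta>]]])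
    have gr0n: "norm (gr0 x) \<le> 1" for x
      by (rule derivative_norm_le_one[OF rt_der]) (unfold rt_def, rule mollify_lipschitz[OF \<eta> iD Dl])
    have rtD: "\<bar>rt x - D x\<bar> \<le> \<tau>" for x
    proof -
      have "norm (mollify \<eta> D x - D x) \<le> \<tau>"
      proof (rule mollify_dist_le[OF \<eta> iD])
        fix y assume "y \<in> ball x \<tau>"
        then show "norm (D y - D x) \<le> \<tau>" using Dl[of y x] by (simp add: dist_norm norm_minus_commute)
      qed
      then show ?thesis by (simp add: rt_def)
    qed
    have rts: "0 \<le> rt x" "rt x \<le> s / 2" for x
    proof -
      have "norm (mollify \<eta> D x - s/4) \<le> s/4"
      proof (rule mollify_dist_le[OF \<eta> iD])
        fix y show "norm (D y - s/4) \<le> s/4" using D0[of y] Ds[of y] unfolding real_norm_def by linarith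
      qed
      then have "\<bar>rt x - s/4\<bar> \<le> s/4" by (simp add: rt_def)
      then show "0 \<le> rt x" "rt x \<le> s / 2" by linarith+
    qed
    \<comment> \<open>The distance function is mollified to be differentiable. The added constant
      keeps the size positive on the good set and compensates the mollification error, so that
      \<open>D x \<le> r x / e\<close>.\<close>
    define r where "r x = e * rt x + e * \<tau>" for x
    define gr where "gr x = e *\<^sub>R gr0 x" for x
    have r_der: "(r has_derivative (\<lambda>h. gr x \<bullet> h)) (at x)" for x
    proof -
      have "(r has_derivative (\<lambda>h. e * (gr0 x \<bullet> h) + 0)) (at x)"
        unfolding r_def[abs_def] by (intro has_derivative_add has_derivative_mult_right rt_der has_derivative_const)
      then show ?thesis by (simp add: gr_def)
    qed
    have grc: "continuous_on UNIV gr" unfolding gr_def[abs_def] by (intro continuous_intros gr0c)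
    have grn: "norm (gr x) \<le> e" for x using gr0n[of x] e(1) by (simp add: gr_def mult_left_le)
    have r0: "0 < r x" for x using rts(1)[of x] e(1) \<tau>(1) unfolding r_def by (simp add: add_nonneg_pos)
    have rD: "D x \<le> r x / e" for x
    proof -
      have "D x \<le> rt x + \<tau>" using rtD[of x] by linarith
      also have "\<dots> = r x / e" using e(1) by (simp add: r_def add_divide_distrib)
      finally show ?thesis .
    qed
    have r_le: "r x \<le> rt x + \<tau>" for x
    proof -
      have "r x = e * (rt x + \<tau>)" by (simp add: r_def distrib_left)
      also have "\<dots> \<le> rt x + \<tau>" using e rts(1)[of x] \<tau>(1) by (intro mult_left_le_one_le) auto
      finally show ?thesis .
    qed
    have rs: "r x \<le> 3 * s / 2" for x
    proof -
      have "r x \<le> rt x + \<tau>" by (rule r_le)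
      also have "\<dots> \<le> s / 2 + s" by (intro add_mono rts(2) \<tau>(2))
      finally show ?thesis by simp
    qed
    have rB: "r x \<le> 2 * \<tau>" if "x \<notin> B" for x
    proof -
      have "rt x \<le> \<tau>" using rtD[of x] DA[OF that] by linarith
      then show ?thesis using r_le[of x] by linarith
    qed
    define P where "P x z = x + r x *\<^sub>R z" for x z :: "real^'d"
    define M where "M x z = G (P x z) + outer (G (P x z) *v z) (gr x)" for x z
    define \<phi>' where "\<phi>' x = integral ucube (\<lambda>z. \<phi> (P x z))" for x
    define G' where "G' x = integral ucube (M x)" for x
    have cm': "C1_map \<phi>' G'"
      using C1_map_variable_average(1)[OF cm r_der grc] unfolding \<phi>'_def[abs_def] G'_def[abs_def] M_def[abs_def] P_def .
    have Pc: "continuous_on S (P x)" for x S unfolding P_def[abs_def] by (intro continuous_intros)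
    have GPc: "continuous_on S (\<lambda>z. G (P x z))" for x S by (rule continuous_on_compose2[OF Gc Pc]) auto
    have fPc: "continuous_on S (\<lambda>z. f (P x z))" for x S by (rule continuous_on_compose2[OF fc Pc]) auto
    have oc: "continuous_on S (\<lambda>z. outer (G (P x z) *v z) (gr x))" for x S
      unfolding matrix_vector_mult_def by (intro continuous_intros GPc)
    have avg: "integral ucube (\<lambda>z. f (P x z)) \<le> e" for x
    proof -
      obtain y where y: "y \<in> A" "infdist x A = dist x y" using infdist_attains_inf[OF Ac Ane] by blast
      have "y \<notin> B" using y(1) by (simp add: A_def)
      show ?thesis
        unfolding P_def
      proof (rule integral_ucube_average_le[OF fc f0 r0, where S = "ball y (r x * q)"])
        fix z :: "real^'d" assume z: "z \<in> ucube"
        have "norm (r x *\<^sub>R z) \<le> r x * (?d / 2)" using norm_ucube[OF z] r0[of x] by (simp add: mult_left_mono)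
        also have "\<dots> < r x * ?d" using r0[of x] by simp
        finally have "norm (r x *\<^sub>R z) < r x * ?d" .
        moreover have "dist y (x + r x *\<^sub>R z) \<le> dist x y + norm (r x *\<^sub>R z)"
          using norm_triangle_ineq4[of "y - x" "r x *\<^sub>R z"] by (simp add: dist_norm norm_minus_commute algebra_simps)
        moreover have "dist x y \<le> r x / e" using rD[of x] y(2) by (simp add: D_def)
        ultimately have "dist y (x + r x *\<^sub>R z) < r x / e + r x * ?d" by linarith
        then show "x + r x *\<^sub>R z \<in> ball y (r x * q)" by (simp add: q_def distrib_left)
      next
        have "(\<integral>\<^sup>+y\<in>ball y (r x * q). ennreal (f y) \<partial>lborel) \<le> ennreal (l * (r x * q) ^ ?n)"
          using r0[of x] q by (intro B(3)[OF \<open>y \<notin> B\<close>]) simp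
        also have "l * (r x * q) ^ ?n = e * r x ^ ?n" using q by (simp add: l_def power_mult_distrib)
        finally show "(\<integral>\<^sup>+y\<in>ball y (r x * q). ennreal (f y) \<partial>lborel) \<le> ennreal (e * r x ^ ?n)" .
      qed (use e in auto)
    qed
    have Gn: "norm (G x) \<le> 2 * R + f x" for x
    proof -
      obtain y where y: "y \<in> C" "infdist (\<xi> + G x) C = dist (\<xi> + G x) y"
        using infdist_attains_inf[OF compact_imp_closed[OF C(1)] C(3)] by blast
      have "norm (G x) \<le> norm (\<xi> + G x) + norm \<xi>" using norm_triangle_ineq4[of "\<xi> + G x" \<xi>] by simp
      also have "norm (\<xi> + G x) \<le> norm (\<xi> + G x - y) + norm y" using norm_triangle_ineq[of "\<xi> + G x - y" y] by simp
      finally show ?thesis using y R(2)[OF y(1)] R(2)[OF xi] by (simp add: f_def dist_norm)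
    qed
    \<comment> \<open>The commutator term. The norm of \<open>G\<close> is at most
      \<open>2 * R\<close> plus the distance \<open>f\<close>, whose mean is at most 1, so a
      gradient of \<open>r\<close> of size \<open>e\<close> suffices.\<close>
    define err where "err x = integral ucube (\<lambda>z. outer (G (P x z) *v z) (gr x))" for x
    have errn: "norm (err x) \<le> k / 3" for x
    proof -
      have "norm (err x) \<le> integral ucube (\<lambda>z. (2 * R + f (P x z)) * (?d * e))"
        unfolding err_def
      proof (rule integral_ucube_norm_le[OF oc])
        show "continuous_on ucube (\<lambda>z. (2 * R + f (P x z)) * (?d * e))" by (intro continuous_intros fPc)
        fix z :: "real^'d" assume z: "z \<in> ucube"
        have "norm (G (P x z) *v z) \<le> norm (G (P x z)) * norm z" by (rule norm_matrix_vector_le)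
        also have "\<dots> \<le> (2 * R + f (P x z)) * ?d"
          using norm_ucube[OF z] R(1) f0[of "P x z"] by (intro mult_mono Gn) auto
        finally have "norm (G (P x z) *v z) * norm (gr x) \<le> (2 * R + f (P x z)) * ?d * e"
          using grn[of x] R(1) f0[of "P x z"] by (intro mult_mono) auto
        then show "norm (outer (G (P x z) *v z) (gr x)) \<le> (2 * R + f (P x z)) * (?d * e)"
          by (simp add: norm_outer mult.assoc)
      qed
      also have "\<dots> = (2 * R + integral ucube (\<lambda>z. f (P x z))) * (?d * e)"
        by (simp add: integral_ucube_add_const[OF fPc])
      also have "\<dots> \<le> (2 * R + 1) * (?d * e)"
        using avg[of x] e(1,2) by (intro mult_right_mono) auto
      finally show ?thesis using e3(2) by (simp add: mult.assoc)
    qed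
    have G'eq: "G' x = integral ucube (\<lambda>z. G (P x z)) + err x" for x
      unfolding G'_def M_def[abs_def] err_def
      by (rule Henstock_Kurzweil_Integration.integral_add) (intro integrable_continuous GPc oc)+
    have inf: "infdist (\<xi> + G' x) C \<le> k" for x
    proof -
      let ?J = "integral ucube (\<lambda>z. \<xi> + G (P x z))"
      have J: "?J = \<xi> + integral ucube (\<lambda>z. G (P x z))"
        by (rule integral_ucube_add_const[OF GPc])
      have "infdist (\<xi> + G' x) C \<le> infdist ?J C + dist (\<xi> + G' x) ?J" by (rule infdist_triangle)
      also have "dist (\<xi> + G' x) ?J = norm (err x)" unfolding J G'eq by (simp add: dist_norm)
      also have "infdist ?J C \<le> integral ucube (\<lambda>z. infdist (\<xi> + G (P x z)) C)"
        by (rule infdist_integral_ucube_le) (use C compact_imp_closed GPc in \<open>auto intro!: continuous_intros\<close>)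
      also have "\<dots> \<le> e" using avg[of x] by (simp add: f_def)
      finally show ?thesis using errn[of x] e3(1) k by linarith
    qed
    have close: "norm (G' x - G x) \<le> k" if x: "x \<notin> B" for x
    proof -
      have "norm (integral ucube (\<lambda>z. G (P x z) - G x)) \<le> integral ucube (\<lambda>z :: real^'d. k / 3)"
      proof (rule integral_ucube_norm_le)
        fix z :: "real^'d" assume z: "z \<in> ucube"
        have "norm (r x *\<^sub>R z) = r x * norm z" using r0[of x] by simp
        also have "\<dots> \<le> 2 * \<tau> * (?d / 2)"
          using norm_ucube[OF z] rB[OF x] \<tau>(1) by (intro mult_mono) auto
        also have "\<dots> = \<tau> * ?d" by simp
        finally have "dist (P x z) x < \<delta>" using \<tau>(3) by (simp add: P_def dist_norm)
        then show "norm (G (P x z) - G x) \<le> k / 3" using \<delta>(2)[of "P x z" x] by (simp add: dist_norm)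
      qed (intro continuous_intros GPc)+
      moreover have "integral ucube (\<lambda>z. G (P x z) - G x) = integral ucube (\<lambda>z. G (P x z)) - G x"
        using integral_ucube_add_const[OF GPc[of _ x], of "- G x"] by simp
      ultimately have "norm (integral ucube (\<lambda>z. G (P x z)) - G x) \<le> k / 3" by (simp add: content_ucube)
      moreover have "G' x - G x = (integral ucube (\<lambda>z. G (P x z)) - G x) + err x" unfolding G'eq by simp
      moreover have "norm ((integral ucube (\<lambda>z. G (P x z)) - G x) + err x)
          \<le> norm (integral ucube (\<lambda>z. G (P x z)) - G x) + norm (err x)" by (rule norm_triangle_ineq)
      ultimately have "norm (G' x - G x) \<le> k / 3 + norm (err x)" by (simp only:)
      then show ?thesis using errn[of x] k by linarith
    qed
    have supp': "\<phi>' x = 0" if x: "x \<notin> cbox (vec (a - s)) (vec (b + s))" for x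
    proof -
      obtain i where i: "x $ i < a - s \<or> b + s < x $ i" using x by (auto simp: mem_box_cart not_le)
      have "\<phi> (P x z) = 0" if z: "z \<in> ucube" for z
      proof -
        have "\<bar>z $ i\<bar> \<le> 1/2"
        proof -
          have "-(1/2) \<le> z $ i \<and> z $ i \<le> 1/2" using z by (simp add: mem_box_cart)
          then show ?thesis by linarith
        qed
        \<comment> \<open>A coordinate moves by at most half of \<open>3 * s / 2\<close>, which is
          less than \<open>s\<close>; the support grows by no more than that.\<close>
        then have "\<bar>r x * z $ i\<bar> \<le> (3 * s / 2) * (1/2)" unfolding abs_mult using rs[of x] r0[of x] s by (intro mult_mono) auto
        then have "\<bar>r x * z $ i\<bar> < s" using s by linarith
        then have "P x z $ i < a \<or> b < P x z $ i" using i unfolding P_def by (auto simp: abs_less_iff)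
        then have "\<not> (a \<le> P x z $ i \<and> P x z $ i \<le> b)" by linarith
        then have "P x z \<notin> cbox (vec a) (vec b)" by (auto simp: mem_box_cart)
        then show ?thesis using supp by blast
      qed
      then have "integral ucube (\<lambda>z. \<phi> (P x z)) = integral ucube (\<lambda>z :: real^'d. 0)" by (rule Henstock_Kurzweil_Integration.integral_cong)
      then show ?thesis by (simp add: \<phi>'_def)
    qed
    show "\<exists>\<phi>' G' B. C1_map \<phi>' G' \<and> (\<forall>x. x \<notin> cbox (vec (a - s)) (vec (b + s)) \<longrightarrow> \<phi>' x = 0) \<and> open B \<and>
      emeasure lborel B \<le> ennreal (I / c) \<and> (\<forall>x. infdist (\<xi> + G' x) C \<le> k) \<and> (\<forall>x. x \<notin> B \<longrightarrow> norm (G' x - G x) \<le> k)"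
      by (intro exI[of _ \<phi>'] exI[of _ G'] exI[of _ B] conjI allI impI cm' supp' B(1) BIc inf close)
  qed
qed

subsection \<open>The lower semicontinuous envelope\<close>

lemma homog_mono:
  fixes W W' :: "real^'d::finite \<Rightarrow> real^'d^'m::finite \<Rightarrow> ennreal"
  assumes "\<And>x \<zeta>. W x \<zeta> \<le> W' x \<zeta>"
  shows "homog W \<xi> \<le> homog W' \<xi>"
proof (rule ccontr)
  assume "\<not> ?thesis"
  then obtain c where c: "homog W' \<xi> < c" "c < homog W \<xi>" using dense[of "homog W' \<xi>" "homog W \<xi>"] by (auto simp: not_le)
  obtain N where "reach W' N \<xi> c" by (rule homog_less_reach[OF c(1)])
  then obtain \<phi> G where N: "N \<ge> 1" "grad_pair (cube N) \<phi> G"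
    and le: "(\<integral>\<^sup>+x\<in>cube N. W' x (\<xi> + G x) \<partial>lborel) \<le> c * ennreal (real N ^ CARD('d))"
    unfolding reach_def by blast
  have "(\<integral>\<^sup>+x\<in>cube N. W x (\<xi> + G x) \<partial>lborel) \<le> (\<integral>\<^sup>+x\<in>cube N. W' x (\<xi> + G x) \<partial>lborel)"
    using assms by (intro nn_integral_mono mult_right_mono) auto
  then have "reach W N \<xi> c" unfolding reach_def using N order_trans[OF _ le] by blast
  then have "homog W \<xi> \<le> c" by (rule reach_homog_le)
  then show False using c(2) by simp
qed

text \<open>\<open>ennreal\<close> maps negative reals to 0, so the right-hand side is the integral
  of the positive part.\<close>

lemma ennreal_integral_le_nn_integral:
  fixes f :: "'a \<Rightarrow> real"
  assumes "integrable M f"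
  shows "ennreal (integral\<^sup>L M f) \<le> (\<integral>\<^sup>+x. ennreal (f x) \<partial>M)"
proof -
  have "(\<integral>\<^sup>+x. ennreal (f x) \<partial>M) < \<infinity>" using assms by (simp add: real_integrable_def less_top)
  moreover have "integral\<^sup>L M f \<le> enn2real (\<integral>\<^sup>+x. ennreal (f x) \<partial>M)"
    by (simp add: real_lebesgue_integral_def[OF assms])
  ultimately show ?thesis by (metis ennreal_enn2real ennreal_leI infinity_ennreal_def)
qed

text \<open>Gradients of admissible maps have mean zero, so an affine lower bound passes to the mean
  energy.\<close>

lemma homog_ge_affine:
  fixes W :: "real^'d::finite \<Rightarrow> real^'d^'m::finite \<Rightarrow> ennreal"
  assumes W: "\<And>x \<zeta>. ennreal (\<alpha> + a \<bullet> \<zeta>) \<le> W x \<zeta>"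
  shows "ennreal (\<alpha> + a \<bullet> \<xi>) \<le> homog W \<xi>"
proof (rule ccontr)
  assume "\<not> ?thesis"
  then obtain c where c: "homog W \<xi> < c" "c < ennreal (\<alpha> + a \<bullet> \<xi>)"
    using dense[of "homog W \<xi>" "ennreal (\<alpha> + a \<bullet> \<xi>)"] by (auto simp: not_le)
  obtain N where "reach W N \<xi> c" by (rule homog_less_reach[OF c(1)])
  then obtain \<phi> G where N: "N \<ge> 1" and p: "grad_pair (cube N) \<phi> G"
    and le: "(\<integral>\<^sup>+x\<in>cube N. W x (\<xi> + G x) \<partial>lborel) \<le> c * ennreal (real N ^ CARD('d))"
    unfolding reach_def by blast
  let ?b = "real N ^ CARD('d)"
  have iG: "integrable lborel G" by (rule grad_pair_integrable(2)[OF p bounded_cube])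
  have ic: "integrable lborel (indicator (cube N) :: real^'d \<Rightarrow> real)"
    by (rule integrable_real_indicator) (simp_all add: emeasure_cube)
  have mc: "measure lborel (cube N :: (real^'d) set) = ?b" by (simp add: measure_def emeasure_cube)
  define f where "f x = (\<alpha> + a \<bullet> \<xi>) * indicator (cube N) x + a \<bullet> G x" for x
  have "integrable lborel f" unfolding f_def[abs_def] using ic iG by simp
  moreover have "integral\<^sup>L lborel f = (\<alpha> + a \<bullet> \<xi>) * ?b"
    unfolding f_def[abs_def] using ic iG mc grad_pair_integral_eq_0[OF p bounded_cube] by simp
  ultimately have "ennreal ((\<alpha> + a \<bullet> \<xi>) * ?b) \<le> (\<integral>\<^sup>+x. ennreal (f x) \<partial>lborel)"
    using ennreal_integral_le_nn_integral[of lborel f] by simp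
  also have "\<dots> \<le> (\<integral>\<^sup>+x\<in>cube N. W x (\<xi> + G x) \<partial>lborel)"
  proof (rule nn_integral_mono)
    fix x
    show "ennreal (f x) \<le> W x (\<xi> + G x) * indicator (cube N) x"
    proof (cases "x \<in> cube N")
      case True
      then show ?thesis using W[of "\<xi> + G x" x] by (simp add: f_def inner_add_right add.assoc)
    next
      case False
      then have "G x = 0" using p by (simp add: grad_pair_def)
      then show ?thesis using False by (simp add: f_def)
    qed
  qed
  also note le
  finally have "ennreal (\<alpha> + a \<bullet> \<xi>) * ennreal ?b \<le> c * ennreal ?b" by (simp add: ennreal_mult'')
  moreover have "ennreal ?b * c < ennreal ?b * ennreal (\<alpha> + a \<bullet> \<xi>)"
    using c(2) N by (intro ennreal_mult_strict_left_mono) auto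
  ultimately show False by (simp add: mult.commute not_less[symmetric])
qed

text \<open>A hyperplane separating \<zeta> from \<open>closure C\<close> yields affine functions
  that are nonpositive on \<open>closure C\<close>, hence below \<open>W\<close>, and arbitrarily
  large at \<zeta>.\<close>

lemma homog_finite_in_closure:
  fixes W :: "real^'d::finite \<Rightarrow> real^'d^'m::finite \<Rightarrow> ennreal"
  assumes C: "convex C" and dom: "\<And>x. edom (W x) \<subseteq> closure C" and fin: "homog W \<zeta> < \<infinity>"
  shows "\<zeta> \<in> closure C"
proof (rule ccontr)
  assume "\<zeta> \<notin> closure C"
  then obtain a b where ab: "a \<bullet> \<zeta> < b" "\<And>x. x \<in> closure C \<Longrightarrow> b < a \<bullet> x"
    using separating_hyperplane_closed_point[OF convex_closure[OF C] closed_closure] by blast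
  obtain r where r: "r \<ge> 0" "homog W \<zeta> = ennreal r" using fin by (cases "homog W \<zeta>") auto
  \<comment> \<open>The slope for which the affine function takes the value \<open>r + 1\<close> at
    \<zeta>, just above the supposed value of \<open>homog W\<close>.\<close>
  define k where "k = (r + 1) / (b - a \<bullet> \<zeta>)"
  have k: "k \<ge> 0" "k * (b - a \<bullet> \<zeta>) = r + 1" using r(1) ab(1) by (auto simp: k_def)
  have "ennreal (k * b + (- k *\<^sub>R a) \<bullet> \<omega>) \<le> W x \<omega>" for x \<omega>
  proof (cases "W x \<omega> < \<infinity>")
    case True
    then have "b < a \<bullet> \<omega>" using dom by (auto simp: edom_def intro: ab(2))
    then have "k * b \<le> k * (a \<bullet> \<omega>)" using k(1) by (intro mult_left_mono) auto
    then show ?thesis by (simp add: ennreal_neg)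
  qed (simp add: less_top[symmetric])
  then have "ennreal (k * b + (- k *\<^sub>R a) \<bullet> \<zeta>) \<le> ennreal r" unfolding r(2)[symmetric] by (rule homog_ge_affine)
  moreover have "k * b + (- k *\<^sub>R a) \<bullet> \<zeta> = r + 1" using k(2) by (simp add: right_diff_distrib)
  ultimately show False using r(1) by simp
qed

lemma countable_integer_vectors: "countable {z :: real^'d::finite. \<forall>i. z $ i \<in> \<int>}"
proof (rule countable_subset)
  show "{z :: real^'d. \<forall>i. z $ i \<in> \<int>} \<subseteq> range (\<lambda>k :: 'd \<Rightarrow> int. \<chi> i. real_of_int (k i))"
  proof
    fix z :: "real^'d" assume "z \<in> {z. \<forall>i. z $ i \<in> \<int>}"
    then have "z = (\<chi> i. real_of_int (\<lfloor>z $ i\<rfloor>))" by (simp add: vec_eq_iff)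
    then show "z \<in> range (\<lambda>k :: 'd \<Rightarrow> int. \<chi> i. real_of_int (k i))" by (rule range_eqI[where x = "\<lambda>i. \<lfloor>z $ i\<rfloor>"])
  qed
qed simp

text \<open>The essential bound on one period cell is carried to the whole space by the integer
  translations. There are only countably many, so the union of the exceptional sets is still
  null.\<close>

lemma loc_bounded_Linfty_loc:
  fixes W :: "real^'d::finite \<Rightarrow> real^'d^'m::finite \<Rightarrow> ennreal"
  assumes W: "periodic_integrand W" and U: "open U"
    and L: "\<And>K. compact K \<Longrightarrow> K \<subseteq> U \<Longrightarrow> (\<lambda>x. SUP \<xi>\<in>K. W x \<xi>) \<in> Linfty_loc"
  shows "loc_bounded W U"
  unfolding loc_bounded_def
proof (intro conjI allI impI U)
  fix K :: "(real^'d^'m) set" assume K: "compact K" "K \<subseteq> U"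
  let ?Z = "{z :: real^'d. \<forall>i. z $ i \<in> \<int>}" and ?Q = "cbox 0 (vec 1) :: (real^'d) set"
  obtain M where "AE x in lebesgue_on ?Q. (SUP \<xi>\<in>K. W x \<xi>) \<le> ennreal M"
    using L[OF K] compact_cbox unfolding Linfty_loc_def by blast
  then have "AE x in lebesgue. x \<in> ?Q \<longrightarrow> (SUP \<xi>\<in>K. W x \<xi>) \<le> ennreal M"
    by (subst (asm) AE_restrict_space_iff) auto
  then have "AE x in lborel. x \<in> ?Q \<longrightarrow> (SUP \<xi>\<in>K. W x \<xi>) \<le> ennreal M" (is "AE x in _. ?P x") by (simp add: AE_completion_iff)
  then have "AE x in distr lborel borel ((+) z). ?P x" for z by (subst lborel_distr_plus)
  then have "AE x in lborel. ?P (z + x)" for z by (rule AE_distrD[rotated]) simp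
  then have "AE x in lborel. \<forall>z\<in>?Z. ?P (z + x)" by (subst AE_ball_countable[OF countable_integer_vectors]) blast
  then have "AE x in lborel. \<forall>\<zeta>\<in>K. W x \<zeta> \<le> ennreal M"
  proof eventually_elim
    fix x assume x: "\<forall>z\<in>?Z. ?P (z + x)"
    define z where "z = (\<chi> i. - real_of_int (\<lfloor>x $ i\<rfloor>))"
    have z: "z \<in> ?Z" by (simp add: z_def)
    have "0 \<le> x $ i - real_of_int \<lfloor>x $ i\<rfloor> \<and> x $ i - real_of_int \<lfloor>x $ i\<rfloor> \<le> 1" for i by linarith
    then have "z + x \<in> ?Q" by (simp add: mem_box_cart z_def)
    then have le: "(SUP \<xi>\<in>K. W (z + x) \<xi>) \<le> ennreal M" using x z by blast
    show "\<forall>\<zeta>\<in>K. W x \<zeta> \<le> ennreal M"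
    proof
      fix \<zeta> assume "\<zeta> \<in> K"
      have "W x \<zeta> = W (x + z) \<zeta>" using W z unfolding periodic_integrand_def by simp
      also have "\<dots> = W (z + x) \<zeta>" by (simp only: add.commute)
      also have "\<dots> \<le> (SUP \<xi>\<in>K. W (z + x) \<xi>)" by (rule SUP_upper) fact
      finally show "W x \<zeta> \<le> ennreal M" using le by (rule order_trans)
    qed
  qed
  then show "\<exists>M::real. AE x in lborel. \<forall>\<zeta>\<in>K. W x \<zeta> \<le> ennreal M" by blast
qed

lemma grad_pair_scaleR:
  assumes "grad_pair D \<phi> G"
  shows "grad_pair D (\<lambda>x. t *\<^sub>R \<phi> x) (\<lambda>x. t *\<^sub>R G x)"
proof -
  obtain M where M: "\<And>x. norm (G x) \<le> M" using assms by (auto simp: grad_pair_def)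
  have "norm (t *\<^sub>R G x) \<le> \<bar>t\<bar> * M" for x using M[of x] by (simp add: mult_left_mono)
  then show ?thesis using assms unfolding grad_pair_def
    by (auto intro!: continuous_intros simp: mult.assoc)
qed

lemma C1_map_scaleR:
  assumes "C1_map \<phi> G"
  shows "C1_map (\<lambda>x. t *\<^sub>R \<phi> x) (\<lambda>x. t *\<^sub>R G x)"
  unfolding C1_map_def
proof (intro conjI allI)
  fix x
  have "((\<lambda>x. t *\<^sub>R \<phi> x) has_derivative (\<lambda>h. t *\<^sub>R (G x *v h))) (at x)"
    by (intro has_derivative_scaleR_right C1_map_has_derivative[OF assms])
  then show "((\<lambda>x. t *\<^sub>R \<phi> x) has_derivative (\<lambda>h. (t *\<^sub>R G x) *v h)) (at x)"
    by (simp add: scaleR_matrix_vector_assoc)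
qed (intro continuous_intros C1_map_gradient_continuous[OF assms])

text \<open>Multiplying a test map for \<zeta> by \<open>t\<close> gives one for
  \<open>t *\<^sub>R \<zeta>\<close>, and the total slopes are scaled by \<open>t\<close> pointwise.
  Where \<open>W\<close> is infinite the estimate is trivial.\<close>

lemma homog_scaleR_le:
  fixes W :: "real^'d::finite \<Rightarrow> real^'d^'m::finite \<Rightarrow> ennreal"
  assumes W: "periodic_integrand W" and r: "\<And>x \<xi>. \<xi> \<in> edom (W x) \<Longrightarrow> W x (t *\<^sub>R \<xi>) \<le> W x \<xi> + ennreal \<delta>"
  shows "homog W (t *\<^sub>R \<zeta>) \<le> homog W \<zeta> + ennreal \<delta>"
proof (rule ennreal_le_epsilon)
  fix e :: real assume fin: "homog W \<zeta> + ennreal \<delta> < top" and e: "e > 0"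
  \<comment> \<open>The inequality is strict only for finite values; the rule for \<epsilon>
    supplies finiteness.\<close>
  have "homog W \<zeta> < homog W \<zeta> + ennreal e" using fin e ennreal_add_left_cancel_less[of "homog W \<zeta>" 0 "ennreal e"] by simp
  then obtain N where "reach W N \<zeta> (homog W \<zeta> + ennreal e)" by (rule homog_less_reach)
  then obtain \<phi> G where N: "N \<ge> 1" and p: "grad_pair (cube N) \<phi> G"
    and le: "(\<integral>\<^sup>+x\<in>cube N. W x (\<zeta> + G x) \<partial>lborel) \<le> (homog W \<zeta> + ennreal e) * ennreal (real N ^ CARD('d))"
    unfolding reach_def by blast
  have r': "W x (t *\<^sub>R \<xi>) \<le> W x \<xi> + ennreal \<delta>" for x \<xi>
    using r[of \<xi> x] by (cases "W x \<xi> < \<infinity>") (auto simp: edom_def less_top[symmetric])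
  have [measurable]: "G \<in> borel_measurable borel" using p by (simp add: grad_pair_def)
  have [measurable]: "(\<lambda>x. W x (\<zeta> + G x)) \<in> borel_measurable borel"
    by (rule periodic_integrand_measurable[OF W]) measurable
  have "(\<integral>\<^sup>+x\<in>cube N. W x (t *\<^sub>R \<zeta> + t *\<^sub>R G x) \<partial>lborel)
      \<le> (\<integral>\<^sup>+x. W x (\<zeta> + G x) * indicator (cube N) x + ennreal \<delta> * indicator (cube N) x \<partial>lborel)"
    using r' by (intro nn_integral_mono) (auto simp: indicator_def simp flip: scaleR_add_right)
  also have "\<dots> = (\<integral>\<^sup>+x\<in>cube N. W x (\<zeta> + G x) \<partial>lborel) + ennreal \<delta> * ennreal (real N ^ CARD('d))"
    by (subst nn_integral_add) (simp_all add: emeasure_cube nn_integral_cmult_indicator)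
  also have "\<dots> \<le> (homog W \<zeta> + ennreal e) * ennreal (real N ^ CARD('d)) + ennreal \<delta> * ennreal (real N ^ CARD('d))"
    by (intro add_right_mono le)
  also have "\<dots> = (homog W \<zeta> + ennreal \<delta> + ennreal e) * ennreal (real N ^ CARD('d))"
    by (simp only: distrib_right add_ac)
  finally have "reach W N (t *\<^sub>R \<zeta>) (homog W \<zeta> + ennreal \<delta> + ennreal e)"
    unfolding reach_def using N grad_pair_scaleR[OF p] by blast
  then show "homog W (t *\<^sub>R \<zeta>) \<le> homog W \<zeta> + ennreal \<delta> + ennreal e" by (rule reach_homog_le)
qed

text \<open>The largest \<open>n\<close>-Lipschitz function below \<open>H\<close>; the infimum is that of a nonempty set only if \<open>H \<noteq> \<infinity>\<close> somewhere.\<close>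

definition inf_conv :: "('a::real_normed_vector \<Rightarrow> ennreal) \<Rightarrow> real \<Rightarrow> 'a \<Rightarrow> real" where
  "inf_conv H n \<zeta> = (INF \<omega>\<in>{\<omega>. H \<omega> < \<infinity>}. enn2real (H \<omega>) + n * norm (\<zeta> - \<omega>))"

lemma inf_conv_le:
  assumes "0 \<le> n" "H \<omega> < \<infinity>"
  shows "inf_conv H n \<zeta> \<le> enn2real (H \<omega>) + n * norm (\<zeta> - \<omega>)"
  unfolding inf_conv_def using assms by (intro cINF_lower bdd_belowI2[of _ 0]) auto

lemma inf_conv_ge:
  assumes "H \<omega>0 < \<infinity>" "\<And>\<omega>. H \<omega> < \<infinity> \<Longrightarrow> c \<le> enn2real (H \<omega>) + n * norm (\<zeta> - \<omega>)"
  shows "c \<le> inf_conv H n \<zeta>"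
  unfolding inf_conv_def using assms by (intro cINF_greatest) auto

lemma inf_conv_less:
  assumes "H \<omega>0 < \<infinity>" "inf_conv H n \<zeta> < c"
  shows "\<exists>\<omega>. H \<omega> < \<infinity> \<and> enn2real (H \<omega>) + n * norm (\<zeta> - \<omega>) < c"
  using inf_conv_ge[of H, OF assms(1), of c n \<zeta>] assms(2) by (meson not_le)

lemma inf_conv_mono:
  assumes "0 \<le> n" "n \<le> n'" "H \<omega>0 < \<infinity>"
  shows "inf_conv H n \<zeta> \<le> inf_conv H n' \<zeta>"
proof (rule inf_conv_ge[of H, OF assms(3)])
  fix \<omega> assume "H \<omega> < \<infinity>"
  then have "inf_conv H n \<zeta> \<le> enn2real (H \<omega>) + n * norm (\<zeta> - \<omega>)" by (rule inf_conv_le[of n H, OF assms(1)])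
  also have "\<dots> \<le> enn2real (H \<omega>) + n' * norm (\<zeta> - \<omega>)" using assms(2) by (intro add_left_mono mult_right_mono) auto
  finally show "inf_conv H n \<zeta> \<le> enn2real (H \<omega>) + n' * norm (\<zeta> - \<omega>)" .
qed

lemma lipschitz_integrand_inf_conv:
  assumes n: "0 \<le> n" and H: "H \<omega>0 < \<infinity>"
  shows "lipschitz_integrand (inf_conv H n) n"
proof
  show "0 \<le> inf_conv H n a" for a by (rule inf_conv_ge[of H, OF H]) (use n in simp)
  fix a b
  have "inf_conv H n a - n * norm (a - b) \<le> inf_conv H n b"
  proof (rule inf_conv_ge[of H, OF H])
    fix \<omega> assume "H \<omega> < \<infinity>"
    then have "inf_conv H n a \<le> enn2real (H \<omega>) + n * norm (a - \<omega>)" by (rule inf_conv_le[of n H, OF n])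
    also have "n * norm (a - \<omega>) \<le> n * (norm (a - b) + norm (b - \<omega>))"
      using norm_triangle_ineq[of "a - b" "b - \<omega>"] n by (intro mult_left_mono) auto
    finally show "inf_conv H n a - n * norm (a - b) \<le> enn2real (H \<omega>) + n * norm (b - \<omega>)"
      by (simp add: distrib_left)
  qed
  then show "inf_conv H n a \<le> inf_conv H n b + n * norm (a - b)" by linarith
qed (rule n)

section \<open>Lipschitz approximation of a constrained integrand\<close>

locale constrained_integrand =
  fixes C :: "(real^'d::finite^'m::finite) set" and W :: "real^'d \<Rightarrow> real^'d^'m \<Rightarrow> ennreal"
  assumes C: "bounded C" "convex C" "0 \<in> interior C"
    and periodic: "periodic_integrand W" and loc: "loc_bounded W (interior C)"
    and dom: "\<And>x. edom (W x) \<subseteq> closure C"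
begin

abbreviation "H \<equiv> homog W"
abbreviation "g k \<equiv> inf_conv H (real k)"
abbreviation "hs k \<equiv> lipschitz_integrand.h (g k)"

lemma H_0: "H 0 < \<infinity>"
  by (rule homog_finite(1)[OF loc C(3)])

lemma H_dom: "H \<zeta> < \<infinity> \<Longrightarrow> \<zeta> \<in> closure C"
  by (rule homog_finite_in_closure[OF C(2) dom])

lemma lip: "lipschitz_integrand (g k) (real k)"
  by (rule lipschitz_integrand_inf_conv[of _ H, OF _ H_0]) simp

lemma zero_closure: "0 \<in> closure C"
  using C(3) interior_subset closure_subset by blast

lemma infdist_le_g: "real k * infdist \<zeta> (closure C) \<le> g k \<zeta>"
proof (rule inf_conv_ge[of H, OF H_0])
  fix \<omega> assume "H \<omega> < \<infinity>"
  then have "infdist \<zeta> (closure C) \<le> norm (\<zeta> - \<omega>)" using infdist_le[OF H_dom] by (simp add: dist_norm)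
  then have "real k * infdist \<zeta> (closure C) \<le> real k * norm (\<zeta> - \<omega>)" by (intro mult_left_mono) auto
  then show "real k * infdist \<zeta> (closure C) \<le> enn2real (H \<omega>) + real k * norm (\<zeta> - \<omega>)"
    using enn2real_nonneg[of "H \<omega>"] by linarith
qed

lemma g_le: "ennreal (g k \<zeta>) \<le> H \<zeta>"
proof (cases "H \<zeta> < \<infinity>")
  case True
  then have "g k \<zeta> \<le> enn2real (H \<zeta>)" using inf_conv_le[of "real k" H \<zeta> \<zeta>] by simp
  then have "ennreal (g k \<zeta>) \<le> ennreal (enn2real (H \<zeta>))" by (rule ennreal_leI)
  also have "\<dots> = H \<zeta>" using True by simp
  finally show ?thesis .
qed (simp add: less_top[symmetric])

lemma hs_le: "ennreal (hs k \<zeta>) \<le> H \<zeta>"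
  using lipschitz_integrand.h_le[OF lip] g_le by (meson ennreal_leI order_trans)

lemma hs_mono: "hs k \<zeta> \<le> hs (Suc k) \<zeta>"
proof -
  have "ennreal (hs k \<zeta>) \<le> ennreal (hs (Suc k) \<zeta>)"
    unfolding lipschitz_integrand.homog_eq[OF lip, symmetric]
    by (intro homog_mono ennreal_leI inf_conv_mono[of _ _ H, OF _ _ H_0]) simp_all
  then show ?thesis by (simp only: ennreal_le_iff[OF lipschitz_integrand.h_nonneg[OF lip]])
qed

text \<open>Comparison with \<open>\<omega> = 0\<close>, where \<open>H\<close> is finite, gives
  linear growth; hence the exponent 1.\<close>

lemma hs_growth: "\<exists>\<alpha>>0. \<forall>\<xi>. hs k \<xi> \<le> \<alpha> * (1 + norm \<xi> powr 1)"
proof (intro exI conjI allI)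
  let ?\<alpha> = "enn2real (H 0) + real k + 1"
  show "?\<alpha> > 0" using enn2real_nonneg[of "H 0"] by linarith
  fix \<xi>
  have "hs k \<xi> \<le> g k \<xi>" by (rule lipschitz_integrand.h_le[OF lip])
  also have "\<dots> \<le> enn2real (H 0) + real k * norm \<xi>" using inf_conv_le[of "real k" H 0 \<xi>] H_0 by simp
  also have "\<dots> \<le> ?\<alpha> * 1 + ?\<alpha> * norm \<xi>"
    using enn2real_nonneg[of "H 0"] by (intro add_mono mult_right_mono) auto
  also have "\<dots> = ?\<alpha> * (1 + norm \<xi> powr 1)" by (simp add: distrib_left)
  finally show "hs k \<xi> \<le> ?\<alpha> * (1 + norm \<xi> powr 1)" .
qed

text \<open>All compactness data for a fixed \<open>t\<close>. The set \<open>K\<close> is a closed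
  neighbourhood of the compact set \<open>t *\<^sub>R closure C\<close> in
  \<open>interior C\<close>, and on it \<open>H\<close> is bounded and uniformly continuous. The
  radius \<open>3 * \<rho>\<close> leaves room for two errors of size \<rho>, one from truncation
  and one from the infimal convolution.\<close>

lemma scaled_neighbourhood:
  assumes t: "0 \<le> t" "t < 1" and e: "0 < \<epsilon>"
  obtains \<rho> M :: real and K where "0 < \<rho>" "0 \<le> M" "K \<subseteq> interior C"
    "\<And>\<omega>. infdist \<omega> (closure C) \<le> \<rho> \<Longrightarrow> t *\<^sub>R \<omega> \<in> K" "\<And>\<omega>. \<omega> \<in> K \<Longrightarrow> H \<omega> \<le> ennreal M"
    "\<And>\<omega> \<omega>'. \<omega> \<in> K \<Longrightarrow> \<omega>' \<in> K \<Longrightarrow> norm (\<omega> - \<omega>') < 3 * \<rho> \<Longrightarrow> H \<omega> \<le> H \<omega>' + ennreal \<epsilon>"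
proof -
  let ?C = "closure C"
  define T where "T = (\<lambda>x. t *\<^sub>R x) ` ?C"
  have Cc: "compact ?C" using C(1) by simp
  have Cn: "?C \<noteq> {}" using zero_closure by auto
  have Tc: "compact T" unfolding T_def by (intro compact_continuous_image Cc continuous_intros)
  have Tn: "T \<noteq> {}" using Cn by (simp add: T_def)
  have TU: "T \<subseteq> interior C"
  proof
    fix y assume "y \<in> T"
    then obtain x where x: "x \<in> ?C" "y = t *\<^sub>R x" by (auto simp: T_def)
    show "y \<in> interior C"
      using mem_interior_closure_convex_shrink[OF C(2,3) x(1), of "1 - t"] t x(2)
      by (cases "t = 0") (auto simp: C(3) algebra_simps)
  qed
  obtain r where r: "r > 0" "(\<Union>x\<in>T. cball x r) \<subseteq> interior C"
    using compact_subset_open_imp_cball_epsilon_subset[OF Tc open_interior TU] by blast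
  define K where "K = {x. infdist x T \<le> r}"
  have Kc: "compact K" unfolding K_def by (rule compact_infdist_le[OF Tn Tc r(1)])
  have KU: "K \<subseteq> interior C"
  proof
    fix x assume "x \<in> K"
    moreover obtain y where "y \<in> T" "infdist x T = dist x y"
      using infdist_attains_inf[OF compact_imp_closed[OF Tc] Tn] by blast
    ultimately have "x \<in> (\<Union>x\<in>T. cball x r)" by (auto simp: K_def dist_commute)
    then show "x \<in> interior C" using r(2) by blast
  qed
  obtain M where M: "0 \<le> M" "AE x in lborel. \<forall>\<zeta>\<in>K. W x \<zeta> \<le> ennreal M"
    by (rule loc_boundedE[OF loc Kc KU])
  have HM: "H \<omega> \<le> ennreal M" if \<omega>: "\<omega> \<in> K" for \<omega>
    by (rule homog_le_const) (use M(2) in \<open>eventually_elim, use \<omega> in blast\<close>)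
  have uc: "uniformly_continuous_on K (\<lambda>\<xi>. enn2real (H \<xi>))"
    by (rule compact_uniformly_continuous[OF continuous_on_subset[OF homog_continuous_on[OF periodic loc] KU] Kc])
  have "\<exists>s>0. \<forall>\<omega>\<in>K. \<forall>\<omega>'\<in>K. dist \<omega>' \<omega> < s \<longrightarrow> dist (enn2real (H \<omega>')) (enn2real (H \<omega>)) < \<epsilon>"
    using spec[OF uc[unfolded uniformly_continuous_on_def], of \<epsilon>] e by (rule mp)
  then obtain s where s: "s > 0" "\<forall>\<omega>\<in>K. \<forall>\<omega>'\<in>K. dist \<omega>' \<omega> < s \<longrightarrow> dist (enn2real (H \<omega>')) (enn2real (H \<omega>)) < \<epsilon>"
    by (elim exE conjE) (rule that)
  show ?thesis
  proof (rule that[of "min r (s / 3)" M K])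
    show "t *\<^sub>R \<omega> \<in> K" if "infdist \<omega> ?C \<le> min r (s / 3)" for \<omega>
    proof -
      obtain y where y: "y \<in> ?C" "infdist \<omega> ?C = dist \<omega> y"
        using infdist_attains_inf[OF closed_closure Cn, of \<omega>] by blast
      have "infdist (t *\<^sub>R \<omega>) T \<le> dist (t *\<^sub>R \<omega>) (t *\<^sub>R y)"
        unfolding T_def by (intro infdist_le imageI y(1))
      also have "\<dots> = t * dist \<omega> y" using t(1) by (simp add: dist_norm flip: scaleR_diff_right)
      also have "\<dots> \<le> dist \<omega> y" using t by (simp add: mult_left_le_one_le)
      finally show ?thesis using that y(2) by (simp add: K_def)
    qed
    show "H \<omega> \<le> H \<omega>' + ennreal \<epsilon>" if "\<omega> \<in> K" "\<omega>' \<in> K" "norm (\<omega> - \<omega>') < 3 * min r (s / 3)" for \<omega> \<omega>'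
    proof -
      have "dist (enn2real (H \<omega>)) (enn2real (H \<omega>')) < \<epsilon>" using that by (intro s(2)[rule_format]) (auto simp: dist_norm)
      then have "enn2real (H \<omega>) \<le> enn2real (H \<omega>') + \<epsilon>" by (simp add: dist_real_def)
      then have "ennreal (enn2real (H \<omega>)) \<le> ennreal (enn2real (H \<omega>') + \<epsilon>)" by (rule ennreal_leI)
      also have "\<dots> = ennreal (enn2real (H \<omega>')) + ennreal \<epsilon>" using e by (intro ennreal_plus) auto
      finally have "ennreal (enn2real (H \<omega>)) \<le> ennreal (enn2real (H \<omega>')) + ennreal \<epsilon>" .
      then show ?thesis using homog_finite(2)[OF loc] that(1,2) KU by (metis subsetD)
    qed
  qed (use r s M(1) KU HM in auto)
qed

text \<open>Off three sets of measure at most \<open>q\<close> each, \<open>H\<close> at the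
  truncated and scaled gradient exceeds \<open>g k\<close> at the original one by at most
  \<open>\<delta> + 2 * \<epsilon>\<close>; on these sets only the bound \<open>M\<close> is
  available. The seven \<epsilon> are one from the choice of the test map, one from
  \<open>e0\<close>, two from the comparison, and three from \<open>M * q\<close>. All parameters
  except \<open>k\<close> and the maps are fixed beforehand, and \<open>M\<close> does not depend on
  \<open>k\<close>.\<close>

lemma homog_scaled_le_aux:
  assumes t: "0 \<le> t" "t < 1" and \<delta>: "0 \<le> \<delta>" "\<And>\<zeta>. H (t *\<^sub>R \<zeta>) \<le> H \<zeta> + ennreal \<delta>"
    and \<xi>: "\<xi> \<in> closure C" and m: "\<And>k. hs k \<xi> \<le> m" and \<epsilon>: "0 < \<epsilon>" "\<epsilon> \<le> 1"
  shows "H (t *\<^sub>R \<xi>) \<le> ennreal (m + \<delta> + 7 * \<epsilon>)"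
proof -
  let ?C = "closure C" and ?d = "CARD('d)" and ?Q = "cube 1 :: (real^'d) set"
  obtain \<rho> M :: real and K where \<rho>: "0 < \<rho>" and M: "0 \<le> M" and K: "K \<subseteq> interior C"
    "\<And>\<omega>. infdist \<omega> ?C \<le> \<rho> \<Longrightarrow> t *\<^sub>R \<omega> \<in> K" "\<And>\<omega>. \<omega> \<in> K \<Longrightarrow> H \<omega> \<le> ennreal M"
    "\<And>\<omega> \<omega>'. \<omega> \<in> K \<Longrightarrow> \<omega>' \<in> K \<Longrightarrow> norm (\<omega> - \<omega>') < 3 * \<rho> \<Longrightarrow> H \<omega> \<le> H \<omega>' + ennreal \<epsilon>"
    by (rule scaled_neighbourhood[OF t \<epsilon>(1)]) (rule that)
  have m0: "0 \<le> m" using m[of 0] lipschitz_integrand.h_nonneg[OF lip, of 0 \<xi>] by linarith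
  have Cc: "compact ?C" using C(1) by simp
  have Cn: "?C \<noteq> {}" using \<xi> by auto
  obtain c :: real where c: "0 < c" and trunc:
    "\<And>\<xi> (\<phi> :: real^'d \<Rightarrow> real^'m) G I s a b. \<lbrakk>\<xi> \<in> ?C; C1_map \<phi> G; \<forall>x. x \<notin> cbox (vec a) (vec b) \<longrightarrow> \<phi> x = 0;
      (\<integral>\<^sup>+x. ennreal (infdist (\<xi> + G x) ?C) \<partial>lborel) \<le> ennreal I; 0 \<le> I; 0 < s; I < c * s ^ ?d\<rbrakk>
    \<Longrightarrow> \<exists>\<phi>' G' B. C1_map \<phi>' G' \<and> (\<forall>x. x \<notin> cbox (vec (a - s)) (vec (b + s)) \<longrightarrow> \<phi>' x = 0) \<and> open B \<and>
      emeasure lborel B \<le> ennreal (I / c) \<and> (\<forall>x. infdist (\<xi> + G' x) ?C \<le> \<rho>) \<and> (\<forall>x. x \<notin> B \<longrightarrow> norm (G' x - G x) \<le> \<rho>)"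
    by (rule lipschitz_truncation[OF Cc convex_closure[OF C(2)] Cn \<rho>]) (rule that, assumption, blast)
  define q where "q = \<epsilon> / (M + 1)"
  have q: "0 < q" "M * q \<le> \<epsilon>"
  proof -
    show "0 < q" using \<epsilon> M by (simp add: q_def)
    have "M * q = \<epsilon> * (M / (M + 1))" by (simp add: q_def)
    also have "\<dots> \<le> \<epsilon> * 1" using \<epsilon> M by (intro mult_left_mono) (auto simp: divide_le_eq_1)
    finally show "M * q \<le> \<epsilon>" by simp
  qed
  \<comment> \<open>The unit cube enlarged by \<open>2 * s\<close> on every side has volume exactly
    \<open>1 + q\<close>: one \<open>s\<close> for the truncation, and another that exceeds the
    spreading \<open>e0\<close> of the test map.\<close>
  define s where "s = (root ?d (1 + q) - 1) / 4"
  have s: "0 < s" "(1 + 4 * s) ^ ?d = 1 + q"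
  proof -
    have "1 < root ?d (1 + q)" using q(1) by (subst real_root_gt_1_iff) auto
    then show "0 < s" by (simp add: s_def)
    have "1 + 4 * ((y - 1) / 4) = y" for y :: real by (simp add: field_simps)
    then have "1 + 4 * s = root ?d (1 + q)" unfolding s_def .
    then show "(1 + 4 * s) ^ ?d = 1 + q" using q(1) by (simp add: real_root_pow_pos)
  qed
  \<comment> \<open>The allowed mean distance to \<open>closure C\<close>: small enough for the
    truncation with margin \<open>s\<close> to apply and for its bad set to have measure at most
    \<open>q\<close>.\<close>
  define I where "I = min (c * s ^ ?d / 2) (c * q)"
  have I: "0 < I" "I < c * s ^ ?d" "I / c \<le> q"
  proof -
    have "0 < c * s ^ ?d" using c s(1) by simp
    moreover have "0 < c * q" using c q(1) by simp
    moreover have "I \<le> c * s ^ ?d / 2" by (simp add: I_def)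
    ultimately show "0 < I" "I < c * s ^ ?d" by (auto simp: I_def)
    have "I \<le> q * c" by (simp add: I_def mult.commute)
    then show "I / c \<le> q" using c by (simp add: pos_divide_le_eq)
  qed
  define e0 where "e0 = min (min (s / 2) \<epsilon>) (I / 2)"
  have e0: "0 < e0" "e0 \<le> s / 2" "e0 \<le> \<epsilon>" "e0 \<le> I / 2" using s(1) \<epsilon>(1) I(1) by (auto simp: e0_def)
  \<comment> \<open>The threshold for Markov's inequality: the integral of \<open>g k\<close> is at
    most \<open>m + 2\<close>, so \<open>g k\<close> exceeds \<open>P\<close> on a set of measure at
    most \<open>q\<close>.\<close>
  define P where "P = (m + 2) / q"
  have P: "0 < P" "(m + 2) / P = q" using m0 q(1) by (auto simp: P_def)
  \<comment> \<open>Two demands on the Lipschitz constant: the energy bound must force the mean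
    distance inside the cube below \<open>I / 2\<close>, and an almost minimizing point in the
    infimal convolution must be within \<rho> wherever \<open>g k\<close> is at most
    \<open>P\<close>.\<close>
  obtain k :: nat where "k > 0" and kI: "(m + 2) / real k \<le> I / 2" and kP: "(P + 1) / real k < \<rho>"
  proof -
    obtain k1 :: nat where k1: "2 * (m + 2) / I < real k1" using reals_Archimedean2 by blast
    obtain k2 :: nat where k2: "(P + 1) / \<rho> < real k2" using reals_Archimedean2 by blast
    let ?k = "max k1 k2"
    have "0 < (P + 1) / \<rho>" using P \<rho> by simp
    then have k0: "real ?k > 0" using k2 by linarith
    show ?thesis
    proof (rule that[of ?k])
      show "?k > 0" using k0 by simp
      have "2 * (m + 2) / I < real ?k" using k1 by simp
      then show "(m + 2) / real ?k \<le> I / 2" using k0 I(1) by (simp add: field_simps)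
      have "(P + 1) / \<rho> < real ?k" using k2 by simp
      then show "(P + 1) / real ?k < \<rho>" using k0 \<rho> by (simp add: field_simps)
    qed
  qed
  then have k: "real k > 0" by simp
  interpret L: lipschitz_integrand "g k" "real k" by (rule lip)
  have "L.h \<xi> < m + \<epsilon>" using m[of k] \<epsilon> by simp
  then obtain \<phi> G where cm: "C1_map \<phi> G" and supp: "\<And>x. x \<notin> cbox (vec (- e0)) (vec (1 + e0)) \<Longrightarrow> \<phi> x = 0"
    and gi: "(\<integral>\<^sup>+x\<in>?Q. ennreal (g k (\<xi> + G x)) \<partial>lborel) \<le> ennreal (m + \<epsilon> + e0)"
    and Go: "(\<integral>\<^sup>+x\<in>- ?Q. ennreal (norm (G x)) \<partial>lborel) \<le> ennreal e0"
    by (rule L.h_less_C1[OF _ e0(1)]) (rule that)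
  have Gm [measurable]: "G \<in> borel_measurable borel"
    by (rule borel_measurable_continuous_onI[OF C1_map_gradient_continuous[OF cm]])
  have gm [measurable]: "(\<lambda>x. g k (\<xi> + G x)) \<in> borel_measurable borel"
    by (rule measurable_compose[OF _ L.g_measurable]) measurable
  have gi2: "(\<integral>\<^sup>+x\<in>?Q. ennreal (g k (\<xi> + G x)) \<partial>lborel) \<le> ennreal (m + 2)"
    by (rule order_trans[OF gi]) (use e0 \<epsilon> in \<open>intro ennreal_leI, linarith\<close>)
  have small: "(\<integral>\<^sup>+x. ennreal (infdist (\<xi> + G x) ?C) \<partial>lborel) \<le> ennreal I"
  proof -
    have "(\<integral>\<^sup>+x. ennreal (infdist (\<xi> + G x) ?C) \<partial>lborel)
      \<le> (\<integral>\<^sup>+x. ennreal (1 / real k) * (ennreal (g k (\<xi> + G x)) * indicator ?Q x) + ennreal (norm (G x)) * indicator (- ?Q) x \<partial>lborel)"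
    proof (rule nn_integral_mono)
      fix x :: "real^'d"
      have "infdist (\<xi> + G x) ?C \<le> 1 / real k * g k (\<xi> + G x)"
        using infdist_le_g[of k "\<xi> + G x"] k by (simp add: field_simps)
      then have "ennreal (infdist (\<xi> + G x) ?C) \<le> ennreal (1 / real k) * ennreal (g k (\<xi> + G x))"
        using k L.nonneg by (subst ennreal_mult[symmetric]) (auto intro: ennreal_leI)
      \<comment> \<open>Outside the unit cube there is no energy bound; since \<xi> lies in
        \<open>closure C\<close>, the spilled gradient bounds the distance there.\<close>
      moreover have "infdist (\<xi> + G x) ?C \<le> norm (G x)" using infdist_le[OF \<xi>, of "\<xi> + G x"] by (simp add: dist_norm)
      ultimately show "ennreal (infdist (\<xi> + G x) ?C)
        \<le> ennreal (1 / real k) * (ennreal (g k (\<xi> + G x)) * indicator ?Q x) + ennreal (norm (G x)) * indicator (- ?Q) x"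
        by (auto simp: indicator_def intro: ennreal_leI)
    qed
    also have "\<dots> = ennreal (1 / real k) * (\<integral>\<^sup>+x\<in>?Q. ennreal (g k (\<xi> + G x)) \<partial>lborel) + (\<integral>\<^sup>+x\<in>- ?Q. ennreal (norm (G x)) \<partial>lborel)"
      by (simp add: nn_integral_add nn_integral_cmult)
    also have "\<dots> \<le> ennreal (1 / real k) * ennreal (m + 2) + ennreal e0"
      by (intro add_mono mult_left_mono gi2 Go) simp
    also have "\<dots> = ennreal ((m + 2) / real k + e0)"
      using k m0 e0(1) by (simp flip: ennreal_mult ennreal_plus)
    also have "\<dots> \<le> ennreal I" using kI e0(4) by (intro ennreal_leI) linarith
    finally show ?thesis .
  qed
  have supp': "\<forall>x. x \<notin> cbox (vec (- e0)) (vec (1 + e0)) \<longrightarrow> \<phi> x = 0" using supp by blast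
  obtain \<phi>' G' B where cm': "C1_map \<phi>' G'" and z': "\<And>x. x \<notin> cbox (vec (- e0 - s)) (vec (1 + e0 + s)) \<Longrightarrow> \<phi>' x = 0"
    and B: "open B" "emeasure lborel B \<le> ennreal (I / c)" and near: "\<And>x. infdist (\<xi> + G' x) ?C \<le> \<rho>"
    and close: "\<And>x. x \<notin> B \<Longrightarrow> norm (G' x - G x) \<le> \<rho>"
    using trunc[OF \<xi> cm supp' small less_imp_le[OF I(1)] s(1) I(2)] by blast
  have [measurable]: "B \<in> sets borel" using B(1) by simp
  define B2 where "B2 = {x \<in> ?Q. P < g k (\<xi> + G x)}"
  have B2m [measurable]: "B2 \<in> sets borel" unfolding B2_def by measurable
  have B2: "emeasure lborel B2 \<le> ennreal q"
  proof -
    have "ennreal P * emeasure lborel B2 = (\<integral>\<^sup>+x. ennreal P * indicator B2 x \<partial>lborel)"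
      by (rule nn_integral_cmult_indicator[symmetric]) measurable
    also have "\<dots> \<le> (\<integral>\<^sup>+x\<in>?Q. ennreal (g k (\<xi> + G x)) \<partial>lborel)"
      by (intro nn_integral_mono) (auto simp: indicator_def B2_def intro!: ennreal_leI)
    also have "\<dots> \<le> ennreal (m + 2)" by (rule gi2)
    also have "\<dots> = ennreal P * ennreal q" using P q(1) m0 by (simp add: P_def flip: ennreal_mult)
    finally show ?thesis using P(1) by (subst (asm) ennreal_mult_le_mult_iff) auto
  qed
  define R where "R = (box (vec (- (2 * s))) (vec (1 + 2 * s)) :: (real^'d) set)"
  have [measurable]: "R \<in> sets borel" by (simp add: R_def)
  have QR: "?Q \<subseteq> R"
  proof
    fix x assume x: "x \<in> ?Q"
    have "- (2 * s) < x $ i \<and> x $ i < 1 + 2 * s" for i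
    proof -
      have "0 < x $ i \<and> x $ i < 1" using x by (simp add: cube_def)
      then show ?thesis using s(1) by linarith
    qed
    then show "x \<in> R" by (simp add: R_def mem_box_cart)
  qed
  have mR: "emeasure lborel R = ennreal (1 + q)"
    using emeasure_box_const(1)[of "- (2 * s)" "1 + 2 * s", where 'd = 'd] s by (simp add: R_def add.commute)
  have RQ: "emeasure lborel (R - ?Q) = ennreal q"
    using QR q(1) by (subst emeasure_Diff) (auto simp: mR emeasure_cube ennreal_minus simp flip: ennreal_1)
  have inK: "t *\<^sub>R (\<xi> + G' x) \<in> K" for x by (rule K(2)[OF near])
  have good: "H (t *\<^sub>R (\<xi> + G' x)) \<le> ennreal (g k (\<xi> + G x)) + ennreal (\<delta> + 2 * \<epsilon>)"
    if x: "x \<notin> B" "g k (\<xi> + G x) \<le> P" for x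
  proof -
    \<comment> \<open>The point \<omega> almost attains the infimal convolution. It lies in
      \<open>closure C\<close> and near the gradient, so after scaling by \<open>t\<close> both lie
      in \<open>K\<close>, where the uniform continuity of \<open>H\<close> and the radial estimate
      at \<omega> can be combined.\<close>
    have "g k (\<xi> + G x) < g k (\<xi> + G x) + \<epsilon>" using \<epsilon> by simp
    then obtain \<omega> where \<omega>: "H \<omega> < \<infinity>" "enn2real (H \<omega>) + real k * norm (\<xi> + G x - \<omega>) < g k (\<xi> + G x) + \<epsilon>"
      using inf_conv_less[of H, OF H_0] by blast
    have "real k * norm (\<xi> + G x - \<omega>) < P + 1" using \<omega>(2) x(2) \<epsilon>(2) enn2real_nonneg[of "H \<omega>"] by linarith
    then have "norm (\<xi> + G x - \<omega>) < (P + 1) / real k" using k by (simp add: pos_less_divide_eq mult.commute)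
    then have n1: "norm (\<xi> + G x - \<omega>) < \<rho>" using kP by linarith
    have "t *\<^sub>R (\<xi> + G' x) - t *\<^sub>R \<omega> = t *\<^sub>R ((G' x - G x) + (\<xi> + G x - \<omega>))" by (simp add: algebra_simps)
    then have "norm (t *\<^sub>R (\<xi> + G' x) - t *\<^sub>R \<omega>) = t * norm ((G' x - G x) + (\<xi> + G x - \<omega>))" using t(1) by simp
    also have "\<dots> \<le> norm ((G' x - G x) + (\<xi> + G x - \<omega>))" using t by (simp add: mult_left_le_one_le)
    also have "\<dots> \<le> norm (G' x - G x) + norm (\<xi> + G x - \<omega>)" by (rule norm_triangle_ineq)
    also have "\<dots> < 3 * \<rho>" using close[OF x(1)] n1 \<rho> by linarith
    finally have n2: "norm (t *\<^sub>R (\<xi> + G' x) - t *\<^sub>R \<omega>) < 3 * \<rho>" .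
    have "t *\<^sub>R \<omega> \<in> K" using \<rho> H_dom[OF \<omega>(1)] by (intro K(2)) simp
    then have "H (t *\<^sub>R (\<xi> + G' x)) \<le> H (t *\<^sub>R \<omega>) + ennreal \<epsilon>" by (intro K(4) inK n2)
    also have "\<dots> \<le> H \<omega> + ennreal \<delta> + ennreal \<epsilon>" by (intro add_right_mono \<delta>(2))
    also have "H \<omega> \<le> ennreal (g k (\<xi> + G x) + \<epsilon>)"
    proof -
      have "0 \<le> real k * norm (\<xi> + G x - \<omega>)" by simp
      then have "enn2real (H \<omega>) \<le> g k (\<xi> + G x) + \<epsilon>" using \<omega>(2) by linarith
      then have "ennreal (enn2real (H \<omega>)) \<le> ennreal (g k (\<xi> + G x) + \<epsilon>)" by (rule ennreal_leI)
      then show ?thesis using \<omega>(1) by (simp add: less_top)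
    qed
    finally have "H (t *\<^sub>R (\<xi> + G' x)) \<le> ennreal (g k (\<xi> + G x) + \<epsilon>) + ennreal \<delta> + ennreal \<epsilon>" by (simp add: add_right_mono)
    also have "\<dots> = ennreal (g k (\<xi> + G x)) + ennreal (\<delta> + 2 * \<epsilon>)"
      using \<epsilon> \<delta>(1) L.nonneg[of "\<xi> + G x"] by (simp flip: ennreal_plus)
    finally show ?thesis .
  qed
  have jensen: "H (t *\<^sub>R \<xi>) * ennreal ((1 + 2 * s - (- (2 * s))) ^ ?d)
      \<le> (\<integral>\<^sup>+x\<in>box (vec (- (2 * s))) (vec (1 + 2 * s)). H (t *\<^sub>R \<xi> + t *\<^sub>R G' x) \<partial>lborel)"
  proof (rule homog_jensen_box[OF periodic loc])
    show "C1_map (\<lambda>x. t *\<^sub>R \<phi>' x) (\<lambda>x. t *\<^sub>R G' x)" by (rule C1_map_scaleR[OF cm'])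
    show "compact (cbox (vec (- e0 - s)) (vec (1 + e0 + s)) :: (real^'d) set)" by simp
    show "cbox (vec (- e0 - s)) (vec (1 + e0 + s)) \<subseteq> (box (vec (- (2 * s))) (vec (1 + 2 * s)) :: (real^'d) set)"
    proof
      fix x :: "real^'d" assume x: "x \<in> cbox (vec (- e0 - s)) (vec (1 + e0 + s))"
      have "- (2 * s) < x $ i \<and> x $ i < 1 + 2 * s" for i
      proof -
        have "- e0 - s \<le> x $ i \<and> x $ i \<le> 1 + e0 + s" using x by (simp add: mem_box_cart)
        then show ?thesis using e0(2) s(1) by linarith
      qed
      then show "x \<in> box (vec (- (2 * s))) (vec (1 + 2 * s))" by (simp add: mem_box_cart)
    qed
    show "t *\<^sub>R \<phi>' x = 0" if "x \<notin> cbox (vec (- e0 - s)) (vec (1 + e0 + s))" for x using z'[OF that] by simp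
    show "t *\<^sub>R \<xi> + t *\<^sub>R G' x \<in> interior C" for x using inK[of x] K(1) by (auto simp: scaleR_add_right)
  qed (use s in simp)
  have s4: "1 + 2 * s - (- (2 * s)) = 1 + 4 * s" by simp
  have "H (t *\<^sub>R \<xi>) * 1 \<le> H (t *\<^sub>R \<xi>) * ennreal (1 + q)" using q(1) by (intro mult_left_mono) auto
  also have "\<dots> \<le> (\<integral>\<^sup>+x\<in>R. H (t *\<^sub>R (\<xi> + G' x)) \<partial>lborel)"
    using jensen unfolding s4 s(2) R_def scaleR_add_right .
  also have "\<dots> \<le> (\<integral>\<^sup>+x. ennreal (g k (\<xi> + G x)) * indicator ?Q x + (ennreal (\<delta> + 2 * \<epsilon>) * indicator ?Q x
      + (ennreal M * indicator B x + (ennreal M * indicator B2 x + ennreal M * indicator (R - ?Q) x))) \<partial>lborel)"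
    (is "_ \<le> (\<integral>\<^sup>+x. ?F x \<partial>lborel)")
  proof (rule nn_integral_mono)
    fix x :: "real^'d"
    show "H (t *\<^sub>R (\<xi> + G' x)) * indicator R x \<le> ?F x"
    proof (cases "x \<in> R \<and> x \<notin> B \<and> x \<notin> B2 \<and> x \<in> ?Q")
      case True
      then have "g k (\<xi> + G x) \<le> P" by (auto simp: B2_def)
      then have "H (t *\<^sub>R (\<xi> + G' x)) * indicator R x \<le> (ennreal (g k (\<xi> + G x)) + ennreal (\<delta> + 2 * \<epsilon>)) * 1"
        using True good[of x] by simp
      also have "\<dots> \<le> ?F x" using True by simp
      finally show ?thesis .
    next
      case False
      have "ennreal M * indicator R x \<le> ennreal M * indicator B x + (ennreal M * indicator B2 x + ennreal M * indicator (R - ?Q) x)"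
        using False by (auto simp: indicator_def)
      also have "\<dots> \<le> ?F x" by (rule order_trans[OF add_increasing add_increasing]) auto
      finally show ?thesis using mult_right_mono[OF K(3)[OF inK[of x]], of "indicator R x"] by (rule order_trans[rotated]) simp
    qed
  qed
  also have "\<dots> = (\<integral>\<^sup>+x\<in>?Q. ennreal (g k (\<xi> + G x)) \<partial>lborel) + (ennreal (\<delta> + 2 * \<epsilon>) * 1
      + (ennreal M * emeasure lborel B + (ennreal M * emeasure lborel B2 + ennreal M * emeasure lborel (R - ?Q))))"
    by (simp add: nn_integral_add nn_integral_cmult_indicator emeasure_cube)
  also have "\<dots> \<le> ennreal (m + \<epsilon> + e0) + (ennreal (\<delta> + 2 * \<epsilon>) * 1 + (ennreal M * ennreal q + (ennreal M * ennreal q + ennreal M * ennreal q)))"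
    unfolding RQ by (intro add_mono gi mult_left_mono order_trans[OF B(2) ennreal_leI[OF I(3)]] B2) auto
  also have "\<dots> = ennreal (m + \<epsilon> + e0 + (\<delta> + 2 * \<epsilon> + (M * q + (M * q + M * q))))"
    using m0 \<epsilon> e0(1) \<delta>(1) M q(1) by (simp add: ennreal_mult[symmetric] ennreal_plus[symmetric] del: ennreal_plus)
  also have "\<dots> \<le> ennreal (m + \<delta> + 7 * \<epsilon>)" using q(2) e0(3) by (intro ennreal_leI) linarith
  finally show ?thesis by simp
qed

lemma homog_scaled_le:
  assumes t: "0 \<le> t" "t < 1" and \<delta>: "0 \<le> \<delta>" "\<And>\<zeta>. H (t *\<^sub>R \<zeta>) \<le> H \<zeta> + ennreal \<delta>"
    and \<xi>: "\<xi> \<in> closure C" and m: "\<And>k. hs k \<xi> \<le> m"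
  shows "H (t *\<^sub>R \<xi>) \<le> ennreal (m + \<delta>)"
proof (rule ennreal_le_epsilon)
  fix e :: real assume e: "e > 0"
  have m0: "0 \<le> m" using m[of 0] lipschitz_integrand.h_nonneg[OF lip, of 0 \<xi>] by linarith
  have "H (t *\<^sub>R \<xi>) \<le> ennreal (m + \<delta> + 7 * min 1 (e / 7))"
    using e by (intro homog_scaled_le_aux[OF t \<delta> \<xi> m]) auto
  also have "\<dots> \<le> ennreal (m + \<delta> + e)" by (intro ennreal_leI) (simp add: min_def)
  also have "\<dots> = ennreal (m + \<delta>) + ennreal e" using m0 \<delta>(1) e by (intro ennreal_plus) auto
  finally show "H (t *\<^sub>R \<xi>) \<le> ennreal (m + \<delta>) + ennreal e" .
qed

text \<open>A multiple \<open>k\<close> of the signed distance to a separating hyperplane is an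
  affine function below \<open>g k\<close>, so it stays below the homogenization; its value at \<xi>
  grows linearly in \<open>k\<close>.\<close>

lemma hs_bounded_in_closure:
  assumes m: "\<And>k. hs k \<xi> \<le> m"
  shows "\<xi> \<in> closure C"
proof (rule ccontr)
  assume "\<xi> \<notin> closure C"
  then obtain a b where ab: "a \<bullet> \<xi> < b" "\<And>x. x \<in> closure C \<Longrightarrow> b < a \<bullet> x"
    using separating_hyperplane_closed_point[OF convex_closure[OF C(2)] closed_closure] by blast
  have a: "norm a > 0" using ab(1) ab(2)[OF zero_closure] by auto
  define r where "r = (b - a \<bullet> \<xi>) / norm a"
  have r: "r > 0" using ab(1) a by (simp add: r_def)
  have m0: "0 \<le> m" using m[of 0] lipschitz_integrand.h_nonneg[OF lip, of 0 \<xi>] by linarith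
  obtain k :: nat where "m / r < real k" using reals_Archimedean2 by blast
  then have k: "m < real k * r" using r by (simp add: pos_divide_less_eq)
  have le: "real k * b / norm a + (- (real k / norm a) *\<^sub>R a) \<bullet> \<zeta> \<le> g k \<zeta>" for \<zeta>
  proof (rule inf_conv_ge[of H, OF H_0])
    fix \<omega> assume "H \<omega> < \<infinity>"
    then have "b < a \<bullet> \<omega>" by (intro ab(2) H_dom)
    have "a \<bullet> (\<omega> - \<zeta>) \<le> norm a * norm (\<omega> - \<zeta>)" by (rule norm_cauchy_schwarz)
    then have "b - a \<bullet> \<zeta> \<le> norm a * norm (\<zeta> - \<omega>)"
      using \<open>b < a \<bullet> \<omega>\<close> unfolding inner_diff_right norm_minus_commute[of \<zeta>] by linarith
    then have "(real k / norm a) * (b - a \<bullet> \<zeta>) \<le> (real k / norm a) * (norm a * norm (\<zeta> - \<omega>))" using a by (intro mult_left_mono) auto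
    then have "(real k / norm a) * (b - a \<bullet> \<zeta>) \<le> real k * norm (\<zeta> - \<omega>)" using a by simp
    moreover have "real k * b / norm a + (- (real k / norm a) *\<^sub>R a) \<bullet> \<zeta> = (real k / norm a) * (b - a \<bullet> \<zeta>)"
      by (simp add: right_diff_distrib)
    ultimately show "real k * b / norm a + (- (real k / norm a) *\<^sub>R a) \<bullet> \<zeta> \<le> enn2real (H \<omega>) + real k * norm (\<zeta> - \<omega>)"
      using enn2real_nonneg[of "H \<omega>"] by linarith
  qed
  have "ennreal (real k * b / norm a + (- (real k / norm a) *\<^sub>R a) \<bullet> \<xi>) \<le> homog (\<lambda>(x :: real^'d) \<zeta>. ennreal (g k \<zeta>)) \<xi>"
    by (intro homog_ge_affine ennreal_leI le)
  also have "\<dots> \<le> ennreal m" unfolding lipschitz_integrand.homog_eq[OF lip] by (intro ennreal_leI m)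
  finally have "real k * b / norm a + (- (real k / norm a) *\<^sub>R a) \<bullet> \<xi> \<le> m" using m0 by (simp add: ennreal_le_iff)
  moreover have "real k * b / norm a + (- (real k / norm a) *\<^sub>R a) \<bullet> \<xi> = real k * r"
    by (simp add: r_def right_diff_distrib diff_divide_distrib)
  ultimately show False using k by simp
qed

text \<open>Every \<open>hs k\<close> is a continuous minorant of \<open>H\<close>, hence the lower
  bound. Conversely, a lower semicontinuous minorant that exceeds \<open>m + e\<close> at \<xi> does
  so at \<open>t *\<^sub>R \<xi>\<close> for \<open>t\<close> close to 1, which contradicts the
  bound for \<open>H (t *\<^sub>R \<xi>)\<close>.\<close>

lemma lsc_envelope_eq_SUP:
  assumes radial: "\<And>\<delta>::real. \<delta> > 0 \<Longrightarrow> \<exists>\<eta>>0. \<forall>t\<in>{0..<1::real}. 1 - t \<le> \<eta> \<longrightarrow> (\<forall>\<zeta>. H (t *\<^sub>R \<zeta>) \<le> H \<zeta> + ennreal \<delta>)"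
  shows "lsc_envelope H \<xi> = (SUP k. ennreal (hs k \<xi>))"
proof (rule antisym)
  show "(SUP k. ennreal (hs k \<xi>)) \<le> lsc_envelope H \<xi>"
  proof (rule SUP_least)
    fix k
    have "continuous_on UNIV (hs k)"
      by (rule lipschitz_integrand.lipschitz_continuous[OF lip lipschitz_integrand.h_lipschitz[OF lip]])
    then have "continuous_on UNIV (\<lambda>\<zeta>. ennreal (hs k \<zeta>))" by (rule continuous_on_ennreal)
    then have "lsc (\<lambda>\<zeta>. ennreal (hs k \<zeta>))"
      unfolding lsc_def by (auto intro: open_Collect_less continuous_on_const)
    then show "ennreal (hs k \<xi>) \<le> lsc_envelope H \<xi>"
      unfolding lsc_envelope_def using hs_le by (intro SUP_upper2[where i = "\<lambda>\<zeta>. ennreal (hs k \<zeta>)"]) auto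
  qed
  show "lsc_envelope H \<xi> \<le> (SUP k. ennreal (hs k \<xi>))"
  proof (cases "SUP k. ennreal (hs k \<xi>)")
    case (real m)
    have "ennreal (hs k \<xi>) \<le> ennreal m" for k unfolding real(2)[symmetric] by (rule SUP_upper) simp
    then have m: "hs k \<xi> \<le> m" for k using real(1) by (simp add: ennreal_le_iff)
    have \<xi>: "\<xi> \<in> closure C" by (rule hs_bounded_in_closure[OF m])
    have "u \<xi> \<le> ennreal m" if u: "lsc u" "\<And>y. u y \<le> H y" for u
    proof (rule ennreal_le_epsilon, rule ccontr)
      fix e :: real assume e: "e > 0" and "\<not> u \<xi> \<le> ennreal m + ennreal e"
      then have "\<xi> \<in> {x. ennreal (m + e) < u x}" using real(1) by (simp add: not_le)
      moreover have "open {x. ennreal (m + e) < u x}" using u(1) by (simp add: lsc_def)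
      ultimately obtain r where r: "r > 0" "ball \<xi> r \<subseteq> {x. ennreal (m + e) < u x}" using open_contains_ball by blast
      obtain \<eta> where \<eta>: "\<eta> > 0" "\<forall>t\<in>{0..<1::real}. 1 - t \<le> \<eta> \<longrightarrow> (\<forall>\<zeta>. H (t *\<^sub>R \<zeta>) \<le> H \<zeta> + ennreal e)"
        using radial[OF e] by blast
      \<comment> \<open>Close enough to 1 for the radial estimate and for
        \<open>t *\<^sub>R \<xi>\<close> to lie in the ball; the bound 1 keeps \<open>t\<close>
        nonnegative, and \<open>norm \<xi> + 1\<close> allows for \<open>\<xi> = 0\<close>.\<close>
      define t where "t = 1 - min (min 1 \<eta>) (r / (norm \<xi> + 1))"
      have N: "norm \<xi> + 1 > 0" by (simp add: add_nonneg_pos)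
      then have "0 < r / (norm \<xi> + 1)" using r(1) by simp
      then have t: "0 \<le> t" "t < 1" "1 - t \<le> \<eta>" "1 - t \<le> r / (norm \<xi> + 1)" using \<eta>(1) by (auto simp: t_def)
      have "(1 - t) * norm \<xi> < (1 - t) * (norm \<xi> + 1)" using t(2) by simp
      also have "\<dots> \<le> r" using t(4) N by (simp add: pos_le_divide_eq)
      finally have "(1 - t) * norm \<xi> < r" .
      moreover have "\<xi> - t *\<^sub>R \<xi> = (1 - t) *\<^sub>R \<xi>" by (simp add: scaleR_diff_left)
      ultimately have "t *\<^sub>R \<xi> \<in> ball \<xi> r" using t(2) by (simp add: dist_norm)
      then have "ennreal (m + e) < u (t *\<^sub>R \<xi>)" using r(2) by blast
      also have "\<dots> \<le> H (t *\<^sub>R \<xi>)" by (rule u(2))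
      also have "\<dots> \<le> ennreal (m + e)" using e \<eta>(2) t by (intro homog_scaled_le[OF t(1,2) _ _ \<xi> m]) auto
      finally show False by simp
    qed
    then have "lsc_envelope H \<xi> \<le> ennreal m" unfolding lsc_envelope_def by (intro SUP_least) auto
    then show ?thesis by (simp only: real(2))
  next
    case top
    then show ?thesis by (simp only: top_greatest)
  qed
qed

lemma sup_quasiconvex_lsc_envelope:
  assumes radial: "\<And>\<delta>::real. \<delta> > 0 \<Longrightarrow> \<exists>\<eta>>0. \<forall>t\<in>{0..<1::real}. 1 - t \<le> \<eta> \<longrightarrow> (\<forall>\<zeta>. H (t *\<^sub>R \<zeta>) \<le> H \<zeta> + ennreal \<delta>)"
  shows "sup_quasiconvex 1 (lsc_envelope H)"
  unfolding sup_quasiconvex_def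
proof (intro conjI exI[of _ hs] allI hs_mono hs_growth)
  note [measurable] = lipschitz_integrand.h_measurable[OF lip]
  have eq: "lsc_envelope H = (\<lambda>\<xi>. SUP k. ennreal (hs k \<xi>))"
    by (rule ext) (rule lsc_envelope_eq_SUP[OF radial])
  show "lsc_envelope H \<in> borel_measurable borel" unfolding eq by measurable
  show "quasiconvex (hs k)" for k by (rule lipschitz_integrand.h_quasiconvex[OF lip])
  show "(SUP k. ennreal (hs k \<xi>)) = lsc_envelope H \<xi>" for \<xi> by (simp only: eq)
qed

end

theorem corollary1p1:
  fixes C :: "(real^'d::finite^'m::finite) set"
    and W :: "real^'d \<Rightarrow> real^'d^'m \<Rightarrow> ennreal"
  assumes C_bounded: "bounded C" and C_convex: "convex C" and C_zero: "0 \<in> interior C"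
    and W_meas: "(\<lambda>(x, \<xi>). W x \<xi>) \<in> borel_measurable borel"
    and W_periodic: "\<And>x z \<xi>. (\<forall>i. z $ i \<in> \<int>) \<Longrightarrow> W (x + z) \<xi> = W x \<xi>"
    and W_dom: "\<And>x. edom (W x) \<subseteq> closure C"
    and cond1: "\<And>\<delta>::real. \<delta> > 0 \<Longrightarrow> \<exists>\<eta>::real. \<eta> > 0 \<and>
      (\<forall>x. \<forall>\<xi>\<in>edom (W x). \<forall>t\<in>{0..<1}. 1 - t \<le> \<eta> \<longrightarrow> W x (t *\<^sub>R \<xi>) \<le> W x \<xi> + ennreal \<delta>)"
    and cond2: "\<And>K. compact K \<Longrightarrow> K \<subseteq> interior C \<Longrightarrow> (\<lambda>x. SUP \<xi>\<in>K. W x \<xi>) \<in> Linfty_loc"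
    and cond3: "\<And>s::real. s > 0 \<Longrightarrow> \<exists>K. compact K \<and> K \<subseteq> interior C \<and>
      (\<forall>x. (INF \<xi>\<in>closure C - K. W x \<xi>) \<ge> ennreal s)"
  shows "sup_quasiconvex 1 (lsc_envelope (homog W))"
proof -
  have W: "periodic_integrand W" unfolding periodic_integrand_def using W_meas W_periodic by blast
  interpret constrained_integrand C W
    by unfold_locales (rule C_bounded C_convex C_zero W loc_bounded_Linfty_loc[OF W open_interior cond2] W_dom; assumption?)+
  show ?thesis
  proof (rule sup_quasiconvex_lsc_envelope)
    fix \<delta> :: real assume "\<delta> > 0"
    then obtain \<eta> where \<eta>: "\<eta> > 0" "\<forall>x. \<forall>\<xi>\<in>edom (W x). \<forall>t\<in>{0..<1}. 1 - t \<le> \<eta> \<longrightarrow> W x (t *\<^sub>R \<xi>) \<le> W x \<xi> + ennreal \<delta>"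
      using cond1 by blast
    \<comment> \<open>Condition (1) passes to \<open>H\<close> with the same \<eta>, and for every
      \<zeta>, since scaling a test map scales all its slopes.\<close>
    have "H (t *\<^sub>R \<zeta>) \<le> H \<zeta> + ennreal \<delta>" if "t \<in> {0..<1}" "1 - t \<le> \<eta>" for t \<zeta>
      by (rule homog_scaleR_le[OF W]) (use \<eta>(2) that in blast)
    then show "\<exists>\<eta>>0. \<forall>t\<in>{0..<1::real}. 1 - t \<le> \<eta> \<longrightarrow> (\<forall>\<zeta>. H (t *\<^sub>R \<zeta>) \<le> H \<zeta> + ennreal \<delta>)" using \<eta>(1) by blast
  qed
qed

end
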